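(* Let $A_0$ be a $d\times d$ expansive integral matrix with $\det A_0=\pm2$. Let $S$ be a $d\times d$ integral matrix with $\det S=\pm1$ and $A$ an integral matrix with $A_0=S^{-1}AS$, such that $A\mathbb{Z}^d=A^\tau\mathbb{Z}^d$ and there are $\vec\ell_A,\vec q_A\in\mathbb{Z}^d$ with: $\mathbb{Z}^d=(\vec\ell_A+A\mathbb{Z}^d)\dot\cup A\mathbb{Z}^d$; $\vec q_A\circ A\mathbb{Z}^d\subseteq2\mathbb{Z}$ and $\vec q_A\circ(\vec\ell_A+A\mathbb{Z}^d)\subseteq2\mathbb{Z}+1$; for $\vec m\in A\mathbb{Z}^d$, $\vec n\in\mathbb{Z}^d$: $\mathbb{Z}^d=(\vec n-A\mathbb{Z}^d)\dot\cup(\vec\ell_A-\vec m-\vec n+A\mathbb{Z}^d)$; for $\vec m\in\vec\ell_A+A\mathbb{Z}^d$, $\vec n\in\mathbb{Z}^d$: $\vec n-A\mathbb{Z}^d=\vec\ell_A-\vec m-\vec n+A\mathbb{Z}^d$. Let $\{h_{\vec n}\}$ be a finite solution, supported in $\Lambda_0=\mathbb{Z}^d\cap[-N_0,N_0]^d$, of $\sum_{\vec n}h_{\vec n}\overline{h_{\vec n+\vec k}}=\delta_{\vec0,\vec k}$ ($\vec k\in A\mathbb{Z}^d$), $\sum_{\vec n}h_{\vec n}=\sqrt2$. Let $m_0(\vec t)=\frac1{\sqrt2}\sum_{\vec n\in\Lambda_0}h_{\vec n}e^{-i\vec n\circ\vec t}$, $\varphi_A=\mathcal F^{-1}g$ with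 $g(\vec\xi)=(2\pi)^{-d/2}\prod_{j\ge1}m_0((A^\tau)^{-j}\vec\xi)$, and $\psi_A=\sum_{\vec n\in\mathbb{Z}^d}(-1)^{\vec q_A\circ\vec n}\overline{h_{\vec\ell_A-\vec n}}D_AT_{\vec n}\varphi_A$. Define $\varphi_{A_0}(\vec t)=\varphi_A(S\vec t)$ and $\psi_{A_0}(\vec t)=\psi_A(S\vec t)$. Then: (1) $\psi_{A_0}$ is a Parseval's frame wavelet associated with $A_0$; (2) $\varphi_{A_0}=\sum_{\vec n\in\Lambda_0}h_{\vec n}D_{A_0}T_{S^{-1}\vec n}\varphi_{A_0}$ and $\psi_{A_0}=\sum_{\vec n:\,\vec\ell_A-\vec n\in\Lambda_0}(-1)^{\vec q_A\circ\vec n}\overline{h_{\vec\ell_A-\vec n}}D_{A_0}T_{S^{-1}\vec n}\varphi_{A_0}$; (3) $V^{(n)}_{A_0}(\varphi_{A_0})\subset V^{(n+1)}_{A_0}(\varphi_{A_0})$ for all $n\in\mathbb{Z}$; (4) $\overline{\bigcup_{n\in\mathbb{Z}}V^{(n)}_{A_0}(\varphi_{A_0})}=L^2(\mathbb{R}^d)$.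
   Context: $\vec x\circ\vec y=\sum_j x_j\overline{y_j}$; $A^\tau$ is the transpose; a matrix is expansive if all eigenvalues have modulus $>1$. $(T_{\vec\ell}f)(\vec t)=f(\vec t-\vec\ell)$; for an integral matrix $B$ with $|\det B|=2$, $(D_Bf)(\vec t)=\sqrt2 f(B\vec t)$. Fourier transform $(\mathcal Ff)(\vec s)=(2\pi)^{-d/2}\int e^{-i\vec s\circ\vec t}f(\vec t)d\vec t$ extended unitarily to $L^2(\mathbb{R}^d)$. $\psi$ is a Parseval's frame wavelet associated with $B$ if $\sum_{n\in\mathbb{Z},\vec\ell\in\mathbb{Z}^d}|\langle f,D_B^nT_{\vec\ell}\psi\rangle|^2=\|f\|^2$ for all $f\in L^2(\mathbb{R}^d)$. For $f\in L^2(\mathbb{R}^d)$: $V^{(0)}_B(f)=\overline{\mathrm{span}}\{T_{\vec\ell}f:\vec\ell\in\mathbb{Z}^d\}$ and $V^{(n)}_B(f)=D_B^nV^{(0)}_B(f)$, $n\in\mathbb{Z}$. (The matrix $A$, being similar to $A_0$, is expansive with $|\det A|=2$.) *)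

theory Defs
  imports "HOL-Analysis.Analysis"
begin

section \<open>Lattice, integral matrices, expansive matrices\<close>

definition Zd :: "(real^'d::finite) set" where
  "Zd = {v. \<forall>i. v $ i \<in> \<int>}"

definition integral_matrix :: "real^'d^'d \<Rightarrow> bool" where
  "integral_matrix B \<longleftrightarrow> (\<forall>i j. B $ i $ j \<in> \<int>)"

text \<open>Eigenvalues are taken over the complex numbers.\<close>
definition expansive :: "real^'d^'d \<Rightarrow> bool" where
  "expansive B \<longleftrightarrow> (\<forall>c::complex. (\<exists>v::complex^'d. v \<noteq> 0 \<and>
      map_matrix complex_of_real B *v v = c *s v) \<longrightarrow> 1 < cmod c)"

definition mat_pow :: "real^'d^'d \<Rightarrow> nat \<Rightarrow> real^'d^'d" where
  "mat_pow B k = (((**) B) ^^ k) (mat 1)"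

section \<open>Translation and dilation operators\<close>

definition transl :: "real^'d \<Rightarrow> (real^'d \<Rightarrow> complex) \<Rightarrow> (real^'d \<Rightarrow> complex)" where
  "transl l f = (\<lambda>t. f (t - l))"

definition dil :: "real^'d^'d \<Rightarrow> (real^'d \<Rightarrow> complex) \<Rightarrow> (real^'d \<Rightarrow> complex)" where
  "dil B f = (\<lambda>t. complex_of_real (sqrt 2) * f (B *v t))"

text \<open>The inverse operator of \<open>dil B\<close>.\<close>
definition dil_inv :: "real^'d^'d \<Rightarrow> (real^'d \<Rightarrow> complex) \<Rightarrow> (real^'d \<Rightarrow> complex)" where
  "dil_inv B f = (\<lambda>t. f (matrix_inv B *v t) / complex_of_real (sqrt 2))"

definition dil_pow :: "real^'d^'d \<Rightarrow> int \<Rightarrow> (real^'d \<Rightarrow> complex) \<Rightarrow> (real^'d \<Rightarrow> complex)" where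
  "dil_pow B n = (if 0 \<le> n then dil B ^^ nat n else dil_inv B ^^ nat (- n))"

section \<open>L^2(R^d)\<close>

definition square_integrable :: "(real^'d::finite \<Rightarrow> complex) \<Rightarrow> bool" where
  "square_integrable f \<longleftrightarrow> f \<in> borel_measurable lebesgue \<and>
     integrable lebesgue (\<lambda>x. (cmod (f x))\<^sup>2)"

definition L2_inner :: "(real^'d::finite \<Rightarrow> complex) \<Rightarrow> (real^'d \<Rightarrow> complex) \<Rightarrow> complex" where
  "L2_inner f g = (LINT x|lebesgue. f x * cnj (g x))"

definition L2_norm_sq :: "(real^'d::finite \<Rightarrow> complex) \<Rightarrow> real" where
  "L2_norm_sq f = (LINT x|lebesgue. (cmod (f x))\<^sup>2)"

text \<open>Squared L^2 distance, valued in ennreal (infinite if the difference is not in L^2).\<close>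
definition L2_dist_sq :: "(real^'d::finite \<Rightarrow> complex) \<Rightarrow> (real^'d \<Rightarrow> complex) \<Rightarrow> ennreal" where
  "L2_dist_sq f g = (\<integral>\<^sup>+ x. ennreal ((cmod (f x - g x))\<^sup>2) \<partial>lebesgue)"

text \<open>Closure in L^2 of a set of functions (functions, not a.e.-classes).\<close>
definition L2_closure :: "(real^'d::finite \<Rightarrow> complex) set \<Rightarrow> (real^'d \<Rightarrow> complex) set" where
  "L2_closure X = {g. square_integrable g \<and> (\<forall>\<epsilon>>0. \<exists>x\<in>X. L2_dist_sq g x < ennreal \<epsilon>)}"

section \<open>Fourier transform\<close>

definition cube :: "real \<Rightarrow> (real^'d::finite) set" where
  "cube R = {s. \<forall>i. \<bar>s $ i\<bar> \<le> R}"

text \<open>Inverse Fourier integral for integrable functions.\<close>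
definition inv_fourier_int :: "(real^'d::finite \<Rightarrow> complex) \<Rightarrow> (real^'d \<Rightarrow> complex)" where
  "inv_fourier_int g = (\<lambda>t. complex_of_real ((2 * pi) powr (- real CARD('d) / 2)) *
      (LINT s|lebesgue. exp (\<i> * complex_of_real (s \<bullet> t)) * g s))"

text \<open>Inverse of the unitary (Plancherel) Fourier transform on L^2: the L^2-limit of the
  inverse Fourier integrals of the truncations of g to the cubes [-R,R]^d.\<close>
definition inv_fourier_L2 :: "(real^'d::finite \<Rightarrow> complex) \<Rightarrow> (real^'d \<Rightarrow> complex)" where
  "inv_fourier_L2 g = (SOME \<phi>. square_integrable \<phi> \<and>
      ((\<lambda>R::real. L2_dist_sq \<phi> (inv_fourier_int (\<lambda>s. indicator (cube R) s * g s))) \<longlongrightarrow> 0) at_top)"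

section \<open>Frames and MRA spaces\<close>

definition parseval_frame_wavelet :: "real^'d^'d \<Rightarrow> (real^'d::finite \<Rightarrow> complex) \<Rightarrow> bool" where
  "parseval_frame_wavelet B \<psi> \<longleftrightarrow> square_integrable \<psi> \<and>
     (\<forall>f. square_integrable f \<longrightarrow>
        ((\<lambda>(n::int, l). (cmod (L2_inner f (dil_pow B n (transl l \<psi>))))\<^sup>2) has_sum L2_norm_sq f)
          (UNIV \<times> Zd))"

definition V0 :: "(real^'d::finite \<Rightarrow> complex) \<Rightarrow> (real^'d \<Rightarrow> complex) set" where
  "V0 f = L2_closure {(\<lambda>t. \<Sum>l\<in>F. c l * transl l f t) | F c. finite F \<and> F \<subseteq> Zd}"

definition Vn :: "real^'d^'d \<Rightarrow> int \<Rightarrow> (real^'d::finite \<Rightarrow> complex) \<Rightarrow> (real^'d \<Rightarrow> complex) set" where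
  "Vn B n f = dil_pow B n ` V0 f"

section \<open>The construction\<close>

definition Lambda0 :: "nat \<Rightarrow> (real^'d::finite) set" where
  "Lambda0 N0 = {n \<in> Zd. \<forall>i. \<bar>n $ i\<bar> \<le> real N0}"

definition m0 :: "nat \<Rightarrow> (real^'d::finite \<Rightarrow> complex) \<Rightarrow> real^'d \<Rightarrow> complex" where
  "m0 N0 h t = (1 / complex_of_real (sqrt 2)) *
     (\<Sum>n\<in>Lambda0 N0. h n * exp (- \<i> * complex_of_real (n \<bullet> t)))"

definition g_fun :: "nat \<Rightarrow> (real^'d::finite \<Rightarrow> complex) \<Rightarrow> real^'d^'d \<Rightarrow> real^'d \<Rightarrow> complex" where
  "g_fun N0 h A \<xi> = complex_of_real ((2 * pi) powr (- real CARD('d) / 2)) *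
     (\<Prod>j. m0 N0 h (mat_pow (matrix_inv (transpose A)) (Suc j) *v \<xi>))"

definition phi_A :: "nat \<Rightarrow> (real^'d::finite \<Rightarrow> complex) \<Rightarrow> real^'d^'d \<Rightarrow> real^'d \<Rightarrow> complex" where
  "phi_A N0 h A = inv_fourier_L2 (g_fun N0 h A)"

definition psi_A :: "nat \<Rightarrow> (real^'d::finite \<Rightarrow> complex) \<Rightarrow> real^'d^'d \<Rightarrow> real^'d \<Rightarrow> real^'d
    \<Rightarrow> real^'d \<Rightarrow> complex" where
  "psi_A N0 h A lA qA = (\<lambda>t. \<Sum>\<^sub>\<infinity>n\<in>Zd. (-1) powi \<lfloor>qA \<bullet> n\<rfloor> * cnj (h (lA - n)) *
      dil A (transl n (phi_A N0 h A)) t)"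

end

theory Submission
  imports Defs "HOL-Computational_Algebra.Fundamental_Theorem_Algebra" "HOL-Probability.Characteristic_Functions"
begin

text \<open>
  The product defining \<open>g\<close> is the pointwise limit of the partial products \<open>P\<^sub>k\<close>, which are the Fourier
  transforms of the discrete cascade measures \<open>E\<^sub>k = \<Sum>\<^sub>m 2\<^bsup>-k/2\<^esup> a\<^sub>k(m) \<delta>(A\<^bsup>-k\<^esup> m)\<close>. The orthogonality of \<open>h\<close> gives
  \<open>\<Sum>\<^sub>m |a\<^sub>k(m)|\<^sup>2 = 1\<close>, hence \<open>g\<close> is square integrable by Fatou's lemma, and the total variations of the \<open>E\<^sub>k\<close> are
  uniformly bounded because \<open>E\<^sub>k\<close> has at most \<open>O(2\<^sup>k)\<close> atoms. Thus \<open>\<phi> = \<F>\<^sup>-\<^sup>1 g\<close> is the weak limit of the \<open>E\<^sub>k\<close>, first against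
  Gaussians and then against continuous functions of compact support. It therefore has compact support and
  integral one, and it satisfies the refinement equation.

  From there on all arguments take place in the time domain. The conditions on \<open>\<ell>\<^sub>A\<close> and \<open>q\<^sub>A\<close> say that the masks of
  \<open>\<phi>\<close> and \<open>\<psi>\<close> form a perfect reconstruction filter bank, so the energies \<open>e\<^sub>n(f) = \<Sum>\<^sub>l |\<langle>f, D\<^sup>n T\<^sub>l \<phi>\<rangle>|\<^sup>2\<close> satisfy
  \<open>e\<^sub>n\<^sub>+\<^sub>1(f) = e\<^sub>n(f) + \<Sum>\<^sub>l |\<langle>f, D\<^sup>n T\<^sub>l \<psi>\<rangle>|\<^sup>2\<close>. For continuous \<open>f\<close> of compact support, \<open>e\<^sub>n(f)\<close> is a Riemann sum
  tending to \<open>\<parallel>f\<parallel>\<^sup>2\<close> as \<open>n \<rightarrow> \<infinity>\<close>, and it tends to 0 as \<open>n \<rightarrow> -\<infinity>\<close>. Telescoping yields the Parseval identity on a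
  dense class, and the same limit yields the density of the spaces \<open>V\<^sup>(\<^sup>n\<^sup>)\<close>.
\<close>

text \<open>The translates of phi need not be orthonormal, so the spaces \<open>Vn\<close> come with
  no ready projection formula; the energies \<open>Ec\<close> take their place, and their
  monotonicity in the level yields a Bessel bound at every level. For continuous functions of
  compact support all coefficient sequences are finite, so the filter bank enters only as a finite
  identity. The Fourier side serves to identify the function chosen by
  \<open>inv_fourier_L2\<close>, which is given only as an L^2 limit. The contraction half of
  Plancherel's theorem makes the truncated integrals Cauchy, so the choice has a witness. Gaussians
  are the test functions there because \<open>g\<close> is only known to be bounded and square
  integrable: a Gaussian makes all integrals absolutely convergent, and its transform is explicit.
  Two matrices are involved. The cascade runs for A, for which the orthogonality of h is stated; the
  frame argument runs for A0, with masks read through S. Conjugation by S also carries the decay of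
  the inverse powers from A0, where expansiveness is assumed, to A.\<close>

section \<open>Linear changes of variables\<close>

text \<open>The library proves this for \<open>wellorder\<close> index types only; elementary matrices reach every finite index type.\<close>

lemma measure_lebesgue_invertible_image:
  fixes M :: "real^'n::finite^'n"
  assumes "det M \<noteq> 0" "S \<in> lmeasurable"
  shows "(*v) M ` S \<in> lmeasurable \<and> measure lebesgue ((*v) M ` S) = \<bar>det M\<bar> * measure lebesgue S"
proof -
  \<comment> \<open>The implication makes the zero-row case vacuous, and a product is invertible
    only if both factors are.\<close>
  define P where "P = (\<lambda>M::real^'n^'n. det M \<noteq> 0 \<longrightarrow> (\<forall>S\<in>lmeasurable. (*v) M ` S \<in> lmeasurable \<and>
      measure lebesgue ((*v) M ` S) = \<bar>det M\<bar> * measure lebesgue S))"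
  have "P M"
  proof (rule induct_matrix_elementary_alt)
    fix A B :: "real^'n^'n" assume AB: "P A" "P B"
    show "P (A ** B)"
      unfolding P_def
    proof (intro impI ballI)
      fix S :: "(real^'n) set" assume "det (A ** B) \<noteq> 0" and S: "S \<in> lmeasurable"
      then have d: "det A \<noteq> 0" "det B \<noteq> 0" by (auto simp: det_mul)
      have e: "(*v) (A ** B) ` S = (*v) A ` ((*v) B ` S)"
        by (auto simp: matrix_vector_mul_assoc image_iff)
      have B: "(*v) B ` S \<in> lmeasurable" "measure lebesgue ((*v) B ` S) = \<bar>det B\<bar> * measure lebesgue S"
        using AB(2) d S unfolding P_def by auto
      then show "(*v) (A ** B) ` S \<in> lmeasurable \<and>
          measure lebesgue ((*v) (A ** B) ` S) = \<bar>det (A ** B)\<bar> * measure lebesgue S"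
        using AB(1) d unfolding P_def e by (auto simp: det_mul abs_mult)
    qed
  next
    fix A :: "real^'n^'n" and i assume "row i A = 0"
    then show "P A" unfolding P_def using det_zero_row(2) by blast
  next
    fix A :: "real^'n^'n" assume A: "\<And>i j. i \<noteq> j \<Longrightarrow> A $ i $ j = 0"
    have "A *v x = (\<chi> k. A $ k $ k * x $ k)" for x
    proof -
      have "(\<Sum>j\<in>UNIV. A $ k $ j * x $ j) = (\<Sum>j\<in>UNIV. if j = k then A $ k $ k * x $ k else 0)" for k
        by (intro sum.cong) (auto simp: A)
      then show ?thesis by (simp add: vec_eq_iff matrix_vector_mult_def)
    qed
    then have "(*v) A = (\<lambda>x. \<chi> k. A $ k $ k * x $ k)" by auto
    then show "P A" unfolding P_def
      using measurable_stretch measure_stretch det_diagonal[of A] A by auto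
  next
    fix m n :: 'n assume mn: "m \<noteq> n"
    let ?T = "Transposition.transpose m n"
    let ?M = "(\<chi> i j. mat 1 $ i $ ?T j) :: real^'n^'n"
    have Mx: "?M *v x = (\<chi> i. x $ ?T i)" for x
    proof -
      have "(\<Sum>j\<in>UNIV. mat 1 $ i $ ?T j * x $ j) = (\<Sum>j\<in>UNIV. if j = ?T i then x $ j else 0)" for i
        by (intro sum.cong) (auto simp: mat_def)
      then show ?thesis
        by (simp add: vec_eq_iff matrix_vector_mult_def)
    qed
    have d: "\<bar>det ?M\<bar> = 1"
      by (simp add: det_permute_columns permutes_swap_id sign_swap_id abs_mult)
    have im: "measure lebesgue ((*v) ?M ` cbox a b) = 1 * measure lebesgue (cbox a b)" for a b
    proof -
      have "(*v) ?M ` cbox a b = cbox (?M *v a) (?M *v b)"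
      proof (intro equalityI subsetI)
        fix y assume "y \<in> cbox (?M *v a) (?M *v b)"
        then have "(\<chi> i. y $ ?T i) \<in> cbox a b" "y = ?M *v (\<chi> i. y $ ?T i)"
          unfolding Mx by (auto simp: mem_box_cart vec_eq_iff) (metis transpose_involutory)+
        then show "y \<in> (*v) ?M ` cbox a b" by blast
      qed (auto simp: Mx mem_box_cart)
      moreover have "cbox (?M *v a) (?M *v b) = {} \<longleftrightarrow> cbox a b = {}"
        unfolding calculation[symmetric] by simp
      moreover have "(\<Prod>i\<in>UNIV. (?M *v b) $ i - (?M *v a) $ i) = (\<Prod>i\<in>UNIV. b $ i - a $ i)"
        unfolding Mx
        using prod.permute [OF permutes_swap_id[of m UNIV n], of "\<lambda>i. b $ i - a $ i"]
        by (simp add: o_def)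
      ultimately show ?thesis
        by (simp add: content_cbox_if_cart)
    qed
    have lin: "linear ((*v) ?M)" by simp
    have "(*v) ?M ` S \<in> lmeasurable \<and> measure lebesgue ((*v) ?M ` S) = \<bar>det ?M\<bar> * measure lebesgue S"
      if "S \<in> lmeasurable" for S
      unfolding d using measure_linear_sufficient[OF lin that im, THEN conjunct1]
        measure_linear_sufficient[OF lin that im, THEN conjunct2, symmetric] by (rule conjI)
    then show "P ?M" unfolding P_def by blast
  next
    fix m n :: 'n assume mn: "m \<noteq> n"
    let ?M = "(\<chi> i j. of_bool (i = m \<and> j = n \<or> i = j)) :: real^'n^'n"
    have Mx: "(*v) ?M = (\<lambda>x. \<chi> i. if i = m then x $ m + x $ n else x $ i)"
    proof (rule ext)
      fix x :: "real^'n"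
      have "(\<Sum>j\<in>UNIV. of_bool (i = m \<and> j = n \<or> i = j) * x $ j) =
          (\<Sum>j\<in>UNIV. (if j = i then x $ j else 0) + (if j = n then (if i = m then x $ j else 0) else 0))" for i
        using mn by (intro sum.cong) auto
      then show "?M *v x = (\<chi> i. if i = m then x $ m + x $ n else x $ i)"
        by (auto simp: vec_eq_iff matrix_vector_mult_def sum.distrib)
    qed
    have "?M = (\<chi> k. if k = m then row m (mat 1) + 1 *s row n (mat 1) else row k (mat 1))"
      using mn by (auto simp: vec_eq_iff row_def mat_def)
    then have d: "\<bar>det ?M\<bar> = 1"
      using det_row_operation[OF mn, of "mat 1 :: real^'n^'n" 1] by simp
    have im: "measure lebesgue ((*v) ?M ` cbox a b) = 1 * measure lebesgue (cbox a b)" for a b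
    proof (cases "cbox a b = {}")
      case False
      \<comment> \<open>\<open>measure_shear_interval\<close> asks for a nonnegative lower corner,
        so the box is first moved to the origin.\<close>
      have c: "cbox a b = (+) a ` cbox 0 (b - a)"
        by (simp flip: cbox_translation)
      then have ne: "cbox 0 (b - a) \<noteq> {}" using False by auto
      have "(*v) ?M ` cbox a b = (+) (?M *v a) ` ((*v) ?M ` cbox 0 (b - a))"
        unfolding c by (auto simp: image_image matrix_vector_right_distrib)
      then have "measure lebesgue ((*v) ?M ` cbox a b) = measure lebesgue ((*v) ?M ` cbox 0 (b - a))"
        by (simp only: measure_translation)
      also have "\<dots> = measure lebesgue (cbox 0 (b - a))"
        unfolding Mx by (rule measure_shear_interval) (use mn ne in auto)
      also have "\<dots> = measure lebesgue (cbox a b)"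
        unfolding c by (simp only: measure_translation)
      finally show ?thesis by simp
    qed simp
    have lin: "linear ((*v) ?M)" by simp
    have "(*v) ?M ` S \<in> lmeasurable \<and> measure lebesgue ((*v) ?M ` S) = \<bar>det ?M\<bar> * measure lebesgue S"
      if "S \<in> lmeasurable" for S
      unfolding d using measure_linear_sufficient[OF lin that im, THEN conjunct1]
        measure_linear_sufficient[OF lin that im, THEN conjunct2, symmetric] by (rule conjI)
    then show "P ?M" unfolding P_def by blast
  qed
  then show ?thesis using assms unfolding P_def by blast
qed

lemma matrix_inv_invertible:
  fixes M :: "real^'n::finite^'n"
  assumes "det M \<noteq> 0"
  shows "M ** matrix_inv M = mat 1" "matrix_inv M ** M = mat 1"
    "M *v (matrix_inv M *v x) = x" "matrix_inv M *v (M *v x) = x"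
proof -
  have "\<exists>A'. M ** A' = mat 1 \<and> A' ** M = mat 1"
    using assms by (simp add: invertible_det_nz[symmetric] invertible_def)
  then have "M ** matrix_inv M = mat 1 \<and> matrix_inv M ** M = mat 1"
    unfolding matrix_inv_def by (rule someI_ex)
  then show "M ** matrix_inv M = mat 1" "matrix_inv M ** M = mat 1" by auto
  then show "M *v (matrix_inv M *v x) = x" "matrix_inv M *v (M *v x) = x"
    by (simp_all add: matrix_vector_mul_assoc)
qed

lemma det_matrix_inv:
  fixes M :: "real^'n::finite^'n"
  assumes "det M \<noteq> 0"
  shows "det (matrix_inv M) = inverse (det M)"
  using matrix_inv_invertible(1)[OF assms] det_mul[of M "matrix_inv M"] assms
  by (simp add: field_simps)

text \<open>The preimage is the image under the inverse matrix followed by a translation, hence the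
  factor \<open>1 / |det M|\<close>. Sets of infinite measure are exhausted by their intersections
  with balls.\<close>

lemma lebesgue_affine_vimage:
  fixes M :: "real^'n::finite^'n"
  assumes d: "det M \<noteq> 0" and X: "X \<in> sets lebesgue"
  shows "{t. M *v t + v \<in> X} \<in> sets lebesgue"
    and "emeasure lebesgue {t. M *v t + v \<in> X} = ennreal (1 / \<bar>det M\<bar>) * emeasure lebesgue X"
proof -
  let ?N = "matrix_inv M"
  have dN: "det ?N \<noteq> 0" "\<bar>det ?N\<bar> = 1 / \<bar>det M\<bar>" using det_matrix_inv[OF d] d by (auto simp: field_simps simp flip: abs_mult)
  define Y where "Y = (\<lambda>k::nat. X \<inter> ball 0 (real k))"
  have Ym: "Y k \<in> lmeasurable" for k
    unfolding Y_def using X by (intro bounded_set_imp_lmeasurable) (auto simp: bounded_Int)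
  have YX: "(\<Union>k. Y k) = X"
    unfolding Y_def using reals_Archimedean2 by auto
  have vim: "{t. M *v t + v \<in> Z} = (+) (- (?N *v v)) ` ((*v) ?N ` Z)" for Z
  proof (intro equalityI subsetI)
    fix t assume "t \<in> {t. M *v t + v \<in> Z}"
    then have "M *v t + v \<in> Z" "t = - (?N *v v) + ?N *v (M *v t + v)"
      by (auto simp: matrix_vector_right_distrib matrix_inv_invertible[OF d])
    then show "t \<in> (+) (- (?N *v v)) ` ((*v) ?N ` Z)" by blast
  next
    fix t assume "t \<in> (+) (- (?N *v v)) ` ((*v) ?N ` Z)"
    then obtain z where z: "z \<in> Z" "t = - (?N *v v) + ?N *v z" by auto
    then have "M *v t + v = z"
      by (simp add: matrix_vector_right_distrib matrix_vector_mult_diff_distrib matrix_inv_invertible[OF d])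
    then show "t \<in> {t. M *v t + v \<in> Z}" using z by simp
  qed
  have k: "{t. M *v t + v \<in> Y k} \<in> lmeasurable"
    "emeasure lebesgue {t. M *v t + v \<in> Y k} = ennreal (1 / \<bar>det M\<bar>) * emeasure lebesgue (Y k)" for k
  proof -
    note * = measure_lebesgue_invertible_image[OF dN(1) Ym[of k]]
    show l: "{t. M *v t + v \<in> Y k} \<in> lmeasurable"
      unfolding vim by (rule measurable_translation) (use * in blast)
    have "measure lebesgue {t. M *v t + v \<in> Y k} = 1 / \<bar>det M\<bar> * measure lebesgue (Y k)"
      unfolding vim measure_translation using * dN by simp
    then show "emeasure lebesgue {t. M *v t + v \<in> Y k} = ennreal (1 / \<bar>det M\<bar>) * emeasure lebesgue (Y k)"
      using fmeasurableD2[OF l] fmeasurableD2[OF Ym[of k]]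
      by (simp add: emeasure_eq_ennreal_measure flip: ennreal_mult'')
  qed
  have U: "{t. M *v t + v \<in> X} = (\<Union>k. {t. M *v t + v \<in> Y k})" using YX by blast
  have ks: "{t. M *v t + v \<in> Y k} \<in> sets lebesgue" "Y k \<in> sets lebesgue" for k using k(1)[of k] Ym[of k] by auto
  show "{t. M *v t + v \<in> X} \<in> sets lebesgue"
    unfolding U using ks(1) by blast
  have inc: "incseq Y" "incseq (\<lambda>k. {t. M *v t + v \<in> Y k})"
    by (auto simp: incseq_def Y_def intro: less_le_trans)
  have "emeasure lebesgue {t. M *v t + v \<in> X} = (SUP k. emeasure lebesgue {t. M *v t + v \<in> Y k})"
    unfolding U by (rule SUP_emeasure_incseq[symmetric]) (use ks inc in auto)
  also have "\<dots> = (SUP k. ennreal (1 / \<bar>det M\<bar>) * emeasure lebesgue (Y k))" using k by simp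
  also have "\<dots> = ennreal (1 / \<bar>det M\<bar>) * (SUP k. emeasure lebesgue (Y k))"
    by (simp add: SUP_mult_left_ennreal)
  also have "(SUP k. emeasure lebesgue (Y k)) = emeasure lebesgue X"
    using SUP_emeasure_incseq[of Y lebesgue] ks inc YX by auto
  finally show "emeasure lebesgue {t. M *v t + v \<in> X} = ennreal (1 / \<bar>det M\<bar>) * emeasure lebesgue X" .
qed

lemma measurable_lebesgue_affine:
  fixes M :: "real^'n::finite^'n"
  assumes "det M \<noteq> 0"
  shows "(\<lambda>t. M *v t + v) \<in> lebesgue \<rightarrow>\<^sub>M lebesgue"
  by (rule measurableI) (use lebesgue_affine_vimage(1)[OF assms] in \<open>auto simp: vimage_def\<close>)

text \<open>The rules for integrals and for integrability under affine substitution are read off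
  from this one identity of measures.\<close>

lemma distr_lebesgue_affine:
  fixes M :: "real^'n::finite^'n"
  assumes d: "det M \<noteq> 0"
  shows "distr lebesgue lebesgue (\<lambda>t. M *v t + v) = density lebesgue (\<lambda>_. ennreal (1 / \<bar>det M\<bar>))"
  using measurable_lebesgue_affine[OF d] lebesgue_affine_vimage(2)[OF d]
  by (intro measure_eqI) (auto simp: emeasure_distr emeasure_density nn_integral_cmult_indicator vimage_def)

lemma nn_integral_affine:
  fixes M :: "real^'n::finite^'n" and f :: "real^'n \<Rightarrow> ennreal"
  assumes "det M \<noteq> 0" "f \<in> borel_measurable lebesgue"
  shows "(\<integral>\<^sup>+ t. f (M *v t + v) \<partial>lebesgue) = ennreal (1 / \<bar>det M\<bar>) * (\<integral>\<^sup>+ t. f t \<partial>lebesgue)"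
  using nn_integral_distr[OF measurable_lebesgue_affine[OF assms(1)], of f v]
  unfolding distr_lebesgue_affine[OF assms(1)]
  using assms by (simp add: nn_integral_density nn_integral_cmult)

lemma
  fixes M :: "real^'n::finite^'n" and f :: "real^'n \<Rightarrow> 'b::{banach,second_countable_topology}"
  assumes d: "det M \<noteq> 0" and f: "f \<in> borel_measurable lebesgue"
  shows integral_affine: "(LINT t|lebesgue. f (M *v t + v)) = (1 / \<bar>det M\<bar>) *\<^sub>R (LINT t|lebesgue. f t)"
    and integrable_affine: "integrable lebesgue (\<lambda>t. f (M *v t + v)) \<longleftrightarrow> integrable lebesgue f"
    and measurable_affine: "(\<lambda>t. f (M *v t + v)) \<in> borel_measurable lebesgue"
proof -
  note m = measurable_lebesgue_affine[OF d, of v]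
  show "(\<lambda>t. f (M *v t + v)) \<in> borel_measurable lebesgue"
    using measurable_compose[OF m f] .
  show "(LINT t|lebesgue. f (M *v t + v)) = (1 / \<bar>det M\<bar>) *\<^sub>R (LINT t|lebesgue. f t)"
    using integral_distr[OF m f] f unfolding distr_lebesgue_affine[OF d]
    by (simp add: integral_density)
  have scaleR_iff: "integrable lebesgue (\<lambda>t. c *\<^sub>R f t) \<longleftrightarrow> integrable lebesgue f" if "c \<noteq> 0" for c
    using that integrable_scaleR_right[of c lebesgue f] integrable_scaleR_right[of "1/c" lebesgue "\<lambda>t. c *\<^sub>R f t"]
    by auto
  have "(1 / \<bar>det M\<bar>) \<noteq> 0" using d by simp
  note scaleR_iff = scaleR_iff[OF this]
  show "integrable lebesgue (\<lambda>t. f (M *v t + v)) \<longleftrightarrow> integrable lebesgue f"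
    using integrable_distr_eq[OF m f] f d unfolding distr_lebesgue_affine[OF d]
    by (simp add: integrable_density scaleR_iff)
qed

lemma AE_affine:
  fixes M :: "real^'n::finite^'n"
  assumes d: "det M \<noteq> 0" and P: "AE t in lebesgue. P t"
  shows "AE t in lebesgue. P (M *v t + v)"
proof -
  from P obtain N where N: "N \<in> null_sets lebesgue" "{t. \<not> P t} \<subseteq> N"
    by (auto simp: eventually_ae_filter)
  have "{t. M *v t + v \<in> N} \<in> null_sets lebesgue"
    using lebesgue_affine_vimage[OF d, of N v] N(1) by (auto simp: null_sets_def)
  then show ?thesis
    using N(2) by (auto simp: eventually_ae_filter intro!: bexI[of _ "{t. M *v t + v \<in> N}"])
qed

section \<open>Square-integrable functions\<close>

lemma square_integrable_iff_nn_integral: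
  "square_integrable f \<longleftrightarrow> f \<in> borel_measurable lebesgue \<and> (\<integral>\<^sup>+ x. ennreal ((cmod (f x))\<^sup>2) \<partial>lebesgue) < \<infinity>"
  by (auto simp: square_integrable_def integrable_iff_bounded)

lemma nn_integral_cmod_sq:
  "square_integrable f \<Longrightarrow> (\<integral>\<^sup>+ x. ennreal ((cmod (f x))\<^sup>2) \<partial>lebesgue) = ennreal (L2_norm_sq f)"
  unfolding square_integrable_def L2_norm_sq_def by (intro nn_integral_eq_integral) auto

lemma L2_norm_sq_nonneg [simp]: "0 \<le> L2_norm_sq f"
  by (simp add: L2_norm_sq_def)

lemma square_integrable_mult_integrable:
  assumes "square_integrable f" "square_integrable g"
  shows "integrable lebesgue (\<lambda>x. f x * g x)"
proof (rule Bochner_Integration.integrable_bound)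
  show "integrable lebesgue (\<lambda>x. (cmod (f x))\<^sup>2 + (cmod (g x))\<^sup>2)"
    using assms by (auto simp: square_integrable_def)
  show "(\<lambda>x. f x * g x) \<in> borel_measurable lebesgue"
    using assms by (auto simp: square_integrable_def)
  have "2 * (a * b) \<le> a\<^sup>2 + b\<^sup>2" for a b :: real using sum_squares_bound[of a b] by simp
  then have "a * b \<le> a\<^sup>2 + b\<^sup>2" if "0 \<le> a" "0 \<le> b" for a b :: real
    using that by (smt (verit) mult_nonneg_nonneg)
  then show "AE x in lebesgue. norm (f x * g x) \<le> norm ((cmod (f x))\<^sup>2 + (cmod (g x))\<^sup>2)"
    by (auto simp: norm_mult)
qed

lemma square_integrable_cmult:
  "square_integrable f \<Longrightarrow> square_integrable (\<lambda>x. c * f x)"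
  unfolding square_integrable_def by (auto simp: norm_mult power_mult_distrib)

lemma square_integrable_cnj:
  "square_integrable f \<Longrightarrow> square_integrable (\<lambda>x. cnj (f x))"
  unfolding square_integrable_def
  by (auto intro: borel_measurable_continuous_on[where f=cnj] continuous_intros)

lemma square_integrable_bound:
  assumes "f \<in> borel_measurable lebesgue" "integrable lebesgue (\<lambda>x. (w x)\<^sup>2)"
    "AE x in lebesgue. cmod (f x) \<le> w x"
  shows "square_integrable f"
  unfolding square_integrable_def
proof
  show "integrable lebesgue (\<lambda>x. (cmod (f x))\<^sup>2)"
  proof (rule Bochner_Integration.integrable_bound[OF assms(2)])
    show "AE x in lebesgue. norm ((cmod (f x))\<^sup>2) \<le> norm ((w x)\<^sup>2)"
      using assms(3) by eventually_elim (simp add: power_mono)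
  qed (use assms(1) in auto)
qed fact

lemma square_integrable_add:
  assumes "square_integrable f" "square_integrable g"
  shows "square_integrable (\<lambda>x. f x + g x)"
  unfolding square_integrable_def
proof
  show "integrable lebesgue (\<lambda>x. (cmod (f x + g x))\<^sup>2)"
  proof (rule Bochner_Integration.integrable_bound)
    show "integrable lebesgue (\<lambda>x. 2 * (cmod (f x))\<^sup>2 + 2 * (cmod (g x))\<^sup>2)"
      using assms by (auto simp: square_integrable_def)
    have "(cmod (a + b))\<^sup>2 \<le> 2 * (cmod a)\<^sup>2 + 2 * (cmod b)\<^sup>2" for a b
    proof -
      have "(cmod (a + b))\<^sup>2 \<le> (cmod a + cmod b)\<^sup>2" by (simp add: norm_triangle_ineq power_mono)
      also have "\<dots> \<le> 2 * (cmod a)\<^sup>2 + 2 * (cmod b)\<^sup>2"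
        using sum_squares_bound[of "cmod a" "cmod b"] by (simp add: power2_sum)
      finally show ?thesis .
    qed
    then show "AE x in lebesgue. norm ((cmod (f x + g x))\<^sup>2) \<le> norm (2 * (cmod (f x))\<^sup>2 + 2 * (cmod (g x))\<^sup>2)"
      by auto
  qed (use assms in \<open>auto simp: square_integrable_def\<close>)
qed (use assms in \<open>auto simp: square_integrable_def\<close>)

lemma square_integrable_diff:
  assumes "square_integrable f" "square_integrable g"
  shows "square_integrable (\<lambda>x. f x - g x)"
  using square_integrable_add[OF assms(1) square_integrable_cmult[OF assms(2), of "-1"]] by simp

lemma square_integrable_zero [simp]: "square_integrable (\<lambda>x. 0)"
  by (simp add: square_integrable_def)

lemma square_integrable_sum:
  assumes "\<And>i. i \<in> I \<Longrightarrow> square_integrable (f i)"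
  shows "square_integrable (\<lambda>x. \<Sum>i\<in>I. f i x)"
  using assms by (induction I rule: infinite_finite_induct) (auto intro: square_integrable_add)

lemma square_integrable_AE_cong:
  assumes "square_integrable f" "AE x in lebesgue. f x = g x"
  shows "square_integrable g" "L2_norm_sq g = L2_norm_sq f"
proof -
  have m: "f \<in> borel_measurable lebesgue" "g \<in> borel_measurable lebesgue"
    using assms borel_measurable_AE by (auto simp: square_integrable_def)
  have "AE x in lebesgue. (cmod (f x))\<^sup>2 = (cmod (g x))\<^sup>2" using assms(2) by eventually_elim simp
  then show "square_integrable g" "L2_norm_sq g = L2_norm_sq f"
    using assms(1) m integrable_cong_AE[of "\<lambda>x. (cmod (f x))\<^sup>2" lebesgue "\<lambda>x. (cmod (g x))\<^sup>2"]
      integral_cong_AE[of "\<lambda>x. (cmod (f x))\<^sup>2" lebesgue "\<lambda>x. (cmod (g x))\<^sup>2"]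
    by (auto simp: square_integrable_def L2_norm_sq_def)
qed

lemma square_integrable_affine:
  fixes M :: "real^'n::finite^'n"
  assumes "det M \<noteq> 0" "square_integrable f"
  shows "square_integrable (\<lambda>t. f (M *v t + v))"
    "L2_norm_sq (\<lambda>t. f (M *v t + v)) = L2_norm_sq f / \<bar>det M\<bar>"
proof -
  have m: "(\<lambda>t. (cmod (f t))\<^sup>2) \<in> borel_measurable lebesgue"
    using assms(2) by (auto simp: square_integrable_def)
  show "square_integrable (\<lambda>t. f (M *v t + v))"
    using assms measurable_affine[OF assms(1), of f v] integrable_affine[OF assms(1) m, of v]
    by (simp add: square_integrable_def)
  show "L2_norm_sq (\<lambda>t. f (M *v t + v)) = L2_norm_sq f / \<bar>det M\<bar>"
    unfolding L2_norm_sq_def using integral_affine[OF assms(1) m, of v] by simp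
qed

section \<open>The L^2 seminorm, Cauchy-Schwarz and completeness\<close>

definition L2n :: "(real^'d::finite \<Rightarrow> complex) \<Rightarrow> real" where
  "L2n f = sqrt (L2_norm_sq f)"

lemma L2n_nonneg [simp]: "0 \<le> L2n f" and L2n_sq [simp]: "(L2n f)\<^sup>2 = L2_norm_sq f"
  by (simp_all add: L2n_def)

lemma L2_dist_sq_eq:
  assumes "square_integrable f" "square_integrable g"
  shows "L2_dist_sq f g = ennreal ((L2n (\<lambda>x. f x - g x))\<^sup>2)"
  unfolding L2_dist_sq_def using nn_integral_cmod_sq[OF square_integrable_diff[OF assms]] by simp

text \<open>The integral of the absolute value is bounded, not merely the absolute value of the
  integral: the Fubini argument in \<open>convolution_pairing\<close> needs this stronger
  form.\<close>

lemma Cauchy_Schwarz_abs: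
  assumes f: "square_integrable f" and g: "square_integrable g"
  shows "(LINT x|lebesgue. cmod (f x * g x)) \<le> L2n f * L2n g"
proof -
  have m [measurable]: "f \<in> borel_measurable lebesgue" "g \<in> borel_measurable lebesgue"
    using f g by (auto simp: square_integrable_def)
  let ?I = "LINT x|lebesgue. cmod (f x * g x)"
  have "(\<integral>\<^sup>+x. ennreal (cmod (f x)) * ennreal (cmod (g x)) \<partial>lebesgue) = ennreal ?I"
    using nn_integral_eq_integral[OF integrable_norm[OF square_integrable_mult_integrable[OF f g]]]
    by (simp add: norm_mult ennreal_mult)
  moreover have "(\<integral>\<^sup>+x. ennreal (cmod (f x)) * ennreal (cmod (g x)) \<partial>lebesgue)\<^sup>2
      \<le> (\<integral>\<^sup>+x. (ennreal (cmod (f x)))\<^sup>2 \<partial>lebesgue) * (\<integral>\<^sup>+x. (ennreal (cmod (g x)))\<^sup>2 \<partial>lebesgue)"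
    by (rule Cauchy_Schwarz_nn_integral) auto
  ultimately have "ennreal (?I\<^sup>2) \<le> ennreal (L2_norm_sq f * L2_norm_sq g)"
    using nn_integral_cmod_sq[OF f] nn_integral_cmod_sq[OF g]
    by (simp add: ennreal_power ennreal_mult)
  then have "?I\<^sup>2 \<le> (L2n f * L2n g)\<^sup>2"
    by (simp add: power_mult_distrib)
  then show ?thesis
    by (rule power2_le_imp_le) simp
qed

lemma Cauchy_Schwarz_integral:
  assumes "square_integrable f" "square_integrable g"
  shows "cmod (LINT x|lebesgue. f x * g x) \<le> L2n f * L2n g"
  using integral_norm_bound[of lebesgue "\<lambda>x. f x * g x"] Cauchy_Schwarz_abs[OF assms] by linarith

lemma L2n_cnj [simp]: "L2n (\<lambda>x. cnj (f x)) = L2n f"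
  by (simp add: L2n_def L2_norm_sq_def)

lemma Cauchy_Schwarz_L2_inner:
  assumes "square_integrable f" "square_integrable g"
  shows "cmod (L2_inner f g) \<le> L2n f * L2n g"
  unfolding L2_inner_def using Cauchy_Schwarz_integral[OF assms(1) square_integrable_cnj[OF assms(2)]] by simp

lemma L2_inner_self:
  "L2_inner f f = of_real (L2_norm_sq f)"
  by (simp add: L2_inner_def L2_norm_sq_def complex_norm_square[symmetric] integral_complex_of_real[symmetric])

lemma L2_inner_commute: "L2_inner g f = cnj (L2_inner f g)"
  unfolding L2_inner_def using integral_bounded_linear'[OF bounded_linear_cnj bounded_linear_cnj,
      of lebesgue "\<lambda>x. f x * cnj (g x)"]
  by (simp add: mult.commute)

lemma L2_inner_add_left:
  assumes "square_integrable f" "square_integrable g" "square_integrable k"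
  shows "L2_inner (\<lambda>x. f x + g x) k = L2_inner f k + L2_inner g k"
  unfolding L2_inner_def
  using square_integrable_mult_integrable[OF assms(1) square_integrable_cnj[OF assms(3)]]
    square_integrable_mult_integrable[OF assms(2) square_integrable_cnj[OF assms(3)]]
  by (simp add: distrib_right)

lemma L2_inner_cmult_left: "L2_inner (\<lambda>x. c * f x) k = c * L2_inner f k"
  unfolding L2_inner_def by (simp add: mult.assoc)

lemma L2_inner_cmult_right: "L2_inner f (\<lambda>x. c * k x) = cnj c * L2_inner f k"
  by (subst (1 2) L2_inner_commute) (simp add: L2_inner_cmult_left)

lemma L2_inner_diff_left:
  assumes "square_integrable f" "square_integrable g" "square_integrable k"
  shows "L2_inner (\<lambda>x. f x - g x) k = L2_inner f k - L2_inner g k"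
  using L2_inner_add_left[OF assms(1) square_integrable_cmult[OF assms(2), of "-1"] assms(3)]
    L2_inner_cmult_left[of "-1" g k] by simp

lemma L2_inner_sum_left:
  assumes "\<And>i. i \<in> I \<Longrightarrow> square_integrable (f i)" "square_integrable k"
  shows "L2_inner (\<lambda>x. \<Sum>i\<in>I. f i x) k = (\<Sum>i\<in>I. L2_inner (f i) k)"
  using assms(1)
proof (induction I rule: infinite_finite_induct)
  case (insert i I)
  then show ?case
    using L2_inner_add_left[of "f i" "\<lambda>x. \<Sum>i\<in>I. f i x" k] square_integrable_sum[of I f] assms(2) by simp
qed (simp_all add: L2_inner_def)

lemma L2_inner_sum_right:
  assumes "\<And>i. i \<in> I \<Longrightarrow> square_integrable (f i)" "square_integrable k"
  shows "L2_inner k (\<lambda>x. \<Sum>i\<in>I. f i x) = (\<Sum>i\<in>I. L2_inner k (f i))"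
  by (subst (1 2) L2_inner_commute) (simp add: L2_inner_sum_left[OF assms])

lemma L2_inner_AE_cong_right:
  assumes "square_integrable f" "square_integrable g" "AE x in lebesgue. g x = g' x"
  shows "L2_inner f g = L2_inner f g'"
proof -
  have "square_integrable g'" using square_integrable_AE_cong(1)[OF assms(2,3)] .
  then have "(\<lambda>x. f x * cnj (g x)) \<in> borel_measurable lebesgue" "(\<lambda>x. f x * cnj (g' x)) \<in> borel_measurable lebesgue"
    using square_integrable_mult_integrable[OF assms(1) square_integrable_cnj] assms(2)
    by (auto intro: borel_measurable_integrable)
  then show ?thesis unfolding L2_inner_def
    using assms(3) by (intro integral_cong_AE) auto
qed

text \<open>The square of the left side is the inner product of f + g with itself; Cauchy-Schwarz
  applied to both summands leaves one factor \<open>L2n (f + g)\<close> to be cancelled, with the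
  value 0 treated apart.\<close>

lemma L2n_triangle:
  assumes f: "square_integrable f" and g: "square_integrable g"
  shows "L2n (\<lambda>x. f x + g x) \<le> L2n f + L2n g"
proof (rule power2_le_imp_le)
  note s = square_integrable_add[OF f g]
  have e: "of_real ((L2n (\<lambda>x. f x + g x))\<^sup>2) = L2_inner f (\<lambda>x. f x + g x) + L2_inner g (\<lambda>x. f x + g x)"
    using L2_inner_add_left[OF f g s] by (simp add: L2_inner_self)
  have "cmod (of_real ((L2n (\<lambda>x. f x + g x))\<^sup>2)) \<le> L2n f * L2n (\<lambda>x. f x + g x) + L2n g * L2n (\<lambda>x. f x + g x)"
    unfolding e using Cauchy_Schwarz_L2_inner[OF f s] Cauchy_Schwarz_L2_inner[OF g s]
    using norm_triangle_ineq[of "L2_inner f (\<lambda>x. f x + g x)" "L2_inner g (\<lambda>x. f x + g x)"]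
    by linarith
  then have *: "(L2n (\<lambda>x. f x + g x))\<^sup>2 \<le> (L2n f + L2n g) * L2n (\<lambda>x. f x + g x)"
    by (simp add: distrib_right norm_power del: L2n_sq)
  then have "L2n (\<lambda>x. f x + g x) \<le> L2n f + L2n g"
    by (cases "L2n (\<lambda>x. f x + g x) = 0")
       (auto simp: power2_eq_square mult_le_cancel_right order.strict_iff_order simp del: L2n_sq)
  then show "(L2n (\<lambda>x. f x + g x))\<^sup>2 \<le> (L2n f + L2n g)\<^sup>2" by (intro power_mono) auto
qed simp

lemma L2n_cmult: "L2n (\<lambda>x. c * f x) = cmod c * L2n f"
  by (simp add: L2n_def L2_norm_sq_def norm_mult power_mult_distrib real_sqrt_mult)

lemma L2n_minus_commute: "L2n (\<lambda>x. f x - g x) = L2n (\<lambda>x. g x - f x)"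
  by (simp add: L2n_def L2_norm_sq_def norm_minus_commute)

lemma L2n_triangle_diff:
  assumes f: "square_integrable f" and g: "square_integrable g" and h: "square_integrable h"
  shows "L2n (\<lambda>x. f x - h x) \<le> L2n (\<lambda>x. f x - g x) + L2n (\<lambda>x. g x - h x)"
  using L2n_triangle[OF square_integrable_diff[OF f g] square_integrable_diff[OF g h]] by simp

lemma L2n_le_diff:
  assumes f: "square_integrable f" and g: "square_integrable g"
  shows "L2n f \<le> L2n g + L2n (\<lambda>x. f x - g x)"
  using L2n_triangle[OF g square_integrable_diff[OF f g]] by simp

lemma L2_norm_sq_eq_0_AE:
  assumes "square_integrable f" "L2_norm_sq f = 0"
  shows "AE x in lebesgue. f x = 0"
  using integral_nonneg_eq_0_iff_AE[of lebesgue "\<lambda>x. (cmod (f x))\<^sup>2"] assms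
  by (auto simp: square_integrable_def L2_norm_sq_def)

text \<open>Ordinary dominated convergence applied to the squared differences, for which four times
  the square of w is a majorant since f inherits the bound w from the sequence.\<close>

lemma L2_dominated_convergence:
  fixes f :: "real^'d::finite \<Rightarrow> complex" and s :: "nat \<Rightarrow> real^'d \<Rightarrow> complex"
  assumes f: "f \<in> borel_measurable lebesgue" and s: "\<And>n. s n \<in> borel_measurable lebesgue"
    and w: "integrable lebesgue (\<lambda>x. (w x)\<^sup>2)"
    and lim: "AE x in lebesgue. (\<lambda>n. s n x) \<longlonglongrightarrow> f x"
    and dom: "\<And>n. AE x in lebesgue. cmod (s n x) \<le> w x"
  shows "square_integrable f" "\<And>n. square_integrable (s n)" "(\<lambda>n. L2n (\<lambda>x. s n x - f x)) \<longlonglongrightarrow> 0"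
proof -
  show sn: "square_integrable (s n)" for n by (rule square_integrable_bound[OF s w dom])
  have "AE x in lebesgue. \<forall>n. cmod (s n x) \<le> w x" using dom by (simp add: AE_all_countable)
  with lim have fw: "AE x in lebesgue. cmod (f x) \<le> w x"
  proof eventually_elim
    case (elim x)
    then show ?case by (intro tendsto_upperbound[OF tendsto_norm[of "\<lambda>n. s n x"]]) auto
  qed
  show "square_integrable f" by (rule square_integrable_bound[OF f w fw])
  have "(\<lambda>n. LINT x|lebesgue. (cmod (s n x - f x))\<^sup>2) \<longlonglongrightarrow> (LINT (x::real^'d)|lebesgue. (0 :: real))"
  proof (rule integral_dominated_convergence)
    show "integrable lebesgue (\<lambda>x. 4 * (w x)\<^sup>2)" using w by simp
    show "AE x in lebesgue. (\<lambda>n. (cmod (s n x - f x))\<^sup>2) \<longlonglongrightarrow> 0"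
      using lim
    proof eventually_elim
      case (elim x)
      then have "(\<lambda>n. (cmod (s n x - f x))\<^sup>2) \<longlonglongrightarrow> (cmod (f x - f x))\<^sup>2"
        by (intro tendsto_intros)
      then show ?case by simp
    qed
    show "AE x in lebesgue. norm ((cmod (s n x - f x))\<^sup>2) \<le> 4 * (w x)\<^sup>2" for n
      using fw dom[of n]
    proof eventually_elim
      case (elim x)
      then have "cmod (s n x - f x) \<le> 2 * w x" using norm_triangle_ineq4[of "s n x" "f x"] by linarith
      then have "(cmod (s n x - f x))\<^sup>2 \<le> (2 * w x)\<^sup>2" by (intro power_mono) auto
      then show ?case by (simp add: power_mult_distrib)
    qed
  qed (use f s in auto)
  then show "(\<lambda>n. L2n (\<lambda>x. s n x - f x)) \<longlonglongrightarrow> 0"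
    unfolding L2n_def L2_norm_sq_def using tendsto_real_sqrt[of _ 0 sequentially] by simp
qed

lemma L2_inner_tendsto_left:
  assumes "\<And>n. square_integrable (s n)" "square_integrable f" "square_integrable g"
    "(\<lambda>n. L2n (\<lambda>x. s n x - f x)) \<longlonglongrightarrow> 0"
  shows "(\<lambda>n. L2_inner (s n) g) \<longlonglongrightarrow> L2_inner f g"
proof -
  have "(\<lambda>n. L2_inner (s n) g - L2_inner f g) \<longlonglongrightarrow> 0"
  proof (rule Lim_null_comparison)
    show "\<forall>\<^sub>F n in sequentially. norm (L2_inner (s n) g - L2_inner f g) \<le> L2n (\<lambda>x. s n x - f x) * L2n g"
      using Cauchy_Schwarz_L2_inner[OF square_integrable_diff[OF assms(1,2)] assms(3)]
        L2_inner_diff_left[OF assms(1-3)] by simp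
    show "(\<lambda>n. L2n (\<lambda>x. s n x - f x) * L2n g) \<longlonglongrightarrow> 0"
      using tendsto_mult_left_zero[OF assms(4)] by simp
  qed
  then show ?thesis by (simp add: LIM_zero_iff)
qed

lemma L2n_tendsto:
  assumes "\<And>n. square_integrable (s n)" "square_integrable f"
    "(\<lambda>n. L2n (\<lambda>x. s n x - f x)) \<longlonglongrightarrow> 0"
  shows "(\<lambda>n. L2n (s n)) \<longlonglongrightarrow> L2n f"
proof -
  have "(\<lambda>n. L2n (s n) - L2n f) \<longlonglongrightarrow> 0"
  proof (rule Lim_null_comparison[OF _ assms(3)])
    have "norm (L2n (s n) - L2n f) \<le> L2n (\<lambda>x. s n x - f x)" for n
      using L2n_le_diff[OF assms(1)[of n] assms(2)] L2n_le_diff[OF assms(2) assms(1)[of n]]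
        L2n_minus_commute[of f "s n"]
      by (simp add: abs_le_iff)
    then show "\<forall>\<^sub>F n in sequentially. norm (L2n (s n) - L2n f) \<le> L2n (\<lambda>x. s n x - f x)"
      by simp
  qed
  then show ?thesis by (simp add: LIM_zero_iff)
qed

lemma LIMSEQ_0_less:
  fixes X :: "nat \<Rightarrow> real"
  assumes "X \<longlonglongrightarrow> 0" "e > 0"
  shows "\<exists>n. X n < e"
  using order_tendstoD(2)[OF assms] by (auto simp: eventually_sequentially)

text \<open>Riesz-Fischer. A fast Cauchy subsequence converges almost everywhere, and Fatou's lemma
  bounds the distance of every late \<open>f n\<close> to the pointwise limit.\<close>

lemma L2_complete:
  fixes f :: "nat \<Rightarrow> real^'d::finite \<Rightarrow> complex"
  assumes f: "\<And>n. square_integrable (f n)"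
    and cauchy: "\<And>e. e > 0 \<Longrightarrow> \<exists>N. \<forall>m\<ge>N. \<forall>n\<ge>N. L2n (\<lambda>x. f m x - f n x) < e"
  obtains g where "square_integrable g" "(\<lambda>n. L2n (\<lambda>x. f n x - g x)) \<longlonglongrightarrow> 0"
proof -
  have "\<exists>N. \<forall>m\<ge>N. \<forall>n\<ge>N. L2n (\<lambda>x. f m x - f n x) < (1/2)^k" for k :: nat
    by (rule cauchy) simp
  then obtain N where N: "\<And>k m n. m \<ge> N k \<Longrightarrow> n \<ge> N k \<Longrightarrow> L2n (\<lambda>x. f m x - f n x) < (1/2)^k"
    by metis
  \<comment> \<open>Adding up the thresholds puts both \<open>r k\<close> and
    \<open>r (Suc k)\<close> beyond \<open>N k\<close>, and the summands 1 force \<open>r k\<close>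
    to be at least k.\<close>
  define r where "r = (\<lambda>k. \<Sum>i\<le>k. N i + 1)"
  have rN: "r k \<ge> N k" for k unfolding r_def
    using member_le_sum[of k "{..k}" "\<lambda>i. N i + 1"] by simp
  have rk: "r k \<ge> k" for k
    by (induction k) (auto simp: r_def)
  have rS: "r (Suc k) \<ge> N k" for k using rN[of k] by (simp add: r_def)
  have m [measurable]: "f n \<in> borel_measurable lebesgue" for n using f by (simp add: square_integrable_def)
  let ?d = "\<lambda>k x. f (r (Suc k)) x - f (r k) x"
  have sd: "square_integrable (?d k)" for k by (intro square_integrable_diff f)
  \<comment> \<open>The squared norms of the increments are below \<open>(1/4)^k\<close>, so the
    weight \<open>2^k\<close> still leaves a convergent series. Pointwise it forces geometric decay
    of the increments with ratio \<open>sqrt (1/2)\<close>.\<close>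
  have "(\<integral>\<^sup>+x. (\<Sum>k. ennreal (2^k * (cmod (?d k x))\<^sup>2)) \<partial>lebesgue) =
      (\<Sum>k. \<integral>\<^sup>+x. ennreal (2^k * (cmod (?d k x))\<^sup>2) \<partial>lebesgue)"
    by (rule nn_integral_suminf) auto
  also have "\<dots> \<le> (\<Sum>k. ennreal ((1/2)^k))"
  proof (rule suminf_le)
    fix k
    have "(\<integral>\<^sup>+x. ennreal (2^k * (cmod (?d k x))\<^sup>2) \<partial>lebesgue) = ennreal (2^k * L2_norm_sq (?d k))"
      using nn_integral_cmod_sq[OF sd, of k] by (simp add: ennreal_mult nn_integral_cmult)
    also have "\<dots> \<le> ennreal ((1/2)^k)"
    proof (rule ennreal_leI)
      have "(L2n (?d k))\<^sup>2 \<le> ((1/2)^k)\<^sup>2"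
        using N[OF rS rN, of k] by (intro power_mono) auto
      then have "2^k * L2_norm_sq (?d k) \<le> 2^k * ((1/2)^k)\<^sup>2" by simp
      also have "\<dots> = (1/2::real)^k" by (simp add: power2_eq_square power_divide)
      finally show "2^k * L2_norm_sq (?d k) \<le> (1/2)^k" .
    qed
    finally show "(\<integral>\<^sup>+x. ennreal (2^k * (cmod (?d k x))\<^sup>2) \<partial>lebesgue) \<le> ennreal ((1/2)^k)" .
  qed auto
  also have "\<dots> < \<infinity>"
    by (subst suminf_ennreal2) (auto simp: less_top[symmetric])
  finally have "AE x in lebesgue. (\<Sum>k. ennreal (2^k * (cmod (?d k x))\<^sup>2)) \<noteq> \<infinity>"
    by (intro nn_integral_PInf_AE) auto
  then have conv: "AE x in lebesgue. convergent (\<lambda>k. f (r k) x)"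
  proof eventually_elim
    case (elim x)
    have sm: "summable (\<lambda>k. 2^k * (cmod (?d k x))\<^sup>2)"
      by (rule summable_suminf_not_top) (use elim in auto)
    obtain K where K: "\<And>k. 2^k * (cmod (?d k x))\<^sup>2 \<le> K"
    proof -
      obtain K where "\<forall>k. norm (2^k * (cmod (?d k x))\<^sup>2) \<le> K"
        using summable_imp_Bseq[OF sm] by (rule BseqE)
      then have "2^k * (cmod (?d k x))\<^sup>2 \<le> K" for k by (simp add: abs_mult)
      then show thesis by (rule that)
    qed
    have "0 \<le> 2^0 * (cmod (?d 0 x))\<^sup>2" by simp
    then have "K \<ge> 0" using K[of 0] by (rule order_trans)
    have "cmod (?d k x) \<le> sqrt K * (sqrt (1/2))^k" for k
    proof (rule power2_le_imp_le)
      have "(sqrt K * (sqrt (1/2))^k)\<^sup>2 = K * (1/2)^k"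
      proof -
        have "((sqrt (1/2))^k)\<^sup>2 = ((sqrt (1/2))\<^sup>2)^k" by (simp only: power_mult[symmetric] mult.commute)
        then show ?thesis using \<open>K \<ge> 0\<close> by (simp only: power_mult_distrib) simp
      qed
      then show "(cmod (?d k x))\<^sup>2 \<le> (sqrt K * (sqrt (1/2))^k)\<^sup>2"
        using K[of k] by (simp only:) (simp add: field_simps power_divide)
    qed (use \<open>K \<ge> 0\<close> in simp)
    then have b: "norm (?d k x) \<le> sqrt K * (sqrt (1/2))^k" if "k \<ge> 0" for k by blast
    have "summable (\<lambda>k. sqrt K * (sqrt (1/2))^k)"
      by (intro summable_mult summable_geometric) (simp add: real_sqrt_lt_1_iff)
    from summable_comparison_test'[OF this b] have "summable (\<lambda>k. ?d k x)" .
    then show "convergent (\<lambda>k. f (r k) x)"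
      by (simp only: summable_iff_convergent sum_lessThan_telescope[of "\<lambda>k. f (r k) x"]
          convergent_diff_const_right_iff)
  qed
  define g where "g = (\<lambda>x. lim (\<lambda>k. f (r k) x))"
  have gm [measurable]: "g \<in> borel_measurable lebesgue"
    unfolding g_def by (rule borel_measurable_lim_metric) auto
  have lim: "AE x in lebesgue. (\<lambda>k. f (r k) x) \<longlonglongrightarrow> g x"
    using conv by eventually_elim (simp add: g_def convergent_LIMSEQ_iff)
  have bound: "(\<integral>\<^sup>+x. ennreal ((cmod (f n x - g x))\<^sup>2) \<partial>lebesgue) \<le> ennreal (((1/2)^j)\<^sup>2)" if "n \<ge> N j" for n j
  proof -
    have "(\<integral>\<^sup>+x. ennreal ((cmod (f n x - g x))\<^sup>2) \<partial>lebesgue) =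
        (\<integral>\<^sup>+x. liminf (\<lambda>k. ennreal ((cmod (f n x - f (r k) x))\<^sup>2)) \<partial>lebesgue)"
    proof (rule nn_integral_cong_AE)
      show "AE x in lebesgue. ennreal ((cmod (f n x - g x))\<^sup>2) = liminf (\<lambda>k. ennreal ((cmod (f n x - f (r k) x))\<^sup>2))"
        using lim
      proof eventually_elim
        case (elim x)
        then have "(\<lambda>k. ennreal ((cmod (f n x - f (r k) x))\<^sup>2)) \<longlonglongrightarrow> ennreal ((cmod (f n x - g x))\<^sup>2)"
          by (intro tendsto_intros tendsto_ennrealI)
        then show ?case by (rule lim_imp_Liminf[OF sequentially_bot, symmetric])
      qed
    qed
    also have "\<dots> \<le> liminf (\<lambda>k. \<integral>\<^sup>+x. ennreal ((cmod (f n x - f (r k) x))\<^sup>2) \<partial>lebesgue)"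
      by (rule nn_integral_liminf) auto
    also have "\<dots> \<le> liminf (\<lambda>k::nat. ennreal (((1/2)^j)\<^sup>2))"
    proof (rule Liminf_mono)
      show "\<forall>\<^sub>F k in sequentially. (\<integral>\<^sup>+x. ennreal ((cmod (f n x - f (r k) x))\<^sup>2) \<partial>lebesgue) \<le> ennreal (((1/2)^j)\<^sup>2)"
        using eventually_ge_at_top[of "N j"]
      proof eventually_elim
        case (elim k)
        then have "L2n (\<lambda>x. f n x - f (r k) x) < (1/2)^j" using N[OF that, of "r k"] rk[of k] by linarith
        then have "(L2n (\<lambda>x. f n x - f (r k) x))\<^sup>2 \<le> ((1/2)^j)\<^sup>2" by (intro power_mono) auto
        then show ?case
          using nn_integral_cmod_sq[OF square_integrable_diff[OF f f], of n "r k"] by (simp add: ennreal_leI)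
      qed
    qed
    also have "\<dots> = ennreal (((1/2)^j)\<^sup>2)" by (simp add: Liminf_const)
    finally show ?thesis .
  qed
  \<comment> \<open>Any j serves here; with j = 0 the limit differs from a square integrable
    function by one of finite norm.\<close>
  have sq: "square_integrable (\<lambda>x. f (N 0) x - g x)"
    using bound[of 0 "N 0"] by (auto simp: square_integrable_iff_nn_integral intro: le_less_trans)
  have g: "square_integrable g"
    using square_integrable_diff[OF f sq, of "N 0"] by simp
  have "(\<lambda>n. L2n (\<lambda>x. f n x - g x)) \<longlonglongrightarrow> 0"
  proof (rule LIMSEQ_I)
    fix e :: real assume "e > 0"
    then obtain j where j: "(1/2)^j < e" using real_arch_pow_inv[of e "1/2"] by auto
    have "L2n (\<lambda>x. f n x - g x) < e" if "n \<ge> N j" for n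
    proof -
      have "ennreal (L2_norm_sq (\<lambda>x. f n x - g x)) \<le> ennreal (((1/2)^j)\<^sup>2)"
        using bound[OF that] nn_integral_cmod_sq[OF square_integrable_diff[OF f g], of n] by simp
      then have "(L2n (\<lambda>x. f n x - g x))\<^sup>2 \<le> ((1/2)^j)\<^sup>2" by simp
      then have "L2n (\<lambda>x. f n x - g x) \<le> (1/2)^j" by (rule power2_le_imp_le) simp
      then show ?thesis using j by simp
    qed
    then show "\<exists>no. \<forall>n\<ge>no. norm (L2n (\<lambda>x. f n x - g x) - 0) < e" by auto
  qed
  with g show thesis by (rule that)
qed

section \<open>Continuous functions of compact support\<close>

definition Cc :: "(real^'d::finite \<Rightarrow> complex) \<Rightarrow> bool" where
  "Cc u \<longleftrightarrow> continuous_on UNIV u \<and> (\<exists>R. \<forall>x. norm x > R \<longrightarrow> u x = 0)"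

lemma Cc_bounded:
  assumes "Cc u"
  obtains K R where "K \<ge> 0" "R \<ge> 0" "\<And>x. cmod (u x) \<le> K" "\<And>x. norm x > R \<Longrightarrow> u x = 0"
proof -
  from assms obtain R where c: "continuous_on UNIV u" and R: "\<And>x. norm x > R \<Longrightarrow> u x = 0"
    by (auto simp: Cc_def)
  have "compact (u ` cball 0 R)"
    by (intro compact_continuous_image continuous_on_subset[OF c]) auto
  then obtain K where K: "\<And>x. x \<in> cball 0 R \<Longrightarrow> cmod (u x) \<le> K"
    using compact_imp_bounded bounded_iff by (metis image_eqI)
  have "cmod (u x) \<le> max K 0" for x
    using K[of x] R[of x] by (cases "norm x > R") (auto simp: le_max_iff_disj)
  moreover have "\<And>x. norm x > max R 0 \<Longrightarrow> u x = 0" using R by simp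
  ultimately show thesis using that[of "max K 0" "max R 0"] by simp
qed

lemma Cc_measurable: "Cc u \<Longrightarrow> u \<in> borel_measurable borel"
  by (simp add: Cc_def borel_measurable_continuous_onI)

lemma Cc_measurable_lebesgue: "Cc u \<Longrightarrow> u \<in> borel_measurable lebesgue"
  by (rule measurable_completion) (simp add: Cc_measurable)

lemma integrable_indicator_cball:
  "integrable lebesgue (\<lambda>x::real^'d::finite. c * indicator (cball 0 R) x :: real)"
proof -
  have "emeasure lborel (cball (0::real^'d) R) < \<infinity>" by (rule emeasure_bounded_finite) simp
  then show ?thesis by (intro integrable_mult_right integrable_real_indicator) auto
qed

lemma indicator_scaled_sq: "(K * indicator S x)\<^sup>2 = (K\<^sup>2 * indicator S x :: real)"
  by (simp add: indicator_def)

lemma bounded_support_square_integrable: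
  fixes f :: "real^'d::finite \<Rightarrow> complex"
  assumes "f \<in> borel_measurable lebesgue" "\<And>x. cmod (f x) \<le> K" "\<And>x. norm x > R \<Longrightarrow> f x = 0"
  shows "square_integrable f" "integrable lebesgue f"
proof -
  have b: "cmod (f x) \<le> K * indicator (cball 0 R) x" for x
    using assms(2)[of x] assms(3)[of x] by (cases "norm x > R") auto
  have "integrable lebesgue (\<lambda>x::real^'d. (K * indicator (cball 0 R) x)\<^sup>2)"
    using integrable_indicator_cball[of "K\<^sup>2" R]
    by (simp only: indicator_scaled_sq)
  from square_integrable_bound[OF assms(1) this] b show "square_integrable f" by simp
  show "integrable lebesgue f"
    by (rule Bochner_Integration.integrable_bound[OF integrable_indicator_cball[of K R] assms(1)])
       (intro AE_I2, use b in \<open>auto intro: order_trans[OF _ abs_ge_self]\<close>)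
qed

lemma Cc_square_integrable: "Cc u \<Longrightarrow> square_integrable u"
  and Cc_integrable: "Cc u \<Longrightarrow> integrable lebesgue u"
  by (metis Cc_bounded Cc_measurable_lebesgue bounded_support_square_integrable)+

lemma Cc_mult_left: "Cc u \<Longrightarrow> continuous_on UNIV v \<Longrightarrow> Cc (\<lambda>x. v x * u x)"
  by (auto simp: Cc_def intro!: continuous_intros)

lemma Cc_cnj: "Cc u \<Longrightarrow> Cc (\<lambda>x. cnj (u x))"
  by (auto simp: Cc_def intro!: continuous_intros)

definition cutoff :: "real \<Rightarrow> real^'d::finite \<Rightarrow> complex" where
  "cutoff R x = of_real (max 0 (min 1 (R + 1 - norm x)))"

lemma cutoff_le_1: "cmod (cutoff R x) \<le> 1"
  and cutoff_eq_1: "norm x \<le> R \<Longrightarrow> cutoff R x = 1"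
  and cutoff_eq_0: "norm x > R + 1 \<Longrightarrow> cutoff R x = 0"
  by (auto simp: cutoff_def)

lemma continuous_cutoff: "continuous_on UNIV (cutoff R)"
  unfolding cutoff_def by (intro continuous_intros)

lemma Cc_cutoff: "Cc (cutoff R)"
  using continuous_cutoff cutoff_eq_0 unfolding Cc_def by blast

text \<open>Lebesgue measurability supplies continuous functions converging to f almost everywhere,
  but with no majorant. Clipping the values and cutting off the support provides one, so dominated
  convergence is used twice: from f to its clipped version, and from the continuous approximants,
  clipped in the same way, to that version.\<close>

lemma Cc_dense:
  fixes f :: "real^'d::finite \<Rightarrow> complex"
  assumes f: "square_integrable f" and "e > 0"
  obtains u where "Cc u" "L2n (\<lambda>x. u x - f x) < e"
proof -
  have fm [measurable]: "f \<in> borel_measurable lebesgue" using f by (simp add: square_integrable_def)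
  then have "f measurable_on UNIV"
    using measurable_on_iff_borel_measurable[of UNIV f] by simp
  then obtain Z and g :: "nat \<Rightarrow> real^'d \<Rightarrow> complex" where Z: "negligible Z"
    and g: "\<And>n. continuous_on UNIV (g n)" and lim: "\<And>x. x \<notin> Z \<Longrightarrow> (\<lambda>n. g n x) \<longlonglongrightarrow> f x"
    by (auto simp: measurable_on_def)
  have ae: "AE x in lebesgue. (\<lambda>n. g n x) \<longlonglongrightarrow> f x"
    using Z lim by (auto simp: negligible_iff_null_sets eventually_ae_filter)
  \<comment> \<open>The radial retraction onto the disc of radius k + 1: continuous, bounded, and
    never increasing the modulus.\<close>
  define clip where "clip = (\<lambda>k::nat. \<lambda>z::complex. z / of_real (max 1 (cmod z / real (Suc k))))"
  have nclip: "cmod (clip k z) = cmod z / max 1 (cmod z / real (Suc k))" for k z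
    unfolding clip_def norm_divide norm_of_real by simp
  have clipk: "cmod (clip k z) \<le> real (Suc k)" for k z
  proof (cases "cmod z \<le> real (Suc k)")
    case False
    then have "cmod z / real (Suc k) \<ge> 1" "cmod z \<noteq> 0" by (auto simp: field_simps)
    then show ?thesis unfolding nclip by (simp add: max_def)
  next
    case True
    then have "cmod z / real (Suc k) \<le> 1" by (simp add: field_simps)
    then show ?thesis unfolding nclip using True by (simp add: max_def)
  qed
  have clipz: "cmod (clip k z) \<le> cmod z" for k z
    unfolding nclip using mult_left_mono[of 1 "max 1 (cmod z / real (Suc k))" "cmod z"]
    by (simp add: divide_le_eq)
  have clipc: "continuous_on UNIV (clip k)" for k
    unfolding clip_def by (intro continuous_intros) (auto simp: max_def)
  have clipl: "(\<lambda>k. clip k z) \<longlonglongrightarrow> z" for z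
  proof (rule tendsto_eventually)
    obtain k0 :: nat where "cmod z \<le> real k0" using real_arch_simple by blast
    then show "\<forall>\<^sub>F k in sequentially. clip k z = z"
      by (intro eventually_sequentiallyI[of k0]) (auto simp: clip_def max_def field_simps)
  qed
  let ?F = "\<lambda>k x. cutoff (real k) x * clip k (f x)"
  have Fm: "?F k \<in> borel_measurable lebesgue" for k
    using borel_measurable_continuous_on[OF clipc fm, of k] Cc_measurable_lebesgue[OF Cc_cutoff]
    by (intro borel_measurable_times) auto
  have "(\<lambda>k. L2n (\<lambda>x. ?F k x - f x)) \<longlonglongrightarrow> 0"
  proof (rule L2_dominated_convergence(3)[where w="\<lambda>x. cmod (f x)"])
    show "integrable lebesgue (\<lambda>x. (cmod (f x))\<^sup>2)" using f by (simp add: square_integrable_def)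
    show "AE x in lebesgue. (\<lambda>k. ?F k x) \<longlonglongrightarrow> f x"
    proof (rule AE_I2)
      fix x :: "real^'d"
      obtain k0 :: nat where "norm x \<le> real k0" using real_arch_simple by blast
      then have "(\<lambda>k. cutoff (real k) x) \<longlonglongrightarrow> 1"
        by (intro tendsto_eventually eventually_sequentiallyI[of k0] cutoff_eq_1) auto
      then show "(\<lambda>k. ?F k x) \<longlonglongrightarrow> f x" using tendsto_mult[OF _ clipl, of "\<lambda>k. cutoff (real k) x" 1 "f x"] by simp
    qed
    show "AE x in lebesgue. cmod (?F k x) \<le> cmod (f x)" for k
      using mult_mono[OF cutoff_le_1 clipz] by (intro AE_I2) (auto simp: norm_mult)
  qed (use fm Fm in auto)
  then obtain k where k: "L2n (\<lambda>x. ?F k x - f x) < e / 2"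
    using \<open>e > 0\<close> LIMSEQ_0_less[of _ "e/2"] half_gt_zero by blast
  let ?u = "\<lambda>n x. cutoff (real k) x * clip k (g n x)"
  have cu: "Cc (?u n)" for n
  proof -
    have "Cc (\<lambda>x. clip k (g n x) * cutoff (real k) x)"
      by (intro Cc_mult_left Cc_cutoff continuous_on_compose2[OF clipc g]) simp
    then show ?thesis by (simp add: mult.commute)
  qed
  have dom: "cmod (cutoff (real k) x * clip k z) \<le> real (Suc k) * indicator (cball 0 (real k + 1)) x" for x :: "real^'d" and z
    using mult_mono[OF cutoff_le_1[of "real k" x] clipk[of k z]] cutoff_eq_0[of "real k" x]
    by (cases "norm x > real k + 1") (auto simp: norm_mult)
  have lu: "(\<lambda>n. L2n (\<lambda>x. ?u n x - ?F k x)) \<longlonglongrightarrow> 0"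
  proof (rule L2_dominated_convergence(3)[where w="\<lambda>x. real (Suc k) * indicator (cball 0 (real k + 1)) x"])
    show "integrable lebesgue (\<lambda>x::real^'d. (real (Suc k) * indicator (cball 0 (real k + 1)) x)\<^sup>2)"
      using integrable_indicator_cball[of "(real (Suc k))\<^sup>2" "real k + 1"]
      by (simp only: indicator_scaled_sq)
    show "AE x in lebesgue. (\<lambda>n. ?u n x) \<longlonglongrightarrow> ?F k x"
      using ae
    proof eventually_elim
      case (elim x)
      have "isCont (clip k) (f x)" using clipc by (simp add: continuous_on_eq_continuous_at)
      then have "(\<lambda>n. clip k (g n x)) \<longlonglongrightarrow> clip k (f x)" by (rule isCont_tendsto_compose) (rule elim)
      then show ?case by (intro tendsto_intros)
    qed
  qed (use Fm Cc_measurable_lebesgue[OF cu] dom in auto)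
  then obtain n where n: "L2n (\<lambda>x. ?u n x - ?F k x) < e / 2"
    using \<open>e > 0\<close> LIMSEQ_0_less[of _ "e/2"] half_gt_zero by blast
  have "square_integrable (?F k)"
    by (rule bounded_support_square_integrable[OF Fm[of k], of "real (Suc k)" "real k + 1"])
       (use mult_mono[OF cutoff_le_1 clipk] cutoff_eq_0 in \<open>auto simp: norm_mult\<close>)
  then have "L2n (\<lambda>x. ?u n x - f x) < e"
    using L2n_triangle_diff[OF Cc_square_integrable[OF cu[of n]] _ f, of "?F k"] k n by linarith
  then show thesis using that cu by blast
qed

lemma Cc_dense_seq:
  fixes f :: "real^'d::finite \<Rightarrow> complex"
  assumes f: "square_integrable f"
  obtains u where "\<And>n. Cc (u n)" "(\<lambda>n. L2n (\<lambda>x. u n x - f x)) \<longlonglongrightarrow> 0"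
proof -
  have "\<exists>u. Cc u \<and> L2n (\<lambda>x. u x - f x) < 1 / real (Suc n)" for n
    using Cc_dense[OF f, of "1 / real (Suc n)"] by (metis of_nat_0_less_iff zero_less_Suc zero_less_divide_1_iff)
  then obtain u where u: "\<And>n. Cc (u n)" "\<And>n. L2n (\<lambda>x. u n x - f x) < 1 / real (Suc n)" by metis
  have "(\<lambda>n. L2n (\<lambda>x. u n x - f x)) \<longlonglongrightarrow> 0"
  proof (rule Lim_null_comparison)
    show "\<forall>\<^sub>F n in sequentially. norm (L2n (\<lambda>x. u n x - f x)) \<le> 1 / real (Suc n)"
      using u(2) by (auto intro!: always_eventually less_imp_le)
    show "(\<lambda>n. 1 / real (Suc n)) \<longlonglongrightarrow> 0" by (rule LIMSEQ_Suc) (rule lim_1_over_n)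
  qed
  then show thesis using that u by blast
qed

text \<open>By density w is an L^2 limit of test functions, each of which is orthogonal to w; so w
  is orthogonal to itself.\<close>

lemma Cc_integral_eq_0_imp_AE:
  fixes w :: "real^'d::finite \<Rightarrow> complex"
  assumes w: "square_integrable w" and 0: "\<And>u. Cc u \<Longrightarrow> (LINT x|lebesgue. w x * u x) = 0"
  shows "AE x in lebesgue. w x = 0"
proof -
  obtain u where u: "\<And>n. Cc (u n)" "(\<lambda>n. L2n (\<lambda>x. u n x - w x)) \<longlonglongrightarrow> 0"
    using Cc_dense_seq[OF w] by blast
  have "L2_inner (u n) w = 0" for n
    using 0[OF Cc_cnj[OF u(1)], of n] L2_inner_commute[of w "u n"] by (metis L2_inner_commute L2_inner_def complex_cnj_zero)
  then have "L2_inner w w = 0"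
    using L2_inner_tendsto_left[OF Cc_square_integrable[OF u(1)] w w u(2)] by (simp add: LIMSEQ_const_iff)
  then show ?thesis using L2_norm_sq_eq_0_AE[OF w] by (simp add: L2_inner_self)
qed

section \<open>Powers of the inverse of an expansive matrix\<close>

text \<open>Summing the recurrence bounds a partial sum by r times itself plus a constant; since r <
  1 it can be absorbed on the left.\<close>

lemma summable_norm_recurrence:
  fixes y z :: "nat \<Rightarrow> 'a::real_normed_vector"
  assumes rec: "\<And>k. norm (y (Suc k)) \<le> r * norm (y k) + norm (z k)"
    and r: "0 \<le> r" "r < 1" and z: "summable (\<lambda>k. norm (z k))"
  shows "summable (\<lambda>k. norm (y k))"
proof -
  define Z where "Z = (\<Sum>k. norm (z k))"
  have "(\<Sum>k<n. norm (y k)) \<le> (norm (y 0) + Z) / (1 - r)" for n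
  proof -
    have "(\<Sum>k<n. norm (y k)) \<le> (\<Sum>k<Suc n. norm (y k))" by simp
    also have "\<dots> = norm (y 0) + (\<Sum>k<n. norm (y (Suc k)))" by (rule sum.lessThan_Suc_shift)
    also have "\<dots> \<le> norm (y 0) + (\<Sum>k<n. r * norm (y k) + norm (z k))"
      using rec by (intro add_left_mono sum_mono)
    also have "\<dots> = norm (y 0) + r * (\<Sum>k<n. norm (y k)) + (\<Sum>k<n. norm (z k))"
      by (simp add: sum.distrib sum_distrib_left)
    also have "\<dots> \<le> norm (y 0) + r * (\<Sum>k<n. norm (y k)) + Z"
      unfolding Z_def by (intro add_left_mono sum_le_suminf[OF z]) auto
    finally show ?thesis using r by (simp add: field_simps)
  qed
  then show ?thesis
    by (intro summableI_nonneg_bounded) auto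
qed

lemma norm_scale_complex_vec: "norm (c *s (x::complex^'d::finite)) = cmod c * norm x"
  by (simp add: norm_vec_def norm_mult L2_set_right_distrib)

text \<open>A repeated vector is cancelled by the coefficients 1 and -1; otherwise the vectors with
  indices up to the dimension are too many to be independent. Stated over the reals, so that a
  complex space is covered as a real Euclidean space.\<close>

lemma real_dependent_family:
  fixes w :: "nat \<Rightarrow> 'a::euclidean_space"
  obtains c :: "nat \<Rightarrow> real" and N where "\<exists>i\<le>N. c i \<noteq> 0" "(\<Sum>i\<le>N. c i *\<^sub>R w i) = 0"
proof (cases "inj_on w {..DIM('a)}")
  case False
  then obtain i j where ij: "i \<le> DIM('a)" "j \<le> DIM('a)" "i \<noteq> j" "w i = w j" by (auto simp: inj_on_def)
  let ?c = "\<lambda>k. if k = i then 1 else if k = j then -1 else (0::real)"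
  have "(\<Sum>k\<le>DIM('a). ?c k *\<^sub>R w k) = (\<Sum>k\<in>{i,j}. ?c k *\<^sub>R w k)"
    using ij by (intro sum.mono_neutral_right) auto
  also have "\<dots> = 0" using ij by simp
  finally have "(\<Sum>k\<le>DIM('a). ?c k *\<^sub>R w k) = 0" .
  moreover have "\<exists>k\<le>DIM('a). ?c k \<noteq> 0" using ij(1) by auto
  ultimately show thesis by (intro that[where c="?c" and N="DIM('a)"])
next
  case True
  then have "card (w ` {..DIM('a)}) > DIM('a)" by (simp add: card_image)
  then have "dependent (w ` {..DIM('a)})" by (intro dependent_biggerset) auto
  then obtain u where u: "\<exists>v\<in>w ` {..DIM('a)}. u v \<noteq> 0" "(\<Sum>v\<in>w ` {..DIM('a)}. u v *\<^sub>R v) = 0"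
    using dependent_finite[of "w ` {..DIM('a)}"] by auto
  then show thesis
    by (intro that[where c="u \<circ> w" and N="DIM('a)"]) (use True in \<open>auto simp: sum.reindex\<close>)
qed

context
  fixes C :: "complex^'d::finite^'d"
begin

text \<open>The vector p(C) v, evaluated by Horner's scheme.\<close>

definition poly_act :: "complex poly \<Rightarrow> complex^'d \<Rightarrow> complex^'d" where
  "poly_act p v = fold_coeffs (\<lambda>a w. a *s v + C *v w) p 0"

lemma poly_act_0 [simp]: "poly_act 0 v = 0"
  by (simp add: poly_act_def)

lemma poly_act_pCons [simp]: "poly_act (pCons a p) v = a *s v + C *v poly_act p v"
  by (cases "p = 0 \<and> a = 0") (auto simp: poly_act_def fold_coeffs_pCons_coeff_not_0_eq fold_coeffs_pCons_not_0_0_eq)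

lemma poly_act_add: "poly_act (p + q) v = poly_act p v + poly_act q v"
  by (induction p q rule: poly_induct2)
     (auto simp: matrix_vector_right_distrib vector_sadd_rdistrib algebra_simps)

lemma poly_act_smult: "poly_act (smult c p) v = c *s poly_act p v"
  by (induction p) (auto simp: vector_scalar_commute[symmetric] vector_add_ldistrib vector_smult_assoc)

lemma poly_act_linear_factor: "poly_act ([:-c, 1:] * q) v = C *v poly_act q v - c *s poly_act q v"
proof -
  have "[:-c, 1:] * q = smult (-c) q + pCons 0 q" by (simp add: mult_pCons_left)
  then show ?thesis by (simp only: poly_act_add poly_act_smult poly_act_pCons) (simp add: vec_eq_iff)
qed

lemma poly_act_diff: "poly_act p (v - w) = poly_act p v - poly_act p w"
  by (induction p) (auto simp: matrix_vector_mult_diff_distrib vector_ssub_ldistrib)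

lemma poly_act_scale: "poly_act p (c *s v) = c *s poly_act p v"
  by (induction p) (auto simp: vector_scalar_commute[symmetric] vector_add_ldistrib vector_smult_assoc mult.commute)

lemma poly_act_mat: "poly_act p (C *v v) = C *v poly_act p v"
  by (induction p) (auto simp: vector_scalar_commute matrix_vector_right_distrib)

lemma poly_act_monom: "poly_act (monom a i) v = a *s (((*v) C ^^ i) v)"
  by (induction i) (auto simp: monom_0 monom_Suc vector_scalar_commute)

lemma poly_act_sum: "poly_act (\<Sum>i\<in>I. p i) v = (\<Sum>i\<in>I. poly_act (p i) v)"
  by (induction I rule: infinite_finite_induct) (auto simp: poly_act_add)

text \<open>A linear dependence among the iterates v, C v, C^2 v, ... is a polynomial that
  annihilates v.\<close>

lemma annihilating_poly_exists: "\<exists>p. p \<noteq> 0 \<and> poly_act p v = 0"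
proof -
  obtain c :: "nat \<Rightarrow> real" and N where c: "\<exists>i\<le>N. c i \<noteq> 0" "(\<Sum>i\<le>N. c i *\<^sub>R (((*v) C ^^ i) v)) = 0"
    by (rule real_dependent_family)
  let ?p = "\<Sum>i\<le>N. monom (complex_of_real (c i)) i"
  obtain i where i: "i \<le> N" "c i \<noteq> 0" using c by blast
  have "coeff ?p i = complex_of_real (c i)"
    using i by (simp add: coeff_sum)
  then have "?p \<noteq> 0" using i by (metis coeff_0 of_real_eq_0_iff)
  moreover have "c i *\<^sub>R x = complex_of_real (c i) *s x" for i and x :: "complex^'d"
    unfolding vec_eq_iff vector_scaleR_component vector_smult_component by (simp add: scaleR_conv_of_real)
  then have "poly_act ?p v = 0" using c(2) by (simp add: poly_act_sum poly_act_monom)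
  ultimately show ?thesis by blast
qed

lemma poly_root_factor:
  fixes p :: "complex poly"
  assumes "p \<noteq> 0" "poly p c = 0"
  obtains q where "p = [:-c, 1:] * q" "q \<noteq> 0" "degree q < degree p"
proof -
  from assms(2) obtain q where q: "p = [:-c, 1:] * q" by (auto simp: poly_eq_0_iff_dvd dvd_def)
  then have "q \<noteq> 0" using assms by auto
  then have "degree p = Suc (degree q)" unfolding q by (subst degree_mult_eq) auto
  then show thesis using that q \<open>q \<noteq> 0\<close> by auto
qed

text \<open>Splitting off one linear factor of the annihilating polynomial at a time avoids the Jordan normal form.\<close>

lemma summable_powers_of_annihilated:
  assumes "p \<noteq> 0" "\<And>c. poly p c = 0 \<Longrightarrow> cmod c < 1" "poly_act p v = 0"
  shows "summable (\<lambda>k. norm (((*v) C ^^ k) v))"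
  using assms
proof (induction "degree p" arbitrary: p v rule: less_induct)
  case less
  show ?case
  proof (cases "degree p = 0")
    case True
    then obtain a where "p = [:a:]" by (metis degree_eq_zeroE)
    with less have "v = 0" by (auto simp: vector_mul_eq_0)
    moreover have "((*v) C ^^ k) 0 = 0" for k by (induction k) auto
    ultimately show ?thesis by simp
  next
    case False
    then obtain c where c: "poly p c = 0"
      using fundamental_theorem_of_algebra[of p] by (auto simp: constant_degree)
    obtain q where q: "p = [:-c, 1:] * q" "q \<noteq> 0" "degree q < degree p"
      using poly_root_factor[OF less.prems(1) c] by blast
    let ?w = "C *v v - c *s v"
    have "poly_act q ?w = 0"
      using less.prems(3) by (simp add: q(1) poly_act_linear_factor poly_act_diff poly_act_mat poly_act_scale del: mult_pCons_left)
    then have w: "summable (\<lambda>k. norm (((*v) C ^^ k) ?w))"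
      using less.hyps[OF q(3) q(2)] less.prems(2) q(1) by auto
    have lin: "((*v) C ^^ k) (x - c *s y) = ((*v) C ^^ k) x - c *s ((*v) C ^^ k) y" for k x y
      by (induction k) (auto simp: matrix_vector_mult_diff_distrib vector_scalar_commute)
    have "((*v) C ^^ Suc k) v = c *s ((*v) C ^^ k) v + ((*v) C ^^ k) ?w" for k
      unfolding lin by (simp add: funpow_swap1)
    then have "norm (((*v) C ^^ Suc k) v) \<le> cmod c * norm (((*v) C ^^ k) v) + norm (((*v) C ^^ k) ?w)" for k
      using norm_triangle_ineq[of "c *s ((*v) C ^^ k) v" "((*v) C ^^ k) ?w"] by (simp add: norm_scale_complex_vec del: funpow.simps)
    then show ?thesis
      by (rule summable_norm_recurrence) (use less.prems(2)[OF c] w in auto)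
  qed
qed

text \<open>In an annihilating polynomial of least degree every root c is an eigenvalue: after
  division by the factor of c, the remaining polynomial maps v to a nonzero eigenvector.\<close>

lemma summable_powers_of_spectral_radius_less_1:
  assumes ev: "\<And>c w. w \<noteq> 0 \<Longrightarrow> C *v w = c *s w \<Longrightarrow> cmod c < 1"
  shows "summable (\<lambda>k. norm (((*v) C ^^ k) v))"
proof -
  define p where "p = arg_min degree (\<lambda>p. p \<noteq> 0 \<and> poly_act p v = 0)"
  have p: "p \<noteq> 0" "poly_act p v = 0"
    using arg_min_natI[of "\<lambda>p. p \<noteq> 0 \<and> poly_act p v = 0"] annihilating_poly_exists[of v] unfolding p_def by blast+
  have min: "degree p \<le> degree q" if "q \<noteq> 0" "poly_act q v = 0" for q
    using arg_min_nat_le[of "\<lambda>p. p \<noteq> 0 \<and> poly_act p v = 0" q degree] that unfolding p_def by blast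
  have "cmod c < 1" if c: "poly p c = 0" for c
  proof -
    obtain q where q: "p = [:-c, 1:] * q" "q \<noteq> 0" "degree q < degree p"
      using poly_root_factor[OF p(1) c] by blast
    then have "poly_act q v \<noteq> 0" using min[of q] by auto
    moreover have "C *v poly_act q v = c *s poly_act q v"
      using p(2) by (simp add: q(1) poly_act_linear_factor del: mult_pCons_left)
    ultimately show ?thesis by (rule ev)
  qed
  then show ?thesis using summable_powers_of_annihilated p by blast
qed

end

lemma mat_pow_0 [simp]: "mat_pow B 0 = mat 1"
  and mat_pow_Suc: "mat_pow B (Suc k) = B ** mat_pow B k"
  by (simp_all add: mat_pow_def)

lemma mat_pow_vec: "mat_pow B k *v x = ((*v) B ^^ k) x"
  by (induction k) (auto simp: mat_pow_Suc matrix_vector_mul_assoc[symmetric])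

definition cvec :: "real^'d::finite \<Rightarrow> complex^'d" where
  "cvec x = (\<chi> i. complex_of_real (x $ i))"

lemma norm_cvec: "norm (cvec x) = norm x"
  by (simp add: norm_vec_def cvec_def)

lemma map_matrix_of_real_mult:
  "map_matrix complex_of_real (A ** B) = map_matrix complex_of_real A ** map_matrix complex_of_real B"
  by (simp add: vec_eq_iff map_matrix_def matrix_matrix_mult_def)

lemma map_matrix_of_real_vec: "map_matrix complex_of_real A *v cvec x = cvec (A *v x)"
  by (simp add: vec_eq_iff map_matrix_def matrix_vector_mult_def cvec_def)

text \<open>An eigenvalue c of the inverse is nonzero and its reciprocal is an eigenvalue of B, so
  expansiveness puts c inside the unit disc. The vector x is embedded into the complex space, where
  eigenvalues are available.\<close>

lemma summable_inverse_powers: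
  fixes B C :: "real^'d::finite^'d"
  assumes ex: "expansive B" and BC: "B ** C = mat 1"
  shows "summable (\<lambda>k. norm (mat_pow C k *v x))"
proof -
  let ?B = "map_matrix complex_of_real B" and ?C = "map_matrix complex_of_real C"
  have BC': "?B ** ?C = mat 1"
    unfolding map_matrix_of_real_mult[symmetric] BC by (simp add: vec_eq_iff map_matrix_def mat_def)
  have ev: "cmod c < 1" if w: "w \<noteq> 0" "?C *v w = c *s w" for c w
  proof -
    have e: "w = c *s (?B *v w)"
      using arg_cong[OF w(2), of "(*v) ?B"] by (simp add: matrix_vector_mul_assoc BC' vector_scalar_commute)
    then have c: "c \<noteq> 0" using w(1) by auto
    have "?B *v w = (1 / c) *s w"
      by (subst (2) e) (simp add: vector_smult_assoc c)
    then have "1 < cmod (1 / c)" using ex w(1) unfolding expansive_def by blast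
    then show ?thesis using c by (simp add: norm_divide field_simps)
  qed
  have "((*v) ?C ^^ k) (cvec x) = cvec (((*v) C ^^ k) x)" for k
    by (induction k) (auto simp: map_matrix_of_real_vec)
  then show ?thesis
    using summable_powers_of_spectral_radius_less_1[of ?C "cvec x", OF ev] by (simp add: norm_cvec mat_pow_vec)
qed

section \<open>Extending Bessel and Parseval identities from a dense class\<close>

text \<open>For a finite index set both sides are continuous in f with respect to the L^2
  seminorm.\<close>

lemma Bessel_extend:
  fixes e :: "'i \<Rightarrow> real^'d::finite \<Rightarrow> complex"
  assumes e: "\<And>i. i \<in> F \<Longrightarrow> square_integrable (e i)" and F: "finite F"
    and cc: "\<And>u. Cc u \<Longrightarrow> (\<Sum>i\<in>F. (cmod (L2_inner u (e i)))\<^sup>2) \<le> L2_norm_sq u"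
    and f: "square_integrable f"
  shows "(\<Sum>i\<in>F. (cmod (L2_inner f (e i)))\<^sup>2) \<le> L2_norm_sq f"
proof -
  obtain u where u: "\<And>n. Cc (u n)" "(\<lambda>n. L2n (\<lambda>x. u n x - f x)) \<longlonglongrightarrow> 0"
    using Cc_dense_seq[OF f] by blast
  note su = Cc_square_integrable[OF u(1)]
  have "(\<lambda>n. \<Sum>i\<in>F. (cmod (L2_inner (u n) (e i)))\<^sup>2) \<longlonglongrightarrow> (\<Sum>i\<in>F. (cmod (L2_inner f (e i)))\<^sup>2)"
    by (intro tendsto_sum tendsto_power tendsto_norm L2_inner_tendsto_left[OF su f e u(2)])
  moreover have "(\<lambda>n. (L2n (u n))\<^sup>2) \<longlonglongrightarrow> (L2n f)\<^sup>2"
    by (intro tendsto_power L2n_tendsto[OF su f u(2)])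
  ultimately show ?thesis
    using cc[OF u(1)] by (intro LIMSEQ_le[where X="\<lambda>n. \<Sum>i\<in>F. (cmod (L2_inner (u n) (e i)))\<^sup>2"]) auto
qed

lemma has_sum_nonneg_realI:
  fixes g :: "'i \<Rightarrow> real"
  assumes nn: "\<And>i. 0 \<le> g i"
    and le: "\<And>F. finite F \<Longrightarrow> F \<subseteq> I \<Longrightarrow> sum g F \<le> s"
    and ge: "\<And>\<epsilon>. \<epsilon> > 0 \<Longrightarrow> \<exists>F. finite F \<and> F \<subseteq> I \<and> s - \<epsilon> \<le> sum g F"
  shows "(g has_sum s) I"
  unfolding has_sum_def
proof (rule tendstoI)
  fix \<epsilon> :: real assume "\<epsilon> > 0"
  then obtain F where F: "finite F" "F \<subseteq> I" "s - \<epsilon>/2 \<le> sum g F" using ge[of "\<epsilon>/2"] by auto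
  have "dist (sum g Y) s < \<epsilon>" if "finite Y" "F \<subseteq> Y" "Y \<subseteq> I" for Y
  proof -
    have "sum g F \<le> sum g Y" using that nn by (intro sum_mono2) auto
    then show ?thesis using F(3) le[OF that(1,3)] \<open>\<epsilon> > 0\<close> by (simp add: dist_real_def)
  qed
  then show "\<forall>\<^sub>F Y in finite_subsets_at_top I. dist (sum g Y) s < \<epsilon>"
    unfolding eventually_finite_subsets_at_top using F(1,2) by blast
qed

text \<open>The Bessel bound makes the analysis map a contraction. Replacing f by a nearby test
  function u therefore costs little on both sides, and the lower bound for u carries over to f.
  Three errors enter: the deficit for u, the change of the coefficients and the change of the
  norm.\<close>

lemma Parseval_extend:
  fixes e :: "'i \<Rightarrow> real^'d::finite \<Rightarrow> complex"
  assumes e: "\<And>i. i \<in> I \<Longrightarrow> square_integrable (e i)"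
    and le: "\<And>u F. Cc u \<Longrightarrow> finite F \<Longrightarrow> F \<subseteq> I \<Longrightarrow> (\<Sum>i\<in>F. (cmod (L2_inner u (e i)))\<^sup>2) \<le> L2_norm_sq u"
    and ge: "\<And>u \<epsilon>. Cc u \<Longrightarrow> \<epsilon> > 0 \<Longrightarrow> \<exists>F. finite F \<and> F \<subseteq> I \<and> L2_norm_sq u - \<epsilon> \<le> (\<Sum>i\<in>F. (cmod (L2_inner u (e i)))\<^sup>2)"
    and f: "square_integrable f"
  shows "((\<lambda>i. (cmod (L2_inner f (e i)))\<^sup>2) has_sum L2_norm_sq f) I"
proof (rule has_sum_nonneg_realI)
  have Bessel: "(\<Sum>i\<in>F. (cmod (L2_inner g (e i)))\<^sup>2) \<le> L2_norm_sq g"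
    if "finite F" "F \<subseteq> I" "square_integrable g" for F g
    by (rule Bessel_extend[OF e _ le]) (use that in auto)
  show "(\<Sum>i\<in>F. (cmod (L2_inner f (e i)))\<^sup>2) \<le> L2_norm_sq f" if "finite F" "F \<subseteq> I" for F
    using Bessel that f by blast
  fix \<epsilon> :: real assume "\<epsilon> > 0"
  \<comment> \<open>The deficit will be at most \<open>(3 * \<eta>) * (2 * L2n f)\<close>, which
    explains the 6; the constant term keeps K positive when f vanishes.\<close>
  define K where "K = 6 * L2n f + 6"
  have K: "K > 0" unfolding K_def using L2n_nonneg[of f] by linarith
  define \<eta> where "\<eta> = min 1 (\<epsilon> / K)"
  have eta: "\<eta> > 0" "\<eta> \<le> 1" "K * \<eta> \<le> \<epsilon>"
    using \<open>\<epsilon> > 0\<close> K by (auto simp: \<eta>_def min_def field_simps)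
  obtain u where u: "Cc u" "L2n (\<lambda>x. u x - f x) < \<eta>" using Cc_dense[OF f eta(1)] by blast
  note su = Cc_square_integrable[OF u(1)]
  have "\<eta>\<^sup>2 > 0" using eta by simp
  from ge[OF u(1) this] obtain F where F: "finite F" "F \<subseteq> I"
    "L2_norm_sq u - \<eta>\<^sup>2 \<le> (\<Sum>i\<in>F. (cmod (L2_inner u (e i)))\<^sup>2)" by blast
  let ?N = "\<lambda>g. L2_set (\<lambda>i. cmod (L2_inner g (e i))) F"
  have N2: "(?N g)\<^sup>2 = (\<Sum>i\<in>F. (cmod (L2_inner g (e i)))\<^sup>2)" for g
    by (simp add: L2_set_def sum_nonneg)
  have Nu: "L2n u \<le> ?N u + \<eta>"
  proof (rule power2_le_imp_le)
    have "(L2n u)\<^sup>2 \<le> (?N u)\<^sup>2 + \<eta>\<^sup>2" using F(3) N2[of u] by simp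
    also have "\<dots> \<le> (?N u + \<eta>)\<^sup>2" using eta L2_set_nonneg[of _ F] by (simp add: power2_sum)
    finally show "(L2n u)\<^sup>2 \<le> (?N u + \<eta>)\<^sup>2" .
  qed (use eta L2_set_nonneg[of _ F] in \<open>simp add: add_nonneg_nonneg\<close>)
  have "?N u \<le> ?N f + ?N (\<lambda>x. u x - f x)"
  proof -
    have "?N u \<le> L2_set (\<lambda>i. cmod (L2_inner f (e i)) + cmod (L2_inner (\<lambda>x. u x - f x) (e i))) F"
    proof (rule L2_set_mono)
      fix i assume i: "i \<in> F"
      have "square_integrable (e i)" using i e F(2) by blast
      then have "L2_inner u (e i) = L2_inner f (e i) + L2_inner (\<lambda>x. u x - f x) (e i)"
        using L2_inner_diff_left[OF su f] by simp
      then show "cmod (L2_inner u (e i)) \<le> cmod (L2_inner f (e i)) + cmod (L2_inner (\<lambda>x. u x - f x) (e i))"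
        using norm_triangle_ineq by metis
    qed simp
    also have "\<dots> \<le> ?N f + ?N (\<lambda>x. u x - f x)" by (rule L2_set_triangle_ineq)
    finally show ?thesis .
  qed
  moreover have "?N (\<lambda>x. u x - f x) \<le> \<eta>"
  proof (rule power2_le_imp_le)
    have "(?N (\<lambda>x. u x - f x))\<^sup>2 \<le> (L2n (\<lambda>x. u x - f x))\<^sup>2"
      unfolding N2 using Bessel[OF F(1,2) square_integrable_diff[OF su f]] by simp
    also have "\<dots> \<le> \<eta>\<^sup>2" using u(2) by (intro power_mono) auto
    finally show "(?N (\<lambda>x. u x - f x))\<^sup>2 \<le> \<eta>\<^sup>2" .
  qed (use eta in simp)
  moreover have "L2n f \<le> L2n u + \<eta>"
    using L2n_le_diff[OF f su] u(2) L2n_minus_commute[of f u] by linarith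
  ultimately have 1: "L2n f \<le> ?N f + 3 * \<eta>" using Nu by linarith
  have nn: "0 \<le> ?N f" by simp
  have "?N f \<le> L2n f"
    by (rule power2_le_imp_le) (use Bessel[OF F(1,2) f] N2[of f] in auto)
  then have "L2n f - ?N f \<ge> 0" "L2n f + ?N f \<le> 2 * L2n f" by auto
  have "L2_norm_sq f - (?N f)\<^sup>2 = (L2n f - ?N f) * (L2n f + ?N f)"
    by (simp add: square_diff_square_factored power2_eq_square[symmetric] algebra_simps)
  also have "\<dots> \<le> (3 * \<eta>) * (2 * L2n f)"
    using 1 nn \<open>L2n f + ?N f \<le> 2 * L2n f\<close> \<open>L2n f - ?N f \<ge> 0\<close> by (intro mult_mono) auto
  also have "\<dots> \<le> K * \<eta>" unfolding K_def using eta L2n_nonneg[of f] by (simp add: algebra_simps)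
  also have "\<dots> \<le> \<epsilon>" using eta by simp
  finally have "L2_norm_sq f - \<epsilon> \<le> (\<Sum>i\<in>F. (cmod (L2_inner f (e i)))\<^sup>2)" using N2[of f] by simp
  then show "\<exists>F. finite F \<and> F \<subseteq> I \<and> L2_norm_sq f - \<epsilon> \<le> (\<Sum>i\<in>F. (cmod (L2_inner f (e i)))\<^sup>2)"
    using F by blast
qed simp

text \<open>The synthesis operator of a Bessel family is a contraction, since it is adjoint to the analysis operator.\<close>

lemma Bessel_approximation:
  fixes e :: "'i \<Rightarrow> real^'d::finite \<Rightarrow> complex"
  assumes e: "\<And>i. i \<in> F \<Longrightarrow> square_integrable (e i)" and F: "finite F"
    and Bessel: "\<And>g. square_integrable g \<Longrightarrow> (\<Sum>i\<in>F. (cmod (L2_inner g (e i)))\<^sup>2) \<le> L2_norm_sq g"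
    and f: "square_integrable f"
  shows "L2_norm_sq (\<lambda>x. f x - (\<Sum>i\<in>F. L2_inner f (e i) * e i x))
      \<le> L2_norm_sq f - (\<Sum>i\<in>F. (cmod (L2_inner f (e i)))\<^sup>2)"
proof -
  let ?u = "\<lambda>x. \<Sum>i\<in>F. L2_inner f (e i) * e i x"
  let ?S = "\<Sum>i\<in>F. (cmod (L2_inner f (e i)))\<^sup>2"
  have u: "square_integrable ?u" by (intro square_integrable_sum square_integrable_cmult e)
  have inner: "L2_inner g ?u = (\<Sum>i\<in>F. cnj (L2_inner f (e i)) * L2_inner g (e i))" if "square_integrable g" for g
    by (subst L2_inner_sum_right) (auto intro: square_integrable_cmult e that simp: L2_inner_cmult_right)
  have fu: "L2_inner f ?u = of_real ?S"
    unfolding inner[OF f] by (simp only: of_real_sum complex_norm_square mult.commute)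
  \<comment> \<open>The inner product of \<open>?u\<close> with itself is a sum of products of
    coefficients of f and of \<open>?u\<close>; Cauchy-Schwarz and the Bessel bound for
    \<open>?u\<close> itself give \<open>sqrt ?S\<close> times the norm of \<open>?u\<close>, and
    one factor cancels.\<close>
  have "L2_norm_sq ?u \<le> ?S"
  proof -
    have "L2_norm_sq ?u = cmod (L2_inner ?u ?u)" by (simp add: L2_inner_self)
    also have "\<dots> \<le> (\<Sum>i\<in>F. cmod (L2_inner f (e i)) * cmod (L2_inner ?u (e i)))"
      unfolding inner[OF u] by (rule sum_norm_le) (simp add: norm_mult)
    also have "\<dots> \<le> L2_set (\<lambda>i. cmod (L2_inner f (e i))) F * L2_set (\<lambda>i. cmod (L2_inner ?u (e i))) F"
      using L2_set_mult_ineq[of "\<lambda>i. cmod (L2_inner f (e i))" "\<lambda>i. cmod (L2_inner ?u (e i))" F] by simp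
    also have "\<dots> \<le> sqrt ?S * sqrt (L2_norm_sq ?u)"
      unfolding L2_set_def using Bessel[OF u] by (intro mult_left_mono) (auto intro: sum_nonneg)
    finally have *: "L2_norm_sq ?u \<le> sqrt ?S * sqrt (L2_norm_sq ?u)" .
    show ?thesis
    proof (cases "L2_norm_sq ?u = 0")
      case False
      then have p: "sqrt (L2_norm_sq ?u) > 0" using L2_norm_sq_nonneg[of ?u] by (simp add: less_le)
      have "sqrt (L2_norm_sq ?u) * sqrt (L2_norm_sq ?u) \<le> sqrt ?S * sqrt (L2_norm_sq ?u)" using * by simp
      then have "sqrt (L2_norm_sq ?u) \<le> sqrt ?S" using p by (simp only: mult_le_cancel_right_pos)
      then show ?thesis by simp
    qed (simp add: sum_nonneg)
  qed
  moreover have "of_real (L2_norm_sq (\<lambda>x. f x - ?u x)) = (of_real (L2_norm_sq f - 2 * ?S + L2_norm_sq ?u) :: complex)"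
  proof -
    note d = square_integrable_diff[OF f u]
    have "of_real (L2_norm_sq (\<lambda>x. f x - ?u x)) = L2_inner f (\<lambda>x. f x - ?u x) - L2_inner ?u (\<lambda>x. f x - ?u x)"
      unfolding L2_inner_self[symmetric] using L2_inner_diff_left[OF f u d] by simp
    also have "L2_inner f (\<lambda>x. f x - ?u x) = of_real (L2_norm_sq f) - of_real ?S"
      using L2_inner_diff_left[OF f u f] fu L2_inner_commute[of f ?u]
        L2_inner_commute[of f "\<lambda>x. f x - ?u x"] by (simp add: L2_inner_self)
    also have "L2_inner ?u (\<lambda>x. f x - ?u x) = of_real ?S - of_real (L2_norm_sq ?u)"
      using L2_inner_diff_left[OF f u u] fu L2_inner_commute[of ?u "\<lambda>x. f x - ?u x"] by (simp add: L2_inner_self)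
    finally show ?thesis by simp
  qed
  then have "L2_norm_sq (\<lambda>x. f x - ?u x) = L2_norm_sq f - 2 * ?S + L2_norm_sq ?u"
    by (simp only: of_real_eq_iff)
  ultimately show ?thesis by linarith
qed

section \<open>The integer lattice\<close>

lemma Zd_0 [simp]: "0 \<in> Zd" and Zd_add: "x \<in> Zd \<Longrightarrow> y \<in> Zd \<Longrightarrow> x + y \<in> Zd"
  and Zd_diff: "x \<in> Zd \<Longrightarrow> y \<in> Zd \<Longrightarrow> x - y \<in> Zd"
  by (auto simp: Zd_def)

lemma Zd_integral_matrix:
  assumes "integral_matrix B" "x \<in> Zd"
  shows "B *v x \<in> Zd"
  using assms by (auto simp: Zd_def integral_matrix_def matrix_vector_mult_def intro!: Ints_sum Ints_mult)

lemma finite_Zd_bounded: "finite {l::real^'d::finite. l \<in> Zd \<and> (\<forall>i. \<bar>l $ i\<bar> \<le> r)}"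
proof -
  let ?X = "real_of_int ` {- \<lceil>r\<rceil>..\<lceil>r\<rceil>}"
  have "{l::real^'d. l \<in> Zd \<and> (\<forall>i. \<bar>l $ i\<bar> \<le> r)} \<subseteq> (\<lambda>f. \<chi> i. f i) ` (PiE UNIV (\<lambda>_. ?X))"
  proof
    fix l :: "real^'d" assume l: "l \<in> {l. l \<in> Zd \<and> (\<forall>i. \<bar>l $ i\<bar> \<le> r)}"
    have "l $ i \<in> ?X" for i
    proof -
      obtain k :: int where k: "l $ i = of_int k" using l by (auto simp: Zd_def Ints_def)
      have "\<bar>of_int k :: real\<bar> \<le> r" using l k by (metis (mono_tags, lifting) mem_Collect_eq)
      then have "k \<in> {- \<lceil>r\<rceil>..\<lceil>r\<rceil>}" by (auto simp: abs_le_iff) linarith+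
      then show ?thesis using k by blast
    qed
    then show "l \<in> (\<lambda>f. \<chi> i. f i) ` (PiE UNIV (\<lambda>_. ?X))"
      by (intro image_eqI[of _ _ "\<lambda>i. l $ i"]) (auto simp: vec_eq_iff)
  qed
  then show ?thesis by (rule finite_subset) (intro finite_imageI finite_PiE, auto)
qed

lemma finite_Zd_cball: "finite {l::real^'d::finite. l \<in> Zd \<and> norm l \<le> r}"
  by (rule finite_subset[OF _ finite_Zd_bounded[of r]]) (use component_le_norm_cart order_trans in blast)

definition vfloor :: "real^'d::finite \<Rightarrow> real^'d" where
  "vfloor t = (\<chi> i. of_int \<lfloor>t $ i\<rfloor>)"

lemma vfloor_Zd [simp]: "vfloor t \<in> Zd"
  by (simp add: vfloor_def Zd_def)

lemma vfloor_frac: "0 \<le> (t - vfloor t) $ i" "(t - vfloor t) $ i \<le> 1"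
  by (simp_all add: vfloor_def) linarith+

text \<open>The half-open unit cell at l lies between the open and the closed cube, both of measure
  1.\<close>

lemma vfloor_cell:
  assumes l: "l \<in> Zd"
  shows "{t::real^'d::finite. vfloor t = l} \<in> sets lebesgue" "measure lebesgue {t. vfloor t = l} = 1"
    "emeasure lebesgue {t. vfloor t = l} = 1"
proof -
  have cell: "vfloor t = l \<longleftrightarrow> (\<forall>i. l $ i \<le> t $ i \<and> t $ i < l $ i + 1)" for t
  proof -
    have "real_of_int \<lfloor>t $ i\<rfloor> = l $ i \<longleftrightarrow> l $ i \<le> t $ i \<and> t $ i < l $ i + 1" for i
    proof -
      obtain k :: int where k: "l $ i = of_int k" using l by (auto simp: Zd_def Ints_def)
      show ?thesis unfolding k using floor_eq_iff[of "t $ i" k] by auto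
    qed
    then show ?thesis by (simp add: vfloor_def vec_eq_iff)
  qed
  let ?o = "(\<chi> i. 1) :: real^'d"
  have sub: "box l (l + ?o) \<subseteq> {t. vfloor t = l}" "{t. vfloor t = l} \<subseteq> cbox l (l + ?o)"
    by (auto simp: cell mem_box_cart less_imp_le)
  have "{t. vfloor t = l} = (\<Inter>i\<in>UNIV. {t. l $ i \<le> t $ i} \<inter> {t. t $ i < l $ i + 1})" by (auto simp: cell)
  also have "\<dots> \<in> sets borel"
    by (intro sets.finite_INT sets.Int) (auto intro!: borel_closed borel_open closed_halfspace_component_ge_cart open_halfspace_component_lt_cart)
  finally have b: "{t. vfloor t = l} \<in> sets borel" .
  then show s: "{t. vfloor t = l} \<in> sets lebesgue" by simp
  have c: "measure lborel (cbox l (l + ?o)) = 1" by (simp add: content_cbox_if_cart interval_eq_empty_cart)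
  have e1: "emeasure lborel (cbox l (l + ?o)) = 1"
    using c emeasure_eq_ennreal_measure[of lborel "cbox l (l + ?o)"] emeasure_lborel_cbox_finite[of l "l + ?o"] by (simp add: less_top)
  have "emeasure lborel (box l (l + ?o)) = 1"
    using e1 by (simp add: emeasure_lborel_box_eq emeasure_lborel_cbox_eq)
  then have "emeasure lborel {t. vfloor t = l} = 1"
    using emeasure_mono[OF sub(1), of lborel] emeasure_mono[OF sub(2), of lborel] e1 b by (auto intro: antisym)
  then show em: "emeasure lebesgue {t. vfloor t = l} = 1" using b by simp
  show "measure lebesgue {t. vfloor t = l} = 1" using em by (simp add: measure_def)
qed

text \<open>Rewrites a lattice sum as an integral, so that Riemann sums are accessible to dominated
  convergence and lattice points can be counted by volume.\<close>

lemma integral_step_function: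
  fixes F :: "real^'d::finite \<Rightarrow> real"
  assumes K: "finite K" "K \<subseteq> Zd" and 0: "\<And>l. l \<in> Zd \<Longrightarrow> l \<notin> K \<Longrightarrow> F l = 0"
  shows "integrable lebesgue (\<lambda>t. F (vfloor t))" "(LINT t|lebesgue. F (vfloor t)) = (\<Sum>l\<in>K. F l)"
proof -
  have e: "(\<lambda>t. F (vfloor t)) = (\<lambda>t. \<Sum>l\<in>K. F l * indicator {t. vfloor t = l} t)"
  proof
    fix t :: "real^'d"
    have "(\<Sum>l\<in>K. F l * indicator {t. vfloor t = l} t) = (\<Sum>l\<in>K. if l = vfloor t then F l else 0)"
      by (intro sum.cong) auto
    then show "F (vfloor t) = (\<Sum>l\<in>K. F l * indicator {t. vfloor t = l} t)" using K 0[of "vfloor t"] by simp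
  qed
  have i: "integrable lebesgue (\<lambda>t. F l * indicator {t. vfloor t = l} t)" if "l \<in> K" for l
    using vfloor_cell[of l] that K by (intro integrable_mult_right integrable_real_indicator) auto
  show "integrable lebesgue (\<lambda>t. F (vfloor t))" unfolding e by (intro Bochner_Integration.integrable_sum i)
  show "(LINT t|lebesgue. F (vfloor t)) = (\<Sum>l\<in>K. F l)"
    unfolding e using i
    by (subst Bochner_Integration.integral_sum) (auto intro!: sum.cong simp: vfloor_cell(2)[OF subsetD[OF K(2)]])
qed

section \<open>Dilations and translations\<close>

lemma transl_affine: "transl l f = (\<lambda>t. f (mat 1 *v t + (- l)))"
  by (simp add: transl_def)

lemma square_integrable_transl: "square_integrable f \<Longrightarrow> square_integrable (transl l f)"
  unfolding transl_affine by (rule square_integrable_affine) auto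

lemma
  fixes B :: "real^'d::finite^'d"
  assumes "det B \<noteq> 0"
  shows dil_dil_inv: "dil B (dil_inv B f) = f" and dil_inv_dil: "dil_inv B (dil B f) = f"
  by (simp_all add: dil_def dil_inv_def matrix_inv_invertible[OF assms])

lemma dil_pow_0 [simp]: "dil_pow B 0 f = f"
  by (simp add: dil_pow_def)

lemma dil_pow_Suc:
  fixes B :: "real^'d::finite^'d"
  assumes d: "det B \<noteq> 0"
  shows "dil_pow B (n + 1) f = dil B (dil_pow B n f)"
proof (cases "n \<ge> 0")
  case True
  then have "nat (n + 1) = Suc (nat n)" by simp
  with True show ?thesis by (simp add: dil_pow_def)
next
  case False
  then have e: "nat (- n) = Suc (nat (- (n + 1)))" by simp
  have "dil_pow B n f = dil_inv B ((dil_inv B ^^ nat (- (n + 1))) f)"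
    using False by (simp add: dil_pow_def e)
  moreover have "dil_pow B (n + 1) f = (dil_inv B ^^ nat (- (n + 1))) f"
    using False by (cases "n = -1") (auto simp: dil_pow_def)
  ultimately show ?thesis by (simp add: dil_dil_inv[OF d])
qed

lemma dil_pow_minus_1:
  fixes B :: "real^'d::finite^'d"
  assumes d: "det B \<noteq> 0"
  shows "dil_pow B (n - 1) f = dil_inv B (dil_pow B n f)"
  using dil_pow_Suc[OF d, of "n - 1" f] by (simp add: dil_inv_dil[OF d])

lemma dil_pow_Suc':
  fixes B :: "real^'d::finite^'d"
  assumes d: "det B \<noteq> 0"
  shows "dil_pow B (n + 1) f = dil_pow B n (dil B f)"
proof (induction n rule: int_induct[of _ 0])
  case base
  show ?case using dil_pow_Suc[OF d, of 0 f] by simp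
next
  case (step1 i)
  then show ?case using dil_pow_Suc[OF d, of "i + 1" f] dil_pow_Suc[OF d, of i "dil B f"] by simp
next
  case (step2 i)
  then show ?case using dil_pow_minus_1[OF d, of "i + 1" f] dil_pow_minus_1[OF d, of i "dil B f"] by simp
qed

lemma dil_pow_uminus_Suc:
  fixes B :: "real^'d::finite^'d"
  assumes d: "det B \<noteq> 0"
  shows "dil_pow B (- (n + 1)) f = dil_inv B (dil_pow B (- n) f)"
  using dil_pow_minus_1[OF d, of "- n" f] by simp

context
  fixes B :: "real^'d::finite^'d"
  assumes detB: "\<bar>det B\<bar> = 2"
begin

lemma dB0: "det B \<noteq> 0" using detB by auto

lemma square_integrable_dil:
  assumes "square_integrable f"
  shows "square_integrable (dil B f)" "L2_norm_sq (dil B f) = L2_norm_sq f"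
proof -
  note * = square_integrable_affine[OF dB0 assms, of 0]
  show "square_integrable (dil B f)"
    unfolding dil_def using square_integrable_cmult[OF *(1)] by simp
  have "(L2n (dil B f))\<^sup>2 = L2_norm_sq f"
    unfolding dil_def L2n_cmult power_mult_distrib using *(2) detB by (simp add: norm_mult)
  then show "L2_norm_sq (dil B f) = L2_norm_sq f" by simp
qed

lemma square_integrable_dil_inv:
  assumes "square_integrable f"
  shows "square_integrable (dil_inv B f)"
proof -
  have "det (matrix_inv B) \<noteq> 0" using det_matrix_inv[OF dB0] dB0 by simp
  from square_integrable_cmult[OF square_integrable_affine(1)[OF this assms, of 0], of "1 / complex_of_real (sqrt 2)"]
  show ?thesis by (simp add: dil_inv_def)
qed

lemma L2_norm_sq_dil_inv: "square_integrable f \<Longrightarrow> L2_norm_sq (dil_inv B f) = L2_norm_sq f"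
  using square_integrable_dil(2)[OF square_integrable_dil_inv] by (simp add: dil_dil_inv[OF dB0])

lemma square_integrable_dil_pow:
  assumes "square_integrable f"
  shows "square_integrable (dil_pow B n f)"
proof (induction n rule: int_induct[of _ 0])
  case (step1 i) then show ?case using dil_pow_Suc[OF dB0, of i f] square_integrable_dil by simp
next
  case (step2 i) then show ?case using dil_pow_minus_1[OF dB0, of i f] square_integrable_dil_inv by simp
qed (use assms in simp)

text \<open>Unitarity of the dilation: the Jacobian 1/2 cancels the two factors
  \<open>sqrt 2\<close>.\<close>

lemma L2_inner_dil:
  assumes f: "square_integrable f" and g: "square_integrable g"
  shows "L2_inner f (dil B g) = L2_inner (dil_inv B f) g"
proof -
  define F where "F = (\<lambda>s. dil_inv B f s * cnj (g s))"
  have i: "integrable lebesgue F"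
    unfolding F_def by (rule square_integrable_mult_integrable[OF square_integrable_dil_inv[OF f] square_integrable_cnj[OF g]])
  have "(LINT t|lebesgue. F (B *v t + 0)) = (1 / \<bar>det B\<bar>) *\<^sub>R (LINT s|lebesgue. F s)"
    by (rule integral_affine[OF dB0]) (use i in auto)
  moreover have "f t * cnj (dil B g t) = 2 * F (B *v t + 0)" for t
  proof -
    have "complex_of_real (sqrt 2) * complex_of_real (sqrt 2) = 2"
      by (simp flip: of_real_mult)
    then show ?thesis
      by (simp add: F_def dil_def dil_inv_def matrix_inv_invertible[OF dB0] field_simps)
  qed
  ultimately show ?thesis
    unfolding L2_inner_def by (simp add: detB F_def[symmetric])
qed

lemma L2_inner_dil_pow:
  assumes f: "square_integrable f" and g: "square_integrable g"
  shows "L2_inner f (dil_pow B n g) = L2_inner (dil_pow B (- n) f) g"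
  using f
proof (induction n arbitrary: f rule: int_induct[of _ 0])
  case (step1 i)
  have "L2_inner f (dil_pow B (i + 1) g) = L2_inner (dil_inv B f) (dil_pow B i g)"
    unfolding dil_pow_Suc[OF dB0] by (rule L2_inner_dil[OF step1.prems square_integrable_dil_pow[OF g]])
  also have "\<dots> = L2_inner (dil_pow B (- i) (dil_inv B f)) g"
    by (rule step1.IH[OF square_integrable_dil_inv[OF step1.prems]])
  also have "dil_pow B (- i) (dil_inv B f) = dil_pow B (- (i + 1)) f"
    using dil_pow_Suc'[OF dB0, of "- (i + 1)" "dil_inv B f"] by (simp add: dil_dil_inv[OF dB0])
  finally show ?case .
next
  case (step2 i)
  note sf = step2.prems
  have "L2_inner f (dil_pow B (i - 1) g) = L2_inner (dil_inv B (dil B f)) (dil_pow B (i - 1) g)"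
    by (simp add: dil_inv_dil[OF dB0])
  also have "\<dots> = L2_inner (dil B f) (dil B (dil_pow B (i - 1) g))"
    by (rule L2_inner_dil[symmetric]) (auto intro: square_integrable_dil(1) square_integrable_dil_pow sf g)
  also have "dil B (dil_pow B (i - 1) g) = dil_pow B i g" using dil_pow_Suc[OF dB0, of "i - 1" g] by simp
  also have "L2_inner (dil B f) (dil_pow B i g) = L2_inner (dil_pow B (- i) (dil B f)) g"
    by (rule step2.IH[OF square_integrable_dil(1)[OF sf]])
  also have "dil_pow B (- i) (dil B f) = dil_pow B (- (i - 1)) f"
    using dil_pow_Suc'[OF dB0, of "- i" f] by simp
  finally show ?case .
qed simp

lemma Cc_linear_compose:
  fixes M :: "real^'d^'d"
  assumes "Cc u" "det M \<noteq> 0"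
  shows "Cc (\<lambda>t. c * u (M *v t))"
proof -
  obtain R where R: "\<And>x. norm x > R \<Longrightarrow> u x = 0" and c: "continuous_on UNIV u"
    using assms(1) by (auto simp: Cc_def)
  obtain K where K: "K > 0" "\<And>x. norm (matrix_inv M *v x) \<le> norm x * K"
    using bounded_linear.pos_bounded[OF matrix_vector_mul_bounded_linear[of "matrix_inv M"]] by blast
  have "u (M *v t) = 0" if "norm t > R * K" for t
  proof (rule R)
    have "norm t \<le> norm (M *v t) * K" using K(2)[of "M *v t"] by (simp add: matrix_inv_invertible[OF assms(2)])
    then show "norm (M *v t) > R" using that K(1) by (meson less_le_trans mult_less_cancel_right_pos)
  qed
  then show ?thesis
    unfolding Cc_def
    by (auto intro!: continuous_intros continuous_on_compose2[OF c] exI[of _ "R * K"] matrix_vector_mult_linear_continuous_on)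
qed

lemma Cc_dil_pow:
  assumes "Cc u"
  shows "Cc (dil_pow B n u)"
proof (induction n rule: int_induct[of _ 0])
  case (step1 i)
  show ?case unfolding dil_pow_Suc[OF dB0] dil_def by (rule Cc_linear_compose[OF step1.IH dB0])
next
  case (step2 i)
  have "det (matrix_inv B) \<noteq> 0" using det_matrix_inv[OF dB0] dB0 by simp
  from Cc_linear_compose[OF step2.IH this, of "1 / complex_of_real (sqrt 2)"]
  show ?case unfolding dil_pow_minus_1[OF dB0] dil_inv_def by simp
qed (use assms in simp)

lemma L2_norm_sq_dil_pow:
  assumes "square_integrable f"
  shows "L2_norm_sq (dil_pow B n f) = L2_norm_sq f"
proof (induction n rule: int_induct[of _ 0])
  case (step1 i) then show ?case
    using dil_pow_Suc[OF dB0, of i f] square_integrable_dil(2)[OF square_integrable_dil_pow[OF assms]] by simp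
next
  case (step2 i) then show ?case
    using dil_pow_minus_1[OF dB0, of i f] L2_norm_sq_dil_inv[OF square_integrable_dil_pow[OF assms]] by simp
qed simp

lemma dil_pow_sum: "dil_pow B n (\<lambda>t. \<Sum>l\<in>F. c l * f l t) = (\<lambda>t. \<Sum>l\<in>F. c l * dil_pow B n (f l) t)"
proof (induction n rule: int_induct[of _ 0])
  case (step1 i)
  then show ?case unfolding dil_pow_Suc[OF dB0] by (simp add: dil_def sum_distrib_left mult_ac)
next
  case (step2 i)
  then show ?case unfolding dil_pow_minus_1[OF dB0] by (simp add: dil_inv_def sum_divide_distrib)
qed simp

end

lemma dil_pow_nat: "dil_pow B (int n) f t = complex_of_real (sqrt 2) ^ n * f (mat_pow B n *v t)"
proof -
  have "(dil B ^^ n) f t = complex_of_real (sqrt 2) ^ n * f (mat_pow B n *v t)"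
    by (induction n arbitrary: t) (auto simp: dil_def mat_pow_vec funpow_swap1[of "(*v) B"])
  then show ?thesis by (simp add: dil_pow_def)
qed

lemma dil_pow_neg_nat:
  "dil_pow B (- int n) f t = f (mat_pow (matrix_inv B) n *v t) / complex_of_real (sqrt 2) ^ n"
proof -
  have "(dil_inv B ^^ n) f t = f (mat_pow (matrix_inv B) n *v t) / complex_of_real (sqrt 2) ^ n"
    by (induction n arbitrary: t) (auto simp: dil_inv_def mat_pow_vec funpow_swap1[of "(*v) (matrix_inv B)"])
  then show ?thesis by (auto simp: dil_pow_def)
qed

lemma transl_AE:
  assumes "AE t in lebesgue. f t = g t"
  shows "AE t in lebesgue. transl l f t = transl l g t"
  using AE_affine[of "mat 1" "\<lambda>t. f t = g t" "- l"] assms by (simp add: transl_def)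

lemma det_mat_pow: "det (mat_pow B k) = det B ^ k"
  by (induction k) (auto simp: mat_pow_Suc det_mul)

lemma mat_pow_inverse:
  fixes B :: "real^'d::finite^'d"
  assumes d: "det B \<noteq> 0"
  shows "mat_pow (matrix_inv B) k *v (mat_pow B k *v x) = x" "mat_pow B k *v (mat_pow (matrix_inv B) k *v x) = x"
proof -
  have *: "(g ^^ k) ((f ^^ k) x) = x" if "\<And>x. g (f x) = x" for f g :: "real^'d \<Rightarrow> real^'d" and x
    by (induction k arbitrary: x) (auto simp: funpow_swap1 that)
  show "mat_pow (matrix_inv B) k *v (mat_pow B k *v x) = x" "mat_pow B k *v (mat_pow (matrix_inv B) k *v x) = x"
    unfolding mat_pow_vec by (rule *, simp add: matrix_inv_invertible[OF d])+
qed

section \<open>Decay of matrix powers\<close>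

text \<open>The sum of the norms of the columns. It bounds the operator norm, and its summability
  along matrix powers is inherited column by column.\<close>

definition col_sum :: "real^'d::finite^'d \<Rightarrow> real" where
  "col_sum M = (\<Sum>i\<in>UNIV. norm (M *v axis i 1))"

lemma col_sum_nonneg [simp]: "0 \<le> col_sum M"
  by (simp add: col_sum_def sum_nonneg)

lemma norm_matrix_vector_le_col_sum:
  fixes q :: "real^'d::finite"
  assumes "\<And>i. \<bar>q $ i\<bar> \<le> r"
  shows "norm (M *v q) \<le> r * col_sum M"
proof -
  have "M *v q = M *v (\<Sum>i\<in>UNIV. q $ i *\<^sub>R axis i 1)"
    using basis_expansion[of q] by (simp add: scalar_mult_eq_scaleR)
  also have "\<dots> = (\<Sum>i\<in>UNIV. q $ i *\<^sub>R (M *v axis i 1))"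
    using linear_sum[OF matrix_vector_mul_linear, of M "\<lambda>i. q $ i *\<^sub>R axis i 1" UNIV]
    by (simp add: matrix_vector_mult_scaleR)
  also have "norm \<dots> \<le> (\<Sum>i\<in>UNIV. r * norm (M *v axis i 1))"
    by (rule sum_norm_le) (use assms in \<open>auto intro: mult_right_mono\<close>)
  finally show ?thesis by (simp add: col_sum_def sum_distrib_left)
qed

lemma summable_col_sum:
  assumes "\<And>x. summable (\<lambda>k. norm (mat_pow C k *v x))"
  shows "summable (\<lambda>k. col_sum (mat_pow C k))"
  unfolding col_sum_def by (intro summable_sum assms)

lemma col_sum_tendsto_0:
  assumes "\<And>x. summable (\<lambda>k. norm (mat_pow C k *v x))"
  shows "(\<lambda>k. col_sum (mat_pow C k)) \<longlonglongrightarrow> 0"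
  using summable_col_sum[OF assms] by (rule summable_LIMSEQ_zero)

lemma col_sum_bounded:
  assumes "\<And>x. summable (\<lambda>k. norm (mat_pow C k *v x))"
  obtains D where "D \<ge> 0" "\<And>k. col_sum (mat_pow C k) \<le> D"
proof -
  obtain D where D: "\<forall>k. norm (col_sum (mat_pow C k)) \<le> D"
    using summable_imp_Bseq[OF summable_col_sum[OF assms]] by (rule BseqE)
  have "col_sum (mat_pow C k) \<le> D" for k using D[rule_format, of k] by simp
  moreover from this[of 0] have "D \<ge> 0" using col_sum_nonneg order_trans by blast
  ultimately show thesis by (rule that[rotated])
qed

section \<open>The frame property of a refinable function\<close>

text \<open>\<open>filter_bank\<close> is perfect reconstruction: analysing a sequence with the
  masks a and b preserves its l^2 norm, expressed on pairs of lattice points. K may be any finite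
  set catching every l for which \<open>p - B *v l\<close> meets the masks, so that only finite sums
  occur.\<close>

locale refinable_pair =
  fixes B :: "real^'d::finite^'d" and a b :: "real^'d \<Rightarrow> complex" and L :: "(real^'d) set"
    and phi psi :: "real^'d \<Rightarrow> complex" and R :: real
  assumes detB: "\<bar>det B\<bar> = 2"
    and B_Zd: "\<And>x. x \<in> Zd \<Longrightarrow> B *v x \<in> Zd"
    and decay: "\<And>x. summable (\<lambda>k. norm (mat_pow (matrix_inv B) k *v x))"
    and L: "finite L" "L \<subseteq> Zd" and ab_L: "\<And>n. n \<notin> L \<Longrightarrow> a n = 0" "\<And>n. n \<notin> L \<Longrightarrow> b n = 0"
    and filter_bank: "\<And>p p' K. p \<in> Zd \<Longrightarrow> p' \<in> Zd \<Longrightarrow> finite K \<Longrightarrow> K \<subseteq> Zd \<Longrightarrow>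
      {l\<in>Zd. p - B *v l \<in> L} \<subseteq> K \<Longrightarrow>
      (\<Sum>l\<in>K. a (p - B *v l) * cnj (a (p' - B *v l)) + b (p - B *v l) * cnj (b (p' - B *v l))) = (if p = p' then 1 else 0)"
    and phi: "square_integrable phi" and phi_supp: "AE t in lebesgue. norm t > R \<longrightarrow> phi t = 0"
    and phi_int: "(LINT t|lebesgue. phi t) = 1" and R: "R \<ge> 0"
    and phi_eq: "AE t in lebesgue. phi t = (\<Sum>n\<in>L. a n * dil B (transl n phi) t)"
    and psi_eq: "AE t in lebesgue. psi t = (\<Sum>n\<in>L. b n * dil B (transl n phi) t)"
begin

abbreviation C where "C \<equiv> matrix_inv B"

lemma dB: "det B \<noteq> 0" by (rule dB0[OF detB])

lemma two_scale_square_integrable: "square_integrable (\<lambda>t. \<Sum>n\<in>L. c n * dil B (transl n phi) t)"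
  by (intro square_integrable_sum square_integrable_cmult square_integrable_dil[OF detB] square_integrable_transl phi)

lemma psi: "square_integrable psi"
proof (rule square_integrable_AE_cong(1)[OF two_scale_square_integrable])
  show "AE t in lebesgue. (\<Sum>n\<in>L. b n * dil B (transl n phi) t) = psi t"
    using psi_eq by eventually_elim simp
qed

lemma phi_integrable: "integrable lebesgue phi"
proof -
  have "square_integrable (\<lambda>t. indicator (cball 0 R) t :: complex)"
    by (rule bounded_support_square_integrable[of _ 1 R]) (auto split: split_indicator intro!: borel_measurable_indicator)
  from square_integrable_mult_integrable[OF phi this]
  have i: "integrable lebesgue (\<lambda>t. phi t * indicator (cball 0 R) t)" .
  show ?thesis
    by (rule integrable_cong_AE_imp[OF i])
       (use phi in \<open>simp add: square_integrable_def\<close>, use phi_supp in \<open>eventually_elim, auto simp: indicator_def\<close>)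
qed

text \<open>Since T_l D = D T_(B l), translating a two-scale relation only shifts the indices on its
  right side; unitarity of D then moves the dilation onto f. A coefficient of f is thus a filtered
  sequence of coefficients one level finer.\<close>

lemma L2_inner_transl_two_scale:
  assumes f: "square_integrable f" and ae: "AE t in lebesgue. w t = (\<Sum>n\<in>L. c n * dil B (transl n phi) t)"
  shows "L2_inner f (transl l w) = (\<Sum>n\<in>L. cnj (c n) * L2_inner (dil_inv B f) (transl (B *v l + n) phi))"
proof -
  have t: "transl l (\<lambda>t. \<Sum>n\<in>L. c n * dil B (transl n phi) t) = (\<lambda>t. \<Sum>n\<in>L. c n * dil B (transl (B *v l + n) phi) t)"
    by (simp add: transl_def dil_def matrix_vector_mult_diff_distrib diff_diff_eq)
  have s: "square_integrable (dil B (transl (B *v l + n) phi))" for n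
    by (intro square_integrable_dil[OF detB] square_integrable_transl phi)
  have sw: "square_integrable w"
  proof (rule square_integrable_AE_cong(1)[OF two_scale_square_integrable])
    show "AE t in lebesgue. (\<Sum>n\<in>L. c n * dil B (transl n phi) t) = w t" using ae by eventually_elim simp
  qed
  have "L2_inner f (transl l w) = L2_inner f (transl l (\<lambda>t. \<Sum>n\<in>L. c n * dil B (transl n phi) t))"
    by (rule L2_inner_AE_cong_right[OF f square_integrable_transl[OF sw] transl_AE[OF ae]])
  also have "\<dots> = (\<Sum>n\<in>L. L2_inner f (\<lambda>t. c n * dil B (transl (B *v l + n) phi) t))"
    unfolding t by (rule L2_inner_sum_right) (auto intro: square_integrable_cmult s f)
  also have "\<dots> = (\<Sum>n\<in>L. cnj (c n) * L2_inner (dil_inv B f) (transl (B *v l + n) phi))"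
    unfolding L2_inner_cmult_right using L2_inner_dil[OF detB f square_integrable_transl[OF phi]] by simp
  finally show ?thesis .
qed

text \<open>Expanding the squares and summing over l first produces, for each pair of points,
  exactly the sum in \<open>filter_bank\<close>, which leaves the diagonal.\<close>

lemma filter_bank_isometry:
  assumes K: "finite K" "K \<subseteq> Zd" and c': "\<And>p. p \<in> Zd \<Longrightarrow> p \<notin> K \<Longrightarrow> c' p = 0"
    and K1: "finite K1" "K1 \<subseteq> Zd" "\<And>l n. l \<in> Zd \<Longrightarrow> n \<in> L \<Longrightarrow> B *v l + n \<in> K \<Longrightarrow> l \<in> K1"
  shows "(\<Sum>l\<in>K1. (cmod (\<Sum>n\<in>L. cnj (a n) * c' (B *v l + n)))\<^sup>2 + (cmod (\<Sum>n\<in>L. cnj (b n) * c' (B *v l + n)))\<^sup>2)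
     = (\<Sum>p\<in>K. (cmod (c' p))\<^sup>2)"
proof -
  \<comment> \<open>Substitution p = B l + n. The mask vanishes off L and the sequence vanishes off
    K, so both sums agree with the sum over the union of the two index ranges.\<close>
  have re: "(\<Sum>n\<in>L. cnj (c n) * c' (B *v l + n)) = (\<Sum>p\<in>K. cnj (c (p - B *v l)) * c' p)"
    if l: "l \<in> Zd" and c: "\<And>n. n \<notin> L \<Longrightarrow> c n = 0" for c l
  proof -
    have "(\<Sum>n\<in>L. cnj (c n) * c' (B *v l + n)) = (\<Sum>p\<in>(\<lambda>n. B *v l + n) ` L. cnj (c (p - B *v l)) * c' p)"
      by (subst sum.reindex) (auto simp: inj_on_def)
    also have "\<dots> = (\<Sum>p\<in>(\<lambda>n. B *v l + n) ` L \<union> K. cnj (c (p - B *v l)) * c' p)"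
    proof (rule sum.mono_neutral_left)
      show "\<forall>p\<in>(\<lambda>n. B *v l + n) ` L \<union> K - (\<lambda>n. B *v l + n) ` L. cnj (c (p - B *v l)) * c' p = 0"
      proof
        fix p assume "p \<in> (\<lambda>n. B *v l + n) ` L \<union> K - (\<lambda>n. B *v l + n) ` L"
        then have "p - B *v l \<notin> L" by (force simp: image_iff)
        then show "cnj (c (p - B *v l)) * c' p = 0" using c by simp
      qed
    qed (use L K in auto)
    also have "\<dots> = (\<Sum>p\<in>K. cnj (c (p - B *v l)) * c' p)"
    proof (rule sum.mono_neutral_right)
      show "\<forall>p\<in>(\<lambda>n. B *v l + n) ` L \<union> K - K. cnj (c (p - B *v l)) * c' p = 0"
        using c' Zd_add[OF B_Zd[OF l]] L(2) by auto
    qed (use L K in auto)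
    finally show ?thesis .
  qed
  have sq: "complex_of_real ((cmod (\<Sum>p\<in>K. cnj (c (p - B *v l)) * c' p))\<^sup>2) =
      (\<Sum>p\<in>K. \<Sum>p'\<in>K. c' p * cnj (c' p') * (c (p' - B *v l) * cnj (c (p - B *v l))))" for c :: "real^'d \<Rightarrow> complex" and l
    unfolding complex_norm_square
    by (simp add: sum_product mult_ac)
  have "complex_of_real (\<Sum>l\<in>K1. (cmod (\<Sum>n\<in>L. cnj (a n) * c' (B *v l + n)))\<^sup>2 + (cmod (\<Sum>n\<in>L. cnj (b n) * c' (B *v l + n)))\<^sup>2)
     = (\<Sum>l\<in>K1. \<Sum>p\<in>K. \<Sum>p'\<in>K. c' p * cnj (c' p') *
          (a (p' - B *v l) * cnj (a (p - B *v l)) + b (p' - B *v l) * cnj (b (p - B *v l))))"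
    unfolding of_real_sum
  proof (rule sum.cong[OF refl])
    fix l assume "l \<in> K1"
    then have l: "l \<in> Zd" using K1 by blast
    show "complex_of_real ((cmod (\<Sum>n\<in>L. cnj (a n) * c' (B *v l + n)))\<^sup>2 + (cmod (\<Sum>n\<in>L. cnj (b n) * c' (B *v l + n)))\<^sup>2)
       = (\<Sum>p\<in>K. \<Sum>p'\<in>K. c' p * cnj (c' p') *
          (a (p' - B *v l) * cnj (a (p - B *v l)) + b (p' - B *v l) * cnj (b (p - B *v l))))"
    proof -
      have "(\<Sum>n\<in>L. cnj (a n) * c' (B *v l + n)) = (\<Sum>p\<in>K. cnj (a (p - B *v l)) * c' p)"
        "(\<Sum>n\<in>L. cnj (b n) * c' (B *v l + n)) = (\<Sum>p\<in>K. cnj (b (p - B *v l)) * c' p)"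
        using re[OF l] ab_L by simp_all
      then show ?thesis by (simp only: of_real_add sq distrib_left sum.distrib)
    qed
  qed
  also have "\<dots> = (\<Sum>p\<in>K. \<Sum>p'\<in>K. \<Sum>l\<in>K1. c' p * cnj (c' p') *
          (a (p' - B *v l) * cnj (a (p - B *v l)) + b (p' - B *v l) * cnj (b (p - B *v l))))"
    by (subst sum.swap, rule sum.cong[OF refl], rule sum.swap)
  also have "\<dots> = (\<Sum>p\<in>K. \<Sum>p'\<in>K. c' p * cnj (c' p') * (if p' = p then 1 else 0))"
  proof (intro sum.cong refl)
    fix p p' assume p: "p \<in> K" "p' \<in> K"
    have "{l \<in> Zd. p' - B *v l \<in> L} \<subseteq> K1"
    proof safe
      fix l assume "l \<in> Zd" "p' - B *v l \<in> L"
      then show "l \<in> K1" using K1(3)[of l "p' - B *v l"] p by simp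
    qed
    then have "(\<Sum>l\<in>K1. a (p' - B *v l) * cnj (a (p - B *v l)) + b (p' - B *v l) * cnj (b (p - B *v l))) = (if p' = p then 1 else 0)"
      using filter_bank[of p' p K1] p K K1 by blast
    then show "(\<Sum>l\<in>K1. c' p * cnj (c' p') * (a (p' - B *v l) * cnj (a (p - B *v l)) + b (p' - B *v l) * cnj (b (p - B *v l))))
       = c' p * cnj (c' p') * (if p' = p then 1 else 0)"
      by (simp only: sum_distrib_left[symmetric])
  qed
  also have "\<dots> = (\<Sum>p\<in>K. c' p * cnj (c' p))"
    using K(1) by (simp add: if_distrib cong: if_cong)
  also have "\<dots> = complex_of_real (\<Sum>p\<in>K. (cmod (c' p))\<^sup>2)"
    by (simp only: of_real_sum complex_norm_square)
  finally show ?thesis by (simp only: of_real_eq_iff)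
qed

section \<open>Coefficient energies and their limits over the levels\<close>

definition cf :: "(real^'d \<Rightarrow> complex) \<Rightarrow> real^'d \<Rightarrow> complex" where "cf f l = L2_inner f (transl l phi)"
definition df :: "(real^'d \<Rightarrow> complex) \<Rightarrow> real^'d \<Rightarrow> complex" where "df f l = L2_inner f (transl l psi)"

text \<open>Infinite sums keep the index range independent of f; on the class \<open>Cc\<close> all
  but finitely many terms vanish.\<close>

definition Ec :: "(real^'d \<Rightarrow> complex) \<Rightarrow> real" where "Ec f = (\<Sum>\<^sub>\<infinity>l\<in>Zd. (cmod (cf f l))\<^sup>2)"
definition Ed :: "(real^'d \<Rightarrow> complex) \<Rightarrow> real" where "Ed f = (\<Sum>\<^sub>\<infinity>l\<in>Zd. (cmod (df f l))\<^sup>2)"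

lemma infsum_finite_support:
  fixes g :: "real^'d \<Rightarrow> real"
  assumes "finite K" "K \<subseteq> Zd" "\<And>l. l \<in> Zd \<Longrightarrow> l \<notin> K \<Longrightarrow> g l = 0"
  shows "(\<Sum>\<^sub>\<infinity>l\<in>Zd. g l) = sum g K"
proof -
  have "(\<Sum>\<^sub>\<infinity>l\<in>Zd. g l) = (\<Sum>\<^sub>\<infinity>l\<in>K. g l)" by (rule infsum_cong_neutral) (use assms in auto)
  then show ?thesis using assms(1) by simp
qed

lemma cf_eq_0:
  assumes supp: "\<And>x. norm x > r \<Longrightarrow> f x = 0" and l: "norm l > R + r"
  shows "cf f l = 0"
proof -
  have "AE t in lebesgue. norm (t - l) > R \<longrightarrow> phi (t - l) = 0"
    using AE_affine[of "mat 1" "\<lambda>t. norm t > R \<longrightarrow> phi t = 0" "- l"] phi_supp by simp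
  then have "AE t in lebesgue. f t * cnj (transl l phi t) = 0"
  proof eventually_elim
    case (elim t)
    show ?case
    proof (cases "norm t > r")
      case False
      have "norm l \<le> norm t + norm (t - l)" using norm_triangle_ineq4[of t "t - l"] by simp
      then show ?thesis using elim False l by (simp add: transl_def)
    qed (simp add: supp)
  qed
  then show ?thesis
    unfolding cf_def L2_inner_def by (rule integral_eq_zero_AE)
qed

definition Zb :: "real \<Rightarrow> (real^'d) set" where "Zb r = {l. l \<in> Zd \<and> norm l \<le> r}"

lemma Zb: "finite (Zb r)" "Zb r \<subseteq> Zd" "l \<in> Zd \<Longrightarrow> l \<notin> Zb r \<Longrightarrow> norm l > r"
  by (auto simp: Zb_def finite_Zd_cball)

lemma Ec_eq_sum:
  assumes "\<And>x. norm x > r \<Longrightarrow> f x = 0"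
  shows "Ec f = (\<Sum>l\<in>Zb (R + r). (cmod (cf f l))\<^sup>2)"
  unfolding Ec_def by (rule infsum_finite_support) (use Zb cf_eq_0[where f=f and r=r, OF assms] in auto)

text \<open>The coefficients of \<open>dil_inv B f\<close> form a sequence supported in the finite
  set K, to which \<open>filter_bank_isometry\<close> applies; K1 collects the points l whose
  shifted mask meets K.\<close>

lemma energy_step:
  assumes f: "Cc f"
  shows "Ec (dil_inv B f) = Ec f + Ed f" "\<exists>K. finite K \<and> K \<subseteq> Zd \<and> (\<forall>l\<in>Zd - K. df f l = 0)"
proof -
  have sf: "square_integrable f" by (rule Cc_square_integrable[OF f])
  have "Cc (dil_inv B f)" using Cc_dil_pow[OF detB f, of "-1"] by (simp add: dil_pow_def)
  then obtain r where r: "\<And>x. norm x > r \<Longrightarrow> dil_inv B f x = 0" by (auto simp: Cc_def)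
  define K where "K = Zb (R + r)"
  define K1 where "K1 = {l\<in>Zd. \<exists>n\<in>L. B *v l + n \<in> K}"
  have K: "finite K" "K \<subseteq> Zd" unfolding K_def by (simp_all add: Zb)
  have "K1 \<subseteq> (\<lambda>(p, n). C *v (p - n)) ` (K \<times> L)"
  proof
    fix l assume "l \<in> K1"
    then obtain n where n: "n \<in> L" "B *v l + n \<in> K" by (auto simp: K1_def)
    have "l = (\<lambda>(p, n). C *v (p - n)) (B *v l + n, n)" by (simp add: matrix_inv_invertible[OF dB])
    then show "l \<in> (\<lambda>(p, n). C *v (p - n)) ` (K \<times> L)" using n by blast
  qed
  then have K1: "finite K1" "K1 \<subseteq> Zd"
    using finite_subset[of K1] K L by (auto simp: K1_def)
  let ?c = "cf (dil_inv B f)"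
  have c0: "?c p = 0" if "p \<in> Zd" "p \<notin> K" for p
    using that Zb(3)[of p "R + r"] cf_eq_0[where f="dil_inv B f" and r=r and l=p, OF r] unfolding K_def by blast
  have cd: "cf f l = (\<Sum>n\<in>L. cnj (a n) * ?c (B *v l + n))" "df f l = (\<Sum>n\<in>L. cnj (b n) * ?c (B *v l + n))" for l
    unfolding cf_def df_def by (rule L2_inner_transl_two_scale[OF sf phi_eq] L2_inner_transl_two_scale[OF sf psi_eq])+
  have "?c (B *v l + n) = 0" if "l \<in> Zd" "l \<notin> K1" "n \<in> L" for l n
    using c0[of "B *v l + n"] that Zd_add[OF B_Zd] L(2) by (auto simp: K1_def)
  then have z: "cf f l = 0" "df f l = 0" if "l \<in> Zd" "l \<notin> K1" for l
    unfolding cd using that by simp_all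
  show "\<exists>K. finite K \<and> K \<subseteq> Zd \<and> (\<forall>l\<in>Zd - K. df f l = 0)" using K1 z by blast
  have "Ec f + Ed f = (\<Sum>l\<in>K1. (cmod (cf f l))\<^sup>2 + (cmod (df f l))\<^sup>2)"
    unfolding Ec_def Ed_def sum.distrib
    using infsum_finite_support[OF K1, of "\<lambda>l. (cmod (cf f l))\<^sup>2"] infsum_finite_support[OF K1, of "\<lambda>l. (cmod (df f l))\<^sup>2"] z by simp
  also have "\<dots> = (\<Sum>p\<in>K. (cmod (?c p))\<^sup>2)"
    unfolding cd by (rule filter_bank_isometry[OF K c0 K1]) (auto simp: K1_def)
  also have "\<dots> = Ec (dil_inv B f)"
    unfolding K_def by (rule Ec_eq_sum[where f="dil_inv B f" and r=r, OF r, symmetric])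
  finally show "Ec (dil_inv B f) = Ec f + Ed f" ..
qed

text \<open>The inner products are approximated by the values of \<open>f\<close> at the points \<open>B\<^bsup>-n\<^esup> l\<close>, since \<open>\<phi>\<close> has integral one and shrinking support.\<close>

lemma energy_limit_fine:
  assumes f: "Cc f"
  shows "(\<lambda>n. Ec (dil_pow B (- int n) f)) \<longlonglongrightarrow> L2_norm_sq f"
proof -
  obtain K r where Kr: "K \<ge> 0" "r \<ge> 0" "\<And>x. cmod (f x) \<le> K" "\<And>x. norm x > r \<Longrightarrow> f x = 0"
    using Cc_bounded[OF f] by blast
  obtain D where D: "D \<ge> 0" "\<And>k. col_sum (mat_pow C k) \<le> D" using col_sum_bounded[OF decay] by blast
  have cont: "isCont f x" for x using f by (simp add: Cc_def continuous_on_eq_continuous_at)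
  \<comment> \<open>The coefficient freed from its factor \<open>sqrt 2 ^ n\<close>: an average of
    f, weighted by the conjugate of phi, around the grid point
    \<open>mat_pow C n *v l\<close>.\<close>
  define G where "G = (\<lambda>n l. LINT s|lebesgue. f (mat_pow C n *v (s + l)) * cnj (phi s))"
  have fm: "f \<in> borel_measurable lebesgue" by (rule Cc_measurable_lebesgue[OF f])
  have dC: "det (mat_pow C n) \<noteq> 0" for n
    using det_matrix_inv[OF dB] dB by (simp add: det_mat_pow)
  have s2: "complex_of_real (sqrt 2) ^ n \<noteq> 0" for n by simp
  have phim: "phi \<in> borel_measurable lebesgue" using phi by (simp add: square_integrable_def)
  have cphi: "(\<lambda>s. cnj (phi s)) \<in> borel_measurable lebesgue"
    using square_integrable_cnj[OF phi] by (simp add: square_integrable_def)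
  have cfG: "cf (dil_pow B (- int n) f) l = G n l / complex_of_real (sqrt 2) ^ n" for n l
  proof -
    let ?H = "\<lambda>t. f (mat_pow C n *v t) * cnj (phi (t - l))"
    have "?H \<in> borel_measurable lebesgue"
    proof (rule borel_measurable_times)
      show "(\<lambda>t. f (mat_pow C n *v t)) \<in> borel_measurable lebesgue"
        using measurable_affine[OF dC fm, of n 0] by simp
      show "(\<lambda>t. cnj (phi (t - l))) \<in> borel_measurable lebesgue"
        using measurable_affine[of "mat 1", OF _ cphi, of "- l"] by simp
    qed
    from integral_affine[of "mat 1", OF _ this, of l]
    have "(LINT t|lebesgue. ?H t) = (LINT t|lebesgue. ?H (t + l))" by simp
    then show ?thesis
      unfolding cf_def L2_inner_def G_def dil_pow_neg_nat transl_def by simp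
  qed
  have Gb: "cmod (G n l) \<le> K * (LINT s|lebesgue. cmod (phi s))" for n l
  proof -
    have "cmod (G n l) \<le> (LINT s|lebesgue. K * cmod (phi s))"
      unfolding G_def
    proof (rule Bochner_Integration.integral_norm_bound_integral)
      show "integrable lebesgue (\<lambda>s. f (mat_pow C n *v (s + l)) * cnj (phi s))"
      proof (rule Bochner_Integration.integrable_bound[OF integrable_mult_right[OF integrable_norm[OF phi_integrable], of K]])
        have "(\<lambda>s. f (mat_pow C n *v (s + l))) = (\<lambda>s. f (mat_pow C n *v s + mat_pow C n *v l))"
          by (simp add: matrix_vector_right_distrib)
        then show "(\<lambda>s. f (mat_pow C n *v (s + l)) * cnj (phi s)) \<in> borel_measurable lebesgue"
          using measurable_affine[OF dC fm, of n "mat_pow C n *v l"] cphi by (intro borel_measurable_times) auto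
      qed (intro AE_I2, use Kr(1,3) in \<open>auto simp: norm_mult intro: mult_right_mono\<close>)
      show "integrable lebesgue (\<lambda>s. K * cmod (phi s))" using phi_integrable by simp
    qed (use Kr(3) in \<open>auto simp: norm_mult intro: mult_right_mono\<close>)
    then show ?thesis by simp
  qed
  let ?x = "\<lambda>n t. mat_pow C n *v vfloor (mat_pow B n *v t)"
  have xt: "norm (t - ?x n t) \<le> col_sum (mat_pow C n)" for n t
  proof -
    let ?q = "mat_pow B n *v t - vfloor (mat_pow B n *v t)"
    have "t - ?x n t = mat_pow C n *v ?q"
      by (simp add: matrix_vector_mult_diff_distrib mat_pow_inverse[OF dB])
    moreover have "norm (mat_pow C n *v ?q) \<le> 1 * col_sum (mat_pow C n)"
      using vfloor_frac[of "mat_pow B n *v t"] by (intro norm_matrix_vector_le_col_sum) (simp add: abs_le_iff)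
    ultimately show ?thesis by simp
  qed
  have xlim: "(\<lambda>n. ?x n t) \<longlonglongrightarrow> t" for t
  proof -
    have "(\<lambda>n. t - ?x n t) \<longlonglongrightarrow> 0"
      by (rule Lim_null_comparison[OF _ col_sum_tendsto_0[OF decay]]) (use xt in simp)
    from tendsto_diff[OF tendsto_const[of t] this] show ?thesis by simp
  qed
  \<comment> \<open>A uniform support bound for the step functions: t is within D of its grid point,
    and points of the support of phi are moved by at most \<open>R * D\<close>, so beyond this
    radius f is evaluated only outside its support.\<close>
  have G0: "G n (vfloor (mat_pow B n *v t)) = 0" if "norm t > r + D * (1 + R)" for n t
  proof -
    have "AE s in lebesgue. f (mat_pow C n *v (s + vfloor (mat_pow B n *v t))) * cnj (phi s) = 0"
      using phi_supp
    proof eventually_elim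
      case (elim s)
      show ?case
      proof (cases "norm s > R")
        case False
        have "norm (mat_pow C n *v s) \<le> R * col_sum (mat_pow C n)"
          using False component_le_norm_cart[of s] by (intro norm_matrix_vector_le_col_sum) (meson order_trans not_less)
        also have "\<dots> \<le> R * D" using D(2) R by (intro mult_left_mono) auto
        finally have s1: "norm (mat_pow C n *v s) \<le> R * D" .
        have "norm t \<le> norm (t - ?x n t) + norm (mat_pow C n *v s) + norm (mat_pow C n *v s + ?x n t)"
          using norm_triangle_ineq[of "t - ?x n t" "?x n t"] norm_triangle_ineq4[of "mat_pow C n *v s + ?x n t" "mat_pow C n *v s"]
          by simp
        then have "norm (mat_pow C n *v s + ?x n t) > r"
          using that s1 order_trans[OF xt[of t n] D(2)[of n]] by (simp add: algebra_simps)
        then show ?thesis using Kr(4) by (simp add: matrix_vector_right_distrib)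
      qed (use elim in simp)
    qed
    then show ?thesis unfolding G_def by (rule integral_eq_zero_AE)
  qed
  have Glim: "(\<lambda>n. G n (vfloor (mat_pow B n *v t))) \<longlonglongrightarrow> f t" for t
  proof -
    have "(\<lambda>n. G n (vfloor (mat_pow B n *v t))) \<longlonglongrightarrow> (LINT s|lebesgue. f t * cnj (phi s))"
      unfolding G_def
    proof (rule integral_dominated_convergence[where w="\<lambda>s. K * cmod (phi s)"])
      show "integrable lebesgue (\<lambda>s. K * cmod (phi s))" using phi_integrable by simp
      show "(\<lambda>s. f t * cnj (phi s)) \<in> borel_measurable lebesgue" using cphi by simp
      show "(\<lambda>s. f (mat_pow C n *v (s + vfloor (mat_pow B n *v t))) * cnj (phi s)) \<in> borel_measurable lebesgue" for n
      proof -
        have "(\<lambda>s. f (mat_pow C n *v (s + l))) = (\<lambda>s. f (mat_pow C n *v s + mat_pow C n *v l))" for l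
          by (simp add: matrix_vector_right_distrib)
        then show ?thesis
          using measurable_affine[OF dC fm, of n] cphi by (intro borel_measurable_times) auto
      qed
      show "AE s in lebesgue. (\<lambda>n. f (mat_pow C n *v (s + vfloor (mat_pow B n *v t))) * cnj (phi s)) \<longlonglongrightarrow> f t * cnj (phi s)"
      proof (intro AE_I2 tendsto_mult tendsto_const)
        fix s :: "real^'d"
        have "(\<lambda>n. mat_pow C n *v s) \<longlonglongrightarrow> 0"
          using summable_LIMSEQ_zero[OF decay, of s] by (simp add: tendsto_norm_zero_iff)
        from tendsto_add[OF this xlim[of t]]
        have "(\<lambda>n. mat_pow C n *v (s + vfloor (mat_pow B n *v t))) \<longlonglongrightarrow> t"
          by (simp add: matrix_vector_right_distrib)
        then show "(\<lambda>n. f (mat_pow C n *v (s + vfloor (mat_pow B n *v t)))) \<longlonglongrightarrow> f t"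
          by (rule isCont_tendsto_compose[OF cont])
      qed
      show "AE s in lebesgue. norm (f (mat_pow C n *v (s + vfloor (mat_pow B n *v t))) * cnj (phi s)) \<le> K * cmod (phi s)" for n
        using Kr(3) by (intro AE_I2) (auto simp: norm_mult intro: mult_right_mono)
    qed
    moreover have "(LINT s|lebesgue. cnj (phi s)) = 1"
      using integral_bounded_linear[OF bounded_linear_cnj phi_integrable] phi_int by simp
    ultimately show ?thesis by simp
  qed
  \<comment> \<open>Each grid cell is an affine image of a unit cell and has measure
    \<open>1 / 2 ^ n\<close>, which is the squared normalisation lost in \<open>G\<close>; the
    energy therefore becomes the integral of a step function.\<close>
  have E: "Ec (dil_pow B (- int n) f) = (LINT t|lebesgue. (cmod (G n (vfloor (mat_pow B n *v t))))\<^sup>2)"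
    "integrable lebesgue (\<lambda>t. (cmod (G n (vfloor (mat_pow B n *v t))))\<^sup>2)" for n
  proof -
    obtain r' where r': "\<And>x. norm x > r' \<Longrightarrow> dil_pow B (- int n) f x = 0"
      using Cc_dil_pow[OF detB f] by (auto simp: Cc_def)
    have z: "(cmod (G n l))\<^sup>2 = 0" if "l \<in> Zd" "l \<notin> Zb (R + r')" for l
    proof -
      have "cf (dil_pow B (- int n) f) l = 0" using cf_eq_0[where f="dil_pow B (- int n) f" and r=r', OF r' Zb(3)[OF that]] .
      then show ?thesis unfolding cfG by simp
    qed
    have step: "integrable lebesgue (\<lambda>t. (cmod (G n (vfloor t)))\<^sup>2)"
      "(LINT t|lebesgue. (cmod (G n (vfloor t)))\<^sup>2) = (\<Sum>l\<in>Zb (R + r'). (cmod (G n l))\<^sup>2)"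
      by (rule integral_step_function(1)[where F="\<lambda>l. (cmod (G n l))\<^sup>2", OF Zb(1,2)], rule z, assumption+)
         (rule integral_step_function(2)[where F="\<lambda>l. (cmod (G n l))\<^sup>2", OF Zb(1,2)], rule z, assumption+)
    have m: "(\<lambda>t. (cmod (G n (vfloor t)))\<^sup>2) \<in> borel_measurable lebesgue" using step(1) by auto
    have dBn: "det (mat_pow B n) \<noteq> 0" "\<bar>det (mat_pow B n)\<bar> = 2^n"
      using dB detB by (auto simp: det_mat_pow power_abs)
    have "(sqrt 2 ^ n)\<^sup>2 = ((sqrt 2)\<^sup>2) ^ n" by (simp only: power_mult[symmetric] mult.commute)
    then have s2n: "(cmod (complex_of_real (sqrt 2) ^ n))\<^sup>2 = 2^n" by (simp add: norm_power)
    have "Ec (dil_pow B (- int n) f) = (\<Sum>l\<in>Zb (R + r'). (cmod (cf (dil_pow B (- int n) f) l))\<^sup>2)"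
      by (rule Ec_eq_sum) (rule r')
    also have "\<dots> = (\<Sum>l\<in>Zb (R + r'). (cmod (G n l))\<^sup>2 / 2^n)"
      unfolding cfG norm_divide power_divide s2n ..
    also have "\<dots> = (1 / 2^n) * (LINT t|lebesgue. (cmod (G n (vfloor t)))\<^sup>2)"
      unfolding step(2) by (simp add: sum_divide_distrib)
    also have "\<dots> = (LINT t|lebesgue. (cmod (G n (vfloor (mat_pow B n *v t))))\<^sup>2)"
      using integral_affine[OF dBn(1) m, of 0] dBn(2) by simp
    finally show "Ec (dil_pow B (- int n) f) = (LINT t|lebesgue. (cmod (G n (vfloor (mat_pow B n *v t))))\<^sup>2)" .
    show "integrable lebesgue (\<lambda>t. (cmod (G n (vfloor (mat_pow B n *v t))))\<^sup>2)"
      using integrable_affine[OF dBn(1) m, of 0] step(1) by simp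
  qed
  have "(\<lambda>n. LINT t|lebesgue. (cmod (G n (vfloor (mat_pow B n *v t))))\<^sup>2) \<longlonglongrightarrow> (LINT t|lebesgue. (cmod (f t))\<^sup>2)"
  proof (rule integral_dominated_convergence)
    let ?M = "(K * (LINT s|lebesgue. cmod (phi s)))\<^sup>2"
    show "integrable lebesgue (\<lambda>t::real^'d. ?M * indicator (cball 0 (r + D * (1 + R))) t)" by (rule integrable_indicator_cball)
    show "AE t in lebesgue. norm ((cmod (G n (vfloor (mat_pow B n *v t))))\<^sup>2) \<le> ?M * indicator (cball 0 (r + D * (1 + R))) t" for n
    proof (rule AE_I2)
      fix t :: "real^'d"
      show "norm ((cmod (G n (vfloor (mat_pow B n *v t))))\<^sup>2) \<le> ?M * indicator (cball 0 (r + D * (1 + R))) t"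
        using G0[of t n] power_mono[OF Gb[of n "vfloor (mat_pow B n *v t)"], of 2]
        by (cases "norm t > r + D * (1 + R)") (auto simp: indicator_def)
    qed
    show "AE t in lebesgue. (\<lambda>n. (cmod (G n (vfloor (mat_pow B n *v t))))\<^sup>2) \<longlonglongrightarrow> (cmod (f t))\<^sup>2"
      by (intro AE_I2 tendsto_power tendsto_norm Glim)
  qed (use fm E(2) in auto)
  then show ?thesis unfolding E(1) L2_norm_sq_def .
qed

text \<open>Only a fixed finite set of translates meets the supports of the contracted functions, and each inner product tends to 0 because these supports shrink to a point.\<close>

lemma energy_limit_coarse:
  assumes f: "Cc f"
  shows "(\<lambda>n. Ec (dil_pow B (int n) f)) \<longlonglongrightarrow> 0"
proof -
  obtain K r where Kr: "K \<ge> 0" "r \<ge> 0" "\<And>x. cmod (f x) \<le> K" "\<And>x. norm x > r \<Longrightarrow> f x = 0"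
    using Cc_bounded[OF f] by blast
  obtain D where D: "D \<ge> 0" "\<And>k. col_sum (mat_pow C k) \<le> D" using col_sum_bounded[OF decay] by blast
  let ?f = "\<lambda>n. dil_pow B (int n) f"
  have sf: "square_integrable (?f n)" for n by (rule square_integrable_dil_pow[OF detB Cc_square_integrable[OF f]])
  have supp: "?f n t = 0" if "norm t > r * col_sum (mat_pow C n)" for n t
  proof -
    have "norm (mat_pow B n *v t) > r"
    proof (rule ccontr)
      assume "\<not> norm (mat_pow B n *v t) > r"
      then have "\<bar>(mat_pow B n *v t) $ i\<bar> \<le> r" for i
        using component_le_norm_cart[of "mat_pow B n *v t" i] by linarith
      from norm_matrix_vector_le_col_sum[OF this, of "mat_pow C n"] that show False
        by (simp add: mat_pow_inverse[OF dB])
    qed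
    then show ?thesis unfolding dil_pow_nat by (simp add: Kr(4))
  qed
  have supp': "?f n t = 0" if "norm t > r * D" for n t
    using supp[of n t] that mult_left_mono[OF D(2)[of n] Kr(2)] by linarith
  have lim: "(\<lambda>n. cf (?f n) l) \<longlonglongrightarrow> 0" for l
  proof -
    let ?T = "transl l phi"
    \<comment> \<open>Because the dilated f lives in a shrinking ball, the translate of phi may be
      cut to that ball. The cut translates tend to 0 off the origin, a null set, hence in L^2, while
      the norm of the dilated f stays fixed.\<close>
    let ?s = "\<lambda>n t. indicator (cball 0 (r * col_sum (mat_pow C n))) t * ?T t"
    have sT: "square_integrable ?T" by (rule square_integrable_transl[OF phi])
    have mT: "?T \<in> borel_measurable lebesgue" using sT by (simp add: square_integrable_def)
    have dc: "(\<lambda>n. L2n (\<lambda>t. ?s n t - 0)) \<longlonglongrightarrow> 0 \<and> (\<forall>n. square_integrable (?s n))"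
    proof (intro conjI allI)
      have 1: "integrable lebesgue (\<lambda>t. (cmod (?T t))\<^sup>2)" using sT by (simp add: square_integrable_def)
      have 2: "AE t in lebesgue. (\<lambda>n. ?s n t) \<longlonglongrightarrow> 0"
      proof -
        have "AE t in lebesgue. t \<noteq> (0::real^'d)"
          by (rule AE_completion) (simp add: AE_lborel_singleton)
        then show ?thesis
        proof eventually_elim
          case (elim t)
          have "(\<lambda>n. r * col_sum (mat_pow C n)) \<longlonglongrightarrow> r * 0"
            by (intro tendsto_intros col_sum_tendsto_0[OF decay])
          then have "\<forall>\<^sub>F n in sequentially. r * col_sum (mat_pow C n) < norm t"
            using order_tendstoD(2)[of _ 0 sequentially "norm t"] elim by simp
          then have "\<forall>\<^sub>F n in sequentially. ?s n t = 0"
            by eventually_elim (simp add: indicator_def)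
          then show ?case by (rule tendsto_eventually)
        qed
      qed
      have 3: "AE t in lebesgue. cmod (?s n t) \<le> cmod (?T t)" for n
        by (intro AE_I2) (auto simp: indicator_def)
      have 4: "?s n \<in> borel_measurable lebesgue" for n using mT by (intro borel_measurable_times borel_measurable_indicator) auto
      show "(\<lambda>n. L2n (\<lambda>t. ?s n t - 0)) \<longlonglongrightarrow> 0"
        by (rule L2_dominated_convergence(3)[OF _ 4 1 2 3]) simp
      show "square_integrable (?s n)" for n
        by (rule L2_dominated_convergence(2)[OF _ 4 1 2 3]) simp
    qed
    have eq: "cf (?f n) l = L2_inner (?f n) (?s n)" for n
      unfolding cf_def L2_inner_def
    proof (rule Bochner_Integration.integral_cong[OF refl])
      fix t show "?f n t * cnj (?T t) = ?f n t * cnj (?s n t)"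
        using supp[of n t] by (cases "norm t > r * col_sum (mat_pow C n)") (auto simp: indicator_def)
    qed
    show ?thesis
    proof (rule Lim_null_comparison)
      have "cmod (cf (?f n) l) \<le> L2n f * L2n (\<lambda>t. ?s n t - 0)" for n
        unfolding eq using Cauchy_Schwarz_L2_inner[OF sf, of "?s n" n] dc
          L2_norm_sq_dil_pow[OF detB Cc_square_integrable[OF f], of "int n"]
        by (simp add: L2n_def)
      then show "\<forall>\<^sub>F n in sequentially. norm (cf (?f n) l) \<le> L2n f * L2n (\<lambda>t. ?s n t - 0)" by simp
      show "(\<lambda>n. L2n f * L2n (\<lambda>t. ?s n t - 0)) \<longlonglongrightarrow> 0"
        using tendsto_mult_right_zero[OF conjunct1[OF dc]] by simp
    qed
  qed
  have "(\<lambda>n. \<Sum>l\<in>Zb (R + r * D). (cmod (cf (?f n) l))\<^sup>2) \<longlonglongrightarrow> (\<Sum>l\<in>Zb (R + r * D). (cmod 0)\<^sup>2)"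
    by (intro tendsto_sum tendsto_power tendsto_norm lim)
  moreover have "Ec (?f n) = (\<Sum>l\<in>Zb (R + r * D). (cmod (cf (?f n) l))\<^sup>2)" for n
    by (rule Ec_eq_sum) (rule supp')
  ultimately show ?thesis by simp
qed

end

lemma sum_telescope_int:
  fixes e :: "int \<Rightarrow> real"
  assumes "i \<le> j"
  shows "(\<Sum>n\<in>{i..<j}. e (n + 1) - e n) = e j - e i"
  using assms
proof (induction j rule: int_ge_induct)
  case (step j)
  have "{i..<j + 1} = insert j {i..<j}" using step by auto
  then show ?case using step by simp
qed simp

section \<open>Telescoping over the levels and the Parseval identity\<close>

context refinable_pair
begin

lemma Ec_nonneg: "0 \<le> Ec f"
  unfolding Ec_def by (rule infsum_nonneg) simp

lemma sum_cf_le_Ec: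
  assumes "Cc f" "finite K" "K \<subseteq> Zd"
  shows "(\<Sum>l\<in>K. (cmod (cf f l))\<^sup>2) \<le> Ec f"
proof -
  obtain r where r: "\<And>x. norm x > r \<Longrightarrow> f x = 0" using assms(1) by (auto simp: Cc_def)
  have "(\<Sum>l\<in>K. (cmod (cf f l))\<^sup>2) \<le> (\<Sum>l\<in>Zb (R + r) \<union> K. (cmod (cf f l))\<^sup>2)"
    using assms(2) Zb(1) by (intro sum_mono2) auto
  also have "\<dots> = Ec f"
    unfolding Ec_def
    by (rule infsum_finite_support[symmetric]) (use assms Zb cf_eq_0[where f=f and r=r, OF r] in auto)
  finally show ?thesis .
qed

lemma Ed_eq_sum:
  assumes "Cc f"
  obtains K where "finite K" "K \<subseteq> Zd" "Ed f = (\<Sum>l\<in>K. (cmod (df f l))\<^sup>2)"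
    "\<And>F. finite F \<Longrightarrow> F \<subseteq> Zd \<Longrightarrow> (\<Sum>l\<in>F. (cmod (df f l))\<^sup>2) \<le> Ed f"
proof -
  obtain K where K: "finite K" "K \<subseteq> Zd" "\<forall>l\<in>Zd - K. df f l = 0" using energy_step(2)[OF assms] by blast
  have e: "Ed f = (\<Sum>l\<in>K'. (cmod (df f l))\<^sup>2)" if "finite K'" "K' \<subseteq> Zd" "K \<subseteq> K'" for K'
    unfolding Ed_def by (rule infsum_finite_support) (use that K(3) in auto)
  have "(\<Sum>l\<in>F. (cmod (df f l))\<^sup>2) \<le> Ed f" if "finite F" "F \<subseteq> Zd" for F
    unfolding e[of "K \<union> F", OF finite_UnI[OF K(1) that(1)] Un_least[OF K(2) that(2)] Un_upper1]
    using that K by (intro sum_mono2) auto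
  then show thesis using that[of K] K e[of K] by blast
qed

text \<open>The energy of f against the level-n translates of phi, with the dilation moved onto f by
  unitarity.\<close>

definition en :: "(real^'d \<Rightarrow> complex) \<Rightarrow> int \<Rightarrow> real" where "en f n = Ec (dil_pow B (- n) f)"

lemma en_Suc: "Cc f \<Longrightarrow> en f (n + 1) = en f n + Ed (dil_pow B (- n) f)"
  unfolding en_def dil_pow_uminus_Suc[OF dB] by (rule energy_step(1)[OF Cc_dil_pow[OF detB]])

lemma Ed_nonneg: "0 \<le> Ed f"
  unfolding Ed_def by (rule infsum_nonneg) simp

lemma en_mono:
  assumes "Cc f" "i \<le> j"
  shows "en f i \<le> en f j"
  using assms(2)
proof (induction j rule: int_ge_induct)
  case (step j)
  then show ?case using en_Suc[OF assms(1), of j] Ed_nonneg[of "dil_pow B (- j) f"] by linarith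
qed simp

text \<open>The energies are nondecreasing in the level, so each lies below their limit from
  \<open>energy_limit_fine\<close>.\<close>

lemma en_le:
  assumes "Cc f"
  shows "en f n \<le> L2_norm_sq f"
proof (rule LIMSEQ_le_const)
  show "(\<lambda>k. en f (int k)) \<longlonglongrightarrow> L2_norm_sq f" unfolding en_def by (rule energy_limit_fine[OF assms])
  show "\<exists>N. \<forall>k\<ge>N. en f n \<le> en f (int k)"
    by (rule exI[of _ "nat n"]) (auto intro: en_mono[OF assms])
qed

lemma Bessel_phi:
  assumes K: "finite K" "K \<subseteq> Zd" and f: "square_integrable f"
  shows "(\<Sum>l\<in>K. (cmod (L2_inner f (dil_pow B n (transl l phi))))\<^sup>2) \<le> L2_norm_sq f"
proof (rule Bessel_extend[OF _ K(1) _ f])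
  note st = square_integrable_transl[OF phi]
  show "square_integrable (dil_pow B n (transl l phi))" for l
    by (rule square_integrable_dil_pow[OF detB st])
  fix u :: "real^'d \<Rightarrow> complex" assume u: "Cc u"
  have "(\<Sum>l\<in>K. (cmod (L2_inner u (dil_pow B n (transl l phi))))\<^sup>2) = (\<Sum>l\<in>K. (cmod (cf (dil_pow B (- n) u) l))\<^sup>2)"
    unfolding cf_def using L2_inner_dil_pow[OF detB Cc_square_integrable[OF u] st] by simp
  also have "\<dots> \<le> en u n" unfolding en_def by (rule sum_cf_le_Ec[OF Cc_dil_pow[OF detB u] K])
  also have "\<dots> \<le> L2_norm_sq u" by (rule en_le[OF u])
  finally show "(\<Sum>l\<in>K. (cmod (L2_inner u (dil_pow B n (transl l phi))))\<^sup>2) \<le> L2_norm_sq u" .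
qed

text \<open>For test functions the energies of psi over the levels from -N to N - 1 telescope to
  \<open>en u N - en u (- N)\<close>. This is at most the squared norm of u, and close to it for
  large N by the two limits; \<open>Parseval_extend\<close> does the rest.\<close>

theorem parseval_psi: "parseval_frame_wavelet B psi"
  unfolding parseval_frame_wavelet_def
proof (intro conjI allI impI)
  show "square_integrable psi" by (rule psi)
  fix f assume f: "square_integrable (f :: real^'d \<Rightarrow> complex)"
  let ?e = "\<lambda>(n::int, l). dil_pow B n (transl l psi)"
  note st = square_integrable_transl[OF psi]
  have inner: "L2_inner u (?e (n, l)) = df (dil_pow B (- n) u) l" if "Cc u" for u n l
    unfolding df_def using L2_inner_dil_pow[OF detB Cc_square_integrable[OF that] st] by simp
  have "((\<lambda>i. (cmod (L2_inner f (?e i)))\<^sup>2) has_sum L2_norm_sq f) (UNIV \<times> Zd)"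
  proof (rule Parseval_extend[OF _ _ _ f])
    show "square_integrable (?e i)" for i
      by (cases i) (simp add: square_integrable_dil_pow[OF detB st])
  next
    fix u :: "real^'d \<Rightarrow> complex" and F :: "(int \<times> (real^'d)) set"
    assume u: "Cc u" and F: "finite F" "F \<subseteq> UNIV \<times> Zd"
    obtain N :: nat where N: "\<forall>n\<in>fst ` F. \<bar>n\<bar> < int N"
    proof -
      have "finite ((\<lambda>n. nat \<bar>n\<bar>) ` fst ` F)" using F(1) by simp
      then obtain M where "\<forall>k\<in>(\<lambda>n. nat \<bar>n\<bar>) ` fst ` F. k \<le> M" using finite_nat_set_iff_bounded_le by blast
      then have "\<forall>n\<in>fst ` F. \<bar>n\<bar> < int (Suc M)" by force
      then show thesis by (rule that)
    qed
    \<comment> \<open>Half-open, so that the telescoped difference ends exactly at the levels N and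
      -N. A finite index set lies in one such block of levels times its finite set of
      translations.\<close>
    let ?I = "{- int N..<int N}"
    have sub: "F \<subseteq> ?I \<times> snd ` F"
    proof
      fix x assume x: "x \<in> F"
      then have "\<bar>fst x\<bar> < int N" using N by blast
      then show "x \<in> ?I \<times> snd ` F" using x by (cases x) (auto simp: image_iff, force)
    qed
    have sF: "finite (snd ` F)" "snd ` F \<subseteq> Zd" using F by auto
    have "(\<Sum>i\<in>F. (cmod (L2_inner u (?e i)))\<^sup>2) \<le> (\<Sum>i\<in>?I \<times> snd ` F. (cmod (L2_inner u (?e i)))\<^sup>2)"
      using sF sub by (intro sum_mono2) auto
    also have "\<dots> = (\<Sum>n\<in>?I. \<Sum>l\<in>snd ` F. (cmod (df (dil_pow B (- n) u) l))\<^sup>2)"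
      unfolding sum.cartesian_product inner[OF u, symmetric] by (simp add: case_prod_unfold)
    also have "\<dots> \<le> (\<Sum>n\<in>?I. Ed (dil_pow B (- n) u))"
    proof (rule sum_mono)
      fix n
      show "(\<Sum>l\<in>snd ` F. (cmod (df (dil_pow B (- n) u) l))\<^sup>2) \<le> Ed (dil_pow B (- n) u)"
        using Ed_eq_sum[OF Cc_dil_pow[OF detB u, of "- n"]] sF by metis
    qed
    also have "\<dots> = (\<Sum>n\<in>?I. en u (n + 1) - en u n)" using en_Suc[OF u] by simp
    also have "\<dots> = en u (int N) - en u (- int N)" by (rule sum_telescope_int) simp
    also have "\<dots> \<le> L2_norm_sq u" using en_le[OF u, of "int N"] Ec_nonneg[of "dil_pow B (- (- int N)) u"]
      unfolding en_def by linarith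
    finally show "(\<Sum>i\<in>F. (cmod (L2_inner u (?e i)))\<^sup>2) \<le> L2_norm_sq u" .
  next
    fix u :: "real^'d \<Rightarrow> complex" and \<epsilon> :: real
    assume u: "Cc u" and eps: "\<epsilon> > 0"
    have 1: "\<forall>\<^sub>F n in sequentially. en u (int n) > L2_norm_sq u - \<epsilon> / 2"
      using order_tendstoD(1)[OF energy_limit_fine[OF u], of "L2_norm_sq u - \<epsilon> / 2"] eps by (simp add: en_def)
    have 2: "\<forall>\<^sub>F n in sequentially. en u (- int n) < \<epsilon> / 2"
      using order_tendstoD(2)[OF energy_limit_coarse[OF u], of "\<epsilon> / 2"] eps by (simp add: en_def)
    obtain N where N: "en u (int N) > L2_norm_sq u - \<epsilon> / 2" "en u (- int N) < \<epsilon> / 2"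
      using eventually_happens'[OF sequentially_bot eventually_conj[OF 1 2]] by blast
    let ?I = "{- int N..<int N}"
    have "\<exists>K. finite K \<and> K \<subseteq> Zd \<and> Ed (dil_pow B (- n) u) = (\<Sum>l\<in>K. (cmod (df (dil_pow B (- n) u) l))\<^sup>2)" for n
      by (rule Ed_eq_sum[OF Cc_dil_pow[OF detB u, of "- n"]]) blast
    then obtain K where K: "\<And>n. finite (K n)" "\<And>n. K n \<subseteq> Zd"
      "\<And>n. Ed (dil_pow B (- n) u) = (\<Sum>l\<in>K n. (cmod (df (dil_pow B (- n) u) l))\<^sup>2)" by metis
    have "(\<Sum>i\<in>Sigma ?I K. (cmod (L2_inner u (?e i)))\<^sup>2) = (\<Sum>n\<in>?I. \<Sum>l\<in>K n. (cmod (df (dil_pow B (- n) u) l))\<^sup>2)"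
      using K(1) by (subst sum.Sigma) (auto simp: inner[OF u, symmetric] case_prod_unfold)
    also have "\<dots> = (\<Sum>n\<in>?I. en u (n + 1) - en u n)" using en_Suc[OF u] K(3) by simp
    also have "\<dots> = en u (int N) - en u (- int N)" by (rule sum_telescope_int) simp
    finally have "L2_norm_sq u - \<epsilon> \<le> (\<Sum>i\<in>Sigma ?I K. (cmod (L2_inner u (?e i)))\<^sup>2)" using N by linarith
    moreover have "finite (Sigma ?I K)" "Sigma ?I K \<subseteq> UNIV \<times> Zd" using K(1,2) by auto
    ultimately show "\<exists>F. finite F \<and> F \<subseteq> UNIV \<times> Zd \<and> L2_norm_sq u - \<epsilon> \<le> (\<Sum>i\<in>F. (cmod (L2_inner u (?e i)))\<^sup>2)"
      by blast
  qed
  then show "((\<lambda>(n::int, l). (cmod (L2_inner f (dil_pow B n (transl l psi))))\<^sup>2) has_sum L2_norm_sq f) (UNIV \<times> Zd)"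
    by (simp add: case_prod_unfold)
qed

section \<open>Nesting and density of the spaces V^(n)\<close>

definition V0_span :: "(real^'d \<Rightarrow> complex) set" where
  "V0_span = {(\<lambda>t. \<Sum>l\<in>F. c l * transl l phi t) | F c. finite F \<and> F \<subseteq> Zd}"

lemma V0_spanI: "finite F \<Longrightarrow> F \<subseteq> Zd \<Longrightarrow> (\<lambda>t. \<Sum>l\<in>F. c l * transl l phi t) \<in> V0_span"
  unfolding V0_span_def by (rule CollectI, rule exI[of _ F], rule exI[of _ c]) simp

lemma V0_span_square_integrable: "x \<in> V0_span \<Longrightarrow> square_integrable x"
  unfolding V0_span_def by (auto intro!: square_integrable_sum square_integrable_cmult square_integrable_transl phi)

lemma V0_span_subset: "V0_span \<subseteq> V0 phi"
proof
  fix x assume x: "x \<in> V0_span"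
  have "L2_dist_sq x x = 0" by (simp add: L2_dist_sq_def)
  then show "x \<in> V0 phi"
    using x V0_span_square_integrable[OF x] unfolding V0_def L2_closure_def V0_span_def by force
qed

text \<open>The refinement equation, translated by l and dilated back, expresses D^(-1) T_l phi by
  the translates with indices B l + n; \<open>c'\<close> collects the coefficients belonging to the
  same index. Equality holds almost everywhere, like the refinement equation itself.\<close>

lemma dil_inv_V0_span:
  assumes "x \<in> V0_span"
  obtains x' where "x' \<in> V0_span" "AE t in lebesgue. dil_inv B x t = x' t"
proof -
  from assms obtain F c where x: "x = (\<lambda>t. \<Sum>l\<in>F. c l * transl l phi t)" and F: "finite F" "F \<subseteq> Zd"
    unfolding V0_span_def by blast
  define G where "G = (\<lambda>(l, n). B *v l + n) ` (F \<times> L)"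
  have G: "finite G" "G \<subseteq> Zd" unfolding G_def using F(1) L(1)
    by (auto intro!: Zd_add B_Zd dest: subsetD[OF F(2)] subsetD[OF L(2)])
  define c' where "c' = (\<lambda>p. \<Sum>l\<in>F. c l * a (p - B *v l))"
  define x' where "x' = (\<lambda>t. \<Sum>p\<in>G. c' p * transl p phi t)"
  have re: "(\<Sum>p\<in>G. a (p - B *v l) * transl p phi t) = (\<Sum>n\<in>L. a n * transl (B *v l + n) phi t)" if "l \<in> F" for l t
  proof -
    have "(\<Sum>n\<in>L. a n * transl (B *v l + n) phi t) = (\<Sum>p\<in>(\<lambda>n. B *v l + n) ` L. a (p - B *v l) * transl p phi t)"
      by (subst sum.reindex) (auto simp: inj_on_def)
    also have "\<dots> = (\<Sum>p\<in>G. a (p - B *v l) * transl p phi t)"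
    proof (rule sum.mono_neutral_left)
      show "\<forall>p\<in>G - (\<lambda>n. B *v l + n) ` L. a (p - B *v l) * transl p phi t = 0"
      proof
        fix p assume "p \<in> G - (\<lambda>n. B *v l + n) ` L"
        then have "p - B *v l \<notin> L" by (force simp: image_iff)
        then show "a (p - B *v l) * transl p phi t = 0" using ab_L(1) by simp
      qed
      show "(\<lambda>n. B *v l + n) ` L \<subseteq> G" using that unfolding G_def by force
    qed (rule G)
    finally show ?thesis ..
  qed
  have x'_eq: "x' t = (\<Sum>l\<in>F. c l * (\<Sum>n\<in>L. a n * transl (B *v l + n) phi t))" for t
  proof -
    have "x' t = (\<Sum>p\<in>G. \<Sum>l\<in>F. c l * (a (p - B *v l) * transl p phi t))"
      unfolding x'_def c'_def by (simp add: sum_distrib_right mult.assoc)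
    also have "\<dots> = (\<Sum>l\<in>F. \<Sum>p\<in>G. c l * (a (p - B *v l) * transl p phi t))" by (rule sum.swap)
    also have "\<dots> = (\<Sum>l\<in>F. c l * (\<Sum>n\<in>L. a n * transl (B *v l + n) phi t))"
      using re by (simp add: sum_distrib_left[symmetric])
    finally show ?thesis .
  qed
  have ae1: "AE t in lebesgue. transl l phi t = (\<Sum>n\<in>L. a n * dil B (transl (B *v l + n) phi) t)" for l
    using transl_AE[OF phi_eq, of l]
    by (simp add: transl_def dil_def matrix_vector_mult_diff_distrib diff_diff_eq)
  have dC: "det C \<noteq> 0" using det_matrix_inv[OF dB] dB by simp
  have "AE t in lebesgue. transl l phi (C *v t) / complex_of_real (sqrt 2) = (\<Sum>n\<in>L. a n * transl (B *v l + n) phi t)" for l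
    using AE_affine[OF dC ae1[of l], of 0]
    by eventually_elim (simp add: dil_def matrix_inv_invertible[OF dB] sum_divide_distrib)
  then have "AE t in lebesgue. \<forall>l\<in>F. transl l phi (C *v t) / complex_of_real (sqrt 2) = (\<Sum>n\<in>L. a n * transl (B *v l + n) phi t)"
    using F(1) by (simp add: AE_finite_all)
  then have "AE t in lebesgue. dil_inv B x t = x' t"
  proof eventually_elim
    case (elim t)
    have "dil_inv B x t = (\<Sum>l\<in>F. c l * (transl l phi (C *v t) / complex_of_real (sqrt 2)))"
      unfolding dil_inv_def x by (simp add: sum_divide_distrib)
    also have "\<dots> = x' t" unfolding x'_eq using elim by simp
    finally show ?case .
  qed
  moreover have "x' \<in> V0_span" unfolding x'_def by (intro V0_spanI G)
  ultimately show thesis using that by blast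
qed

text \<open>The inverse dilation is isometric and maps the span into itself up to null sets, so
  approximations are carried over with the same error.\<close>

lemma dil_inv_V0:
  assumes "y \<in> V0 phi"
  shows "dil_inv B y \<in> V0 phi"
proof -
  from assms have y: "square_integrable y" and ex: "\<And>\<epsilon>. \<epsilon> > 0 \<Longrightarrow> \<exists>x\<in>V0_span. L2_dist_sq y x < ennreal \<epsilon>"
    unfolding V0_def L2_closure_def V0_span_def by auto
  have "\<exists>x\<in>V0_span. L2_dist_sq (dil_inv B y) x < ennreal \<epsilon>" if eps: "\<epsilon> > 0" for \<epsilon>
  proof -
    obtain x where x: "x \<in> V0_span" "L2_dist_sq y x < ennreal \<epsilon>" using ex[OF eps] by blast
    obtain x' where x': "x' \<in> V0_span" "AE t in lebesgue. dil_inv B x t = x' t" using dil_inv_V0_span[OF x(1)] by blast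
    note sx = V0_span_square_integrable[OF x(1)] and sx' = V0_span_square_integrable[OF x'(1)]
    note sd = square_integrable_diff[OF y sx]
    have "AE t in lebesgue. dil_inv B (\<lambda>t. y t - x t) t = dil_inv B y t - x' t"
      using x'(2) by eventually_elim (simp add: dil_inv_def diff_divide_distrib)
    from square_integrable_AE_cong(2)[OF square_integrable_dil_inv[OF detB sd] this]
    have "L2_norm_sq (\<lambda>t. dil_inv B y t - x' t) = L2_norm_sq (\<lambda>t. y t - x t)"
      using L2_norm_sq_dil_inv[OF detB sd] by simp
    then have "L2_dist_sq (dil_inv B y) x' = L2_dist_sq y x"
      using L2_dist_sq_eq[OF y sx] L2_dist_sq_eq[OF square_integrable_dil_inv[OF detB y] sx'] by simp
    with x(2) have "L2_dist_sq (dil_inv B y) x' < ennreal \<epsilon>" by (simp only:)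
    then show ?thesis using x'(1) by (rule bexI)
  qed
  then show ?thesis
    using square_integrable_dil_inv[OF detB y] unfolding V0_def L2_closure_def V0_span_def by simp
qed

text \<open>An element D^n y of the smaller space is D^(n+1) applied to D^(-1) y, and
  \<open>dil_inv_V0\<close> keeps D^(-1) y in the base space.\<close>

theorem Vn_nested: "Vn B n phi \<subseteq> Vn B (n + 1) phi"
proof
  fix z assume "z \<in> Vn B n phi"
  then obtain y where y: "y \<in> V0 phi" "z = dil_pow B n y" unfolding Vn_def by blast
  have "z = dil_pow B (n + 1) (dil_inv B y)"
    unfolding dil_pow_Suc'[OF dB] dil_dil_inv[OF dB] by (rule y(2))
  then show "z \<in> Vn B (n + 1) phi" unfolding Vn_def using dil_inv_V0[OF y(1)] by blast
qed

text \<open>At a fine level the energy of a test function nearly exhausts its squared norm. By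
  \<open>Bessel_approximation\<close> the missing energy bounds the squared distance from the test
  function to its finite frame sum, which lies in that level's space.\<close>

theorem Vn_dense: "L2_closure (\<Union>n::int. Vn B n phi) = {f. square_integrable f}"
proof (intro equalityI subsetI)
  fix f assume "f \<in> {f. square_integrable (f :: real^'d \<Rightarrow> complex)}"
  then have f: "square_integrable f" by simp
  have "\<exists>x\<in>(\<Union>n::int. Vn B n phi). L2_dist_sq f x < ennreal \<epsilon>" if "\<epsilon> > 0" for \<epsilon>
  proof -
    \<comment> \<open>Two errors of size \<open>\<delta>\<close> add up to
      \<open>sqrt \<epsilon>\<close>, because \<open>L2_dist_sq\<close> measures the square of the
      distance.\<close>
    define \<delta> where "\<delta> = sqrt \<epsilon> / 2"
    have d: "\<delta> > 0" "(2 * \<delta>)\<^sup>2 = \<epsilon>" using that by (auto simp: \<delta>_def)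
    obtain u where u: "Cc u" "L2n (\<lambda>x. u x - f x) < \<delta>" using Cc_dense[OF f d(1)] by blast
    note su = Cc_square_integrable[OF u(1)]
    have "\<forall>\<^sub>F n in sequentially. Ec (dil_pow B (- int n) u) > L2_norm_sq u - \<delta>\<^sup>2"
      using order_tendstoD(1)[OF energy_limit_fine[OF u(1)], of "L2_norm_sq u - \<delta>\<^sup>2"] d by simp
    then obtain N where N: "Ec (dil_pow B (- int N) u) > L2_norm_sq u - \<delta>\<^sup>2"
      using eventually_happens'[OF sequentially_bot] by blast
    obtain r where r: "\<And>x. norm x > r \<Longrightarrow> dil_pow B (- int N) u x = 0"
      using Cc_dil_pow[OF detB u(1)] by (auto simp: Cc_def)
    let ?K = "Zb (R + r)" and ?e = "\<lambda>l. dil_pow B (int N) (transl l phi)"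
    note st = square_integrable_transl[OF phi]
    have se: "square_integrable (?e l)" for l by (rule square_integrable_dil_pow[OF detB st])
    have "Ec (dil_pow B (- int N) u) = (\<Sum>l\<in>?K. (cmod (cf (dil_pow B (- int N) u) l))\<^sup>2)"
      by (rule Ec_eq_sum) (rule r)
    also have "\<dots> = (\<Sum>l\<in>?K. (cmod (L2_inner u (?e l)))\<^sup>2)"
      unfolding cf_def using L2_inner_dil_pow[OF detB su st] by simp
    finally have S: "(\<Sum>l\<in>?K. (cmod (L2_inner u (?e l)))\<^sup>2) > L2_norm_sq u - \<delta>\<^sup>2" using N by simp
    define x0 where "x0 = (\<lambda>t. \<Sum>l\<in>?K. L2_inner u (?e l) * transl l phi t)"
    define x where "x = (\<lambda>t. \<Sum>l\<in>?K. L2_inner u (?e l) * ?e l t)"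
    have "x = dil_pow B (int N) x0" unfolding x_def x0_def by (rule dil_pow_sum[OF detB, symmetric])
    moreover have "x0 \<in> V0_span" unfolding x0_def by (intro V0_spanI Zb(1,2))
    ultimately have xV: "x \<in> (\<Union>n::int. Vn B n phi)" unfolding Vn_def using V0_span_subset by blast
    have sx: "square_integrable x" unfolding x_def by (intro square_integrable_sum square_integrable_cmult se)
    have "L2_norm_sq (\<lambda>t. u t - x t) \<le> L2_norm_sq u - (\<Sum>l\<in>?K. (cmod (L2_inner u (?e l)))\<^sup>2)"
      unfolding x_def by (rule Bessel_approximation[OF se Zb(1) Bessel_phi[OF Zb(1,2)] su])
    then have "(L2n (\<lambda>t. u t - x t))\<^sup>2 < \<delta>\<^sup>2" using S by simp
    then have "L2n (\<lambda>t. u t - x t) < \<delta>" using d(1) by (intro power_less_imp_less_base[of _ 2 \<delta>]) auto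
    then have "L2n (\<lambda>t. f t - x t) < 2 * \<delta>"
      using L2n_triangle_diff[OF f su sx] u(2) L2n_minus_commute[of f u] by linarith
    then have "(L2n (\<lambda>t. f t - x t))\<^sup>2 < (2 * \<delta>)\<^sup>2" by (intro power_strict_mono) auto
    then have "L2_dist_sq f x < ennreal \<epsilon>"
      unfolding L2_dist_sq_eq[OF f sx] d(2) using that by (simp add: ennreal_less_iff)
    then show ?thesis using xV by blast
  qed
  then show "f \<in> L2_closure (\<Union>n::int. Vn B n phi)" using f unfolding L2_closure_def by simp
qed (simp add: L2_closure_def)

end

section \<open>Gaussian integrals\<close>

lemma
  fixes f :: "'d::finite \<Rightarrow> real \<Rightarrow> complex"
  assumes f: "\<And>i. integrable lborel (f i)"
  shows integrable_prod_vec: "integrable lborel (\<lambda>x::real^'d. \<Prod>i\<in>UNIV. f i (x $ i))"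
    and integral_prod_vec: "(LINT x|lborel. (\<Prod>i\<in>UNIV. f i ((x::real^'d) $ i))) = (\<Prod>i\<in>UNIV. (LINT x|lborel. f i x))"
proof -
  interpret product_sigma_finite "\<lambda>_::real^'d. lborel :: real measure" by standard
  \<comment> \<open>Lebesgue measure is a product over the basis vectors, whereas the factors are
    indexed by coordinates; \<open>idx\<close> recovers the coordinate of a basis vector.\<close>
  define idx where "idx = (\<lambda>b::real^'d. THE i. b = axis i 1)"
  have idx: "idx (axis i 1) = i" for i
    unfolding idx_def by (rule the_equality) (auto simp: axis_eq_axis)
  have B: "(Basis :: (real^'d) set) = range (\<lambda>i. axis i 1)" by (auto simp: Basis_vec_def)
  have inj: "inj (\<lambda>i::'d. axis i (1::real))" by (auto simp: inj_def axis_eq_axis)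
  let ?T = "\<lambda>y. \<Sum>b\<in>(Basis :: (real^'d) set). y b *\<^sub>R b"
  have T: "?T y $ i = y (axis i 1)" for y i
  proof -
    have "?T y $ i = (\<Sum>j\<in>UNIV. (y (axis j 1) *\<^sub>R axis j 1) $ i)"
      unfolding B by (subst sum.reindex[OF inj]) (simp add: o_def)
    also have "\<dots> = (\<Sum>j\<in>UNIV. if j = i then y (axis j 1) else 0)"
      by (intro sum.cong) (auto simp: axis_def)
    finally show ?thesis by simp
  qed
  have e: "(\<Prod>i\<in>UNIV. f i (?T y $ i)) = (\<Prod>b\<in>Basis. f (idx b) (y b))" for y
    unfolding T unfolding B by (subst prod.reindex[OF inj]) (simp add: o_def idx)
  have [measurable]: "f i \<in> borel_measurable borel" for i using f[of i] by auto
  have pm: "(\<lambda>x::real^'d. \<Prod>i\<in>UNIV. f i (x $ i)) \<in> borel_measurable borel" by measurable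
  have Tm: "?T \<in> measurable (Pi\<^sub>M Basis (\<lambda>_. lborel)) borel" by measurable
  have "integrable (Pi\<^sub>M Basis (\<lambda>_. lborel)) (\<lambda>y. \<Prod>b\<in>(Basis::(real^'d) set). f (idx b) (y b))"
    by (rule product_integrable_prod) (use f in auto)
  then show "integrable lborel (\<lambda>x::real^'d. \<Prod>i\<in>UNIV. f i (x $ i))"
    by (subst lborel_eq) (simp only: integrable_distr_eq[OF Tm pm] e)
  have "(LINT x|lborel. (\<Prod>i\<in>UNIV. f i ((x::real^'d) $ i))) =
      (LINT y|Pi\<^sub>M Basis (\<lambda>_. lborel). (\<Prod>b\<in>(Basis::(real^'d) set). f (idx b) (y b)))"
    by (subst lborel_eq) (simp only: integral_distr[OF Tm pm] e)
  also have "\<dots> = (\<Prod>b\<in>(Basis::(real^'d) set). (LINT x|lborel. f (idx b) x))"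
    by (rule product_integral_prod) (use f in auto)
  also have "\<dots> = (\<Prod>i\<in>UNIV. (LINT x|lborel. f i x))"
    unfolding B by (subst prod.reindex[OF inj]) (simp add: o_def idx)
  finally show "(LINT x|lborel. (\<Prod>i\<in>UNIV. f i ((x::real^'d) $ i))) = (\<Prod>i\<in>UNIV. (LINT x|lborel. f i x))" .
qed

text \<open>The substitution y = r x reduces both claims to the characteristic function of the
  standard normal distribution.\<close>

lemma
  assumes r: "r > 0"
  shows integrable_gauss_1d: "integrable lborel (\<lambda>x. iexp (t * x) * complex_of_real (exp (- (r * x)\<^sup>2 / 2)))"
    and integral_gauss_1d: "(LINT x|lborel. iexp (t * x) * complex_of_real (exp (- (r * x)\<^sup>2 / 2)))
       = complex_of_real (sqrt (2 * pi) / r * exp (- (t / r)\<^sup>2 / 2))"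
proof -
  define f where "f = (\<lambda>y. std_normal_density y *\<^sub>R iexp (t / r * y))"
  have nd: "integrable lborel std_normal_density"
    using integrable_std_normal_moment[of 0] by simp
  have fi: "integrable lborel f"
    unfolding f_def by (rule Bochner_Integration.integrable_bound[OF nd]) (auto simp: normal_density_nonneg)
  have "(LINT y|lborel. f y) = (CLINT y|std_normal_distribution. iexp (t / r * y))"
    unfolding f_def by (subst integral_density) (auto simp: normal_density_nonneg)
  also have "\<dots> = complex_of_real (exp (- (t / r)\<^sup>2 / 2))"
    using fun_cong[OF char_std_normal_distribution, of "t / r"] by (simp add: char_def)
  finally have 1: "(LINT y|lborel. f y) = complex_of_real (exp (- (t / r)\<^sup>2 / 2))" .
  have fr: "iexp (t * x) * complex_of_real (exp (- (r * x)\<^sup>2 / 2)) = complex_of_real (sqrt (2 * pi)) * f (0 + r * x)" for x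
    using r by (simp add: f_def std_normal_density_def scaleR_conv_of_real)
  have i: "integrable lborel (\<lambda>x. f (0 + r * x))"
    using lborel_integrable_real_affine_iff[of r f 0] r fi by simp
  show "integrable lborel (\<lambda>x. iexp (t * x) * complex_of_real (exp (- (r * x)\<^sup>2 / 2)))"
    unfolding fr using i by (intro integrable_mult_right)
  have "(LINT y|lborel. f y) = r *\<^sub>R (LINT x|lborel. f (0 + r * x))"
    using lborel_integral_real_affine[of r f 0] r by simp
  then have "(LINT x|lborel. f (0 + r * x)) = complex_of_real (exp (- (t / r)\<^sup>2 / 2) / r)"
    unfolding 1 using r by (simp add: scaleR_conv_of_real field_simps)
  then show "(LINT x|lborel. iexp (t * x) * complex_of_real (exp (- (r * x)\<^sup>2 / 2)))
       = complex_of_real (sqrt (2 * pi) / r * exp (- (t / r)\<^sup>2 / 2))"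
    unfolding fr by simp
qed

text \<open>The parameter r is the reciprocal of the standard deviation, and the value at 0 is 1. Up
  to a constant the Fourier transform exchanges r and 1 / r.\<close>

definition gauss :: "real \<Rightarrow> real^'d::finite \<Rightarrow> real" where
  "gauss r s = exp (- (r * norm s)\<^sup>2 / 2)"

lemma gauss_pos: "gauss r s > 0" and gauss_le_1: "gauss r s \<le> 1"
  by (simp_all add: gauss_def)

lemma continuous_gauss: "continuous_on UNIV (gauss r)"
  unfolding gauss_def by (intro continuous_intros) auto

lemma measurable_gauss [measurable]: "gauss r \<in> borel_measurable borel"
  by (rule borel_measurable_continuous_onI[OF continuous_gauss])

lemma gauss_prod: "gauss r s = (\<Prod>i\<in>UNIV. exp (- (r * s $ i)\<^sup>2 / 2))"
proof -
  have "(norm s)\<^sup>2 = (\<Sum>i\<in>UNIV. (s $ i)\<^sup>2)"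
    unfolding power2_norm_eq_inner inner_vec_def by (simp add: power2_eq_square)
  then have "- (r * norm s)\<^sup>2 / 2 = (\<Sum>i\<in>UNIV. - (r * s $ i)\<^sup>2 / 2)"
    by (simp add: power_mult_distrib sum_distrib_left sum_negf sum_divide_distrib)
  then show ?thesis unfolding gauss_def by (simp add: exp_sum)
qed

lemma iexp_inner_prod: "iexp (s \<bullet> t) = (\<Prod>i\<in>UNIV. iexp (t $ i * s $ i))" for s t :: "real^'d::finite"
proof -
  have "\<i> * complex_of_real (s \<bullet> t) = (\<Sum>i\<in>UNIV. \<i> * complex_of_real (t $ i * s $ i))"
    by (simp add: inner_vec_def sum_distrib_left mult_ac)
  then show ?thesis by (simp only: exp_sum finite)
qed

lemma
  fixes t :: "real^'d::finite"
  assumes r: "r > 0"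
  shows integrable_gauss: "integrable lborel (\<lambda>s. iexp (s \<bullet> t) * complex_of_real (gauss r s))"
    and integral_gauss: "(LINT s|lborel. iexp (s \<bullet> t) * complex_of_real (gauss r s))
       = complex_of_real ((sqrt (2 * pi) / r) ^ CARD('d) * gauss (1 / r) t)"
proof -
  let ?f = "\<lambda>i x. iexp (t $ i * x) * complex_of_real (exp (- (r * x)\<^sup>2 / 2))"
  have e: "iexp (s \<bullet> t) * complex_of_real (gauss r s) = (\<Prod>i\<in>UNIV. ?f i (s $ i))" for s
    unfolding iexp_inner_prod gauss_prod by (simp add: prod.distrib)
  show "integrable lborel (\<lambda>s. iexp (s \<bullet> t) * complex_of_real (gauss r s))"
    unfolding e by (rule integrable_prod_vec) (rule integrable_gauss_1d[OF r])
  have "(LINT s|lborel. iexp (s \<bullet> t) * complex_of_real (gauss r s)) = (\<Prod>i\<in>UNIV. (LINT x|lborel. ?f i x))"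
    unfolding e by (rule integral_prod_vec) (rule integrable_gauss_1d[OF r])
  also have "\<dots> = (\<Prod>i\<in>UNIV. complex_of_real (sqrt (2 * pi) / r * exp (- (t $ i / r)\<^sup>2 / 2)))"
    unfolding integral_gauss_1d[OF r] ..
  also have "\<dots> = complex_of_real ((sqrt (2 * pi) / r) ^ CARD('d) * gauss (1 / r) t)"
  proof -
    have "(sqrt (2 * pi) / r) ^ CARD('d) * gauss (1 / r) t = (\<Prod>i\<in>UNIV. sqrt (2 * pi) / r * exp (- (t $ i / r)\<^sup>2 / 2))"
      unfolding gauss_prod prod.distrib by simp
    then show ?thesis by (simp only: of_real_prod)
  qed
  finally show "(LINT s|lborel. iexp (s \<bullet> t) * complex_of_real (gauss r s))
       = complex_of_real ((sqrt (2 * pi) / r) ^ CARD('d) * gauss (1 / r) t)" .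
qed

lemma
  assumes r: "r > 0"
  shows integrable_gauss_real: "integrable lborel (gauss r :: real^'d::finite \<Rightarrow> real)"
    and integral_gauss_real: "(LINT s|lborel. gauss r (s::real^'d)) = (sqrt (2 * pi) / r) ^ CARD('d)"
proof -
  have i: "integrable lborel (\<lambda>s::real^'d. complex_of_real (gauss r s))"
    using integrable_gauss[OF r, of "0::real^'d"] by simp
  then show "integrable lborel (gauss r :: real^'d \<Rightarrow> real)"
    using complex_of_real_integrable_eq by blast
  have "complex_of_real (LINT s|lborel. gauss r (s::real^'d)) = complex_of_real ((sqrt (2 * pi) / r) ^ CARD('d))"
    using integral_gauss[OF r, of "0::real^'d"] by (simp add: gauss_def)
  then show "(LINT s|lborel. gauss r (s::real^'d)) = (sqrt (2 * pi) / r) ^ CARD('d)"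
    by (simp only: of_real_eq_iff)
qed

section \<open>The Plancherel inequality\<close>

text \<open>The form of Fubini's theorem used for exponential kernels: with a kernel bounded by 1,
  the product of f and w is an integrable majorant.\<close>

lemma Fubini_bounded_kernel:
  fixes f w :: "real^'d::finite \<Rightarrow> complex" and k :: "real^'d \<Rightarrow> real^'d \<Rightarrow> complex"
  assumes f: "integrable lborel f" and w: "integrable lborel w"
    and k [measurable]: "(\<lambda>(s, t). k s t) \<in> borel_measurable (borel \<Otimes>\<^sub>M borel)" and k1: "\<And>s t. cmod (k s t) \<le> 1"
  shows "(LINT t|lborel. (LINT s|lborel. k s t * f s) * w t) = (LINT s|lborel. f s * (LINT t|lborel. k s t * w t))"
proof -
  have [measurable]: "f \<in> borel_measurable borel" "w \<in> borel_measurable borel" using f w by auto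
  have ks [measurable]: "k s \<in> borel_measurable borel" for s using measurable_Pair2[OF k, of s] by simp
  have iw: "integrable lborel (\<lambda>t. k s t * w t)" for s
    by (rule Bochner_Integration.integrable_bound[OF w])
       (auto simp: norm_mult intro!: AE_I2 mult_left_le_one_le k1)
  have "integrable (lborel \<Otimes>\<^sub>M lborel) (\<lambda>(s, t). k s t * f s * w t)"
  proof (rule lborel_pair.Fubini_integrable)
    show "(\<lambda>(s, t). k s t * f s * w t) \<in> borel_measurable (lborel \<Otimes>\<^sub>M lborel)" by measurable
    show "integrable lborel (\<lambda>s. LINT t|lborel. norm (case (s, t) of (s, t) \<Rightarrow> k s t * f s * w t))"
    proof (rule Bochner_Integration.integrable_bound[OF integrable_mult_right[OF f, of "LINT t|lborel. cmod (w t)"]])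
      show "(\<lambda>s. LINT t|lborel. norm (case (s, t) of (s, t) \<Rightarrow> k s t * f s * w t)) \<in> borel_measurable lborel" by measurable
      have "(LINT t|lborel. cmod (k s t * f s * w t)) \<le> (LINT t|lborel. cmod (f s) * cmod (w t))" for s
      proof (rule integral_mono)
        show "integrable lborel (\<lambda>t. cmod (k s t * f s * w t))"
          using integrable_norm[OF integrable_mult_right[OF iw[of s], of "f s"]] by (simp add: norm_mult mult_ac)
        show "integrable lborel (\<lambda>t. cmod (f s) * cmod (w t))" using w by simp
        show "cmod (k s t * f s * w t) \<le> cmod (f s) * cmod (w t)" for t
          using mult_right_mono[OF k1[of s t], of "cmod (f s) * cmod (w t)"] by (simp add: norm_mult mult.assoc)
      qed
      then show "AE s in lborel. norm (LINT t|lborel. norm (case (s, t) of (s, t) \<Rightarrow> k s t * f s * w t))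
          \<le> norm (complex_of_real (LINT t|lborel. cmod (w t)) * f s)"
        by (intro AE_I2) (simp add: norm_mult mult.commute)
    qed
    show "AE s in lborel. integrable lborel (\<lambda>t. case (s, t) of (s, t) \<Rightarrow> k s t * f s * w t)"
      using integrable_mult_right[OF iw] by (intro AE_I2) (simp add: mult_ac)
  qed
  from lborel_pair.Fubini_integral[OF this]
  have "(LINT t|lborel. LINT s|lborel. k s t * f s * w t) = (LINT s|lborel. LINT t|lborel. k s t * f s * w t)" by simp
  moreover have "(LINT s|lborel. k s t * f s * w t) = (LINT s|lborel. k s t * f s) * w t" for t by simp
  moreover have "(LINT t|lborel. k s t * f s * w t) = f s * (LINT t|lborel. k s t * w t)" for s
    by (simp add: mult_ac flip: integral_mult_right_zero)
  ultimately show ?thesis by simp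
qed

lemma measurable_iexp_inner [measurable]:
  "(\<lambda>(s::real^'d::finite, t). iexp (s \<bullet> t)) \<in> borel_measurable (borel \<Otimes>\<^sub>M borel)"
  "(\<lambda>(s::real^'d::finite, t). iexp (- (s \<bullet> t))) \<in> borel_measurable (borel \<Otimes>\<^sub>M borel)"
  by measurable

text \<open>The inverse Fourier integral without its constant, taken over \<open>lborel\<close> so
  that joint measurability is at hand for Fubini's theorem.\<close>

definition fint :: "(real^'d::finite \<Rightarrow> complex) \<Rightarrow> real^'d \<Rightarrow> complex" where
  "fint f t = (LINT s|lborel. iexp (s \<bullet> t) * f s)"

lemma measurable_fint [measurable]:
  assumes [measurable]: "f \<in> borel_measurable borel"
  shows "fint f \<in> borel_measurable borel"
  unfolding fint_def by measurable

lemma integrable_iexp_mult: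
  assumes "integrable lborel f"
  shows "integrable lborel (\<lambda>s::real^'d::finite. iexp (s \<bullet> t) * f s)" "integrable lborel (\<lambda>s. iexp (- (s \<bullet> t)) * f s)"
proof -
  have [measurable]: "f \<in> borel_measurable borel" using assms by auto
  show "integrable lborel (\<lambda>s::real^'d. iexp (s \<bullet> t) * f s)" "integrable lborel (\<lambda>s. iexp (- (s \<bullet> t)) * f s)"
    by (rule Bochner_Integration.integrable_bound[OF assms]; simp add: norm_mult)+
qed

lemma fint_bound:
  assumes "integrable lborel f"
  shows "cmod (fint f t) \<le> (LINT s|lborel. cmod (f s))"
proof -
  have "cmod (fint f t) \<le> (LINT s|lborel. cmod (iexp (s \<bullet> t) * f s))"
    unfolding fint_def by (rule integral_norm_bound)
  then show ?thesis by (simp add: norm_mult)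
qed

lemma norm_integral_le_nn_integral:
  fixes f :: "_ \<Rightarrow> 'b::{banach,second_countable_topology}"
  shows "ennreal (norm (integral\<^sup>L M f)) \<le> (\<integral>\<^sup>+ x. ennreal (norm (f x)) \<partial>M)"
  by (cases "integrable M f") (simp_all add: integral_norm_bound_ennreal not_integrable_integral_eq)

text \<open>The Fourier transform of \<open>gauss r\<close>: a heat kernel whose total mass is the
  d-th power of 2 pi for every r.\<close>

definition heat :: "real \<Rightarrow> real^'d::finite \<Rightarrow> real" where
  "heat r x = (sqrt (2 * pi) / r) ^ CARD('d) * gauss (1 / r) x"

lemma measurable_heat [measurable]: "heat r \<in> borel_measurable borel"
  unfolding heat_def by measurable

lemma heat_nonneg: "r > 0 \<Longrightarrow> heat r x \<ge> 0"
  using gauss_pos[of "1/r" x] by (simp add: heat_def less_imp_le)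

lemma integral_gauss_modulated:
  fixes s s' :: "real^'d::finite"
  assumes r: "r > 0"
  shows "(LINT t|lborel. iexp (- (s' \<bullet> t)) * (iexp (s \<bullet> t) * complex_of_real (gauss r t))) = complex_of_real (heat r (s - s'))"
proof -
  have e: "iexp (- (s' \<bullet> t)) * iexp (s \<bullet> t) = iexp (t \<bullet> (s - s'))" for t
  proof -
    have "\<i> * complex_of_real (- (s' \<bullet> t)) + \<i> * complex_of_real (s \<bullet> t) = \<i> * complex_of_real (t \<bullet> (s - s'))"
      by (simp add: inner_diff_right inner_commute[of t] distrib_left[symmetric] right_diff_distrib)
    then show ?thesis by (simp only: exp_add[symmetric])
  qed
  show ?thesis
    unfolding mult.assoc[symmetric] e integral_gauss[OF r] heat_def ..
qed

lemma nn_integral_heat: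
  fixes s :: "real^'d::finite"
  assumes r: "r > 0"
  shows "(\<integral>\<^sup>+ s'. ennreal (heat r (s - s')) \<partial>lborel) = ennreal ((2 * pi) ^ CARD('d))"
    "(\<integral>\<^sup>+ s'. ennreal (heat r (s' - s)) \<partial>lborel) = ennreal ((2 * pi) ^ CARD('d))"
proof -
  have i: "integrable lborel (heat r :: real^'d \<Rightarrow> real)"
    unfolding heat_def using integrable_gauss_real[of "1/r"] r by (intro integrable_mult_right) auto
  have "(LINT s'|lborel. heat r (s' :: real^'d)) = (sqrt (2 * pi) / r) ^ CARD('d) * (sqrt (2 * pi) / (1 / r)) ^ CARD('d)"
    unfolding heat_def using integral_gauss_real[of "1/r", where 'd='d] r by simp
  also have "\<dots> = (2 * pi) ^ CARD('d)"
    using r unfolding power_mult_distrib[symmetric] by simp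
  finally have v: "(LINT s'|lborel. heat r (s' :: real^'d)) = (2 * pi) ^ CARD('d)" .
  have n: "(\<integral>\<^sup>+ s'. ennreal (heat r (s' :: real^'d)) \<partial>lborel) = ennreal ((2 * pi) ^ CARD('d))"
    unfolding v[symmetric] by (rule nn_integral_eq_integral[OF i]) (use heat_nonneg[OF r] in auto)
  have "(\<integral>\<^sup>+ s'. ennreal (heat r (s' - s)) \<partial>lborel) = (\<integral>\<^sup>+ s'. ennreal (heat r s') \<partial>distr lborel borel ((+) (- s)))"
    by (subst nn_integral_distr) auto
  then show 1: "(\<integral>\<^sup>+ s'. ennreal (heat r (s' - s)) \<partial>lborel) = ennreal ((2 * pi) ^ CARD('d))"
    unfolding lborel_distr_plus n .
  have "heat r (s - s') = heat r (s' - s)" for s' by (simp add: heat_def gauss_def norm_minus_commute)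
  with 1 show "(\<integral>\<^sup>+ s'. ennreal (heat r (s - s')) \<partial>lborel) = ennreal ((2 * pi) ^ CARD('d))" by simp
qed

text \<open>Schur's test: the product of two moduli is at most half the sum of their squares, and
  integrating the kernel in the other variable gives a mass that does not depend on r.\<close>

lemma Schur_heat:
  fixes f :: "real^'d::finite \<Rightarrow> complex"
  assumes [measurable]: "f \<in> borel_measurable borel" and f2: "integrable lborel (\<lambda>s. (cmod (f s))\<^sup>2)" and r: "r > 0"
  shows "(\<integral>\<^sup>+ s. \<integral>\<^sup>+ s'. ennreal (cmod (f s) * cmod (f s') * heat r (s - s')) \<partial>lborel \<partial>lborel)
    \<le> ennreal ((2 * pi) ^ CARD('d) * (LINT s|lborel. (cmod (f s))\<^sup>2))"
proof -
  let ?a = "\<lambda>s. ennreal (1/2 * (cmod (f s))\<^sup>2)" and ?k = "\<lambda>s s'. ennreal (heat r (s - s'))"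
  let ?c = "ennreal ((2 * pi) ^ CARD('d))"
  have "(\<integral>\<^sup>+ s. \<integral>\<^sup>+ s'. ennreal (cmod (f s) * cmod (f s') * heat r (s - s')) \<partial>lborel \<partial>lborel)
    \<le> (\<integral>\<^sup>+ s. \<integral>\<^sup>+ s'. ?a s * ?k s s' + ?a s' * ?k s s' \<partial>lborel \<partial>lborel)"
  proof (intro nn_integral_mono)
    fix s s' :: "real^'d"
    note k0 = heat_nonneg[OF r, of "s - s'"]
    have "cmod (f s) * cmod (f s') \<le> 1/2 * (cmod (f s))\<^sup>2 + 1/2 * (cmod (f s'))\<^sup>2"
      using sum_squares_bound[of "cmod (f s)" "cmod (f s')"] by simp
    from mult_right_mono[OF this k0]
    have "ennreal (cmod (f s) * cmod (f s') * heat r (s - s')) \<le> ennreal ((1/2 * (cmod (f s))\<^sup>2 + 1/2 * (cmod (f s'))\<^sup>2) * heat r (s - s'))"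
      by (rule ennreal_leI)
    also have "\<dots> = (?a s + ?a s') * ?k s s'"
      using k0 by (subst ennreal_mult) (auto simp del: ennreal_plus simp: ennreal_plus[symmetric])
    finally show "ennreal (cmod (f s) * cmod (f s') * heat r (s - s')) \<le> ?a s * ?k s s' + ?a s' * ?k s s'"
      by (simp only: distrib_right)
  qed
  also have "\<dots> = (\<integral>\<^sup>+ s. (\<integral>\<^sup>+ s'. ?a s * ?k s s' \<partial>lborel) + (\<integral>\<^sup>+ s'. ?a s' * ?k s s' \<partial>lborel) \<partial>lborel)"
    by (intro nn_integral_cong nn_integral_add) measurable
  also have "\<dots> = (\<integral>\<^sup>+ s. \<integral>\<^sup>+ s'. ?a s * ?k s s' \<partial>lborel \<partial>lborel) + (\<integral>\<^sup>+ s. \<integral>\<^sup>+ s'. ?a s' * ?k s s' \<partial>lborel \<partial>lborel)"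
    by (intro nn_integral_add) measurable
  also have "(\<integral>\<^sup>+ s. \<integral>\<^sup>+ s'. ?a s' * ?k s s' \<partial>lborel \<partial>lborel) = (\<integral>\<^sup>+ s'. \<integral>\<^sup>+ s. ?a s' * ?k s s' \<partial>lborel \<partial>lborel)"
    by (rule lborel_pair.Fubini'[symmetric]) measurable
  also have "(\<integral>\<^sup>+ s'. \<integral>\<^sup>+ s. ?a s' * ?k s s' \<partial>lborel \<partial>lborel) = (\<integral>\<^sup>+ s'. ?a s' * ?c \<partial>lborel)"
    by (intro nn_integral_cong) (subst nn_integral_cmult, measurable, simp only: nn_integral_heat[OF r])
  also have "(\<integral>\<^sup>+ s. \<integral>\<^sup>+ s'. ?a s * ?k s s' \<partial>lborel \<partial>lborel) = (\<integral>\<^sup>+ s. ?a s * ?c \<partial>lborel)"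
    by (intro nn_integral_cong) (subst nn_integral_cmult, measurable, simp only: nn_integral_heat[OF r])
  also have "(\<integral>\<^sup>+ s. ?a s * ?c \<partial>lborel) = (\<integral>\<^sup>+ s. ?a s \<partial>lborel) * ?c"
    by (rule nn_integral_multc) measurable
  also have "(\<integral>\<^sup>+ s. ?a s \<partial>lborel) = ennreal (1/2 * (LINT s|lborel. (cmod (f s))\<^sup>2))"
    using nn_integral_eq_integral[of lborel "\<lambda>s. 1/2 * (cmod (f s))\<^sup>2"] f2 by simp
  also have "ennreal (1/2 * (LINT s|lborel. (cmod (f s))\<^sup>2)) * ?c + ennreal (1/2 * (LINT s|lborel. (cmod (f s))\<^sup>2)) * ?c
      = ennreal ((2 * pi) ^ CARD('d) * (LINT s|lborel. (cmod (f s))\<^sup>2))"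
  proof -
    have "ennreal (1/2 * x) * ennreal y + ennreal (1/2 * x) * ennreal y = ennreal (y * x)" if "x \<ge> 0" "y \<ge> 0" for x y :: real
      using that by (simp add: ennreal_mult[symmetric] ennreal_plus[symmetric] mult.commute del: ennreal_plus)
    then show ?thesis by simp
  qed
  finally show ?thesis .
qed

text \<open>A Gaussian weight on the transform side turns the squared norm into a quadratic form with the heat kernel, to which Schur's test applies.\<close>

lemma Plancherel_gauss:
  fixes f :: "real^'d::finite \<Rightarrow> complex"
  assumes f: "integrable lborel f" and f2: "integrable lborel (\<lambda>s. (cmod (f s))\<^sup>2)" and r: "r > 0"
  shows "(\<integral>\<^sup>+ t. ennreal ((cmod (fint f t))\<^sup>2 * gauss r t) \<partial>lborel) \<le> ennreal ((2 * pi) ^ CARD('d) * (LINT s|lborel. (cmod (f s))\<^sup>2))"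
proof -
  have fm [measurable]: "f \<in> borel_measurable borel" using f by auto
  define K where "K = (LINT s|lborel. cmod (f s))"
  note b = fint_bound[OF f, folded K_def]
  have K0: "K \<ge> 0" unfolding K_def by simp
  \<comment> \<open>The weighted square is \<open>fint f t * w t\<close>. Expanding the first factor
    and then the conjugate inside w as integrals lets Fubini's theorem be applied twice.\<close>
  define w where "w = (\<lambda>t. cnj (fint f t) * complex_of_real (gauss r t))"
  have [measurable]: "(\<lambda>t. cnj (fint f t)) \<in> borel_measurable borel"
    by (rule borel_measurable_continuous_on[where f=cnj]) (auto intro!: continuous_intros)
  have w: "integrable lborel w"
    unfolding w_def
    by (rule Bochner_Integration.integrable_bound[OF integrable_mult_right[OF integrable_gauss_real[OF r], of K]])
       (use b gauss_pos in \<open>auto simp: norm_mult K0 less_imp_le abs_mult intro!: AE_I2 mult_right_mono\<close>)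
  have ij: "integrable lborel (\<lambda>t. (cmod (fint f t))\<^sup>2 * gauss r t)"
  proof (rule Bochner_Integration.integrable_bound[OF integrable_mult_right[OF integrable_gauss_real[OF r], of "K\<^sup>2"]])
    show "AE t in lborel. norm ((cmod (fint f t))\<^sup>2 * gauss r t) \<le> norm (K\<^sup>2 * gauss r t)"
      using gauss_pos[of r] by (intro AE_I2) (simp add: abs_mult mult_right_mono power_mono[OF b] less_imp_le)
  qed measurable
  have gn: "0 \<le> (cmod (fint f t))\<^sup>2 * gauss r t" for t
    using gauss_pos[of r t] by (intro mult_nonneg_nonneg) auto
  have J0: "(LINT t|lborel. (cmod (fint f t))\<^sup>2 * gauss r t) \<ge> 0"
    by (intro integral_nonneg_AE AE_I2 gn)
  have inner: "(LINT t|lborel. iexp (s \<bullet> t) * w t) = (LINT s'|lborel. cnj (f s') * complex_of_real (heat r (s - s')))" for s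
  proof -
    let ?e = "\<lambda>t. iexp (s \<bullet> t) * complex_of_real (gauss r t)"
    have e: "integrable lborel ?e"
      using integrable_gauss[OF r, of s] by (simp add: inner_commute)
    have cf: "integrable lborel (\<lambda>s. cnj (f s))" using f by simp
    have cn: "cnj (fint f t) = (LINT s'|lborel. iexp (- (s' \<bullet> t)) * cnj (f s'))" for t
    proof -
      have "cnj (fint f t) = (LINT s'|lborel. cnj (iexp (s' \<bullet> t) * f s'))"
        unfolding fint_def by (rule integral_bounded_linear[OF bounded_linear_cnj integrable_iexp_mult(1)[OF f], symmetric])
      then show ?thesis by (simp add: exp_cnj)
    qed
    have wt: "iexp (s \<bullet> t) * w t = (LINT s'|lborel. iexp (- (s' \<bullet> t)) * cnj (f s')) * ?e t" for t
      unfolding w_def cn by (simp only: mult_ac)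
    have "(LINT t|lborel. iexp (s \<bullet> t) * w t) = (LINT s'|lborel. cnj (f s') * (LINT t|lborel. iexp (- (s' \<bullet> t)) * ?e t))"
      unfolding wt by (rule Fubini_bounded_kernel[OF cf e measurable_iexp_inner(2)]) simp
    then show ?thesis unfolding integral_gauss_modulated[OF r] .
  qed
  have J: "complex_of_real (LINT t|lborel. (cmod (fint f t))\<^sup>2 * gauss r t)
      = (LINT s|lborel. f s * (LINT s'|lborel. cnj (f s') * complex_of_real (heat r (s - s'))))"
  proof -
    have e: "complex_of_real ((cmod (fint f t))\<^sup>2 * gauss r t) = (LINT s|lborel. iexp (s \<bullet> t) * f s) * w t" for t
      unfolding w_def fint_def[symmetric] of_real_mult complex_norm_square by (simp only: mult_ac)
    have "complex_of_real (LINT t|lborel. (cmod (fint f t))\<^sup>2 * gauss r t) = (LINT s|lborel. f s * (LINT t|lborel. iexp (s \<bullet> t) * w t))"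
      unfolding integral_complex_of_real[symmetric] e
      by (rule Fubini_bounded_kernel[OF f w measurable_iexp_inner(1)]) simp
    then show ?thesis unfolding inner .
  qed
  let ?I = "\<lambda>s. LINT s'|lborel. cnj (f s') * complex_of_real (heat r (s - s'))"
  have "(\<integral>\<^sup>+ t. ennreal ((cmod (fint f t))\<^sup>2 * gauss r t) \<partial>lborel) = ennreal (LINT t|lborel. (cmod (fint f t))\<^sup>2 * gauss r t)"
    by (rule nn_integral_eq_integral[OF ij]) (intro AE_I2 gn)
  also have "\<dots> = ennreal (cmod (LINT s|lborel. f s * ?I s))"
    unfolding J[symmetric] norm_of_real using J0 by simp
  also have "\<dots> \<le> (\<integral>\<^sup>+ s. ennreal (cmod (f s * ?I s)) \<partial>lborel)"
    by (rule norm_integral_le_nn_integral)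
  also have "\<dots> \<le> (\<integral>\<^sup>+ s. \<integral>\<^sup>+ s'. ennreal (cmod (f s) * cmod (f s') * heat r (s - s')) \<partial>lborel \<partial>lborel)"
  proof (rule nn_integral_mono)
    fix s :: "real^'d"
    have e: "ennreal (cmod (f s)) * ennreal (cmod (cnj (f s') * complex_of_real (heat r (s - s')))) = ennreal (cmod (f s) * cmod (f s') * heat r (s - s'))" for s'
    proof -
      have "cmod (cnj (f s') * complex_of_real (heat r (s - s'))) = cmod (f s') * heat r (s - s')"
        unfolding norm_mult norm_of_real complex_mod_cnj abs_of_nonneg[OF heat_nonneg[OF r]] ..
      then show ?thesis using heat_nonneg[OF r, of "s - s'"] by (simp only: ennreal_mult'[symmetric] norm_ge_zero mult.assoc)
    qed
    have "ennreal (cmod (f s * ?I s)) = ennreal (cmod (f s)) * ennreal (cmod (?I s))"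
      by (simp add: norm_mult ennreal_mult)
    also have "\<dots> \<le> ennreal (cmod (f s)) * (\<integral>\<^sup>+ s'. ennreal (cmod (cnj (f s') * complex_of_real (heat r (s - s')))) \<partial>lborel)"
      by (rule mult_left_mono[OF norm_integral_le_nn_integral]) simp
    also have "\<dots> = (\<integral>\<^sup>+ s'. ennreal (cmod (f s)) * ennreal (cmod (cnj (f s') * complex_of_real (heat r (s - s')))) \<partial>lborel)"
    proof (rule nn_integral_cmult[symmetric])
      have "(\<lambda>s'. cnj (f s')) \<in> borel_measurable borel"
        by (rule borel_measurable_continuous_on[where f=cnj]) (auto intro!: continuous_intros)
      then show "(\<lambda>s'. ennreal (cmod (cnj (f s') * complex_of_real (heat r (s - s'))))) \<in> borel_measurable lborel"
        by measurable
    qed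
    finally show "ennreal (cmod (f s * ?I s)) \<le> (\<integral>\<^sup>+ s'. ennreal (cmod (f s) * cmod (f s') * heat r (s - s')) \<partial>lborel)"
      unfolding e .
  qed
  also have "\<dots> \<le> ennreal ((2 * pi) ^ CARD('d) * (LINT s|lborel. (cmod (f s))\<^sup>2))"
    by (rule Schur_heat[OF fm f2 r])
  finally show ?thesis .
qed

text \<open>The bound in \<open>Plancherel_gauss\<close> is independent of r, so Fatou's lemma
  removes the weight as r tends to 0.\<close>

lemma Plancherel_inequality:
  fixes f :: "real^'d::finite \<Rightarrow> complex"
  assumes f: "integrable lborel f" and f2: "integrable lborel (\<lambda>s. (cmod (f s))\<^sup>2)"
  shows "(\<integral>\<^sup>+ t. ennreal ((cmod (fint f t))\<^sup>2) \<partial>lborel) \<le> ennreal ((2 * pi) ^ CARD('d) * (LINT s|lborel. (cmod (f s))\<^sup>2))"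
    (is "_ \<le> ?B")
proof -
  have [measurable]: "f \<in> borel_measurable borel" using f by auto
  let ?g = "\<lambda>n t. ennreal ((cmod (fint f t))\<^sup>2 * gauss (1 / real (Suc n)) t)"
  have lim: "(\<lambda>n. ?g n t) \<longlonglongrightarrow> ennreal ((cmod (fint f t))\<^sup>2)" for t
  proof -
    have "(\<lambda>n. 1 / real (Suc n)) \<longlonglongrightarrow> 0" by (rule LIMSEQ_Suc) (rule lim_1_over_n)
    then have "(\<lambda>n. gauss (1 / real (Suc n)) t) \<longlonglongrightarrow> exp (- (0 * norm t)\<^sup>2 / 2)"
      unfolding gauss_def by (intro tendsto_intros) auto
    from tendsto_mult[OF tendsto_const[of "(cmod (fint f t))\<^sup>2"] this]
    have "(\<lambda>n. (cmod (fint f t))\<^sup>2 * gauss (1 / real (Suc n)) t) \<longlonglongrightarrow> (cmod (fint f t))\<^sup>2" by simp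
    then show ?thesis by (rule tendsto_ennrealI)
  qed
  have "(\<integral>\<^sup>+ t. ennreal ((cmod (fint f t))\<^sup>2) \<partial>lborel) = (\<integral>\<^sup>+ t. liminf (\<lambda>n. ?g n t) \<partial>lborel)"
    by (intro nn_integral_cong lim_imp_Liminf[OF sequentially_bot, symmetric] lim)
  also have "\<dots> \<le> liminf (\<lambda>n. \<integral>\<^sup>+ t. ?g n t \<partial>lborel)"
    by (rule nn_integral_liminf) measurable
  also have "\<dots> \<le> liminf (\<lambda>n::nat. ?B)"
    by (intro Liminf_mono always_eventually allI Plancherel_gauss[OF f f2]) simp
  also have "\<dots> = ?B" by (simp add: Liminf_const)
  finally show ?thesis .
qed

section \<open>The inverse Fourier transform on square-integrable functions\<close>

text \<open>The constant of the unitary Fourier transform. The dimension is carried by the type, so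
  the type is passed as an argument.\<close>

definition fconst :: "'d::finite itself \<Rightarrow> real" where
  "fconst _ = (2 * pi) powr (- real CARD('d) / 2)"

lemma fconst_pos: "fconst TYPE('d::finite) > 0"
  by (simp add: fconst_def)

lemma fconst_mult: "fconst TYPE('d::finite) * sqrt (2 * pi) ^ CARD('d) = 1"
proof -
  have "sqrt (2 * pi) ^ CARD('d) = (2 * pi) powr (real CARD('d) / 2)"
    by (simp add: powr_half_sqrt[symmetric] powr_powr flip: powr_realpow)
  then show ?thesis unfolding fconst_def by (simp add: powr_minus field_simps)
qed

lemma fconst_sq: "(fconst TYPE('d::finite))\<^sup>2 * (2 * pi) ^ CARD('d) = 1"
proof -
  have "(2 * pi) ^ CARD('d) = (sqrt (2 * pi) ^ CARD('d))\<^sup>2"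
    unfolding power2_eq_square power_mult_distrib[symmetric] by simp
  then have "(fconst TYPE('d))\<^sup>2 * (2 * pi) ^ CARD('d) = (fconst TYPE('d) * sqrt (2 * pi) ^ CARD('d))\<^sup>2"
    by (simp only: power_mult_distrib)
  then show ?thesis unfolding fconst_mult by simp
qed

lemma integral_lebesgue_borel:
  fixes f :: "'a::euclidean_space \<Rightarrow> 'b::{banach,second_countable_topology}"
  shows "f \<in> borel_measurable borel \<Longrightarrow> integral\<^sup>L lebesgue f = integral\<^sup>L lborel f"
  by (rule integral_completion) simp

lemma integrable_lebesgue_borel:
  fixes f :: "'a::euclidean_space \<Rightarrow> 'b::{banach,second_countable_topology}"
  shows "f \<in> borel_measurable borel \<Longrightarrow> integrable lebesgue f \<longleftrightarrow> integrable lborel f"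
  by (rule integrable_completion) simp

lemma borel_measurable_lebesgueI: "f \<in> borel_measurable borel \<Longrightarrow> f \<in> borel_measurable lebesgue"
  by (rule measurable_completion) simp

lemma inv_fourier_int_fint:
  fixes f :: "real^'d::finite \<Rightarrow> complex"
  assumes [measurable]: "f \<in> borel_measurable borel"
  shows "inv_fourier_int f = (\<lambda>t. complex_of_real (fconst TYPE('d)) * fint f t)"
  unfolding inv_fourier_int_def fint_def fconst_def by (subst integral_lebesgue_borel) auto

lemma inv_fourier_int_L2:
  fixes f :: "real^'d::finite \<Rightarrow> complex"
  assumes f [measurable]: "f \<in> borel_measurable borel" and "\<And>x. cmod (f x) \<le> K" "\<And>x. norm x > \<rho> \<Longrightarrow> f x = 0"
  shows "square_integrable (inv_fourier_int f)" "L2_norm_sq (inv_fourier_int f) \<le> L2_norm_sq f"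
    and "inv_fourier_int f \<in> borel_measurable borel"
proof -
  note b = bounded_support_square_integrable[OF borel_measurable_lebesgueI[OF f] assms(2,3)]
  have i: "integrable lborel f" using b(2) integrable_lebesgue_borel[OF f] by simp
  have f2m: "(\<lambda>s. (cmod (f s))\<^sup>2) \<in> borel_measurable borel" by measurable
  have i2: "integrable lborel (\<lambda>s. (cmod (f s))\<^sup>2)"
    using b(1) integrable_lebesgue_borel[OF f2m] by (simp add: square_integrable_def)
  have n: "L2_norm_sq f = (LINT s|lborel. (cmod (f s))\<^sup>2)"
    unfolding L2_norm_sq_def by (rule integral_lebesgue_borel[OF f2m])
  note e = inv_fourier_int_fint[OF f]
  show m: "inv_fourier_int f \<in> borel_measurable borel" unfolding e by measurable
  have "(\<integral>\<^sup>+ t. ennreal ((cmod (inv_fourier_int f t))\<^sup>2) \<partial>lebesgue) = (\<integral>\<^sup>+ t. ennreal ((fconst TYPE('d))\<^sup>2) * ennreal ((cmod (fint f t))\<^sup>2) \<partial>lborel)"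
    unfolding e using fconst_pos[where 'd='d]
    by (subst nn_integral_completion) (auto simp: norm_mult power_mult_distrib ennreal_mult intro!: nn_integral_cong)
  also have "\<dots> = ennreal ((fconst TYPE('d))\<^sup>2) * (\<integral>\<^sup>+ t. ennreal ((cmod (fint f t))\<^sup>2) \<partial>lborel)"
    by (rule nn_integral_cmult) measurable
  also have "\<dots> \<le> ennreal ((fconst TYPE('d))\<^sup>2) * ennreal ((2 * pi) ^ CARD('d) * L2_norm_sq f)"
    unfolding n by (rule mult_left_mono[OF Plancherel_inequality[OF i i2]]) simp
  also have "\<dots> = ennreal ((fconst TYPE('d))\<^sup>2 * (2 * pi) ^ CARD('d) * L2_norm_sq f)"
    by (simp add: ennreal_mult'[symmetric] mult.assoc)
  finally have le: "(\<integral>\<^sup>+ t. ennreal ((cmod (inv_fourier_int f t))\<^sup>2) \<partial>lebesgue) \<le> ennreal (L2_norm_sq f)"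
    unfolding fconst_sq by simp
  then show s: "square_integrable (inv_fourier_int f)"
    unfolding square_integrable_iff_nn_integral using borel_measurable_lebesgueI[OF m]
    by (auto intro: le_less_trans)
  show "L2_norm_sq (inv_fourier_int f) \<le> L2_norm_sq f"
    using le unfolding nn_integral_cmod_sq[OF s] by simp
qed

definition trunc :: "real \<Rightarrow> (real^'d::finite \<Rightarrow> complex) \<Rightarrow> real^'d \<Rightarrow> complex" where
  "trunc R g = (\<lambda>s. indicator (cube R) s * g s)"

lemma cube_borel [measurable]: "(cube R :: (real^'d::finite) set) \<in> sets borel"
proof -
  have "(cube R :: (real^'d) set) = cbox (\<chi> i. - R) (\<chi> i. R)" by (auto simp: cube_def mem_box_cart abs_le_iff minus_le_iff)
  then show ?thesis by simp
qed

lemma norm_le_of_cube: "x \<in> cube R \<Longrightarrow> norm (x::real^'d::finite) \<le> R * real CARD('d)"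
proof -
  assume "x \<in> cube R"
  then have "\<bar>x $ i\<bar> \<le> R" for i by (simp add: cube_def)
  then have "(\<Sum>i\<in>UNIV. \<bar>x $ i\<bar>) \<le> of_nat CARD('d) * R" by (intro sum_bounded_above) simp
  then show ?thesis using norm_le_l1_cart[of x] by (simp add: mult.commute)
qed

lemma square_integrable_gauss_shift:
  fixes x :: "real^'d::finite"
  assumes r: "r > 0"
  shows "square_integrable (\<lambda>t::real^'d. complex_of_real (gauss r (t - x)))"
    "integrable lborel (\<lambda>t::real^'d. complex_of_real (gauss r (t - x)))"
proof -
  have i: "integrable lborel (\<lambda>t::real^'d. complex_of_real (gauss r t))"
    using integrable_gauss[OF r, of "0::real^'d"] by simp
  have "integrable lebesgue (\<lambda>t. complex_of_real (gauss r (mat 1 *v t + (- x))))"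
    by (subst integrable_affine) (auto simp: integrable_lebesgue_borel i intro!: borel_measurable_lebesgueI)
  then show il: "integrable lborel (\<lambda>t::real^'d. complex_of_real (gauss r (t - x)))"
    by (simp add: integrable_lebesgue_borel)
  show "square_integrable (\<lambda>t::real^'d. complex_of_real (gauss r (t - x)))"
    unfolding square_integrable_def
  proof
    show "integrable lebesgue (\<lambda>t. (cmod (complex_of_real (gauss r (t - x))))\<^sup>2)"
    proof (rule Bochner_Integration.integrable_bound)
      show "integrable lebesgue (\<lambda>t::real^'d. complex_of_real (gauss r (t - x)))"
        using il by (simp add: integrable_lebesgue_borel)
      have "(gauss r y)\<^sup>2 \<le> gauss r y" for y :: "real^'d"
        using gauss_pos[of r y] gauss_le_1[of r y] by (simp add: power2_eq_square mult_left_le)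
      then show "AE t in lebesgue. norm ((cmod (complex_of_real (gauss r (t - x))))\<^sup>2) \<le> norm (complex_of_real (gauss r (t - x)))"
        by (intro AE_I2) (auto simp: abs_of_pos[OF gauss_pos])
    qed (auto intro!: borel_measurable_lebesgueI)
  qed (auto intro!: borel_measurable_lebesgueI)
qed

lemma fourier_gauss_shift:
  fixes s x :: "real^'d::finite"
  assumes r: "r > 0"
  shows "(LINT t|lborel. iexp (s \<bullet> t) * complex_of_real (gauss (1 / r) (t - x)))
    = complex_of_real ((sqrt (2 * pi) * r) ^ CARD('d)) * (iexp (s \<bullet> x) * complex_of_real (gauss r s))"
proof -
  have "(LINT t|lborel. iexp (s \<bullet> t) * complex_of_real (gauss (1 / r) (t - x)))
     = (LINT t|distr lborel borel ((+) x). iexp (s \<bullet> t) * complex_of_real (gauss (1 / r) (t - x)))"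
    by (simp only: lborel_distr_plus)
  also have "\<dots> = (LINT t|lborel. iexp (s \<bullet> (x + t)) * complex_of_real (gauss (1 / r) (x + t - x)))"
    by (rule integral_distr) auto
  also have "\<dots> = (LINT t|lborel. iexp (s \<bullet> x) * (iexp (t \<bullet> s) * complex_of_real (gauss (1 / r) t)))"
  proof (rule Bochner_Integration.integral_cong[OF refl])
    fix t
    have "\<i> * complex_of_real (s \<bullet> (x + t)) = \<i> * complex_of_real (s \<bullet> x) + \<i> * complex_of_real (t \<bullet> s)"
      by (simp add: inner_add_right inner_commute[of s t] distrib_left)
    then show "iexp (s \<bullet> (x + t)) * complex_of_real (gauss (1 / r) (x + t - x)) = iexp (s \<bullet> x) * (iexp (t \<bullet> s) * complex_of_real (gauss (1 / r) t))"
      by (simp only: exp_add mult.assoc) simp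
  qed
  also have "\<dots> = iexp (s \<bullet> x) * (LINT t|lborel. iexp (t \<bullet> s) * complex_of_real (gauss (1 / r) t))"
    by simp
  also have "(LINT t|lborel. iexp (t \<bullet> s) * complex_of_real (gauss (1 / r) t)) = complex_of_real ((sqrt (2 * pi) * r) ^ CARD('d) * gauss r s)"
    using integral_gauss[of "1 / r" s] r by simp
  finally show ?thesis by (simp add: mult_ac)
qed

section \<open>Truncations to cubes and their L^2 limit\<close>

context
  fixes g :: "real^'d::finite \<Rightarrow> complex" and K :: real
  assumes g [measurable]: "g \<in> borel_measurable borel" and gK: "\<And>x. cmod (g x) \<le> K" and g2: "square_integrable g"
begin

lemma K_nonneg: "0 \<le> K"
  by (rule order_trans[OF norm_ge_zero gK[of 0]])

lemma measurable_trunc [measurable]: "trunc R g \<in> borel_measurable borel"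
  unfolding trunc_def by measurable

lemma trunc_bound: "cmod (trunc R g x) \<le> K" "norm x > R * real CARD('d) \<Longrightarrow> trunc R g x = 0"
proof -
  show "cmod (trunc R g x) \<le> K" using gK[of x] K_nonneg by (simp add: trunc_def indicator_def)
  show "trunc R g x = 0" if "norm x > R * real CARD('d)"
  proof -
    have "x \<notin> cube R" using that norm_le_of_cube[of x R] by linarith
    then show ?thesis by (simp add: trunc_def)
  qed
qed

lemma trunc_integrable: "integrable lborel (trunc R g)" "square_integrable (trunc R g)"
proof -
  note b = bounded_support_square_integrable[OF borel_measurable_lebesgueI[OF measurable_trunc] trunc_bound]
  show "integrable lborel (trunc R g)"
    unfolding integrable_lebesgue_borel[OF measurable_trunc, symmetric] by (rule b(2))
  show "square_integrable (trunc R g)" by (rule b(1))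
qed

text \<open>The inverse Fourier integral is linear on truncations, and
  \<open>inv_fourier_int_L2\<close> makes it a contraction there.\<close>

lemma inv_fourier_int_trunc_diff:
  "L2n (\<lambda>t. inv_fourier_int (trunc R g) t - inv_fourier_int (trunc R' g) t) \<le> L2n (\<lambda>s. trunc R g s - trunc R' g s)"
proof -
  have b: "cmod (trunc R g x - trunc R' g x) \<le> 2 * K" for x
    using trunc_bound(1)[of R x] trunc_bound(1)[of R' x] norm_triangle_ineq4[of "trunc R g x" "trunc R' g x"] by linarith
  have z: "trunc R g x - trunc R' g x = 0" if "norm x > max R R' * real CARD('d)" for x
  proof -
    have "R * real CARD('d) \<le> max R R' * real CARD('d)" "R' * real CARD('d) \<le> max R R' * real CARD('d)"
      by (auto intro!: mult_right_mono)
    with that have "norm x > R * real CARD('d)" "norm x > R' * real CARD('d)" by linarith+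
    then show ?thesis by (simp add: trunc_bound(2))
  qed
  have m: "(\<lambda>s. trunc R g s - trunc R' g s) \<in> borel_measurable borel" by measurable
  have "inv_fourier_int (\<lambda>s. trunc R g s - trunc R' g s) = (\<lambda>t. inv_fourier_int (trunc R g) t - inv_fourier_int (trunc R' g) t)"
    unfolding inv_fourier_int_fint[OF m] inv_fourier_int_fint[OF measurable_trunc] fint_def
    using integrable_iexp_mult(1)[OF trunc_integrable(1)] by (simp add: right_diff_distrib)
  then have "L2_norm_sq (\<lambda>t. inv_fourier_int (trunc R g) t - inv_fourier_int (trunc R' g) t) \<le> L2_norm_sq (\<lambda>s. trunc R g s - trunc R' g s)"
    using inv_fourier_int_L2(2)[OF m b z] by simp
  then show ?thesis unfolding L2n_def by simp
qed

definition tail :: "nat \<Rightarrow> real" where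
  "tail n = L2n (\<lambda>s. trunc (real n) g s - g s)"

lemma tail_limit: "tail \<longlonglongrightarrow> 0"
  unfolding tail_def
proof (rule L2_dominated_convergence(3)[where w="\<lambda>s. cmod (g s)"])
  show "integrable lebesgue (\<lambda>x. (cmod (g x))\<^sup>2)" using g2 by (simp add: square_integrable_def)
  show "AE x in lebesgue. (\<lambda>n. trunc (real n) g x) \<longlonglongrightarrow> g x"
  proof (rule AE_I2)
    fix x :: "real^'d"
    obtain k0 :: nat where k0: "norm x \<le> real k0" using real_arch_simple by blast
    have "trunc (real n) g x = g x" if "n \<ge> k0" for n
    proof -
      have "\<bar>x $ i\<bar> \<le> real n" for i using component_le_norm_cart[of x i] k0 that by linarith
      then show ?thesis by (simp add: trunc_def cube_def)
    qed
    then show "(\<lambda>n. trunc (real n) g x) \<longlonglongrightarrow> g x"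
      by (intro tendsto_eventually eventually_sequentiallyI[of k0])
  qed
  show "AE x in lebesgue. cmod (trunc (real n) g x) \<le> cmod (g x)" for n
    by (intro AE_I2) (simp add: trunc_def indicator_def)
qed (auto intro: borel_measurable_lebesgueI)

lemma trunc_diff_le_tail:
  assumes "R \<ge> real n" "R' \<ge> real n"
  shows "L2n (\<lambda>s. trunc R g s - trunc R' g s) \<le> tail n"
proof -
  have le: "cmod (trunc R g s - trunc R' g s) \<le> cmod (trunc (real n) g s - g s)" for s
  proof (cases "s \<in> cube (real n)")
    case True
    then have "s \<in> cube R" "s \<in> cube R'" using assms by (auto simp: cube_def intro: order_trans)
    then show ?thesis using True by (simp add: trunc_def)
  next
    case False
    then show ?thesis by (simp add: trunc_def indicator_def)
  qed
  have "L2_norm_sq (\<lambda>s. trunc R g s - trunc R' g s) \<le> L2_norm_sq (\<lambda>s. trunc (real n) g s - g s)"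
    unfolding L2_norm_sq_def
    using square_integrable_diff[OF trunc_integrable(2) trunc_integrable(2), of R R'] square_integrable_diff[OF trunc_integrable(2) g2, of "real n"]
    by (intro integral_mono power_mono le) (auto simp: square_integrable_def)
  then show ?thesis unfolding tail_def L2n_def by simp
qed

text \<open>Along integer radii the truncated integrals are Cauchy, which yields a candidate limit;
  a real radius is compared with its floor through \<open>tail\<close>. The candidate is a witness
  for the choice in \<open>inv_fourier_L2\<close>, whose value then has the same property.\<close>

lemma inv_fourier_L2_spec:
  "square_integrable (inv_fourier_L2 g)"
  "(\<lambda>n. L2n (\<lambda>t. inv_fourier_int (trunc (real n) g) t - inv_fourier_L2 g t)) \<longlonglongrightarrow> 0"
proof -
  let ?F = "\<lambda>R. inv_fourier_int (trunc R g)"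
  have sF: "square_integrable (?F R)" for R
    by (rule inv_fourier_int_L2(1)[OF measurable_trunc trunc_bound])
  have diff: "L2n (\<lambda>t. ?F R t - ?F R' t) \<le> tail n" if "R \<ge> real n" "R' \<ge> real n" for R R' n
    using inv_fourier_int_trunc_diff[of R R'] trunc_diff_le_tail[OF that] by linarith
  have "\<exists>N. \<forall>m\<ge>N. \<forall>n\<ge>N. L2n (\<lambda>t. ?F (real m) t - ?F (real n) t) < e" if e: "e > 0" for e
  proof -
    obtain N where N: "tail N < e" using LIMSEQ_0_less[OF tail_limit e] by blast
    then have "L2n (\<lambda>t. ?F (real m) t - ?F (real n) t) < e" if "m \<ge> N" "n \<ge> N" for m n
      using diff[of N "real m" "real n"] that by simp
    then show ?thesis by blast
  qed
  then obtain \<phi> where \<phi>: "square_integrable \<phi>" "(\<lambda>n. L2n (\<lambda>t. ?F (real n) t - \<phi> t)) \<longlonglongrightarrow> 0"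
    using L2_complete[of "\<lambda>n. ?F (real n)"] sF by blast
  have fl: "filterlim (\<lambda>R::real. nat \<lfloor>R\<rfloor>) sequentially at_top"
    by (rule filterlim_compose[OF filterlim_nat_sequentially filterlim_floor_sequentially])
  have "((\<lambda>R. L2_dist_sq \<phi> (?F R)) \<longlongrightarrow> 0) at_top"
  proof -
    have "((\<lambda>R. L2n (\<lambda>t. \<phi> t - ?F R t)) \<longlongrightarrow> 0) at_top"
    proof (rule Lim_null_comparison)
      show "((\<lambda>R::real. tail (nat \<lfloor>R\<rfloor>) + L2n (\<lambda>t. ?F (real (nat \<lfloor>R\<rfloor>)) t - \<phi> t)) \<longlongrightarrow> 0) at_top"
        using tendsto_add[OF filterlim_compose[OF tail_limit fl] filterlim_compose[OF \<phi>(2) fl]] by simp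
      show "\<forall>\<^sub>F R::real in at_top. norm (L2n (\<lambda>t. \<phi> t - ?F R t)) \<le> tail (nat \<lfloor>R\<rfloor>) + L2n (\<lambda>t. ?F (real (nat \<lfloor>R\<rfloor>)) t - \<phi> t)"
        using eventually_ge_at_top[of "0::real"]
      proof eventually_elim
        case (elim R)
        then have "real (nat \<lfloor>R\<rfloor>) \<le> R" by simp
        then have "L2n (\<lambda>t. ?F R t - ?F (real (nat \<lfloor>R\<rfloor>)) t) \<le> tail (nat \<lfloor>R\<rfloor>)" by (intro diff) auto
        then show ?case
          using L2n_triangle_diff[OF sF[of R] sF[of "real (nat \<lfloor>R\<rfloor>)"] \<phi>(1)] L2n_minus_commute[of \<phi> "?F R"] by simp
      qed
    qed
    then have "((\<lambda>R. ennreal ((L2n (\<lambda>t. \<phi> t - ?F R t))\<^sup>2)) \<longlongrightarrow> ennreal (0\<^sup>2)) at_top"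
      by (intro tendsto_ennrealI tendsto_power)
    then show ?thesis unfolding L2_dist_sq_eq[OF \<phi>(1) sF] by simp
  qed
  then have "\<exists>\<phi>. square_integrable \<phi> \<and> ((\<lambda>R::real. L2_dist_sq \<phi> (inv_fourier_int (\<lambda>s. indicator (cube R) s * g s))) \<longlongrightarrow> 0) at_top"
    using \<phi>(1) unfolding trunc_def by blast
  from someI_ex[OF this] have sp: "square_integrable (inv_fourier_L2 g)" "((\<lambda>R. L2_dist_sq (inv_fourier_L2 g) (?F R)) \<longlongrightarrow> 0) at_top"
    unfolding inv_fourier_L2_def[symmetric] trunc_def by auto
  show "square_integrable (inv_fourier_L2 g)" by (rule sp)
  have "(\<lambda>n. ennreal ((L2n (\<lambda>t. ?F (real n) t - inv_fourier_L2 g t))\<^sup>2)) \<longlonglongrightarrow> ennreal 0"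
    using filterlim_compose[OF sp(2) filterlim_real_sequentially] L2n_minus_commute[of "inv_fourier_L2 g"]
    unfolding L2_dist_sq_eq[OF sp(1) sF] by simp
  then have "(\<lambda>n. (L2n (\<lambda>t. ?F (real n) t - inv_fourier_L2 g t))\<^sup>2) \<longlonglongrightarrow> 0"
    by (subst (asm) tendsto_ennreal_iff) auto
  from tendsto_real_sqrt[OF this]
  show "(\<lambda>n. L2n (\<lambda>t. ?F (real n) t - inv_fourier_L2 g t)) \<longlonglongrightarrow> 0"
    unfolding real_sqrt_abs by simp
qed

text \<open>The multiplication formula, by which the transform may be moved to the other factor. For
  each truncation it is Fubini's theorem; the left side passes to the limit in L^2, the right side
  with the majorant \<open>K * gauss r s\<close>.\<close>

lemma inv_fourier_L2_gauss:
  fixes x :: "real^'d"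
  assumes r: "r > 0"
  shows "(LINT t|lebesgue. inv_fourier_L2 g t * complex_of_real (gauss (1 / r) (t - x)))
    = complex_of_real (fconst TYPE('d) * (sqrt (2 * pi) * r) ^ CARD('d)) * (LINT s|lborel. g s * (iexp (s \<bullet> x) * complex_of_real (gauss r s)))"
proof -
  let ?v = "\<lambda>t. complex_of_real (gauss (1 / r) (t - x))"
  let ?F = "\<lambda>n::nat. inv_fourier_int (trunc (real n) g)"
  let ?c = "complex_of_real (fconst TYPE('d) * (sqrt (2 * pi) * r) ^ CARD('d))"
  have v: "square_integrable ?v" "integrable lborel ?v" using square_integrable_gauss_shift[of "1/r" x] r by auto
  have sF: "square_integrable (?F n)" for n by (rule inv_fourier_int_L2(1)[OF measurable_trunc trunc_bound])
  have eq: "(LINT t|lebesgue. ?F n t * ?v t) = ?c * (LINT s|lborel. trunc (real n) g s * (iexp (s \<bullet> x) * complex_of_real (gauss r s)))" for n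
  proof -
    have "(LINT t|lebesgue. ?F n t * ?v t) = (LINT t|lborel. complex_of_real (fconst TYPE('d)) * (fint (trunc (real n) g) t * ?v t))"
      unfolding inv_fourier_int_fint[OF measurable_trunc] mult.assoc by (rule integral_lebesgue_borel) measurable
    also have "\<dots> = complex_of_real (fconst TYPE('d)) * (LINT t|lborel. fint (trunc (real n) g) t * ?v t)" by simp
    also have "(LINT t|lborel. fint (trunc (real n) g) t * ?v t) = (LINT s|lborel. trunc (real n) g s * (LINT t|lborel. iexp (s \<bullet> t) * ?v t))"
      unfolding fint_def by (rule Fubini_bounded_kernel[OF trunc_integrable(1) v(2) measurable_iexp_inner(1)]) simp
    also have "\<dots> = (LINT s|lborel. complex_of_real ((sqrt (2 * pi) * r) ^ CARD('d)) * (trunc (real n) g s * (iexp (s \<bullet> x) * complex_of_real (gauss r s))))"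
      unfolding fourier_gauss_shift[OF r] by (simp only: mult_ac)
    also have "\<dots> = complex_of_real ((sqrt (2 * pi) * r) ^ CARD('d)) * (LINT s|lborel. trunc (real n) g s * (iexp (s \<bullet> x) * complex_of_real (gauss r s)))"
      by (rule integral_mult_right_zero)
    finally show ?thesis by (simp only: of_real_mult mult.assoc)
  qed
  have "(\<lambda>n. L2_inner (?F n) ?v) \<longlonglongrightarrow> L2_inner (inv_fourier_L2 g) ?v"
    by (rule L2_inner_tendsto_left[OF sF inv_fourier_L2_spec(1) v(1) inv_fourier_L2_spec(2)])
  then have l1: "(\<lambda>n. LINT t|lebesgue. ?F n t * ?v t) \<longlonglongrightarrow> (LINT t|lebesgue. inv_fourier_L2 g t * ?v t)"
    unfolding L2_inner_def by simp
  have "(\<lambda>n. LINT s|lborel. trunc (real n) g s * (iexp (s \<bullet> x) * complex_of_real (gauss r s))) \<longlonglongrightarrow> (LINT s|lborel. g s * (iexp (s \<bullet> x) * complex_of_real (gauss r s)))"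
  proof (rule integral_dominated_convergence[where w="\<lambda>s. K * gauss r s"])
    show "integrable lborel (\<lambda>s::real^'d. K * gauss r s)" using integrable_gauss_real[OF r] by (rule integrable_mult_right)
    show "AE s in lborel. (\<lambda>n. trunc (real n) g s * (iexp (s \<bullet> x) * complex_of_real (gauss r s))) \<longlonglongrightarrow> g s * (iexp (s \<bullet> x) * complex_of_real (gauss r s))"
    proof (intro AE_I2 tendsto_mult tendsto_const)
      fix s :: "real^'d"
      obtain k0 :: nat where k0: "norm s \<le> real k0" using real_arch_simple by blast
      have "trunc (real n) g s = g s" if "n \<ge> k0" for n
      proof -
        have "\<bar>s $ i\<bar> \<le> real n" for i using component_le_norm_cart[of s i] k0 that by linarith
        then show ?thesis by (simp add: trunc_def cube_def)
      qed
      then show "(\<lambda>n. trunc (real n) g s) \<longlonglongrightarrow> g s"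
        by (intro tendsto_eventually eventually_sequentiallyI[of k0])
    qed
    show "AE s in lborel. norm (trunc (real n) g s * (iexp (s \<bullet> x) * complex_of_real (gauss r s))) \<le> K * gauss r s" for n
    proof (rule AE_I2)
      fix s :: "real^'d"
      have "norm (trunc (real n) g s * (iexp (s \<bullet> x) * complex_of_real (gauss r s))) = cmod (trunc (real n) g s) * gauss r s"
        by (simp add: norm_mult abs_of_pos[OF gauss_pos])
      also have "\<dots> \<le> K * gauss r s"
        using gauss_pos[of r s] by (intro mult_right_mono trunc_bound(1)) simp
      finally show "norm (trunc (real n) g s * (iexp (s \<bullet> x) * complex_of_real (gauss r s))) \<le> K * gauss r s" .
    qed
  qed measurable
  from tendsto_mult[OF tendsto_const[of ?c] this] l1
  show ?thesis unfolding eq by (rule LIMSEQ_unique[rotated])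
qed

end

section \<open>From Gaussian test functions to continuous ones\<close>

text \<open>An L^2 limit such as phi is only Lebesgue measurable, while Fubini's theorem is applied
  over \<open>lborel\<close>; a Borel version bridges the gap.\<close>

lemma lebesgue_borel_representative:
  fixes f :: "real^'d::finite \<Rightarrow> complex"
  assumes "f \<in> borel_measurable lebesgue"
  obtains f' where "f' \<in> borel_measurable borel" "AE x in lebesgue. f x = f' x"
proof -
  have "(\<lambda>x. Re (f x)) \<in> borel_measurable lebesgue" "(\<lambda>x. Im (f x)) \<in> borel_measurable lebesgue"
    using assms by auto
  then obtain a b where a: "a \<in> borel_measurable lborel" "AE x in lborel. Re (f x) = a x"
    and b: "b \<in> borel_measurable lborel" "AE x in lborel. Im (f x) = b x"
    by (auto dest!: completion_ex_borel_measurable_real)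
  have m: "(\<lambda>x. Complex (a x) (b x)) \<in> borel_measurable borel"
    using a(1) b(1) by (auto simp: borel_measurable_complex_iff)
  have "AE x in lborel. f x = Complex (a x) (b x)"
    using a(2) b(2) by eventually_elim (auto intro: complex_eqI)
  then have "AE x in lebesgue. f x = Complex (a x) (b x)" by (rule AE_completion)
  with m show thesis by (rule that)
qed

text \<open>Two points at distance below 1 either both lie in the ball of radius R + 1, where
  compactness applies, or both lie where u vanishes.\<close>

lemma Cc_uniformly_continuous:
  fixes u :: "real^'d::finite \<Rightarrow> complex"
  assumes u: "Cc u" and e: "e > 0"
  obtains \<delta> where "\<delta> > 0" "\<And>x y. norm (x - y) < \<delta> \<Longrightarrow> cmod (u x - u y) < e"
proof -
  obtain R where R: "\<And>x. norm x > R \<Longrightarrow> u x = 0" and c: "continuous_on UNIV u" using u by (auto simp: Cc_def)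
  have "uniformly_continuous_on (cball 0 (R + 1)) u"
    by (rule compact_uniformly_continuous[OF continuous_on_subset[OF c]]) auto
  then obtain d where d: "d > 0" "\<And>x y. x \<in> cball 0 (R + 1) \<Longrightarrow> y \<in> cball 0 (R + 1) \<Longrightarrow> dist y x < d \<Longrightarrow> dist (u y) (u x) < e"
    using e unfolding uniformly_continuous_on_def by blast
  have "cmod (u x - u y) < e" if xy: "norm (x - y) < min d 1" for x y
  proof (cases "norm x \<le> R + 1 \<and> norm y \<le> R + 1")
    case True
    then show ?thesis using d(2)[of y x] xy by (simp add: dist_norm)
  next
    case False
    moreover have "norm x \<le> norm y + norm (x - y)" "norm y \<le> norm x + norm (x - y)"
      using norm_triangle_sub[of x y] norm_triangle_sub[of y x] by (auto simp: norm_minus_commute)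
    ultimately have "norm x > R" "norm y > R" using xy by auto
    then show ?thesis using R e by simp
  qed
  then show thesis using that[of "min d 1"] d(1) by simp
qed

section \<open>Mollification by Gaussians\<close>

definition gmass :: "'d::finite itself \<Rightarrow> real" where
  "gmass _ = sqrt (2 * pi) ^ CARD('d)"

lemma gmass_pos: "gmass TYPE('d::finite) > 0"
  by (simp add: gmass_def)

lemma integral_gauss_1: "(LINT z|lborel. gauss 1 (z::real^'d::finite)) = gmass TYPE('d)"
  unfolding gmass_def using integral_gauss_real[OF zero_less_one, where 'd='d] by (simp only: div_by_1)

text \<open>The convolution of u with a normalised Gaussian of standard deviation 1 / (n + 1). The
  substituted form keeps the weight independent of n, which suits the estimates;
  \<open>moll_convolution\<close> returns to translates of one Gaussian.\<close>

definition moll :: "nat \<Rightarrow> (real^'d::finite \<Rightarrow> complex) \<Rightarrow> real^'d \<Rightarrow> complex" where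
  "moll n u t = (LINT z|lborel. u (t - z /\<^sub>R real (Suc n)) * complex_of_real (gauss 1 z)) / complex_of_real (gmass TYPE('d))"

context
  fixes u :: "real^'d::finite \<Rightarrow> complex"
  assumes u: "Cc u"
begin

lemma u_borel [measurable]: "u \<in> borel_measurable borel"
  by (rule Cc_measurable[OF u])

lemma integrable_moll: "integrable lborel (\<lambda>z. u (t - z /\<^sub>R real (Suc n)) * complex_of_real (gauss 1 z))"
proof -
  obtain K \<rho> where "K \<ge> 0" "\<rho> \<ge> 0" and K: "\<And>x. cmod (u x) \<le> K" and "\<And>x. norm x > \<rho> \<Longrightarrow> u x = 0"
    using Cc_bounded[OF u] by blast
  show ?thesis
  proof (rule Bochner_Integration.integrable_bound[OF integrable_mult_right[OF integrable_gauss_real[of 1], of K]])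
    show "AE z in lborel. norm (u (t - z /\<^sub>R real (Suc n)) * complex_of_real (gauss 1 z)) \<le> norm (K * gauss 1 z)"
    proof (rule AE_I2)
      fix z
      have "cmod (u (t - z /\<^sub>R real (Suc n))) * gauss 1 z \<le> K * gauss 1 z"
        using gauss_pos[of 1 z] by (intro mult_right_mono K) simp
      then show "norm (u (t - z /\<^sub>R real (Suc n)) * complex_of_real (gauss 1 z)) \<le> norm (K * gauss 1 z)"
        by (simp add: norm_mult abs_of_pos[OF gauss_pos])
    qed
  qed simp_all
qed

lemma measurable_moll [measurable]: "moll n u \<in> borel_measurable borel"
proof -
  have "(\<lambda>t. LINT z|lborel. u (t - z /\<^sub>R real (Suc n)) * complex_of_real (gauss 1 z)) \<in> borel_measurable borel"
    by (rule lborel.borel_measurable_lebesgue_integral) measurable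
  then show ?thesis unfolding moll_def by (intro borel_measurable_divide borel_measurable_const)
qed

text \<open>The weight is split at norm \<open>\<delta> * (n + 1)\<close>: inside, uniform
  continuity of u applies; outside remains a Gaussian tail that tends to 0, multiplied by twice the
  bound of u.\<close>

lemma moll_uniform:
  assumes e: "e > 0"
  shows "\<exists>N. \<forall>n\<ge>N. \<forall>t. cmod (moll n u t - u t) \<le> e"
proof -
  obtain K \<rho> where K': "K \<ge> 0" "\<rho> \<ge> 0" "\<And>x. cmod (u x) \<le> K" "\<And>x. norm x > \<rho> \<Longrightarrow> u x = 0"
    using Cc_bounded[OF u] by blast
  note K = K'(1,3)
  let ?m = "gmass TYPE('d)"
  have e2: "e / 2 > 0" using e by simp
  obtain \<delta> where \<delta>: "\<delta> > 0" "\<And>x y. norm (x - y) < \<delta> \<Longrightarrow> cmod (u x - u y) < e / 2"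
    using Cc_uniformly_continuous[OF u e2] by blast
  let ?S = "\<lambda>n::nat. {z::real^'d. norm z \<ge> \<delta> * real (Suc n)}"
  have Sm [measurable]: "?S n \<in> sets borel" for n by measurable
  have iS: "integrable lborel (\<lambda>z. indicator (?S n) z * gauss 1 z :: real)" for n
    by (rule Bochner_Integration.integrable_bound[OF integrable_gauss_real[of 1]])
       (measurable, intro AE_I2, auto simp: indicator_def abs_of_pos[OF gauss_pos] less_imp_le[OF gauss_pos])
  have "(\<lambda>n. LINT z|lborel. indicator (?S n) z * gauss 1 z :: real) \<longlonglongrightarrow> (LINT (z::real^'d)|lborel. (0::real))"
  proof (rule integral_dominated_convergence[where w="gauss 1"])
    show "integrable lborel (gauss 1 :: real^'d \<Rightarrow> real)" by (rule integrable_gauss_real) simp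
    show "AE z in lborel. (\<lambda>n. indicator (?S n) z * gauss 1 z :: real) \<longlonglongrightarrow> 0"
    proof (rule AE_I2)
      fix z :: "real^'d"
      obtain k0 :: nat where k0: "norm z / \<delta> \<le> real k0" using real_arch_simple by blast
      have "indicator (?S n) z * gauss 1 z = (0::real)" if "n \<ge> k0" for n
      proof -
        have "norm z / \<delta> < real (Suc n)" using k0 that by simp
        then have "norm z < \<delta> * real (Suc n)" using \<delta>(1) by (simp add: field_simps)
        then show ?thesis by (simp add: indicator_def)
      qed
      then show "(\<lambda>n. indicator (?S n) z * gauss 1 z :: real) \<longlonglongrightarrow> 0"
        by (intro tendsto_eventually eventually_sequentiallyI[of k0])
    qed
    show "AE z in lborel. norm (indicator (?S n) z * gauss 1 z :: real) \<le> gauss 1 z" for n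
      by (intro AE_I2) (auto simp: indicator_def abs_of_pos[OF gauss_pos] less_imp_le[OF gauss_pos])
  qed measurable
  then have "(\<lambda>n. 2 * K / ?m * (LINT z|lborel. indicator (?S n) z * gauss 1 z :: real)) \<longlonglongrightarrow> 2 * K / ?m * 0"
    by (intro tendsto_intros) simp
  then have "(\<lambda>n. 2 * K / ?m * (LINT z|lborel. indicator (?S n) z * gauss 1 z :: real)) \<longlonglongrightarrow> 0"
    by (simp only: mult_zero_right)
  from order_tendstoD(2)[OF this e2]
  have "\<forall>\<^sub>F n in sequentially. 2 * K / ?m * (LINT z|lborel. indicator (?S n) z * gauss 1 z :: real) < e / 2" .
  then obtain N where N: "\<And>n. n \<ge> N \<Longrightarrow> 2 * K / ?m * (LINT z|lborel. indicator (?S n) z * gauss 1 z :: real) < e / 2"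
    unfolding eventually_sequentially by blast
  have "cmod (moll n u t - u t) \<le> e" if n: "n \<ge> N" for n t
  proof -
    let ?r = "real (Suc n)"
    have ig: "integrable lborel (\<lambda>z::real^'d. complex_of_real (gauss 1 z))"
      using integrable_gauss[of 1 "0::real^'d"] by simp
    have ut: "u t = (LINT z|lborel. u t * complex_of_real (gauss 1 (z::real^'d))) / complex_of_real ?m"
      using gmass_pos[where 'd='d] by (simp add: integral_gauss_1)
    have "moll n u t - u t = ((LINT z|lborel. u (t - z /\<^sub>R ?r) * complex_of_real (gauss 1 z)) - (LINT (z::real^'d)|lborel. u t * complex_of_real (gauss 1 z))) / complex_of_real ?m"
      unfolding moll_def diff_divide_distrib by (rule arg_cong2[where f="(-)", OF refl ut])
    also have "(LINT z|lborel. u (t - z /\<^sub>R ?r) * complex_of_real (gauss 1 z)) - (LINT (z::real^'d)|lborel. u t * complex_of_real (gauss 1 z))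
        = (LINT z|lborel. (u (t - z /\<^sub>R ?r) - u t) * complex_of_real (gauss 1 z))"
      unfolding left_diff_distrib using ig by (intro Bochner_Integration.integral_diff[symmetric] integrable_moll integrable_mult_right)
    finally have "cmod (moll n u t - u t) = cmod (LINT z|lborel. (u (t - z /\<^sub>R ?r) - u t) * complex_of_real (gauss 1 z)) / ?m"
      using gmass_pos[where 'd='d] by (simp add: norm_divide)
    also have "cmod (LINT z|lborel. (u (t - z /\<^sub>R ?r) - u t) * complex_of_real (gauss 1 z))
        \<le> (LINT z|lborel. e / 2 * gauss 1 z + 2 * K * (indicator (?S n) z * gauss 1 z))"
    proof (rule Bochner_Integration.integral_norm_bound_integral)
      show "integrable lborel (\<lambda>z. (u (t - z /\<^sub>R ?r) - u t) * complex_of_real (gauss 1 z))"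
        unfolding left_diff_distrib using ig by (intro Bochner_Integration.integrable_diff integrable_moll integrable_mult_right)
      show "integrable lborel (\<lambda>z::real^'d. e / 2 * gauss 1 z + 2 * K * (indicator (?S n) z * gauss 1 z))"
        by (intro Bochner_Integration.integrable_add integrable_mult_right iS integrable_gauss_real) simp
      fix z :: "real^'d"
      have "cmod (u (t - z /\<^sub>R ?r) - u t) \<le> e / 2 + 2 * K * indicator (?S n) z"
      proof (cases "z \<in> ?S n")
        case True
        then show ?thesis using K(2)[of t] K(2)[of "t - z /\<^sub>R ?r"] norm_triangle_ineq4[of "u (t - z /\<^sub>R ?r)" "u t"] e by simp
      next
        case False
        then have "norm (t - z /\<^sub>R ?r - t) < \<delta>" by (simp add: field_simps)
        then show ?thesis using \<delta>(2)[of "t - z /\<^sub>R ?r" t] False by simp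
      qed
      then have "cmod (u (t - z /\<^sub>R ?r) - u t) * gauss 1 z \<le> (e / 2 + 2 * K * indicator (?S n) z) * gauss 1 z"
        using gauss_pos[of 1 z] by (intro mult_right_mono) auto
      then show "norm ((u (t - z /\<^sub>R ?r) - u t) * complex_of_real (gauss 1 z)) \<le> e / 2 * gauss 1 z + 2 * K * (indicator (?S n) z * gauss 1 z)"
        by (simp add: norm_mult abs_of_pos[OF gauss_pos] distrib_right mult.assoc)
    qed
    also have "(LINT z|lborel. e / 2 * gauss 1 z + 2 * K * (indicator (?S n) z * gauss 1 z)) = e / 2 * ?m + 2 * K * (LINT z|lborel. indicator (?S n) z * gauss 1 z)"
    proof -
      have "(LINT z|lborel. e / 2 * gauss 1 z + 2 * K * (indicator (?S n) z * gauss 1 z)) =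
          (LINT (z::real^'d)|lborel. e / 2 * gauss 1 z) + (LINT z|lborel. 2 * K * (indicator (?S n) z * gauss 1 z))"
        by (intro Bochner_Integration.integral_add integrable_mult_right iS integrable_gauss_real zero_less_one)
      then show ?thesis by (simp add: integral_gauss_1)
    qed
    finally have "cmod (moll n u t - u t) \<le> (e / 2 * ?m + 2 * K * (LINT z|lborel. indicator (?S n) z * gauss 1 z)) / ?m"
      using gmass_pos[where 'd='d] by (simp add: divide_right_mono)
    also have "\<dots> = e / 2 + 2 * K / ?m * (LINT z|lborel. indicator (?S n) z * gauss 1 z)"
      using gmass_pos[where 'd='d] by (simp add: add_divide_distrib)
    also have "\<dots> \<le> e" using N[OF n] by simp
    finally show ?thesis .
  qed
  then show ?thesis by blast
qed

text \<open>A common majorant for all n. Where the integrand is nonzero, the norm of t is at most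
  \<open>\<rho>\<close> plus that of z; so half of the exponent of \<open>gauss 1 z\<close> pays for
  decay in t, and the other half stays integrable in z.\<close>

lemma moll_gauss_bound: "\<exists>D. \<forall>n t. cmod (moll n u t) \<le> D * gauss (1/2) t"
proof -
  obtain K \<rho> where K': "K \<ge> 0" "\<rho> \<ge> 0" "\<And>x. cmod (u x) \<le> K" "\<And>x. norm x > \<rho> \<Longrightarrow> u x = 0"
    using Cc_bounded[OF u] by blast
  note K = K'(1,3,2,4)
  let ?s = "1 / sqrt 2"
  let ?I = "LINT z|lborel. gauss ?s (z::real^'d)"
  let ?m = "gmass TYPE('d)"
  have i: "integrable lborel (gauss ?s :: real^'d \<Rightarrow> real)" by (rule integrable_gauss_real) simp
  have "cmod (moll n u t) \<le> K * exp (\<rho>\<^sup>2 / 4) * ?I / ?m * gauss (1/2) t" for n t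
  proof -
    let ?r = "real (Suc n)"
    have "cmod (LINT z|lborel. u (t - z /\<^sub>R ?r) * complex_of_real (gauss 1 z)) \<le> (LINT (z::real^'d)|lborel. K * exp (\<rho>\<^sup>2 / 4) * gauss (1/2) t * gauss ?s z)"
    proof (rule Bochner_Integration.integral_norm_bound_integral[OF integrable_moll])
      show "integrable lborel (\<lambda>z::real^'d. K * exp (\<rho>\<^sup>2 / 4) * gauss (1/2) t * gauss ?s z)" by (rule integrable_mult_right[OF i])
      fix z :: "real^'d"
      show "norm (u (t - z /\<^sub>R ?r) * complex_of_real (gauss 1 z)) \<le> K * exp (\<rho>\<^sup>2 / 4) * gauss (1/2) t * gauss ?s z"
      proof (cases "norm (t - z /\<^sub>R ?r) > \<rho>")
        case True
        then have "u (t - z /\<^sub>R ?r) = 0" by (rule K(4))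
        then show ?thesis using K(1) gauss_pos[of "1/2" t] gauss_pos[of ?s z] by simp
      next
        case False
        have "norm (z /\<^sub>R ?r) \<le> norm z" by (simp add: field_simps mult_left_le)
        then have "norm t \<le> \<rho> + norm z" using False norm_triangle_sub[of t "z /\<^sub>R ?r"] by linarith
        then have "(norm t)\<^sup>2 \<le> (\<rho> + norm z)\<^sup>2" by (intro power_mono) auto
        also have "\<dots> \<le> 2 * \<rho>\<^sup>2 + 2 * (norm z)\<^sup>2" using sum_squares_bound[of \<rho> "norm z"] by (simp add: power2_sum)
        finally have "- (1 * norm z)\<^sup>2 / 2 \<le> \<rho>\<^sup>2 / 4 + (- (1/2 * norm t)\<^sup>2 / 2 + - (?s * norm z)\<^sup>2 / 2)"
          by (simp add: power_mult_distrib power_divide)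
        then have "gauss 1 z \<le> exp (\<rho>\<^sup>2 / 4) * (gauss (1/2) t * gauss ?s z)"
          unfolding gauss_def exp_add[symmetric] by simp
        then have "cmod (u (t - z /\<^sub>R ?r)) * gauss 1 z \<le> K * (exp (\<rho>\<^sup>2 / 4) * (gauss (1/2) t * gauss ?s z))"
          using K(1,2) gauss_pos[of 1 z] by (intro mult_mono) auto
        then show ?thesis by (simp add: norm_mult abs_of_pos[OF gauss_pos] mult.assoc)
      qed
    qed
    then have "cmod (LINT z|lborel. u (t - z /\<^sub>R ?r) * complex_of_real (gauss 1 z)) \<le> K * exp (\<rho>\<^sup>2 / 4) * gauss (1/2) t * ?I" by simp
    from divide_right_mono[OF this, of ?m] show ?thesis
      unfolding moll_def norm_divide using gmass_pos[where 'd='d] by (simp add: mult_ac)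
  qed
  then show ?thesis by blast
qed

lemma moll_L2: "square_integrable (moll n u)" "(\<lambda>n. L2n (\<lambda>t. moll n u t - u t)) \<longlonglongrightarrow> 0"
proof -
  obtain D where D: "\<And>n t. cmod (moll n u t) \<le> D * gauss (1/2) t" using moll_gauss_bound by blast
  have w: "integrable lebesgue (\<lambda>t::real^'d. (D * gauss (1/2) t)\<^sup>2)"
  proof -
    have "integrable lborel (\<lambda>t::real^'d. (D * gauss (1/2) t)\<^sup>2)"
    proof (rule Bochner_Integration.integrable_bound[OF integrable_mult_right[OF integrable_gauss_real[of "1/2"], of "D\<^sup>2"]])
      have "(gauss (1/2) t)\<^sup>2 \<le> gauss (1/2) t" for t :: "real^'d"
        using gauss_pos[of "1/2" t] gauss_le_1[of "1/2" t] by (simp add: power2_eq_square mult_left_le)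
      then show "AE t in lborel. norm ((D * gauss (1/2) (t::real^'d))\<^sup>2) \<le> norm (D\<^sup>2 * gauss (1/2) t)"
        by (intro AE_I2) (simp add: power_mult_distrib abs_mult abs_of_pos[OF gauss_pos] mult_left_mono)
    qed simp_all
    then show ?thesis by (subst integrable_lebesgue_borel) auto
  qed
  have lim: "AE t in lebesgue. (\<lambda>n. moll n u t) \<longlonglongrightarrow> u t"
  proof (intro AE_I2 LIMSEQ_I)
    fix t :: "real^'d" and e :: real assume "e > 0"
    then obtain N where "\<forall>n\<ge>N. \<forall>t. cmod (moll n u t - u t) \<le> e / 2" using moll_uniform[of "e/2"] by auto
    then have "\<forall>n\<ge>N. norm (moll n u t - u t) < e" using \<open>e > 0\<close> by (auto intro: le_less_trans[of _ "e/2"])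
    then show "\<exists>no. \<forall>n\<ge>no. norm (moll n u t - u t) < e" by blast
  qed
  have m: "moll n u \<in> borel_measurable lebesgue" for n by (rule borel_measurable_lebesgueI[OF measurable_moll])
  have d: "AE t in lebesgue. cmod (moll n u t) \<le> D * gauss (1/2) t" for n by (intro AE_I2 D)
  show "square_integrable (moll n u)"
    by (rule L2_dominated_convergence(2)[OF Cc_measurable_lebesgue[OF u] m w lim d])
  show "(\<lambda>n. L2n (\<lambda>t. moll n u t - u t)) \<longlonglongrightarrow> 0"
    by (rule L2_dominated_convergence(3)[OF Cc_measurable_lebesgue[OF u] m w lim d])
qed

lemma moll_convolution:
  "moll n u t = complex_of_real (real (Suc n) ^ CARD('d) / gmass TYPE('d)) * (LINT x|lborel. u x * complex_of_real (gauss (real (Suc n)) (t - x)))"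
proof -
  let ?r = "real (Suc n)"
  \<comment> \<open>The substitution x = t - z / r written as a matrix, so that
    \<open>integral_affine\<close> applies.\<close>
  let ?M = "mat (- 1 / ?r) :: real^'d^'d"
  let ?F = "\<lambda>x. u x * complex_of_real (gauss ?r (t - x))"
  have Mz: "?M *v z = - (z /\<^sub>R ?r)" for z
  proof -
    have "(\<Sum>j\<in>UNIV. (if i = j then c else 0) * z $ j) = c * z $ i" for i and c :: real
      by (simp add: if_distrib[of "\<lambda>x. x * _"] cong: if_cong)
    then show ?thesis by (simp add: vec_eq_iff matrix_vector_mult_def mat_def divide_inverse)
  qed
  have "det ?M = (\<Prod>i\<in>(UNIV::'d set). ?M $ i $ i)" by (rule det_diagonal) (simp add: mat_def)
  then have dM: "det ?M = (- 1 / ?r) ^ CARD('d)" by (simp add: mat_def)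
  have "\<bar>det ?M\<bar> = (1 / ?r) ^ CARD('d)" unfolding dM power_abs by simp
  then have dM': "det ?M \<noteq> 0" "1 / \<bar>det ?M\<bar> = ?r ^ CARD('d)"
    by (auto simp: power_one_over)
  have Fm: "?F \<in> borel_measurable borel" by measurable
  have "(LINT z|lebesgue. ?F (?M *v z + t)) = (1 / \<bar>det ?M\<bar>) *\<^sub>R (LINT x|lebesgue. ?F x)"
    by (rule integral_affine[OF dM'(1) borel_measurable_lebesgueI[OF Fm]])
  moreover have "?F (?M *v z + t) = u (t - z /\<^sub>R ?r) * complex_of_real (gauss 1 z)" for z
    unfolding Mz gauss_def by simp
  moreover have "(\<lambda>z. u (t - z /\<^sub>R ?r) * complex_of_real (gauss 1 z)) \<in> borel_measurable borel" by measurable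
  ultimately have "(LINT z|lborel. u (t - z /\<^sub>R ?r) * complex_of_real (gauss 1 z)) = complex_of_real (?r ^ CARD('d)) * (LINT x|lborel. ?F x)"
    unfolding dM'(2) using integral_lebesgue_borel[OF Fm] integral_lebesgue_borel[of "\<lambda>z. u (t - z /\<^sub>R ?r) * complex_of_real (gauss 1 z)"]
    by (simp add: scaleR_conv_of_real)
  then show ?thesis unfolding moll_def by simp
qed

end

lemma L2n_gauss_shift:
  fixes x :: "real^'d::finite"
  assumes "r > 0"
  shows "L2n (\<lambda>t. complex_of_real (gauss r (t - x))) = L2n (\<lambda>t::real^'d. complex_of_real (gauss r t))"
  using square_integrable_affine(2)[of "mat 1" "\<lambda>t. complex_of_real (gauss r t)" "- x"]
    square_integrable_gauss_shift(1)[OF assms, of "0::real^'d"] by (simp add: L2n_def)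

text \<open>Fubini's theorem is justified by Cauchy-Schwarz: the integral of the modulus of p
  against a translated Gaussian is bounded uniformly in x, since translation preserves the norm, and
  u is integrable.\<close>

lemma convolution_pairing:
  fixes p u :: "real^'d::finite \<Rightarrow> complex"
  assumes p [measurable]: "p \<in> borel_measurable borel" and p2: "square_integrable p" and u: "Cc u" and r: "r > 0"
  shows "(LINT t|lborel. p t * (LINT x|lborel. u x * complex_of_real (gauss r (t - x))))
     = (LINT x|lborel. u x * (LINT t|lborel. p t * complex_of_real (gauss r (t - x))))"
proof -
  have um [measurable]: "u \<in> borel_measurable borel" by (rule Cc_measurable[OF u])
  have ui: "integrable lborel u" using Cc_integrable[OF u] integrable_lebesgue_borel[OF um] by simp
  let ?f = "\<lambda>x t. u x * (p t * complex_of_real (gauss r (t - x)))"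
  let ?Q = "L2n p * L2n (\<lambda>t::real^'d. complex_of_real (gauss r t))"
  have pg_m: "(\<lambda>t. p t * complex_of_real (gauss r (t - x))) \<in> borel_measurable borel" for x by measurable
  have pg: "integrable lborel (\<lambda>t. p t * complex_of_real (gauss r (t - x)))" for x
    using square_integrable_mult_integrable[OF p2 square_integrable_gauss_shift(1)[OF r]]
    unfolding integrable_lebesgue_borel[OF pg_m] .
  have pgn: "(LINT t|lborel. cmod (p t * complex_of_real (gauss r (t - x)))) \<le> ?Q" for x
  proof -
    have "(\<lambda>t. cmod (p t * complex_of_real (gauss r (t - x)))) \<in> borel_measurable borel" by measurable
    from integral_lebesgue_borel[OF this] show ?thesis
      using Cauchy_Schwarz_abs[OF p2 square_integrable_gauss_shift(1)[OF r], of x] L2n_gauss_shift[OF r, of x] by simp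
  qed
  have "integrable (lborel \<Otimes>\<^sub>M lborel) (\<lambda>(x, t). ?f x t)"
  proof (rule lborel_pair.Fubini_integrable)
    show "(\<lambda>(x, t). ?f x t) \<in> borel_measurable (lborel \<Otimes>\<^sub>M lborel)" by measurable
    show "integrable lborel (\<lambda>x. LINT t|lborel. norm (case (x, t) of (x, t) \<Rightarrow> ?f x t))"
    proof (rule Bochner_Integration.integrable_bound[OF integrable_mult_left[OF ui, of ?Q]])
      show "(\<lambda>x. LINT t|lborel. norm (case (x, t) of (x, t) \<Rightarrow> ?f x t)) \<in> borel_measurable lborel" by measurable
      have "norm (LINT t|lborel. norm (?f x t)) \<le> norm (u x * complex_of_real ?Q)" for x
      proof -
        have "(LINT t|lborel. norm (?f x t)) = cmod (u x) * (LINT t|lborel. cmod (p t * complex_of_real (gauss r (t - x))))"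
          unfolding norm_mult[of "u x"] by (rule integral_mult_right_zero)
        also have "\<dots> \<le> cmod (u x) * ?Q" by (rule mult_left_mono[OF pgn]) simp
        finally show ?thesis by (simp add: norm_mult)
      qed
      then show "AE x in lborel. norm (LINT t|lborel. norm (case (x, t) of (x, t) \<Rightarrow> ?f x t)) \<le> norm (u x * complex_of_real ?Q)" by simp
    qed
    show "AE x in lborel. integrable lborel (\<lambda>t. case (x, t) of (x, t) \<Rightarrow> ?f x t)"
      using integrable_mult_right[OF pg] by simp
  qed
  from lborel_pair.Fubini_integral[OF this]
  have "(LINT t|lborel. LINT x|lborel. ?f x t) = (LINT x|lborel. LINT t|lborel. ?f x t)" by simp
  moreover have "(LINT x|lborel. ?f x t) = p t * (LINT x|lborel. u x * complex_of_real (gauss r (t - x)))" for t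
  proof -
    have "?f x t = p t * (u x * complex_of_real (gauss r (t - x)))" for x by (simp only: mult_ac)
    then show ?thesis by (simp only: integral_mult_right_zero)
  qed
  moreover have "(LINT t|lborel. ?f x t) = u x * (LINT t|lborel. p t * complex_of_real (gauss r (t - x)))" for x
    by (rule integral_mult_right_zero)
  ultimately show ?thesis by (simp only:)
qed

text \<open>A mollification of u is a superposition of translates of one Gaussian, so convergence
  against Gaussians passes to it by dominated convergence with majorant
  \<open>C * cmod (u x)\<close>. To return to u itself, the sums E need uniform closeness and the
  integral needs closeness in L^2; mollification provides both.\<close>

lemma weak_limit_from_gauss:
  fixes phi u :: "real^'d::finite \<Rightarrow> complex" and M :: "nat \<Rightarrow> 'i set" and w :: "nat \<Rightarrow> 'i \<Rightarrow> complex" and q :: "nat \<Rightarrow> 'i \<Rightarrow> real^'d"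
  defines "E \<equiv> \<lambda>k F. \<Sum>m\<in>M k. w k m * F (q k m)"
  assumes phi: "square_integrable phi"
    and bound: "\<And>k F b. 0 \<le> b \<Longrightarrow> (\<And>x. cmod (F x) \<le> b) \<Longrightarrow> cmod (E k F) \<le> C * b"
    and gauss: "\<And>r x. r > 0 \<Longrightarrow> (\<lambda>k. E k (\<lambda>t. complex_of_real (gauss r (t - x)))) \<longlonglongrightarrow> (LINT t|lebesgue. phi t * complex_of_real (gauss r (t - x)))"
    and u: "Cc u"
  shows "(\<lambda>k. E k u) \<longlonglongrightarrow> (LINT t|lebesgue. phi t * u t)"
proof -
  have C0: "C \<ge> 0"
    using bound[of 1 "\<lambda>x. 0" 0] by (simp add: E_def)
  have um [measurable]: "u \<in> borel_measurable borel" by (rule Cc_measurable[OF u])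
  have ui: "integrable lborel u" using Cc_integrable[OF u] integrable_lebesgue_borel[OF um] by simp
  have pm: "phi \<in> borel_measurable lebesgue" using phi by (simp add: square_integrable_def)
  obtain p where p [measurable]: "p \<in> borel_measurable borel" and pe: "AE x in lebesgue. phi x = p x"
    using lebesgue_borel_representative[OF pm] by blast
  have p2: "square_integrable p" by (rule square_integrable_AE_cong(1)[OF phi pe])
  have phi_p: "(LINT t|lebesgue. phi t * v t) = (LINT t|lborel. p t * v t)"
    if v [measurable]: "v \<in> borel_measurable borel" for v :: "real^'d \<Rightarrow> complex"
  proof -
    have "(LINT t|lebesgue. phi t * v t) = (LINT t|lebesgue. p t * v t)"
      using pm borel_measurable_lebesgueI[OF v] borel_measurable_lebesgueI[OF p]
      by (intro integral_cong_AE) (auto intro: eventually_mono[OF pe])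
    also have "\<dots> = (LINT t|lborel. p t * v t)" by (rule integral_lebesgue_borel) measurable
    finally show ?thesis .
  qed
  have step1: "(\<lambda>k. E k (moll n u)) \<longlonglongrightarrow> (LINT t|lebesgue. phi t * moll n u t)" for n
  proof -
    let ?r = "real (Suc n)" and ?c = "complex_of_real (real (Suc n) ^ CARD('d) / gmass TYPE('d))"
    let ?g = "\<lambda>x t. complex_of_real (gauss ?r (t - x))"
    have r: "?r > 0" by simp
    have gx_i: "integrable lborel (\<lambda>x. u x * ?g x t)" for t
      by (rule Bochner_Integration.integrable_bound[OF ui])
         (auto simp: norm_mult abs_of_pos[OF gauss_pos] intro!: AE_I2 mult_left_le gauss_le_1)
    have Ek: "E k (moll n u) = ?c * (LINT x|lborel. u x * E k (?g x))" for k
    proof -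
      have "E k (moll n u) = (\<Sum>m\<in>M k. w k m * (?c * (LINT x|lborel. u x * ?g x (q k m))))"
        unfolding E_def moll_convolution[OF u] ..
      also have "\<dots> = ?c * (\<Sum>m\<in>M k. w k m * (LINT x|lborel. u x * ?g x (q k m)))"
        by (simp only: sum_distrib_left mult_ac)
      also have "(\<Sum>m\<in>M k. w k m * (LINT x|lborel. u x * ?g x (q k m))) = (\<Sum>m\<in>M k. (LINT x|lborel. w k m * (u x * ?g x (q k m))))"
        by (simp only: integral_mult_right_zero)
      also have "\<dots> = (LINT x|lborel. (\<Sum>m\<in>M k. w k m * (u x * ?g x (q k m))))"
        by (rule Bochner_Integration.integral_sum[symmetric]) (rule integrable_mult_right[OF gx_i])
      also have "\<dots> = (LINT x|lborel. u x * E k (?g x))"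
        unfolding E_def sum_distrib_left by (simp only: mult_ac)
      finally show ?thesis .
    qed
    have "(\<lambda>k. LINT x|lborel. u x * E k (?g x)) \<longlonglongrightarrow> (LINT x|lborel. u x * (LINT t|lborel. p t * ?g x t))"
    proof (rule integral_dominated_convergence[where w="\<lambda>x. C * cmod (u x)"])
      show "integrable lborel (\<lambda>x. C * cmod (u x))" using ui by (intro integrable_mult_right integrable_norm)
      show "AE x in lborel. (\<lambda>k. u x * E k (?g x)) \<longlonglongrightarrow> u x * (LINT t|lborel. p t * ?g x t)"
      proof (intro AE_I2 tendsto_mult tendsto_const)
        fix x :: "real^'d"
        have "(LINT t|lebesgue. phi t * ?g x t) = (LINT t|lborel. p t * ?g x t)" by (rule phi_p) measurable
        then show "(\<lambda>k. E k (?g x)) \<longlonglongrightarrow> (LINT t|lborel. p t * ?g x t)" using gauss[OF r, of x] by simp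
      qed
      show "AE x in lborel. norm (u x * E k (?g x)) \<le> C * cmod (u x)" for k
      proof (rule AE_I2)
        fix x :: "real^'d"
        have "cmod (E k (?g x)) \<le> C * 1" by (rule bound) (auto simp: abs_of_pos[OF gauss_pos] gauss_le_1)
        from mult_left_mono[OF this, of "cmod (u x)"] show "norm (u x * E k (?g x)) \<le> C * cmod (u x)"
          by (simp add: norm_mult mult.commute)
      qed
      show "(\<lambda>x. u x * E k (?g x)) \<in> borel_measurable lborel" for k unfolding E_def by measurable
      show "(\<lambda>x. u x * (LINT t|lborel. p t * ?g x t)) \<in> borel_measurable lborel" by measurable
    qed
    from tendsto_mult[OF tendsto_const[of ?c] this]
    have "(\<lambda>k. E k (moll n u)) \<longlonglongrightarrow> ?c * (LINT x|lborel. u x * (LINT t|lborel. p t * ?g x t))" unfolding Ek .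
    also have "?c * (LINT x|lborel. u x * (LINT t|lborel. p t * ?g x t)) = ?c * (LINT t|lborel. p t * (LINT x|lborel. u x * ?g x t))"
      unfolding convolution_pairing[OF p p2 u r] ..
    also have "\<dots> = (LINT t|lborel. ?c * (p t * (LINT x|lborel. u x * ?g x t)))" by (simp only: integral_mult_right_zero)
    also have "\<dots> = (LINT t|lborel. p t * moll n u t)"
      unfolding moll_convolution[OF u] by (simp only: mult_ac)
    also have "\<dots> = (LINT t|lebesgue. phi t * moll n u t)" by (rule phi_p[symmetric]) (rule measurable_moll[OF u])
    finally show ?thesis .
  qed
  show ?thesis
  proof (rule LIMSEQ_I)
    fix e :: real assume e: "e > 0"
    \<comment> \<open>This makes the uniform error, multiplied by the total variation bound C, at
      most e / 4; adding 1 avoids division by 0.\<close>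
    define \<eta> where "\<eta> = e / (4 * (C + 1))"
    have eta: "\<eta> > 0" "C * \<eta> \<le> e / 4" using e C0 by (auto simp: \<eta>_def field_simps)
    obtain N1 where N1: "\<And>n t. n \<ge> N1 \<Longrightarrow> cmod (moll n u t - u t) \<le> \<eta>" using moll_uniform[OF u eta(1)] by blast
    have "(\<lambda>n. L2n phi * L2n (\<lambda>t. moll n u t - u t)) \<longlonglongrightarrow> 0"
      using tendsto_mult[OF tendsto_const[of "L2n phi"] moll_L2(2)[OF u]] by simp
    from order_tendstoD(2)[OF this, of "e/4"] e
    obtain N2 where N2: "\<And>n. n \<ge> N2 \<Longrightarrow> L2n phi * L2n (\<lambda>t. moll n u t - u t) < e / 4"
      unfolding eventually_sequentially by auto
    define n where "n = max N1 N2"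
    have n1: "cmod (moll n u t - u t) \<le> \<eta>" for t using N1[of n t] by (simp add: n_def)
    have n2: "L2n phi * L2n (\<lambda>t. moll n u t - u t) < e / 4" using N2[of n] by (simp add: n_def)
    have e4: "e / 4 > 0" using e by simp
    obtain k0 where k0: "\<And>k. k \<ge> k0 \<Longrightarrow> cmod (E k (moll n u) - (LINT t|lebesgue. phi t * moll n u t)) < e / 4"
      using LIMSEQ_D[OF step1[of n] e4] by blast
    have su: "square_integrable u" by (rule Cc_square_integrable[OF u])
    have "(LINT t|lebesgue. phi t * moll n u t) - (LINT t|lebesgue. phi t * u t) = (LINT t|lebesgue. phi t * (moll n u t - u t))"
      unfolding right_diff_distrib
      by (rule Bochner_Integration.integral_diff[symmetric]) (intro square_integrable_mult_integrable phi su moll_L2(1)[OF u])+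
    then have b3: "cmod ((LINT t|lebesgue. phi t * moll n u t) - (LINT t|lebesgue. phi t * u t)) < e / 4"
      using Cauchy_Schwarz_integral[OF phi square_integrable_diff[OF moll_L2(1)[OF u, of n] su]] n2 by simp
    have "cmod (E k u - (LINT t|lebesgue. phi t * u t)) < e" if "k \<ge> k0" for k
    proof -
      have "E k (moll n u) - E k u = E k (\<lambda>t. moll n u t - u t)"
        unfolding E_def by (simp add: sum_subtractf right_diff_distrib)
      then have b1: "cmod (E k (moll n u) - E k u) \<le> e / 4"
        using bound[of \<eta> "\<lambda>t. moll n u t - u t" k] n1 eta by simp
      have tri: "cmod (Y - V) \<le> cmod (X - Y) + cmod (X - Z) + cmod (Z - V)" for X Y Z V :: complex
      proof -
        have "Y - V = - (X - Y) + (X - Z) + (Z - V)" by simp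
        also have "cmod \<dots> \<le> cmod (- (X - Y) + (X - Z)) + cmod (Z - V)" by (rule norm_triangle_ineq)
        also have "cmod (- (X - Y) + (X - Z)) \<le> cmod (X - Y) + cmod (X - Z)"
          using norm_triangle_ineq[of "- (X - Y)" "X - Z"] unfolding norm_minus_cancel .
        finally show ?thesis by simp
      qed
      from tri[of "E k u" "LINT t|lebesgue. phi t * u t" "E k (moll n u)" "LINT t|lebesgue. phi t * moll n u t"]
      show ?thesis using b1 b3 k0[OF that] e by linarith
    qed
    then show "\<exists>no. \<forall>k\<ge>no. norm (E k u - (LINT t|lebesgue. phi t * u t)) < e" by blast
  qed
qed

section \<open>The cascade of a refinement mask\<close>

lemma finite_Lambda0: "finite (Lambda0 N0 :: (real^'d::finite) set)"
  unfolding Lambda0_def by (rule finite_Zd_bounded)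

lemma Lambda0_Zd: "Lambda0 N0 \<subseteq> Zd"
  by (auto simp: Lambda0_def)

lemma mat_pow_Suc_vec: "mat_pow M (Suc k) *v x = mat_pow M k *v (M *v x)"
  by (simp add: mat_pow_vec funpow_swap1)

locale mask =
  fixes A :: "real^'d::finite^'d" and h :: "real^'d \<Rightarrow> complex" and N0 :: nat
  assumes A_int: "integral_matrix A" and detA: "\<bar>det A\<bar> = 2"
    and decay: "\<And>x. summable (\<lambda>k. norm (mat_pow (matrix_inv A) k *v x))"
    and h_supp: "\<And>n. n \<notin> Lambda0 N0 \<Longrightarrow> h n = 0"
    and h_orth: "\<And>k. k \<in> (*v) A ` Zd \<Longrightarrow> (\<Sum>n\<in>Lambda0 N0. h n * cnj (h (n + k))) = (if k = 0 then 1 else 0)"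
    and h_sum: "(\<Sum>n\<in>Lambda0 N0. h n) = complex_of_real (sqrt 2)"
begin

abbreviation C where "C \<equiv> matrix_inv A"
abbreviation \<Lambda> where "\<Lambda> \<equiv> Lambda0 N0 :: (real^'d) set"
abbreviation s2 :: complex where "s2 \<equiv> complex_of_real (sqrt 2)"

lemma dA: "det A \<noteq> 0" using detA by auto

text \<open>\<open>ak k\<close> are the coefficients of the k-fold iterate of the refinement equation, and the finite set \<open>Mk k\<close> contains their support.\<close>

primrec ak :: "nat \<Rightarrow> real^'d \<Rightarrow> complex" where
  "ak 0 = (\<lambda>m. if m = 0 then 1 else 0)"
| "ak (Suc k) = (\<lambda>m. \<Sum>n\<in>\<Lambda>. h n * ak k (C *v (m - n)))"

primrec Mk :: "nat \<Rightarrow> (real^'d) set" where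
  "Mk 0 = {0}"
| "Mk (Suc k) = (\<lambda>(m, n). A *v m + n) ` (Mk k \<times> \<Lambda>)"

lemma finite_Mk: "finite (Mk k)"
  by (induction k) (auto simp: finite_Lambda0)

lemma Mk_Zd: "m \<in> Mk k \<Longrightarrow> m \<in> Zd"
proof (induction k arbitrary: m)
  case (Suc k)
  then obtain p n where pn: "p \<in> Mk k" "n \<in> \<Lambda>" "m = A *v p + n" by auto
  show ?case unfolding pn(3)
    by (intro Zd_add Zd_integral_matrix[OF A_int] Suc.IH[OF pn(1)] subsetD[OF Lambda0_Zd pn(2)])
qed simp

lemma ak_Mk: "m \<notin> Mk k \<Longrightarrow> ak k m = 0"
proof (induction k arbitrary: m)
  case (Suc k)
  have "h n * ak k (C *v (m - n)) = 0" if n: "n \<in> \<Lambda>" for n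
  proof -
    have "C *v (m - n) \<notin> Mk k"
    proof
      assume "C *v (m - n) \<in> Mk k"
      then have "(\<lambda>(m, n). A *v m + n) (C *v (m - n), n) \<in> Mk (Suc k)" using n unfolding Mk.simps by blast
      then show False using Suc.prems by (simp add: matrix_inv_invertible[OF dA])
    qed
    then show ?thesis using Suc.IH by simp
  qed
  then show ?case unfolding ak.simps by (intro sum.neutral ballI)
qed simp

text \<open>A point of \<open>Mk (Suc k)\<close> may come from several pairs (p, n). The coefficient
  \<open>ak\<close> adds up their contributions, so the sum may be taken over pairs instead.\<close>

lemma sum_ak_Suc:
  "(\<Sum>m\<in>Mk (Suc k). ak (Suc k) m * F m) = (\<Sum>n\<in>\<Lambda>. \<Sum>p\<in>Mk k. h n * ak k p * F (A *v p + n))"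
proof -
  have "(\<Sum>m\<in>Mk (Suc k). ak (Suc k) m * F m) = (\<Sum>m\<in>Mk (Suc k). \<Sum>n\<in>\<Lambda>. h n * ak k (C *v (m - n)) * F m)"
    by (simp only: ak.simps sum_distrib_right)
  also have "\<dots> = (\<Sum>n\<in>\<Lambda>. \<Sum>m\<in>Mk (Suc k). h n * ak k (C *v (m - n)) * F m)" by (rule sum.swap)
  also have "\<dots> = (\<Sum>n\<in>\<Lambda>. \<Sum>p\<in>Mk k. h n * ak k p * F (A *v p + n))"
  proof (rule sum.cong[OF refl])
    fix n assume n: "n \<in> \<Lambda>"
    have inj: "inj_on (\<lambda>p. A *v p + n) (Mk k)"
      by (rule inj_onI) (metis add_right_cancel matrix_inv_invertible(4)[OF dA])
    have "(\<Sum>m\<in>Mk (Suc k). h n * ak k (C *v (m - n)) * F m) = (\<Sum>m\<in>(\<lambda>p. A *v p + n) ` Mk k. h n * ak k (C *v (m - n)) * F m)"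
    proof (rule sum.mono_neutral_right)
      show "(\<lambda>p. A *v p + n) ` Mk k \<subseteq> Mk (Suc k)" using n by force
      show "\<forall>m\<in>Mk (Suc k) - (\<lambda>p. A *v p + n) ` Mk k. h n * ak k (C *v (m - n)) * F m = 0"
      proof
        fix m assume m: "m \<in> Mk (Suc k) - (\<lambda>p. A *v p + n) ` Mk k"
        have "m = A *v (C *v (m - n)) + n" by (simp add: matrix_inv_invertible[OF dA])
        then have "C *v (m - n) \<notin> Mk k" using m by blast
        then show "h n * ak k (C *v (m - n)) * F m = 0" by (simp add: ak_Mk)
      qed
    qed (rule finite_Mk)
    also have "\<dots> = (\<Sum>p\<in>Mk k. h n * ak k p * F (A *v p + n))"
      by (subst sum.reindex[OF inj]) (simp add: matrix_inv_invertible[OF dA])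
    finally show "(\<Sum>m\<in>Mk (Suc k). h n * ak k (C *v (m - n)) * F m) = (\<Sum>p\<in>Mk k. h n * ak k p * F (A *v p + n))" .
  qed
  finally show ?thesis .
qed

lemma ak_Suc_eq: "ak (Suc k) m = (\<Sum>p\<in>Mk k. h (m - A *v p) * ak k p)"
proof -
  let ?f = "\<lambda>n. h n * ak k (C *v (m - n))" and ?X = "(\<lambda>p. m - A *v p) ` Mk k"
  have inj: "inj_on (\<lambda>p. m - A *v p) (Mk k)"
    by (rule inj_onI) (metis diff_left_imp_eq matrix_inv_invertible(4)[OF dA])
  have "sum ?f \<Lambda> = sum ?f (\<Lambda> \<union> ?X)"
    by (rule sum.mono_neutral_left) (auto simp: finite_Lambda0 finite_Mk h_supp)
  also have "\<dots> = sum ?f ?X"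
  proof (rule sum.mono_neutral_right)
    show "\<forall>n\<in>\<Lambda> \<union> ?X - ?X. ?f n = 0"
    proof
      fix n assume n: "n \<in> \<Lambda> \<union> ?X - ?X"
      have "n = m - A *v (C *v (m - n))" by (simp add: matrix_inv_invertible[OF dA])
      then have "C *v (m - n) \<notin> Mk k" using n by blast
      then show "?f n = 0" by (simp add: ak_Mk)
    qed
  qed (auto simp: finite_Lambda0 finite_Mk)
  also have "\<dots> = (\<Sum>p\<in>Mk k. h (m - A *v p) * ak k p)"
    by (subst sum.reindex[OF inj]) (simp add: matrix_inv_invertible[OF dA])
  finally show ?thesis by simp
qed

text \<open>Expanding one factor by \<open>sum_ak_Suc\<close> and its conjugate by
  \<open>ak_Suc_eq\<close> brings out the correlation of h at \<open>A *v (p - p')\<close>, where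
  the orthogonality relation gives a Kronecker delta.\<close>

lemma ak_norm: "(\<Sum>m\<in>Mk k. (cmod (ak k m))\<^sup>2) = 1"
proof (induction k)
  case (Suc k)
  have "complex_of_real (\<Sum>m\<in>Mk (Suc k). (cmod (ak (Suc k) m))\<^sup>2) = (\<Sum>m\<in>Mk (Suc k). ak (Suc k) m * cnj (ak (Suc k) m))"
    by (simp only: of_real_sum complex_norm_square)
  also have "\<dots> = (\<Sum>n\<in>\<Lambda>. \<Sum>p\<in>Mk k. h n * ak k p * cnj (ak (Suc k) (A *v p + n)))"
    by (rule sum_ak_Suc)
  also have "\<dots> = (\<Sum>n\<in>\<Lambda>. \<Sum>p\<in>Mk k. \<Sum>p'\<in>Mk k. ak k p * cnj (ak k p') * (h n * cnj (h (n + A *v (p - p')))))"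
    unfolding ak_Suc_eq by (simp add: sum_distrib_left matrix_vector_mult_diff_distrib algebra_simps)
  also have "\<dots> = (\<Sum>p\<in>Mk k. \<Sum>p'\<in>Mk k. \<Sum>n\<in>\<Lambda>. ak k p * cnj (ak k p') * (h n * cnj (h (n + A *v (p - p')))))"
    by (subst sum.swap, rule sum.cong[OF refl], rule sum.swap)
  also have "\<dots> = (\<Sum>p\<in>Mk k. \<Sum>p'\<in>Mk k. if p' = p then ak k p * cnj (ak k p') else 0)"
  proof (intro sum.cong refl)
    fix p p' assume p: "p \<in> Mk k" "p' \<in> Mk k"
    then have "A *v (p - p') \<in> (*v) A ` Zd" using Zd_diff Mk_Zd by blast
    moreover have "A *v (p - p') = 0 \<longleftrightarrow> p' = p"
      using matrix_inv_invertible(4)[OF dA, of "p - p'"] by auto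
    ultimately have "(\<Sum>n\<in>\<Lambda>. h n * cnj (h (n + A *v (p - p')))) = (if p' = p then 1 else 0)"
      using h_orth by simp
    then show "(\<Sum>n\<in>\<Lambda>. ak k p * cnj (ak k p') * (h n * cnj (h (n + A *v (p - p'))))) = (if p' = p then ak k p * cnj (ak k p') else 0)"
      by (simp add: sum_distrib_left[symmetric])
  qed
  also have "\<dots> = (\<Sum>p\<in>Mk k. ak k p * cnj (ak k p))"
    by (simp add: finite_Mk)
  also have "\<dots> = complex_of_real (\<Sum>p\<in>Mk k. (cmod (ak k p))\<^sup>2)"
    by (simp only: of_real_sum complex_norm_square)
  finally show ?case using Suc.IH by (simp only: of_real_eq_iff)
qed simp

definition wk :: "nat \<Rightarrow> real^'d \<Rightarrow> complex" where "wk k m = ak k m / s2 ^ k"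
definition E :: "nat \<Rightarrow> (real^'d \<Rightarrow> complex) \<Rightarrow> complex" where
  "E k F = (\<Sum>m\<in>Mk k. wk k m * F (mat_pow C k *v m))"

lemma E_0: "E 0 F = F 0"
  by (simp add: E_def wk_def)

text \<open>The step at the fine end: each atom is split by displacements of size A^(-k-1). This is
  the form that multiplies the Fourier transform by one more factor.\<close>

lemma E_Suc: "E (Suc k) F = (\<Sum>n\<in>\<Lambda>. h n / s2 * E k (\<lambda>x. F (x + mat_pow C (Suc k) *v n)))"
proof -
  have "E (Suc k) F = (\<Sum>m\<in>Mk (Suc k). ak (Suc k) m * (F (mat_pow C (Suc k) *v m) / s2 ^ Suc k))"
    by (simp add: E_def wk_def)
  also have "\<dots> = (\<Sum>n\<in>\<Lambda>. \<Sum>p\<in>Mk k. h n * ak k p * (F (mat_pow C (Suc k) *v (A *v p + n)) / s2 ^ Suc k))"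
    by (rule sum_ak_Suc)
  also have "\<dots> = (\<Sum>n\<in>\<Lambda>. h n / s2 * E k (\<lambda>x. F (x + mat_pow C (Suc k) *v n)))"
  proof (rule sum.cong[OF refl])
    fix n
    have "mat_pow C (Suc k) *v (A *v p + n) = mat_pow C k *v p + mat_pow C (Suc k) *v n" for p
      by (simp add: matrix_vector_right_distrib) (simp add: mat_pow_Suc_vec matrix_inv_invertible[OF dA])
    then show "(\<Sum>p\<in>Mk k. h n * ak k p * (F (mat_pow C (Suc k) *v (A *v p + n)) / s2 ^ Suc k)) = h n / s2 * E k (\<lambda>x. F (x + mat_pow C (Suc k) *v n))"
      by (simp add: E_def wk_def sum_distrib_left mult.assoc)
  qed
  finally show ?thesis .
qed

text \<open>The cascade measure is an iterated convolution, so a step may be inserted at the coarse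
  end as well. This form turns into the refinement equation in the limit.\<close>

lemma E_Suc': "E (Suc k) F = (\<Sum>n\<in>\<Lambda>. h n / s2 * E k (\<lambda>x. F (C *v (x + n))))"
proof (induction k arbitrary: F)
  case 0
  show ?case unfolding E_Suc E_0 by (simp add: mat_pow_Suc)
next
  case (Suc k)
  have "E (Suc (Suc k)) F = (\<Sum>n\<in>\<Lambda>. h n / s2 * (\<Sum>n'\<in>\<Lambda>. h n' / s2 * E k (\<lambda>x. F (C *v (x + n') + mat_pow C (Suc (Suc k)) *v n))))"
    unfolding E_Suc[of "Suc k"] Suc.IH ..
  also have "\<dots> = (\<Sum>n\<in>\<Lambda>. \<Sum>n'\<in>\<Lambda>. h n' / s2 * (h n / s2 * E k (\<lambda>x. F (C *v (x + mat_pow C (Suc k) *v n + n')))))"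
    unfolding sum_distrib_left
  proof (intro sum.cong refl)
    fix n n'
    have "C *v (x + n') + mat_pow C (Suc (Suc k)) *v n = C *v (x + mat_pow C (Suc k) *v n + n')" for x
      by (simp add: mat_pow_Suc[of C "Suc k"] matrix_vector_mul_assoc[symmetric] matrix_vector_right_distrib add_ac)
    then show "h n / s2 * (h n' / s2 * E k (\<lambda>x. F (C *v (x + n') + mat_pow C (Suc (Suc k)) *v n))) =
        h n' / s2 * (h n / s2 * E k (\<lambda>x. F (C *v (x + mat_pow C (Suc k) *v n + n'))))"
      by (simp only: mult.left_commute)
  qed
  also have "\<dots> = (\<Sum>n'\<in>\<Lambda>. \<Sum>n\<in>\<Lambda>. h n' / s2 * (h n / s2 * E k (\<lambda>x. F (C *v (x + mat_pow C (Suc k) *v n + n')))))"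
    by (rule sum.swap)
  also have "\<dots> = (\<Sum>n'\<in>\<Lambda>. h n' / s2 * E (Suc k) (\<lambda>x. F (C *v (x + n'))))"
    unfolding E_Suc[of k] sum_distrib_left ..
  finally show ?case .
qed

lemma E_1: "E k (\<lambda>x. 1) = 1"
proof (induction k)
  case (Suc k)
  have "E (Suc k) (\<lambda>x. 1) = (\<Sum>n\<in>\<Lambda>. h n) / s2" unfolding E_Suc Suc.IH by (simp add: sum_divide_distrib)
  then show ?case unfolding h_sum by simp
qed (simp add: E_0)

definition Rs :: real where "Rs = (\<Sum>j. \<Sum>n\<in>\<Lambda>. norm (mat_pow C j *v n))"

lemma summable_Rs: "summable (\<lambda>j. \<Sum>n\<in>\<Lambda>. norm (mat_pow C j *v n))"
  by (intro summable_sum decay)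

text \<open>Unrolling the recursion writes the atom as a sum of vectors A^(-j) n_j with each n_j in
  the mask support, and the decay of the inverse powers makes all such sums uniformly
  bounded.\<close>

lemma Mk_support:
  assumes "m \<in> Mk k"
  shows "norm (mat_pow C k *v m) \<le> Rs"
proof -
  have "norm (mat_pow C k *v m) \<le> (\<Sum>j<Suc k. \<Sum>n\<in>\<Lambda>. norm (mat_pow C j *v n))"
    using assms
  proof (induction k arbitrary: m)
    case 0
    then show ?case by (simp add: sum_nonneg)
  next
    case (Suc k)
    then obtain p n where pn: "p \<in> Mk k" "n \<in> \<Lambda>" "m = A *v p + n" by auto
    have "mat_pow C (Suc k) *v m = mat_pow C k *v p + mat_pow C (Suc k) *v n"
      unfolding pn(3) by (simp add: matrix_vector_right_distrib) (simp add: mat_pow_Suc_vec matrix_inv_invertible[OF dA])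
    then have "norm (mat_pow C (Suc k) *v m) \<le> norm (mat_pow C k *v p) + norm (mat_pow C (Suc k) *v n)"
      using norm_triangle_ineq by metis
    also have "norm (mat_pow C (Suc k) *v n) \<le> (\<Sum>n\<in>\<Lambda>. norm (mat_pow C (Suc k) *v n))"
      by (rule member_le_sum[OF pn(2), of "\<lambda>n. norm (mat_pow C (Suc k) *v n)"]) (auto simp: finite_Lambda0)
    finally show ?case using Suc.IH[OF pn(1)] by simp
  qed
  also have "\<dots> \<le> Rs" unfolding Rs_def by (rule sum_le_suminf[OF summable_Rs]) (auto intro: sum_nonneg)
  finally show ?thesis .
qed

lemma Rs_nonneg: "Rs \<ge> 0"
  unfolding Rs_def by (rule suminf_nonneg[OF summable_Rs]) (auto intro: sum_nonneg)

text \<open>The unit cells at the points of \<open>Mk k\<close> are disjoint, and \<open>A\<^bsup>-k\<^esup>\<close> maps them into a fixed ball.\<close>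

lemma card_Mk_bound: "\<exists>K\<ge>0. \<forall>k. real (card (Mk k)) \<le> K * 2 ^ k"
proof -
  obtain D where D: "D \<ge> 0" "\<And>k. col_sum (mat_pow C k) \<le> D" using col_sum_bounded[OF decay] by blast
  let ?B = "cball (0::real^'d) (Rs + D)"
  let ?K = "LINT t|lebesgue. 1 * indicator ?B t :: real"
  have "real (card (Mk k)) \<le> ?K * 2 ^ k" for k
  proof -
    let ?F = "\<lambda>l. indicator (Mk k) l :: real"
    have sub: "Mk k \<subseteq> Zd" using Mk_Zd by blast
    have "integrable lebesgue (\<lambda>t. ?F (vfloor t)) \<and> (LINT t|lebesgue. ?F (vfloor t)) = (\<Sum>l\<in>Mk k. ?F l)"
      by (intro conjI integral_step_function[OF finite_Mk sub]) auto
    then have step: "integrable lebesgue (\<lambda>t. ?F (vfloor t))" "(LINT t|lebesgue. ?F (vfloor t)) = (\<Sum>l\<in>Mk k. ?F l)"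
      by blast+
    have m: "(\<lambda>t. ?F (vfloor t)) \<in> borel_measurable lebesgue" using step(1) by auto
    have dk: "det (mat_pow A k) \<noteq> 0" "\<bar>det (mat_pow A k)\<bar> = 2 ^ k"
      using dA detA by (auto simp: det_mat_pow power_abs)
    have "real (card (Mk k)) = 2 ^ k * (LINT t|lebesgue. ?F (vfloor (mat_pow A k *v t)))"
      using integral_affine[OF dk(1) m, of 0] dk(2) step(2) by simp
    also have "(LINT t|lebesgue. ?F (vfloor (mat_pow A k *v t))) \<le> ?K"
    proof (rule integral_mono)
      show "integrable lebesgue (\<lambda>t. ?F (vfloor (mat_pow A k *v t)))" using integrable_affine[OF dk(1) m, of 0] step(1) by simp
      show "integrable lebesgue (\<lambda>t. 1 * indicator ?B t :: real)" by (rule integrable_indicator_cball)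
      fix t :: "real^'d"
      show "?F (vfloor (mat_pow A k *v t)) \<le> 1 * indicator ?B t"
      proof (cases "vfloor (mat_pow A k *v t) \<in> Mk k")
        case True
        let ?q = "mat_pow A k *v t - vfloor (mat_pow A k *v t)"
        have t: "t = mat_pow C k *v vfloor (mat_pow A k *v t) + mat_pow C k *v ?q"
          by (simp add: matrix_vector_mult_diff_distrib mat_pow_inverse[OF dA])
        have "norm (mat_pow C k *v ?q) \<le> 1 * col_sum (mat_pow C k)"
          using vfloor_frac[of "mat_pow A k *v t"] by (intro norm_matrix_vector_le_col_sum) (simp add: abs_le_iff)
        then have "norm t \<le> Rs + D"
          using Mk_support[OF True] D(2)[of k] norm_triangle_ineq[of "mat_pow C k *v vfloor (mat_pow A k *v t)" "mat_pow C k *v ?q"] t by simp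
        then show ?thesis by (simp add: indicator_def)
      qed simp
    qed
    finally show ?thesis by (simp add: mult.commute)
  qed
  moreover have "?K \<ge> 0" by simp
  ultimately show ?thesis by blast
qed

text \<open>By Cauchy-Schwarz the l^1 norm of \<open>ak k\<close> is at most the root of the number
  of atoms; the resulting \<open>sqrt 2 ^ k\<close> is cancelled by the normalisation in
  \<open>wk\<close>.\<close>

lemma E_bound: "\<exists>K\<ge>0. \<forall>k F b. 0 \<le> b \<longrightarrow> (\<forall>x. cmod (F x) \<le> b) \<longrightarrow> cmod (E k F) \<le> K * b"
proof -
  obtain K where K: "K \<ge> 0" "\<And>k. real (card (Mk k)) \<le> K * 2 ^ k" using card_Mk_bound by blast
  have tv: "(\<Sum>m\<in>Mk k. cmod (wk k m)) \<le> sqrt K" for k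
  proof -
    have "(\<Sum>m\<in>Mk k. \<bar>cmod (ak k m)\<bar> * \<bar>1\<bar>) \<le> L2_set (\<lambda>m. cmod (ak k m)) (Mk k) * L2_set (\<lambda>m. 1) (Mk k)"
      by (rule L2_set_mult_ineq)
    also have "\<dots> = sqrt (real (card (Mk k)))" by (simp add: L2_set_def ak_norm)
    also have "\<dots> \<le> sqrt (K * 2 ^ k)" using K(2) by simp
    also have "\<dots> = sqrt K * sqrt 2 ^ k" by (simp add: real_sqrt_mult real_sqrt_power)
    finally have "(\<Sum>m\<in>Mk k. cmod (ak k m)) / sqrt 2 ^ k \<le> sqrt K" by (simp add: divide_le_eq)
    then show ?thesis by (simp add: wk_def norm_divide norm_power sum_divide_distrib)
  qed
  have "cmod (E k F) \<le> sqrt K * b" if b: "0 \<le> b" "\<forall>x. cmod (F x) \<le> b" for k F b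
  proof -
    have "cmod (E k F) \<le> (\<Sum>m\<in>Mk k. cmod (wk k m) * b)"
      unfolding E_def by (rule sum_norm_le) (use b in \<open>auto simp: norm_mult intro: mult_left_mono\<close>)
    also have "\<dots> \<le> sqrt K * b" unfolding sum_distrib_right[symmetric] by (rule mult_right_mono[OF tv b(1)])
    finally show ?thesis .
  qed
  moreover have "sqrt K \<ge> 0" using K(1) by simp
  ultimately show ?thesis by blast
qed

end

lemma inner_mat_pow_transpose:
  fixes M :: "real^'d::finite^'d"
  shows "(mat_pow (transpose M) k *v y) \<bullet> x = y \<bullet> (mat_pow M k *v x)"
proof (induction k arbitrary: x)
  case (Suc k)
  have t: "(transpose M *v z) \<bullet> x = z \<bullet> (M *v x)" for z x
    by (simp add: transpose_matrix_vector dot_lmul_matrix)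
  have "(mat_pow (transpose M) (Suc k) *v y) \<bullet> x = (mat_pow (transpose M) k *v y) \<bullet> (M *v x)"
    by (simp only: mat_pow_Suc matrix_vector_mul_assoc[symmetric] t)
  then show ?case by (simp only: Suc.IH mat_pow_Suc_vec)
qed simp

lemma matrix_inv_transpose:
  fixes M :: "real^'d::finite^'d"
  assumes "det M \<noteq> 0"
  shows "matrix_inv (transpose M) = transpose (matrix_inv M)"
proof -
  have d: "det (transpose M) \<noteq> 0" using assms by simp
  have "transpose M ** transpose (matrix_inv M) = mat 1"
    unfolding matrix_transpose_mul[symmetric] matrix_inv_invertible[OF assms] by simp
  then have "matrix_inv (transpose M) ** (transpose M ** transpose (matrix_inv M)) = matrix_inv (transpose M)" by simp
  then show ?thesis unfolding matrix_mul_assoc matrix_inv_invertible[OF d] by simp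
qed

section \<open>Orthogonality of exponentials on the cube\<close>

lemma
  assumes l: "l \<in> \<int>"
  shows integrable_exp_interval: "integrable lborel (\<lambda>x. indicator {-pi..pi} x * iexp (- (l * x)))"
    and integral_exp_interval: "(LINT x|lborel. indicator {-pi..pi} x * iexp (- (l * x))) = (if l = 0 then complex_of_real (2 * pi) else 0)"
proof -
  have "integrable lborel (\<lambda>x::real. indicator {-pi..pi} x *\<^sub>R iexp (- (l * x)))"
    by (rule borel_integrable_compact) (auto intro!: continuous_intros)
  then show "integrable lborel (\<lambda>x. indicator {-pi..pi} x * iexp (- (l * x)))"
    by (simp add: scaleR_conv_of_real of_real_indicator)
  have e: "(LINT x|lborel. indicator {-pi..pi} x * iexp (- (l * x))) = (LINT x|lborel. indicator {-pi..pi} x *\<^sub>R iexp (- (l * x)))"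
    by (simp add: scaleR_conv_of_real of_real_indicator)
  show "(LINT x|lborel. indicator {-pi..pi} x * iexp (- (l * x))) = (if l = 0 then complex_of_real (2 * pi) else 0)"
  proof (cases "l = 0")
    case True
    then show ?thesis unfolding e by (simp add: scaleR_conv_of_real)
  next
    case False
    let ?c = "- (\<i> * complex_of_real l)"
    let ?F = "\<lambda>x. exp (?c * complex_of_real x) / ?c"
    have fe: "iexp (- (l * x)) = exp (?c * complex_of_real x)" for x by (simp add: mult.assoc)
    have "(LINT x|lborel. indicator {-pi..pi} x *\<^sub>R iexp (- (l * x))) = ?F pi - ?F (- pi)"
      unfolding fe
    proof (rule integral_FTC_atLeastAtMost)
      show "- pi \<le> pi" by simp
      show "continuous_on {- pi..pi} (\<lambda>x. exp (?c * complex_of_real x))" by (intro continuous_intros)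
      fix x :: real
      have "((\<lambda>z. exp (?c * z) / ?c) has_field_derivative exp (?c * complex_of_real x)) (at (complex_of_real x))"
        using False by (auto intro!: derivative_eq_intros)
      from has_field_derivative_at_within[OF this]
      show "(?F has_vector_derivative exp (?c * complex_of_real x)) (at x within {- pi..pi})"
        by (rule has_vector_derivative_real_field)
    qed
    also have "?F pi - ?F (- pi) = (exp (?c * complex_of_real pi) - exp (?c * complex_of_real (- pi))) / ?c"
      by (rule diff_divide_distrib[symmetric])
    also have "exp (?c * complex_of_real pi) = cis (- (l * pi))" by (simp add: cis_conv_exp mult.assoc)
    also have "exp (?c * complex_of_real (- pi)) = cis (l * pi)" by (simp add: cis_conv_exp mult.assoc)
    also have "cis (- (l * pi)) - cis (l * pi) = 0"
      using l by (simp add: complex_eq_iff sin_times_pi_eq_0)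
    finally show ?thesis unfolding e using False by simp
  qed
qed

lemma
  fixes l :: "real^'d::finite"
  assumes l: "l \<in> Zd"
  shows integrable_exp_cube: "integrable lborel (\<lambda>\<eta>. indicator (cube pi) \<eta> * iexp (- (l \<bullet> \<eta>)))"
    and integral_exp_cube: "(LINT \<eta>|lborel. indicator (cube pi) \<eta> * iexp (- (l \<bullet> \<eta>))) = (if l = 0 then complex_of_real ((2 * pi) ^ CARD('d)) else 0)"
proof -
  let ?f = "\<lambda>i x. indicator {-pi..pi} x * iexp (- (l $ i * x))"
  have li: "l $ i \<in> \<int>" for i using l by (simp add: Zd_def)
  have ind: "(indicator (cube pi) \<eta> :: complex) = (\<Prod>i\<in>UNIV. indicator {-pi..pi} (\<eta> $ i))" for \<eta> :: "real^'d"
  proof (cases "\<eta> \<in> cube pi")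
    case True
    then have "\<eta> $ i \<in> {-pi..pi}" for i by (auto simp: cube_def abs_le_iff minus_le_iff)
    then show ?thesis using True by simp
  next
    case False
    then obtain i where "\<eta> $ i \<notin> {-pi..pi}" by (auto simp: cube_def abs_le_iff minus_le_iff not_le)
    then have "(\<Prod>i\<in>UNIV. indicator {-pi..pi} (\<eta> $ i)) = (0::complex)"
      by (intro prod_zero bexI[of _ i]) auto
    then show ?thesis using False by simp
  qed
  have "- (l \<bullet> \<eta>) = \<eta> \<bullet> (- l)" for \<eta> by (simp add: inner_commute)
  then have e: "indicator (cube pi) \<eta> * iexp (- (l \<bullet> \<eta>)) = (\<Prod>i\<in>UNIV. ?f i (\<eta> $ i))" for \<eta>
    using iexp_inner_prod[of \<eta> "- l"] unfolding ind by (simp add: prod.distrib)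
  show "integrable lborel (\<lambda>\<eta>. indicator (cube pi) \<eta> * iexp (- (l \<bullet> \<eta>)))"
    unfolding e by (rule integrable_prod_vec) (rule integrable_exp_interval[OF li])
  have "(LINT \<eta>|lborel. indicator (cube pi) \<eta> * iexp (- (l \<bullet> \<eta>))) = (\<Prod>i\<in>UNIV. (LINT x|lborel. ?f i x))"
    unfolding e by (rule integral_prod_vec) (rule integrable_exp_interval[OF li])
  also have "\<dots> = (\<Prod>i\<in>(UNIV::'d set). if l $ i = 0 then complex_of_real (2 * pi) else 0)"
    unfolding integral_exp_interval[OF li] ..
  also have "\<dots> = (if l = 0 then complex_of_real ((2 * pi) ^ CARD('d)) else 0)"
  proof (cases "l = 0")
    case False
    then obtain i where "l $ i \<noteq> 0" by (auto simp: vec_eq_iff)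
    then have "(\<Prod>i\<in>(UNIV::'d set). if l $ i = 0 then complex_of_real (2 * pi) else 0) = 0"
      by (intro prod_zero bexI[of _ i]) auto
    then show ?thesis using False by simp
  qed simp
  finally show "(LINT \<eta>|lborel. indicator (cube pi) \<eta> * iexp (- (l \<bullet> \<eta>))) = (if l = 0 then complex_of_real ((2 * pi) ^ CARD('d)) else 0)" .
qed

lemma Parseval_cube:
  fixes w :: "real^'d::finite \<Rightarrow> complex"
  assumes M: "finite M" "M \<subseteq> Zd"
  shows "(\<integral>\<^sup>+ \<eta>. ennreal (indicator (cube pi) \<eta> * (cmod (\<Sum>m\<in>M. w m * iexp (- (m \<bullet> \<eta>))))\<^sup>2) \<partial>lborel)
    = ennreal ((2 * pi) ^ CARD('d) * (\<Sum>m\<in>M. (cmod (w m))\<^sup>2))"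
proof -
  let ?S = "\<lambda>\<eta>. \<Sum>m\<in>M. w m * iexp (- (m \<bullet> \<eta>))"
  have e: "complex_of_real (indicator (cube pi) \<eta> * (cmod (?S \<eta>))\<^sup>2) = (\<Sum>m\<in>M. \<Sum>m'\<in>M. w m * cnj (w m') * (indicator (cube pi) \<eta> * iexp (- ((m - m') \<bullet> \<eta>))))" for \<eta>
  proof -
    have x: "iexp (- (m \<bullet> \<eta>)) * cnj (iexp (- (m' \<bullet> \<eta>))) = iexp (- ((m - m') \<bullet> \<eta>))" for m m'
      by (simp add: exp_cnj exp_add[symmetric] inner_diff_left algebra_simps)
    have "complex_of_real ((cmod (?S \<eta>))\<^sup>2) = (\<Sum>m\<in>M. \<Sum>m'\<in>M. w m * iexp (- (m \<bullet> \<eta>)) * cnj (w m' * iexp (- (m' \<bullet> \<eta>))))"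
      unfolding complex_norm_square cnj_sum sum_product ..
    also have "\<dots> = (\<Sum>m\<in>M. \<Sum>m'\<in>M. w m * cnj (w m') * iexp (- ((m - m') \<bullet> \<eta>)))"
      unfolding x[symmetric] complex_cnj_mult by (simp only: mult_ac)
    finally have "complex_of_real (indicator (cube pi) \<eta> * (cmod (?S \<eta>))\<^sup>2) = indicator (cube pi) \<eta> * (\<Sum>m\<in>M. \<Sum>m'\<in>M. w m * cnj (w m') * iexp (- ((m - m') \<bullet> \<eta>)))"
      by (simp only: of_real_mult of_real_indicator)
    then show ?thesis unfolding sum_distrib_left by (simp only: mult.left_commute)
  qed
  have i2: "integrable lborel (\<lambda>\<eta>. w m * cnj (w m') * (indicator (cube pi) \<eta> * iexp (- ((m - m') \<bullet> \<eta>))))" if "m \<in> M" "m' \<in> M" for m m'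
    using that M(2) by (intro integrable_mult_right integrable_exp_cube Zd_diff) auto
  have ic: "integrable lborel (\<lambda>\<eta>. complex_of_real (indicator (cube pi) \<eta> * (cmod (?S \<eta>))\<^sup>2))"
    unfolding e by (intro Bochner_Integration.integrable_sum i2)
  then have i: "integrable lborel (\<lambda>\<eta>. indicator (cube pi) \<eta> * (cmod (?S \<eta>))\<^sup>2)"
    by (simp only: complex_of_real_integrable_eq)
  have "complex_of_real (LINT \<eta>|lborel. indicator (cube pi) \<eta> * (cmod (?S \<eta>))\<^sup>2)
      = (LINT \<eta>|lborel. (\<Sum>m\<in>M. \<Sum>m'\<in>M. w m * cnj (w m') * (indicator (cube pi) \<eta> * iexp (- ((m - m') \<bullet> \<eta>)))))"
    unfolding integral_complex_of_real[symmetric] e ..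
  also have "\<dots> = (\<Sum>m\<in>M. \<Sum>m'\<in>M. w m * cnj (w m') * (LINT \<eta>|lborel. indicator (cube pi) \<eta> * iexp (- ((m - m') \<bullet> \<eta>))))"
    by (subst Bochner_Integration.integral_sum, intro Bochner_Integration.integrable_sum i2, assumption+, intro sum.cong refl)
       (subst Bochner_Integration.integral_sum, intro i2, assumption+, simp only: integral_mult_right_zero)
  also have "\<dots> = (\<Sum>m\<in>M. \<Sum>m'\<in>M. if m' = m then w m * cnj (w m') * complex_of_real ((2 * pi) ^ CARD('d)) else 0)"
  proof (intro sum.cong refl)
    fix m m' assume "m \<in> M" "m' \<in> M"
    then have "m - m' \<in> Zd" using M(2) by (intro Zd_diff) auto
    from integral_exp_cube[OF this]
    show "w m * cnj (w m') * (LINT \<eta>|lborel. indicator (cube pi) \<eta> * iexp (- ((m - m') \<bullet> \<eta>))) = (if m' = m then w m * cnj (w m') * complex_of_real ((2 * pi) ^ CARD('d)) else 0)"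
      by (cases "m' = m") auto
  qed
  also have "\<dots> = (\<Sum>m\<in>M. w m * cnj (w m) * complex_of_real ((2 * pi) ^ CARD('d)))"
    using M(1) by simp
  also have "\<dots> = complex_of_real ((2 * pi) ^ CARD('d) * (\<Sum>m\<in>M. (cmod (w m))\<^sup>2))"
    unfolding sum_distrib_right[symmetric] complex_norm_square[symmetric] by simp
  finally have v: "(LINT \<eta>|lborel. indicator (cube pi) \<eta> * (cmod (?S \<eta>))\<^sup>2) = (2 * pi) ^ CARD('d) * (\<Sum>m\<in>M. (cmod (w m))\<^sup>2)"
    by (simp only: of_real_eq_iff)
  show ?thesis unfolding v[symmetric] by (rule nn_integral_eq_integral[OF i]) (auto simp: indicator_def)
qed

section \<open>The refinable function\<close>

context mask
begin

abbreviation Ct where "Ct \<equiv> matrix_inv (transpose A)"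

lemma Ct_inner: "x \<bullet> (mat_pow Ct k *v y) = (mat_pow C k *v x) \<bullet> y"
  unfolding matrix_inv_transpose[OF dA] using inner_mat_pow_transpose[of C k y x] by (simp add: inner_commute)

text \<open>A coordinate of the left vector is the inner product of y with a column of
  \<open>mat_pow C k\<close>, so the decay known for the powers of C passes to their
  transposes.\<close>

lemma norm_Ct_le: "norm (mat_pow Ct k *v y) \<le> col_sum (mat_pow C k) * norm y"
proof -
  have "\<bar>(mat_pow Ct k *v y) $ i\<bar> \<le> norm (mat_pow C k *v axis i 1) * norm y" for i
  proof -
    have "(mat_pow Ct k *v y) $ i = (mat_pow C k *v axis i 1) \<bullet> y"
      unfolding Ct_inner[symmetric] by (simp add: inner_axis')
    then show ?thesis using Cauchy_Schwarz_ineq2[of "mat_pow C k *v axis i 1" y] by simp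
  qed
  then have "(\<Sum>i\<in>UNIV. \<bar>(mat_pow Ct k *v y) $ i\<bar>) \<le> (\<Sum>i\<in>UNIV. norm (mat_pow C k *v axis i 1) * norm y)"
    by (intro sum_mono)
  then show ?thesis
    using norm_le_l1_cart[of "mat_pow Ct k *v y"] unfolding col_sum_def sum_distrib_right by linarith
qed

section \<open>Partial products and their limit g\<close>

definition Pk :: "nat \<Rightarrow> real^'d \<Rightarrow> complex" where
  "Pk k \<xi> = (\<Prod>j<k. m0 N0 h (mat_pow Ct (Suc j) *v \<xi>))"

lemma E_mult: "E k (\<lambda>x. F x * c) = E k F * c"
  by (simp add: E_def sum_distrib_right mult.assoc)

lemma Pk_eq_E: "Pk k \<xi> = E k (\<lambda>x. iexp (- (x \<bullet> \<xi>)))"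
proof (induction k)
  case 0
  then show ?case by (simp add: Pk_def E_0)
next
  case (Suc k)
  have F: "iexp (- ((x + y) \<bullet> \<xi>)) = iexp (- (x \<bullet> \<xi>)) * iexp (- (y \<bullet> \<xi>))" for x y :: "real^'d"
    by (simp add: inner_add_left exp_add[symmetric] algebra_simps)
  have "E (Suc k) (\<lambda>x. iexp (- (x \<bullet> \<xi>))) = (\<Sum>n\<in>\<Lambda>. h n / s2 * (Pk k \<xi> * iexp (- ((mat_pow C (Suc k) *v n) \<bullet> \<xi>))))"
    unfolding E_Suc F E_mult Suc.IH ..
  also have "\<dots> = Pk k \<xi> * (\<Sum>n\<in>\<Lambda>. h n / s2 * iexp (- ((mat_pow C (Suc k) *v n) \<bullet> \<xi>)))"
    by (simp add: sum_distrib_left mult.left_commute)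
  also have "(\<Sum>n\<in>\<Lambda>. h n / s2 * iexp (- ((mat_pow C (Suc k) *v n) \<bullet> \<xi>))) = m0 N0 h (mat_pow Ct (Suc k) *v \<xi>)"
    unfolding m0_def Ct_inner[of _ "Suc k"] by (simp add: sum_divide_distrib)
  finally show ?case by (simp add: Pk_def)
qed

text \<open>The normalisation of h gives m0 the value 1 at 0, and the exponential is 1-Lipschitz
  along the imaginary axis. This linear bound is what makes the infinite product converge.\<close>

lemma m0_near_0: "cmod (m0 N0 h t - 1) \<le> (\<Sum>n\<in>\<Lambda>. cmod (h n) * norm n) * norm t"
proof -
  have "m0 N0 h t - 1 = (1 / s2) * (\<Sum>n\<in>\<Lambda>. h n * (iexp (- (n \<bullet> t)) - 1))"
  proof -
    have "1 = (1 / s2) * (\<Sum>n\<in>\<Lambda>. h n)" unfolding h_sum by simp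
    moreover have "m0 N0 h t = (1 / s2) * (\<Sum>n\<in>\<Lambda>. h n * iexp (- (n \<bullet> t)))" by (simp add: m0_def)
    ultimately show ?thesis by (simp add: right_diff_distrib sum_subtractf)
  qed
  also have "cmod \<dots> \<le> 1 * (\<Sum>n\<in>\<Lambda>. cmod (h n) * (norm n * norm t))"
    unfolding norm_mult
  proof (rule mult_mono)
    show "cmod (\<Sum>n\<in>\<Lambda>. h n * (iexp (- (n \<bullet> t)) - 1)) \<le> (\<Sum>n\<in>\<Lambda>. cmod (h n) * (norm n * norm t))"
    proof (rule sum_norm_le)
      fix n :: "real^'d"
      have "cmod (iexp (- (n \<bullet> t)) - 1) \<le> \<bar>- (n \<bullet> t)\<bar>"
        using iexp_approx1[of "- (n \<bullet> t)" 0] by simp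
      also have "\<dots> \<le> norm n * norm t" using Cauchy_Schwarz_ineq2[of n t] by simp
      finally show "norm (h n * (iexp (- (n \<bullet> t)) - 1)) \<le> cmod (h n) * (norm n * norm t)"
        unfolding norm_mult by (rule mult_left_mono) simp
    qed
    show "cmod (1 / s2) \<le> 1" by (simp add: norm_divide)
  qed simp_all
  finally show ?thesis by (simp add: sum_distrib_right mult.assoc)
qed

text \<open>The deviations of the factors from 1 are summable by the decay of the inverse powers, so
  the product converges absolutely and the infinite product in \<open>g_fun\<close> is the limit of
  the partial ones.\<close>

lemma Pk_limit: "(\<lambda>k. Pk k \<xi>) \<longlonglongrightarrow> (\<Prod>j. m0 N0 h (mat_pow Ct (Suc j) *v \<xi>))"
proof -
  let ?f = "\<lambda>j. m0 N0 h (mat_pow Ct (Suc j) *v \<xi>)"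
  let ?K = "(\<Sum>n\<in>\<Lambda>. cmod (h n) * norm n)"
  have "summable (\<lambda>j. cmod (?f j - 1))"
  proof (rule summable_comparison_test'[where N=0])
    show "summable (\<lambda>j. ?K * (col_sum (mat_pow C (Suc j)) * norm \<xi>))"
      by (intro summable_mult summable_mult2) (rule summable_Suc_iff[THEN iffD2, OF summable_col_sum[OF decay]])
    fix j
    have "cmod (?f j - 1) \<le> ?K * norm (mat_pow Ct (Suc j) *v \<xi>)" by (rule m0_near_0)
    also have "\<dots> \<le> ?K * (col_sum (mat_pow C (Suc j)) * norm \<xi>)"
      by (intro mult_left_mono norm_Ct_le sum_nonneg) simp
    finally show "norm (cmod (?f j - 1)) \<le> ?K * (col_sum (mat_pow C (Suc j)) * norm \<xi>)" by simp
  qed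
  then have "convergent_prod ?f"
    by (intro abs_convergent_prod_imp_convergent_prod summable_imp_abs_convergent_prod)
  then have "(\<lambda>n. \<Prod>j\<le>n. ?f j) \<longlonglongrightarrow> prodinf ?f" by (rule convergent_prod_LIMSEQ)
  then have "(\<lambda>n. Pk (Suc n) \<xi>) \<longlonglongrightarrow> prodinf ?f" unfolding Pk_def lessThan_Suc_atMost .
  then show ?thesis by (rule LIMSEQ_imp_Suc)
qed

lemma measurable_Pk [measurable]: "Pk k \<in> borel_measurable borel"
  unfolding Pk_eq_E E_def by measurable

abbreviation "gA \<equiv> g_fun N0 h A"

lemma gA_limit: "(\<lambda>k. complex_of_real (fconst TYPE('d)) * Pk k \<xi>) \<longlonglongrightarrow> gA \<xi>"
  unfolding g_fun_def by (intro tendsto_mult Pk_limit) (simp add: fconst_def)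

lemma measurable_gA [measurable]: "gA \<in> borel_measurable borel"
  by (rule borel_measurable_LIMSEQ_metric[where f="\<lambda>k \<xi>. complex_of_real (fconst TYPE('d)) * Pk k \<xi>"])
     (measurable, rule gA_limit)

lemma Pk_bounded: "\<exists>K\<ge>0. \<forall>k \<xi>. cmod (Pk k \<xi>) \<le> K"
proof -
  obtain K where K: "K \<ge> 0" "\<forall>k F b. 0 \<le> b \<longrightarrow> (\<forall>x. cmod (F x) \<le> b) \<longrightarrow> cmod (E k F) \<le> K * b"
    using E_bound by blast
  have "cmod (Pk k \<xi>) \<le> K * 1" for k \<xi>
    unfolding Pk_eq_E using K(2)[rule_format, of 1 "\<lambda>x. iexp (- (x \<bullet> \<xi>))" k] by simp
  then show ?thesis using K(1) by auto
qed

lemma gA_bounded: "\<exists>K. \<forall>\<xi>. cmod (gA \<xi>) \<le> K"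
proof -
  obtain K where K: "K \<ge> 0" "\<forall>k \<xi>. cmod (Pk k \<xi>) \<le> K" using Pk_bounded by blast
  have "cmod (gA \<xi>) \<le> fconst TYPE('d) * K" for \<xi>
  proof (rule Lim_norm_ubound[OF sequentially_bot gA_limit])
    show "\<forall>\<^sub>F k in sequentially. cmod (complex_of_real (fconst TYPE('d)) * Pk k \<xi>) \<le> fconst TYPE('d) * K"
      using K(2) fconst_pos[where 'd='d] by (auto simp: norm_mult)
  qed
  then show ?thesis by blast
qed

text \<open>On the cube scaled by \<open>(A\<^sup>\<tau>)\<^sup>k\<close>, the partial product is a trigonometric polynomial whose coefficients have square sum one; Fatou's lemma then passes to the limit.\<close>

lemma gA_square_integrable: "square_integrable gA"
proof -
  let ?S = "\<lambda>k \<eta>. \<Sum>m\<in>Mk k. wk k m * iexp (- (m \<bullet> \<eta>))"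
  let ?H = "\<lambda>k \<eta>. ennreal (indicator (cube pi) \<eta> * (cmod (?S k \<eta>))\<^sup>2)"
  have Pk_S: "Pk k \<xi> = ?S k (mat_pow Ct k *v \<xi>)" for k \<xi>
    unfolding Pk_eq_E E_def Ct_inner ..
  have Hm [measurable]: "?H k \<in> borel_measurable borel" for k by measurable
  have w2: "(\<Sum>m\<in>Mk k. (cmod (wk k m))\<^sup>2) = 1 / 2 ^ k" for k
  proof -
    have "(sqrt 2 ^ k)\<^sup>2 = ((sqrt 2)\<^sup>2) ^ k" by (simp only: power_mult[symmetric] mult.commute)
    then have "(cmod (s2 ^ k))\<^sup>2 = 2^k" by (simp add: norm_power)
    then show ?thesis unfolding wk_def norm_divide power_divide by (simp add: ak_norm flip: sum_divide_distrib)
  qed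
  have dCt: "det (mat_pow Ct k) \<noteq> 0" "1 / \<bar>det (mat_pow Ct k)\<bar> = 2 ^ k" for k
  proof -
    have "\<bar>det Ct\<bar> = 1 / 2"
      unfolding matrix_inv_transpose[OF dA] det_transpose det_matrix_inv[OF dA] abs_inverse detA by simp
    then have "\<bar>det (mat_pow Ct k)\<bar> = (1 / 2) ^ k" by (simp only: det_mat_pow power_abs)
    then show "det (mat_pow Ct k) \<noteq> 0" "1 / \<bar>det (mat_pow Ct k)\<bar> = 2 ^ k" by (auto simp: power_one_over)
  qed
  \<comment> \<open>The Jacobian factor \<open>2 ^ k\<close> cancels the square sum
    \<open>1 / 2 ^ k\<close> of the weights, so the bound is independent of k.\<close>
  have int: "(\<integral>\<^sup>+ \<xi>. ?H k (mat_pow Ct k *v \<xi>) \<partial>lebesgue) = ennreal ((2 * pi) ^ CARD('d))" for k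
  proof -
    have "(\<integral>\<^sup>+ \<xi>. ?H k (mat_pow Ct k *v \<xi> + 0) \<partial>lebesgue) = ennreal (2 ^ k) * (\<integral>\<^sup>+ \<eta>. ?H k \<eta> \<partial>lebesgue)"
      unfolding dCt(2)[symmetric] by (rule nn_integral_affine[OF dCt(1) borel_measurable_lebesgueI[OF Hm]])
    also have "(\<integral>\<^sup>+ \<eta>. ?H k \<eta> \<partial>lebesgue) = (\<integral>\<^sup>+ \<eta>. ?H k \<eta> \<partial>lborel)"
      by (rule nn_integral_completion)
    also have "\<dots> = ennreal ((2 * pi) ^ CARD('d) * (1 / 2 ^ k))"
      unfolding w2[symmetric] by (rule Parseval_cube[OF finite_Mk]) (use Mk_Zd in blast)
    also have "ennreal (2 ^ k) * ennreal ((2 * pi) ^ CARD('d) * (1 / 2 ^ k)) = ennreal ((2 * pi) ^ CARD('d))"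
      by (subst ennreal_mult[symmetric]) auto
    finally show ?thesis by simp
  qed
  let ?c = "ennreal ((fconst TYPE('d))\<^sup>2)"
  have lim: "liminf (\<lambda>k. ?c * ?H k (mat_pow Ct k *v \<xi>)) = ennreal ((cmod (gA \<xi>))\<^sup>2)" for \<xi>
  proof (rule lim_imp_Liminf[OF sequentially_bot])
    \<comment> \<open>For fixed \<open>\<xi>\<close> the rescaled points tend to 0 and eventually
      lie in the cube, so the indicator does not affect the limit.\<close>
    have "(\<lambda>k. col_sum (mat_pow C k) * norm \<xi>) \<longlonglongrightarrow> 0 * norm \<xi>"
      by (intro tendsto_intros col_sum_tendsto_0[OF decay])
    then have "\<forall>\<^sub>F k in sequentially. col_sum (mat_pow C k) * norm \<xi> < pi"
      using order_tendstoD(2)[of _ 0 sequentially pi] by simp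
    then have ev: "\<forall>\<^sub>F k in sequentially. ennreal ((cmod (complex_of_real (fconst TYPE('d)) * Pk k \<xi>))\<^sup>2) = ?c * ?H k (mat_pow Ct k *v \<xi>)"
    proof eventually_elim
      case (elim k)
      have "\<bar>(mat_pow Ct k *v \<xi>) $ i\<bar> \<le> pi" for i
        using component_le_norm_cart[of "mat_pow Ct k *v \<xi>" i] norm_Ct_le[of k \<xi>] elim by linarith
      then have "mat_pow Ct k *v \<xi> \<in> cube pi" by (simp add: cube_def)
      then show ?case unfolding Pk_S norm_mult power_mult_distrib
        by (subst ennreal_mult) auto
    qed
    have "(\<lambda>k. ennreal ((cmod (complex_of_real (fconst TYPE('d)) * Pk k \<xi>))\<^sup>2)) \<longlonglongrightarrow> ennreal ((cmod (gA \<xi>))\<^sup>2)"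
      by (intro tendsto_ennrealI tendsto_power tendsto_norm gA_limit)
    then show "(\<lambda>k. ?c * ?H k (mat_pow Ct k *v \<xi>)) \<longlonglongrightarrow> ennreal ((cmod (gA \<xi>))\<^sup>2)"
      by (rule Lim_transform_eventually[OF _ ev])
  qed
  have Hm': "(\<lambda>\<xi>. ?c * ?H k (mat_pow Ct k *v \<xi>)) \<in> borel_measurable lebesgue" for k
  proof -
    have "(\<lambda>\<xi>. ?H k (mat_pow Ct k *v \<xi> + 0)) \<in> borel_measurable lebesgue"
      using measurable_compose[OF measurable_lebesgue_affine[OF dCt(1)[of k]] borel_measurable_lebesgueI[OF Hm[of k]]] .
    then show ?thesis by simp
  qed
  have "(\<integral>\<^sup>+ \<xi>. ennreal ((cmod (gA \<xi>))\<^sup>2) \<partial>lebesgue) \<le> liminf (\<lambda>k. \<integral>\<^sup>+ \<xi>. ?c * ?H k (mat_pow Ct k *v \<xi>) \<partial>lebesgue)"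
    unfolding lim[symmetric] by (rule nn_integral_liminf) (rule Hm')
  also have "\<dots> = liminf (\<lambda>k::nat. ?c * ennreal ((2 * pi) ^ CARD('d)))"
  proof -
    have "(\<integral>\<^sup>+ \<xi>. ?c * ?H k (mat_pow Ct k *v \<xi>) \<partial>lebesgue) = ?c * ennreal ((2 * pi) ^ CARD('d))" for k
    proof -
      have "(\<lambda>\<xi>. ?H k (mat_pow Ct k *v \<xi> + 0)) \<in> borel_measurable lebesgue"
        using measurable_compose[OF measurable_lebesgue_affine[OF dCt(1)[of k]] borel_measurable_lebesgueI[OF Hm[of k]]] .
      then show ?thesis unfolding int[of k, symmetric] by (intro nn_integral_cmult) simp
    qed
    then show ?thesis by simp
  qed
  also have "\<dots> < \<infinity>" by (simp add: Liminf_const ennreal_mult'[symmetric])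
  finally show ?thesis
    unfolding square_integrable_iff_nn_integral using borel_measurable_lebesgueI[OF measurable_gA] by simp
qed

end

lemma Cc_translate:
  assumes "Cc u"
  shows "Cc (\<lambda>t. u (t + v))"
proof -
  obtain R where R: "\<And>x. norm x > R \<Longrightarrow> u x = 0" and c: "continuous_on UNIV u" using assms by (auto simp: Cc_def)
  have "u (t + v) = 0" if "norm t > R + norm v" for t
  proof (rule R)
    show "norm (t + v) > R" using that norm_triangle_ineq4[of "t + v" v] by simp
  qed
  moreover have "continuous_on UNIV (\<lambda>t. u (t + v))"
    by (intro continuous_on_compose2[OF c] continuous_intros) auto
  ultimately show ?thesis unfolding Cc_def by blast
qed

section \<open>The function phi as a weak limit of the cascade measures\<close>

context mask
begin

abbreviation phi where "phi \<equiv> phi_A N0 h A"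

lemma phi_square_integrable: "square_integrable phi"
proof -
  obtain K where K: "\<And>\<xi>. cmod (gA \<xi>) \<le> K" using gA_bounded by blast
  show ?thesis unfolding phi_A_def by (rule inv_fourier_L2_spec(1)[OF measurable_gA K gA_square_integrable])
qed

text \<open>The partial product is a finite sum of exponentials, one per atom; against a modulated
  Gaussian each becomes a heat kernel evaluated at the distance from x to its atom.\<close>

lemma integral_Pk_gauss:
  assumes r: "r > 0"
  shows "(LINT s|lborel. Pk k s * (iexp (s \<bullet> x) * complex_of_real (gauss r s))) = E k (\<lambda>p. complex_of_real (heat r (x - p)))"
proof -
  let ?g = "\<lambda>p s. iexp (- (p \<bullet> s)) * (iexp (x \<bullet> s) * complex_of_real (gauss r s))"
  have i: "integrable lborel (?g p)" for p
  proof -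
    have "integrable lborel (\<lambda>s. iexp (x \<bullet> s) * complex_of_real (gauss r s))"
      using integrable_gauss[OF r, of x] by (simp add: inner_commute)
    from integrable_iexp_mult(2)[OF this, of p] show ?thesis by (simp add: inner_commute)
  qed
  have "(LINT s|lborel. Pk k s * (iexp (s \<bullet> x) * complex_of_real (gauss r s))) = (LINT s|lborel. (\<Sum>m\<in>Mk k. wk k m * ?g (mat_pow C k *v m) s))"
    unfolding Pk_eq_E E_def sum_distrib_right by (simp only: mult.assoc inner_commute[of x])
  also have "\<dots> = (\<Sum>m\<in>Mk k. wk k m * (LINT s|lborel. ?g (mat_pow C k *v m) s))"
    by (subst Bochner_Integration.integral_sum, intro integrable_mult_right i, simp only: integral_mult_right_zero)
  also have "\<dots> = E k (\<lambda>p. complex_of_real (heat r (x - p)))"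
    unfolding integral_gauss_modulated[OF r] E_def ..
  finally show ?thesis .
qed

text \<open>\<open>inv_fourier_L2_gauss\<close> turns the pairing with phi into an integral of g
  against a Gaussian. There the uniform bound on \<open>Pk\<close> permits dominated convergence,
  and \<open>integral_Pk_gauss\<close> translates each integral back into
  \<open>E k\<close>.\<close>

lemma weak_limit_gauss:
  assumes r: "r > 0"
  shows "(\<lambda>k. E k (\<lambda>t. complex_of_real (gauss r (t - x)))) \<longlonglongrightarrow> (LINT t|lebesgue. phi t * complex_of_real (gauss r (t - x)))"
proof -
  \<comment> \<open>The Gaussian on the Fourier side has the reciprocal parameter, so that the one
    tested against phi is \<open>gauss r\<close>; the constants of the two transforms cancel by
    \<open>fconst_sq\<close>.\<close>
  let ?q = "1 / r"
  have q: "?q > 0" using r by simp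
  obtain Kg where Kg: "\<And>\<xi>. cmod (gA \<xi>) \<le> Kg" using gA_bounded by blast
  obtain K where K: "K \<ge> 0" "\<forall>k \<xi>. cmod (Pk k \<xi>) \<le> K" using Pk_bounded by blast
  let ?f = "complex_of_real (fconst TYPE('d))"
  let ?c = "complex_of_real (fconst TYPE('d) * (sqrt (2 * pi) * ?q) ^ CARD('d))"
  let ?e = "\<lambda>s. iexp (s \<bullet> x) * complex_of_real (gauss ?q s)"
  have "(\<lambda>k. LINT s|lborel. ?f * Pk k s * ?e s) \<longlonglongrightarrow> (LINT s|lborel. gA s * ?e s)"
  proof (rule integral_dominated_convergence[where w="\<lambda>s. fconst TYPE('d) * K * gauss ?q s"])
    show "integrable lborel (\<lambda>s::real^'d. fconst TYPE('d) * K * gauss ?q s)"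
      by (intro integrable_mult_right integrable_gauss_real q)
    show "AE s in lborel. (\<lambda>k. ?f * Pk k s * ?e s) \<longlonglongrightarrow> gA s * ?e s"
      by (intro AE_I2 tendsto_mult[OF gA_limit tendsto_const])
    show "AE s in lborel. norm (?f * Pk k s * ?e s) \<le> fconst TYPE('d) * K * gauss ?q s" for k
    proof (rule AE_I2)
      fix s :: "real^'d"
      have "norm (?f * Pk k s * ?e s) = fconst TYPE('d) * cmod (Pk k s) * gauss ?q s"
        using fconst_pos[where 'd='d] by (simp add: norm_mult abs_of_pos[OF gauss_pos])
      also have "\<dots> \<le> fconst TYPE('d) * K * gauss ?q s"
        using K(2) fconst_pos[where 'd='d] gauss_pos[of ?q s] by (intro mult_right_mono mult_left_mono) auto
      finally show "norm (?f * Pk k s * ?e s) \<le> fconst TYPE('d) * K * gauss ?q s" .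
    qed
  qed measurable
  from tendsto_mult[OF tendsto_const[of ?c] this]
  have lim: "(\<lambda>k. ?c * (LINT s|lborel. ?f * Pk k s * ?e s)) \<longlonglongrightarrow> ?c * (LINT s|lborel. gA s * ?e s)" .
  have "?c * (LINT s|lborel. gA s * ?e s) = (LINT t|lebesgue. phi t * complex_of_real (gauss (1 / ?q) (t - x)))"
    unfolding phi_A_def by (rule inv_fourier_L2_gauss[OF measurable_gA Kg gA_square_integrable q, symmetric])
  then have rhs: "?c * (LINT s|lborel. gA s * ?e s) = (LINT t|lebesgue. phi t * complex_of_real (gauss r (t - x)))"
    by simp
  have lhs: "?c * (LINT s|lborel. ?f * Pk k s * ?e s) = E k (\<lambda>t. complex_of_real (gauss r (t - x)))" for k
  proof -
    have "(LINT s|lborel. ?f * Pk k s * ?e s) = ?f * (LINT s|lborel. Pk k s * ?e s)"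
      unfolding mult.assoc[of ?f] by (rule integral_mult_right_zero)
    also have "(LINT s|lborel. Pk k s * ?e s) = E k (\<lambda>p. complex_of_real (heat ?q (x - p)))" by (rule integral_Pk_gauss[OF q])
    also have "\<dots> = E k (\<lambda>p. complex_of_real (gauss r (p - x)) * complex_of_real ((sqrt (2 * pi) / ?q) ^ CARD('d)))"
      unfolding heat_def using r by (simp add: gauss_def norm_minus_commute mult.commute)
    also have "\<dots> = E k (\<lambda>p. complex_of_real (gauss r (p - x))) * complex_of_real ((sqrt (2 * pi) / ?q) ^ CARD('d))" by (rule E_mult)
    finally have "?c * (LINT s|lborel. ?f * Pk k s * ?e s)
       = complex_of_real (fconst TYPE('d) * (sqrt (2 * pi) * ?q) ^ CARD('d) * (fconst TYPE('d) * (sqrt (2 * pi) / ?q) ^ CARD('d))) * E k (\<lambda>p. complex_of_real (gauss r (p - x)))"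
      by (simp only: of_real_mult mult_ac)
    also have "fconst TYPE('d) * (sqrt (2 * pi) * ?q) ^ CARD('d) * (fconst TYPE('d) * (sqrt (2 * pi) / ?q) ^ CARD('d)) = 1"
    proof -
      have "fconst TYPE('d) * (sqrt (2 * pi) * ?q) ^ CARD('d) * (fconst TYPE('d) * (sqrt (2 * pi) / ?q) ^ CARD('d))
         = (fconst TYPE('d))\<^sup>2 * ((sqrt (2 * pi) * ?q) * (sqrt (2 * pi) / ?q)) ^ CARD('d)"
        unfolding power_mult_distrib[of "sqrt (2 * pi) * ?q"] power2_eq_square by (simp only: mult_ac)
      also have "(sqrt (2 * pi) * ?q) * (sqrt (2 * pi) / ?q) = 2 * pi" using r by simp
      finally show ?thesis unfolding fconst_sq .
    qed
    finally show ?thesis by simp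
  qed
  show ?thesis using lim unfolding lhs rhs .
qed

lemma weak_limit:
  assumes "Cc u"
  shows "(\<lambda>k. E k u) \<longlonglongrightarrow> (LINT t|lebesgue. phi t * u t)"
proof -
  obtain K where K: "K \<ge> 0" "\<forall>k F b. 0 \<le> b \<longrightarrow> (\<forall>x. cmod (F x) \<le> b) \<longrightarrow> cmod (E k F) \<le> K * b"
    using E_bound by blast
  show ?thesis
    unfolding E_def
  proof (rule weak_limit_from_gauss[OF phi_square_integrable _ _ assms])
    show "cmod (\<Sum>m\<in>Mk k. wk k m * F (mat_pow C k *v m)) \<le> K * b" if "0 \<le> b" "\<And>x. cmod (F x) \<le> b" for k F b
      using K(2)[rule_format, of b F k] that unfolding E_def by blast
    show "(\<lambda>k. \<Sum>m\<in>Mk k. wk k m * complex_of_real (gauss r (mat_pow C k *v m - x))) \<longlonglongrightarrow> (LINT t|lebesgue. phi t * complex_of_real (gauss r (t - x)))"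
      if "r > 0" for r x
      using weak_limit_gauss[OF that, of x] unfolding E_def .
  qed
qed

text \<open>The functions \<open>ch j\<close> vanish on the ball containing all atoms and increase
  to the indicator of its complement. Every \<open>E k\<close> annihilates \<open>ch j * u\<close>,
  hence so does phi, and the limit in j isolates the part of phi outside the ball.\<close>

lemma phi_support: "AE t in lebesgue. norm t > Rs \<longrightarrow> phi t = 0"
proof -
  define w where "w = (\<lambda>t. indicator (- cball 0 Rs) t * phi t)"
  have phim: "phi \<in> borel_measurable lebesgue" using phi_square_integrable by (simp add: square_integrable_def)
  have wm: "w \<in> borel_measurable lebesgue"
    unfolding w_def using phim by (intro borel_measurable_times borel_measurable_indicator) auto
  have w2: "square_integrable w"
    by (rule square_integrable_bound[OF wm, of "\<lambda>t. cmod (phi t)"])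
       (use phi_square_integrable in \<open>auto simp: square_integrable_def w_def indicator_def\<close>)
  have "AE t in lebesgue. w t = 0"
  proof (rule Cc_integral_eq_0_imp_AE[OF w2])
    fix u :: "real^'d \<Rightarrow> complex" assume u: "Cc u"
    define ch where "ch = (\<lambda>j::nat. \<lambda>t::real^'d. complex_of_real (min 1 (real j * max 0 (norm t - Rs))))"
    have chc: "continuous_on UNIV (ch j)" for j unfolding ch_def by (intro continuous_intros)
    have ch1: "cmod (ch j t) \<le> 1" for j t unfolding ch_def by (simp add: abs_le_iff)
    have cu: "Cc (\<lambda>t. ch j t * u t)" for j by (rule Cc_mult_left[OF u chc])
    have z: "(LINT t|lebesgue. phi t * (ch j t * u t)) = 0" for j
    proof -
      have "E k (\<lambda>t. ch j t * u t) = 0" for k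
        unfolding E_def using Mk_support by (intro sum.neutral ballI) (simp add: ch_def)
      then show ?thesis using weak_limit[OF cu[of j]] by (simp add: LIMSEQ_const_iff)
    qed
    have "(\<lambda>j. LINT t|lebesgue. phi t * (ch j t * u t)) \<longlonglongrightarrow> (LINT t|lebesgue. w t * u t)"
    proof (rule integral_dominated_convergence[where w="\<lambda>t. cmod (phi t * u t)"])
      show "integrable lebesgue (\<lambda>t. cmod (phi t * u t))"
        by (intro integrable_norm square_integrable_mult_integrable phi_square_integrable Cc_square_integrable u)
      show "AE t in lebesgue. (\<lambda>j. phi t * (ch j t * u t)) \<longlonglongrightarrow> w t * u t"
      proof (rule AE_I2)
        fix t :: "real^'d"
        have "(\<lambda>j. ch j t) \<longlonglongrightarrow> indicator (- cball 0 Rs) t"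
        proof (cases "norm t > Rs")
          case True
          obtain j0 :: nat where j0: "1 / (norm t - Rs) \<le> real j0" using real_arch_simple by blast
          have "ch j t = indicator (- cball 0 Rs) t" if "j \<ge> j0" for j
          proof -
            have "1 / (norm t - Rs) \<le> real j" using j0 that by simp
            then have "1 \<le> real j * (norm t - Rs)" using True by (simp add: field_simps)
            then show ?thesis using True by (simp add: ch_def)
          qed
          then show ?thesis by (intro tendsto_eventually eventually_sequentiallyI[of j0])
        next
          case False
          then show ?thesis by (simp add: ch_def)
        qed
        from tendsto_mult[OF tendsto_const[of "phi t"] tendsto_mult[OF this tendsto_const[of "u t"]]]
        show "(\<lambda>j. phi t * (ch j t * u t)) \<longlonglongrightarrow> w t * u t" by (simp add: w_def mult_ac)
      qed
      show "AE t in lebesgue. norm (phi t * (ch j t * u t)) \<le> cmod (phi t * u t)" for j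
      proof (rule AE_I2)
        fix t
        have "cmod (ch j t) * cmod (u t) \<le> 1 * cmod (u t)" by (intro mult_right_mono ch1) simp
        from mult_left_mono[OF this, of "cmod (phi t)"] show "norm (phi t * (ch j t * u t)) \<le> cmod (phi t * u t)"
          by (simp add: norm_mult)
      qed
      show "(\<lambda>t. phi t * (ch j t * u t)) \<in> borel_measurable lebesgue" for j
        by (intro borel_measurable_times phim Cc_measurable_lebesgue[OF cu])
      show "(\<lambda>t. w t * u t) \<in> borel_measurable lebesgue"
        by (intro borel_measurable_times wm Cc_measurable_lebesgue[OF u])
    qed
    then show "(LINT t|lebesgue. w t * u t) = 0" unfolding z by (simp add: LIMSEQ_const_iff)
  qed
  then show ?thesis by eventually_elim (auto simp: w_def indicator_def split: if_splits)
qed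

text \<open>The constant 1 is not a test function, but a cutoff equal to 1 on the ball containing
  all atoms and the support of phi replaces it on both sides.\<close>

lemma phi_integral: "(LINT t|lebesgue. phi t) = 1"
proof -
  have phim: "phi \<in> borel_measurable lebesgue" using phi_square_integrable by (simp add: square_integrable_def)
  let ?u = "cutoff Rs :: real^'d \<Rightarrow> complex"
  have "E k ?u = E k (\<lambda>x. 1)" for k
    unfolding E_def using Mk_support by (intro sum.cong refl) (simp add: cutoff_eq_1)
  then have "(LINT t|lebesgue. phi t * ?u t) = 1"
    using weak_limit[OF Cc_cutoff, of Rs] by (simp add: E_1 LIMSEQ_const_iff)
  moreover have "(LINT t|lebesgue. phi t * ?u t) = (LINT t|lebesgue. phi t)"
  proof (rule integral_cong_AE)
    show "(\<lambda>t. phi t * ?u t) \<in> borel_measurable lebesgue"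
      by (intro borel_measurable_times phim Cc_measurable_lebesgue[OF Cc_cutoff])
    show "AE t in lebesgue. phi t * ?u t = phi t"
      using phi_support by eventually_elim (metis cutoff_eq_1 linorder_not_less mult.right_neutral mult_zero_left)
  qed (rule phim)
  ultimately show ?thesis by simp
qed

text \<open>\<open>E_Suc'\<close> tested against u gives, in the limit, the refinement equation with
  the affine maps acting on u. A change of variables moves them onto phi, and an L^2 function that
  pairs to 0 with every test function vanishes almost everywhere.\<close>

lemma phi_refinement: "AE t in lebesgue. phi t = (\<Sum>n\<in>\<Lambda>. h n * dil A (transl n phi) t)"
proof -
  let ?r = "\<lambda>t. \<Sum>n\<in>\<Lambda>. h n * dil A (transl n phi) t"
  have st: "square_integrable (dil A (transl n phi))" for n
    by (intro square_integrable_dil[OF detA] square_integrable_transl phi_square_integrable)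
  have r2: "square_integrable ?r" by (intro square_integrable_sum square_integrable_cmult st)
  have "AE t in lebesgue. phi t - ?r t = 0"
  proof (rule Cc_integral_eq_0_imp_AE[OF square_integrable_diff[OF phi_square_integrable r2]])
    fix u :: "real^'d \<Rightarrow> complex" assume u: "Cc u"
    have su: "square_integrable u" by (rule Cc_square_integrable[OF u])
    have dC: "det C \<noteq> 0" using det_matrix_inv[OF dA] dA by simp
    have cu: "Cc (\<lambda>x. u (C *v (x + n)))" for n
      using Cc_translate[OF Cc_linear_compose[OF detA u dC, of 1], of n] by simp
    have "(\<lambda>k. E (Suc k) u) \<longlonglongrightarrow> (\<Sum>n\<in>\<Lambda>. h n / s2 * (LINT t|lebesgue. phi t * u (C *v (t + n))))"
      unfolding E_Suc' by (intro tendsto_sum tendsto_mult tendsto_const weak_limit[OF cu])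
    from LIMSEQ_unique[OF LIMSEQ_Suc[OF weak_limit[OF u]] this]
    have "(LINT t|lebesgue. phi t * u t) = (\<Sum>n\<in>\<Lambda>. h n / s2 * (LINT t|lebesgue. phi t * u (C *v (t + n))))" .
    also have "\<dots> = (\<Sum>n\<in>\<Lambda>. h n * (LINT t|lebesgue. dil A (transl n phi) t * u t))"
    proof (intro sum.cong refl)
      fix n :: "real^'d"
      let ?F = "\<lambda>t. phi t * u (C *v (t + n))"
      have "?F \<in> borel_measurable lebesgue"
        using square_integrable_mult_integrable[OF phi_square_integrable Cc_square_integrable[OF cu]] by auto
      from integral_affine[OF dA this, of "- n"]
      have aff: "(LINT t|lebesgue. ?F (A *v t + - n)) = (1 / 2) *\<^sub>R (LINT t|lebesgue. ?F t)" by (simp only: detA)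
      have "?F (A *v t + - n) = phi (A *v t - n) * u t" for t
        by (simp add: matrix_inv_invertible[OF dA])
      then have FI: "(LINT t|lebesgue. ?F (A *v t + - n)) = (LINT t|lebesgue. phi (A *v t - n) * u t)" by (simp only:)
      have D: "(LINT t|lebesgue. dil A (transl n phi) t * u t) = s2 * (LINT t|lebesgue. phi (A *v t - n) * u t)"
        unfolding dil_def transl_def mult.assoc by (rule integral_mult_right_zero)
      \<comment> \<open>The dilation contributes \<open>sqrt 2\<close> and the Jacobian 1/2;
        together they give the factor \<open>1 / s2\<close> of \<open>E_Suc'\<close>.\<close>
      have "s2 * ((1 / 2) *\<^sub>R I) = I / s2" for I :: complex
      proof -
        have "s2 * s2 = 2" by (simp flip: of_real_mult)
        moreover have "s2 \<noteq> 0" by simp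
        ultimately show ?thesis by (simp add: scaleR_conv_of_real divide_simps mult_ac)
      qed
      then have "(LINT t|lebesgue. dil A (transl n phi) t * u t) = (LINT t|lebesgue. ?F t) / s2"
        unfolding D FI[symmetric] aff .
      then show "h n / s2 * (LINT t|lebesgue. ?F t) = h n * (LINT t|lebesgue. dil A (transl n phi) t * u t)" by simp
    qed
    also have "\<dots> = (\<Sum>n\<in>\<Lambda>. (LINT t|lebesgue. h n * (dil A (transl n phi) t * u t)))" by (simp only: integral_mult_right_zero)
    also have "\<dots> = (LINT t|lebesgue. (\<Sum>n\<in>\<Lambda>. h n * (dil A (transl n phi) t * u t)))"
      by (rule Bochner_Integration.integral_sum[symmetric]) (intro integrable_mult_right square_integrable_mult_integrable st su)
    also have "\<dots> = (LINT t|lebesgue. ?r t * u t)" by (simp only: sum_distrib_right mult.assoc)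
    finally have eq: "(LINT t|lebesgue. phi t * u t) = (LINT t|lebesgue. ?r t * u t)" .
    show "(LINT t|lebesgue. (phi t - ?r t) * u t) = 0"
      unfolding left_diff_distrib
      by (subst Bochner_Integration.integral_diff) (intro square_integrable_mult_integrable phi_square_integrable r2 su, intro square_integrable_mult_integrable phi_square_integrable r2 su, simp only: eq diff_self)
  qed
  then show ?thesis by eventually_elim simp
qed

end

section \<open>Unimodular change of the lattice\<close>

lemma Ints_det:
  fixes M :: "real^'n::finite^'n"
  assumes "\<And>i j. M $ i $ j \<in> \<int>"
  shows "det M \<in> \<int>"
  unfolding det_def using assms by (intro Ints_sum Ints_mult Ints_prod Ints_of_int) auto

text \<open>By Cramer's rule the coordinates are integer determinants divided by a determinant 1 or
  -1.\<close>

lemma Zd_unimodular_inverse: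
  fixes S :: "real^'d::finite^'d"
  assumes "integral_matrix S" "det S = 1 \<or> det S = -1" "x \<in> Zd"
  shows "matrix_inv S *v x \<in> Zd"
proof -
  have d: "det S \<noteq> 0" using assms(2) by auto
  let ?M = "\<lambda>k. (\<chi> i j. if j = k then x $ i else S $ i $ j) :: real^'d^'d"
  have "matrix_inv S *v x = (\<chi> k. det (?M k) / det S)"
    using cramer[OF d, of "matrix_inv S *v x" x] by (simp add: matrix_inv_invertible[OF d])
  moreover have "det (?M k) \<in> \<int>" for k
    using assms(1,3) by (intro Ints_det) (simp add: Zd_def integral_matrix_def)
  ultimately show ?thesis using assms(2) by (auto simp: Zd_def)
qed

section \<open>The filter bank\<close>

lemma sum_finite_support_reindex:
  assumes "inj_on g Z" "finite K" "K \<subseteq> Z" "finite Y"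
    and "\<And>l. l \<in> Z \<Longrightarrow> f (g l) \<noteq> 0 \<Longrightarrow> l \<in> K" "\<And>y. f y \<noteq> 0 \<Longrightarrow> y \<in> Y"
  shows "(\<Sum>l\<in>K. f (g l)) = (\<Sum>y\<in>Y \<inter> g ` Z. f y)"
proof -
  have "(\<Sum>l\<in>K. f (g l)) = (\<Sum>y\<in>g ` K. f y)"
    using sum.reindex[OF inj_on_subset[OF assms(1,3)], of f] by simp
  also have "\<dots> = (\<Sum>y\<in>Y \<inter> g ` Z. f y)"
    using assms(2-6) by (intro sum.mono_neutral_cong) auto
  finally show ?thesis .
qed

text \<open>If \<open>m' - m \<in> A Zd\<close>, the two families of arguments partition the lattice and the sum is the orthogonality relation; otherwise they coincide and the signs cancel.\<close>

lemma filter_bank_identity: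
  fixes A :: "real^'d::finite^'d" and h :: "real^'d \<Rightarrow> complex"
  assumes dA: "det A \<noteq> 0" and qA_Z: "qA \<in> Zd"
    and part: "Zd = (\<lambda>v. lA + v) ` ((*v) A ` Zd) \<union> (*v) A ` Zd"
              "(\<lambda>v. lA + v) ` ((*v) A ` Zd) \<inter> (*v) A ` Zd = {}"
    and q_even: "\<forall>v\<in>(*v) A ` Zd. \<exists>k::int. qA \<bullet> v = 2 * of_int k"
    and q_odd: "\<forall>v\<in>(\<lambda>v. lA + v) ` ((*v) A ` Zd). \<exists>k::int. qA \<bullet> v = 2 * of_int k + 1"
    and cond_even: "\<forall>m\<in>(*v) A ` Zd. \<forall>n\<in>Zd.
          Zd = (\<lambda>a. n - a) ` ((*v) A ` Zd) \<union> (\<lambda>a. lA - m - n + a) ` ((*v) A ` Zd) \<and>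
          (\<lambda>a. n - a) ` ((*v) A ` Zd) \<inter> (\<lambda>a. lA - m - n + a) ` ((*v) A ` Zd) = {}"
    and cond_odd: "\<forall>m\<in>(\<lambda>v. lA + v) ` ((*v) A ` Zd). \<forall>n\<in>Zd.
          (\<lambda>a. n - a) ` ((*v) A ` Zd) = (\<lambda>a. lA - m - n + a) ` ((*v) A ` Zd)"
    and h_supp: "\<forall>n. n \<notin> Lambda0 N0 \<longrightarrow> h n = 0"
    and h_orth: "\<forall>k\<in>(*v) A ` Zd.
          (\<Sum>n\<in>Lambda0 N0. h n * cnj (h (n + k))) = (if k = 0 then 1 else 0)"
    and b: "\<And>n. b n = (-1) powi \<lfloor>qA \<bullet> n\<rfloor> * cnj (h (lA - n))"
    and A_Zd: "\<And>x. x \<in> Zd \<Longrightarrow> A *v x \<in> Zd"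
    and m: "m \<in> Zd" "m' \<in> Zd" and K: "finite K" "K \<subseteq> Zd"
    and K_supp: "{l\<in>Zd. m - A *v l \<in> Lambda0 N0 \<or> lA - (m - A *v l) \<in> Lambda0 N0} \<subseteq> K"
  shows "(\<Sum>l\<in>K. h (m - A *v l) * cnj (h (m' - A *v l)) + b (m - A *v l) * cnj (b (m' - A *v l)))
    = (if m = m' then 1 else 0)"
proof -
  let ?L = "Lambda0 N0 :: (real^'d) set" and ?Z = "(*v) A ` Zd"
  \<comment> \<open>Up to sign both families of products are values of the one correlation f: the
    first at \<open>m - A *v l\<close>, the second at \<open>lA - m' + A *v l\<close>, since the
    conjugation in b exchanges the two factors.\<close>
  define k where "k = m' - m"
  define f where "f y = h y * cnj (h (y + k))" for y
  let ?g1 = "\<lambda>l. m - A *v l" and ?g2 = "\<lambda>l. lA - m' + A *v l"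
  define C1 C2 where "C1 = (\<lambda>a. m - a) ` ?Z" and "C2 = (\<lambda>a. lA - k - m + a) ` ?Z"
  have C: "C1 = ?g1 ` Zd" "C2 = ?g2 ` Zd" unfolding C1_def C2_def k_def by (simp_all add: image_image)
  have injA: "inj_on ((*v) A) Zd"
    by (rule inj_on_inverseI[where g="(*v) (matrix_inv A)"]) (rule matrix_inv_invertible(4)[OF dA])
  have k_Zd: "k \<in> Zd" unfolding k_def by (rule Zd_diff[OF m(2,1)])
  have supp: "h n \<noteq> 0 \<Longrightarrow> n \<in> ?L" for n using h_supp by blast
  have f0: "f y \<noteq> 0 \<Longrightarrow> y \<in> ?L" for y using supp by (auto simp: f_def)
  have s1: "(\<Sum>l\<in>K. f (?g1 l)) = (\<Sum>y\<in>?L \<inter> C1. f y)" unfolding C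
  proof (rule sum_finite_support_reindex[OF _ K finite_Lambda0])
    show "inj_on ?g1 Zd" using injA by (auto simp: inj_on_def)
    show "l \<in> K" if "l \<in> Zd" "f (?g1 l) \<noteq> 0" for l using that f0 K_supp by blast
  qed (rule f0)
  have s2: "(\<Sum>l\<in>K. f (?g2 l)) = (\<Sum>y\<in>?L \<inter> C2. f y)" unfolding C
  proof (rule sum_finite_support_reindex[OF _ K finite_Lambda0])
    show "inj_on ?g2 Zd" using injA by (auto simp: inj_on_def)
    fix l assume l: "l \<in> Zd" "f (?g2 l) \<noteq> 0"
    then have "?g2 l + k \<in> ?L" using supp by (auto simp: f_def)
    moreover have "?g2 l + k = lA - (m - A *v l)" by (simp add: k_def)
    ultimately show "l \<in> K" using l(1) K_supp by auto
  qed (rule f0)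
  have t1: "h (m - A *v l) * cnj (h (m' - A *v l)) = f (?g1 l)" for l
  proof -
    have "m' - A *v l = m - A *v l + k" by (simp add: k_def)
    then show ?thesis by (simp only: f_def)
  qed
  have t2: "b (m - A *v l) * cnj (b (m' - A *v l)) = (if even c then 1 else -1) * f (?g2 l)"
    if l: "l \<in> Zd" and c: "qA \<bullet> k = real_of_int c" for l c
  proof -
    let ?n = "m - A *v l"
    have nZ: "?n \<in> Zd" by (intro Zd_diff m A_Zd l)
    have "qA \<bullet> ?n \<in> \<int>" unfolding inner_vec_def
      by (intro Ints_sum) (use nZ qA_Z in \<open>auto simp: Zd_def\<close>)
    then obtain i where i: "qA \<bullet> ?n = real_of_int i" by (elim Ints_cases)
    have n': "m' - A *v l = ?n + k" by (simp add: k_def)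
    have i': "\<lfloor>qA \<bullet> (?n + k)\<rfloor> = i + c" by (simp only: inner_add_right i c flip: of_int_add) (rule floor_of_int)
    \<comment> \<open>The sign of \<open>m - A *v l\<close> enters twice and cancels; what remains
      is the parity of \<open>qA \<bullet> k\<close>, the same for every l.\<close>
    have sg: "(-1) powi i * (-1) powi (i + c) = (if even c then 1 else -1 :: complex)"
      by (simp add: power_int_minus_left)
    have z: "lA - ?n = ?g2 l + k" "lA - (?n + k) = ?g2 l" by (simp_all add: k_def)
    have "b ?n * cnj (b (m' - A *v l)) = ((-1) powi i * (-1) powi (i + c)) * (h (lA - (?n + k)) * cnj (h (lA - ?n)))"
      unfolding n' b i' i floor_of_int by (simp add: power_int_minus_left)
    then show ?thesis unfolding sg z f_def .
  qed
  have kpart: "k \<in> (\<lambda>v. lA + v) ` ?Z \<or> k \<in> ?Z" using k_Zd part(1) by blast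
  have split: "(\<Sum>l\<in>K. h (m - A *v l) * cnj (h (m' - A *v l)) + b (m - A *v l) * cnj (b (m' - A *v l)))
    = (\<Sum>y\<in>?L \<inter> C1. f y) + (if even c then 1 else -1) * (\<Sum>y\<in>?L \<inter> C2. f y)"
    if c: "qA \<bullet> k = real_of_int c" for c
  proof -
    have "(\<Sum>l\<in>K. h (m - A *v l) * cnj (h (m' - A *v l)) + b (m - A *v l) * cnj (b (m' - A *v l)))
      = (\<Sum>l\<in>K. f (?g1 l) + (if even c then 1 else -1) * f (?g2 l))"
    proof (rule sum.cong[OF refl])
      fix l assume "l \<in> K"
      then have l: "l \<in> Zd" using K(2) by blast
      show "h (m - A *v l) * cnj (h (m' - A *v l)) + b (m - A *v l) * cnj (b (m' - A *v l))
        = f (?g1 l) + (if even c then 1 else -1) * f (?g2 l)" unfolding t1 t2[OF l c] ..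
    qed
    then show ?thesis by (simp only: sum.distrib s1 s2 flip: sum_distrib_left)
  qed
  show ?thesis
  proof (cases "k \<in> ?Z")
    case True
    then obtain j where "qA \<bullet> k = 2 * real_of_int j" using q_even by blast
    then have "qA \<bullet> k = real_of_int (2 * j)" by simp
    note sp = split[OF this]
    have "Zd = C1 \<union> C2 \<and> C1 \<inter> C2 = {}" unfolding C1_def C2_def using cond_even True m(1) by blast
    then have "?L = (?L \<inter> C1) \<union> (?L \<inter> C2)" "(?L \<inter> C1) \<inter> (?L \<inter> C2) = {}" using Lambda0_Zd[of N0] by blast+
    then have "(\<Sum>y\<in>?L \<inter> C1. f y) + (\<Sum>y\<in>?L \<inter> C2. f y) = (\<Sum>y\<in>?L. f y)"
      by (metis finite_Int finite_Lambda0 sum.union_disjoint)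
    also have "\<dots> = (if k = 0 then 1 else 0)" unfolding f_def using h_orth True by blast
    finally show ?thesis using sp by (simp add: k_def)
  next
    case False
    then have ko: "k \<in> (\<lambda>v. lA + v) ` ?Z" using kpart by blast
    then obtain j where "qA \<bullet> k = 2 * real_of_int j + 1" using q_odd by blast
    then have "qA \<bullet> k = real_of_int (2 * j + 1)" by simp
    note sp = split[OF this]
    have "C1 = C2" unfolding C1_def C2_def using cond_odd ko m(1) by blast
    moreover have "m \<noteq> m'"
    proof
      assume "m = m'"
      then have "k = A *v 0" by (simp add: k_def)
      then show False using False Zd_0 by blast
    qed
    ultimately show ?thesis using sp by simp
  qed
qed

theorem theorem10p1:
  fixes A0 S A :: "real^'d::finite^'d"
    and lA qA :: "real^'d"
    and h :: "real^'d \<Rightarrow> complex"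
    and N0 :: nat
  assumes A0_int: "integral_matrix A0" and A0_exp: "expansive A0"
    and A0_det: "det A0 = 2 \<or> det A0 = -2"
    and S_int: "integral_matrix S" and S_det: "det S = 1 \<or> det S = -1"
    and A_int: "integral_matrix A"
    and sim: "A0 = matrix_inv S ** A ** S"
    and AT: "(*v) A ` Zd = (*v) (transpose A) ` Zd"
    and lA_Z: "lA \<in> Zd" and qA_Z: "qA \<in> Zd"
    and part: "Zd = (\<lambda>v. lA + v) ` ((*v) A ` Zd) \<union> (*v) A ` Zd"
              "(\<lambda>v. lA + v) ` ((*v) A ` Zd) \<inter> (*v) A ` Zd = {}"
    and q_even: "\<forall>v\<in>(*v) A ` Zd. \<exists>k::int. qA \<bullet> v = 2 * of_int k"
    and q_odd: "\<forall>v\<in>(\<lambda>v. lA + v) ` ((*v) A ` Zd). \<exists>k::int. qA \<bullet> v = 2 * of_int k + 1"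
    and cond_even: "\<forall>m\<in>(*v) A ` Zd. \<forall>n\<in>Zd.
          Zd = (\<lambda>a. n - a) ` ((*v) A ` Zd) \<union> (\<lambda>a. lA - m - n + a) ` ((*v) A ` Zd) \<and>
          (\<lambda>a. n - a) ` ((*v) A ` Zd) \<inter> (\<lambda>a. lA - m - n + a) ` ((*v) A ` Zd) = {}"
    and cond_odd: "\<forall>m\<in>(\<lambda>v. lA + v) ` ((*v) A ` Zd). \<forall>n\<in>Zd.
          (\<lambda>a. n - a) ` ((*v) A ` Zd) = (\<lambda>a. lA - m - n + a) ` ((*v) A ` Zd)"
    and h_supp: "\<forall>n. n \<notin> Lambda0 N0 \<longrightarrow> h n = 0"
    and h_orth: "\<forall>k\<in>(*v) A ` Zd.
          (\<Sum>n\<in>Lambda0 N0. h n * cnj (h (n + k))) = (if k = 0 then 1 else 0)"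
    and h_sum: "(\<Sum>n\<in>Lambda0 N0. h n) = complex_of_real (sqrt 2)"
  defines "phiA0 \<equiv> (\<lambda>t. phi_A N0 h A (S *v t))"
    and "psiA0 \<equiv> (\<lambda>t. psi_A N0 h A lA qA (S *v t))"
  shows "parseval_frame_wavelet A0 psiA0 \<and>
    (AE t in lebesgue. phiA0 t =
           (\<Sum>n\<in>Lambda0 N0. h n * dil A0 (transl (matrix_inv S *v n) phiA0) t)) \<and>
    (AE t in lebesgue. psiA0 t =
           (\<Sum>n\<in>{n\<in>Zd. lA - n \<in> Lambda0 N0}. (-1) powi \<lfloor>qA \<bullet> n\<rfloor> * cnj (h (lA - n)) *
              dil A0 (transl (matrix_inv S *v n) phiA0) t)) \<and>
    (\<forall>n::int. Vn A0 n phiA0 \<subseteq> Vn A0 (n + 1) phiA0) \<and>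
    L2_closure (\<Union>n::int. Vn A0 n phiA0) = {f. square_integrable f}"
proof -
  let ?phi = "phi_A N0 h A" and ?T = "matrix_inv S" and ?L = "Lambda0 N0 :: (real^'d) set"
  let ?L' = "{n\<in>Zd. lA - n \<in> ?L}"
  have dS: "det S \<noteq> 0" using S_det by auto
  have dA0: "det A0 \<noteq> 0" and dA0': "\<bar>det A0\<bar> = 2" using A0_det by auto
  note S_inv = matrix_inv_invertible[OF dS]
  have SA0: "S ** A0 = A ** S" unfolding sim by (simp add: matrix_mul_assoc S_inv)
  have SA0v: "S *v (A0 *v x) = A *v (S *v x)" for x
    using arg_cong[OF SA0, of "\<lambda>M. M *v x"] by (simp add: matrix_vector_mul_assoc)
  have "det S * det A0 = det A * det S" using arg_cong[OF SA0, of det] by (simp add: det_mul)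
  then have detA: "det A = det A0" using dS by simp
  have dA: "det A \<noteq> 0" and dA': "\<bar>det A\<bar> = 2" using dA0 dA0' by (simp_all add: detA)
  have decay0: "summable (\<lambda>k. norm (mat_pow (matrix_inv A0) k *v x))" for x
    by (rule summable_inverse_powers[OF A0_exp matrix_inv_invertible(1)[OF dA0]])
  \<comment> \<open>Expansiveness of A0 gives decay of its inverse powers; this conjugation carries
    the decay to A, for which the cascade is run.\<close>
  have conj: "mat_pow (matrix_inv A) k *v x = S *v (mat_pow (matrix_inv A0) k *v (?T *v x))" for k x
  proof (induction k)
    case (Suc k)
    let ?y = "mat_pow (matrix_inv A0) k *v (?T *v x)"
    have "A *v (S *v (matrix_inv A0 *v ?y)) = S *v ?y"
      by (simp only: SA0v[symmetric] matrix_inv_invertible[OF dA0])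
    then have "matrix_inv A *v (S *v ?y) = S *v (matrix_inv A0 *v ?y)"
      using matrix_inv_invertible(4)[OF dA] by metis
    then show ?case unfolding mat_pow_Suc matrix_vector_mul_assoc[symmetric] Suc.IH .
  qed (simp add: S_inv)
  obtain KS where KS: "\<And>x. norm (S *v x) \<le> KS * norm x"
    using linear_bounded[OF matrix_vector_mul_linear[of S]] by blast
  obtain KT where KT: "KT > 0" "\<And>x. norm (?T *v x) \<le> KT * norm x"
    using linear_bounded_pos[OF matrix_vector_mul_linear[of ?T]] by blast
  have decayA: "summable (\<lambda>k. norm (mat_pow (matrix_inv A) k *v x))" for x
    by (rule summable_comparison_test'[OF summable_mult[OF decay0[of "?T *v x"], of KS], of 0])
       (simp add: conj KS)
  interpret mk: mask A h N0
    by unfold_locales (use A_int dA' decayA h_supp h_orth h_sum in blast)+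
  have S_Zd: "x \<in> Zd \<Longrightarrow> S *v x \<in> Zd" for x by (rule Zd_integral_matrix[OF S_int])
  have T_Zd: "x \<in> Zd \<Longrightarrow> ?T *v x \<in> Zd" for x by (rule Zd_unimodular_inverse[OF S_int S_det])
  \<comment> \<open>Composition with S intertwines D_A T_n with the dilation by A0 after the
    translation by S^(-1) n. Both two-scale relations are transported by this identity.\<close>
  have dil_eq: "dil A0 (transl (?T *v n) phiA0) t = dil A (transl n ?phi) (S *v t)" for n t
    by (simp add: dil_def transl_def phiA0_def matrix_vector_mult_diff_distrib SA0v S_inv)
  have L'_eq: "?L' = (\<lambda>n. lA - n) ` ?L"
  proof (intro equalityI subsetI)
    fix n assume "n \<in> ?L'"
    then show "n \<in> (\<lambda>n. lA - n) ` ?L" by (intro image_eqI[where x="lA - n"]) auto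
  next
    fix n assume "n \<in> (\<lambda>n. lA - n) ` ?L"
    then show "n \<in> ?L'" using Zd_diff[OF lA_Z] Lambda0_Zd by auto
  qed
  have finL': "finite ?L'" unfolding L'_eq by (intro finite_imageI finite_Lambda0)
  \<comment> \<open>The infinite sum in \<open>psi_A\<close> has only finitely many nonzero terms,
    so psi is given pointwise by a finite sum.\<close>
  have psi_sum: "psiA0 t = (\<Sum>n\<in>?L'. (-1) powi \<lfloor>qA \<bullet> n\<rfloor> * cnj (h (lA - n)) * dil A (transl n ?phi) (S *v t))" for t
  proof -
    have "psiA0 t = (\<Sum>\<^sub>\<infinity>n\<in>?L'. (-1) powi \<lfloor>qA \<bullet> n\<rfloor> * cnj (h (lA - n)) * dil A (transl n ?phi) (S *v t))"
      unfolding psiA0_def psi_A_def by (rule infsum_cong_neutral) (use h_supp in auto)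
    then show ?thesis using finL' by simp
  qed
  define a where "a n = h (S *v n)" for n
  define b where "b n = (-1) powi \<lfloor>qA \<bullet> (S *v n)\<rfloor> * cnj (h (lA - S *v n))" for n
  \<comment> \<open>The locale has one index set for both masks, so M contains the supports of both,
    pulled back by S.\<close>
  define M where "M = (*v) ?T ` (?L \<union> ?L')"
  have injT: "inj_on ((*v) ?T) X" for X by (rule inj_on_inverseI[where g="(*v) S"]) (rule S_inv(3))
  have finU: "finite (?L \<union> ?L')" using finL' finite_Lambda0 by blast
  have in_M: "n \<in> M" if "S *v n \<in> ?L \<union> ?L'" for n
    unfolding M_def using that by (intro image_eqI[where x="S *v n"]) (simp_all add: S_inv)
  have phi0: "AE t in lebesgue. phiA0 t = (\<Sum>n\<in>?L. h n * dil A (transl n ?phi) (S *v t))"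
    using AE_affine[OF dS mk.phi_refinement, of 0] by (simp add: phiA0_def)
  have sum_M: "(\<Sum>n\<in>M. c (S *v n) * dil A0 (transl n phiA0) t) = (\<Sum>n\<in>X. c n * dil A (transl n ?phi) (S *v t))"
    if "X \<subseteq> ?L \<union> ?L'" "\<And>n. n \<in> ?L \<union> ?L' \<Longrightarrow> n \<notin> X \<Longrightarrow> c n = 0" for c X t
  proof -
    have "(\<Sum>n\<in>M. c (S *v n) * dil A0 (transl n phiA0) t) = (\<Sum>n\<in>?L \<union> ?L'. c n * dil A (transl n ?phi) (S *v t))"
      unfolding M_def sum.reindex[OF injT] o_def dil_eq S_inv ..
    also have "\<dots> = (\<Sum>n\<in>X. c n * dil A (transl n ?phi) (S *v t))"
      by (rule sum.mono_neutral_right[OF finU that(1)]) (use that(2) in auto)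
    finally show ?thesis .
  qed
  \<comment> \<open>The radius comes from the bound KT for the inverse of S: where
    \<open>S *v t\<close> lies in the ball of radius \<open>mk.Rs\<close>, the norm of t is at most
    KT times that radius.\<close>
  interpret rp: refinable_pair A0 a b M phiA0 psiA0 "KT * mk.Rs"
  proof
    show "\<bar>det A0\<bar> = 2" by (rule dA0')
    show "A0 *v x \<in> Zd" if "x \<in> Zd" for x by (rule Zd_integral_matrix[OF A0_int that])
    show "summable (\<lambda>k. norm (mat_pow (matrix_inv A0) k *v x))" for x by (rule decay0)
    show "finite M" unfolding M_def using finU by blast
    show "M \<subseteq> Zd" unfolding M_def using T_Zd Lambda0_Zd by blast
    show "a n = 0" if "n \<notin> M" for n using that in_M[of n] h_supp by (auto simp: a_def)
    show "b n = 0" if "n \<notin> M" for n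
    proof -
      have "lA - S *v n \<notin> ?L"
      proof
        assume "lA - S *v n \<in> ?L"
        moreover from this have "S *v n \<in> Zd" using Zd_diff[OF lA_Z, of "lA - S *v n"] Lambda0_Zd by auto
        ultimately show False using in_M[of n] that by blast
      qed
      then show ?thesis using h_supp by (simp add: b_def)
    qed
    show "square_integrable phiA0"
      using square_integrable_affine(1)[OF dS mk.phi_square_integrable, of 0] by (simp add: phiA0_def)
    show "AE t in lebesgue. norm t > KT * mk.Rs \<longrightarrow> phiA0 t = 0"
      using AE_affine[OF dS mk.phi_support, of 0]
    proof eventually_elim
      case (elim t)
      have "norm (S *v t) > mk.Rs" if "norm t > KT * mk.Rs"
      proof -
        have "KT * mk.Rs < KT * norm (S *v t)" using that KT(2)[of "S *v t"] by (simp add: S_inv)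
        then show ?thesis using KT(1) by simp
      qed
      then show ?case using elim by (simp add: phiA0_def)
    qed
    show "(LINT t|lebesgue. phiA0 t) = 1"
    proof -
      have "?phi \<in> borel_measurable lebesgue" using mk.phi_square_integrable by (simp add: square_integrable_def)
      from integral_affine[OF dS this, of 0] have "(LINT t|lebesgue. phiA0 t) = (1 / \<bar>det S\<bar>) *\<^sub>R 1"
        unfolding mk.phi_integral phiA0_def by simp
      then show ?thesis using S_det by auto
    qed
    show "KT * mk.Rs \<ge> 0" using KT(1) mk.Rs_nonneg by simp
    show "AE t in lebesgue. phiA0 t = (\<Sum>n\<in>M. a n * dil A0 (transl n phiA0) t)"
      using phi0
    proof eventually_elim
      case (elim t)
      show ?case unfolding elim a_def by (rule sum_M[symmetric]) (use h_supp in auto)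
    qed
    have "psiA0 t = (\<Sum>n\<in>M. b n * dil A0 (transl n phiA0) t)" for t
      unfolding psi_sum b_def
      by (rule sum_M[where c="\<lambda>n. (-1) powi \<lfloor>qA \<bullet> n\<rfloor> * cnj (h (lA - n))", symmetric])
         (use h_supp Lambda0_Zd in auto)
    then show "AE t in lebesgue. psiA0 t = (\<Sum>n\<in>M. b n * dil A0 (transl n phiA0) t)" by (intro AE_I2)
    \<comment> \<open>S maps the lattice bijectively onto itself and carries A0 to A, so the
      identity for A0 at p and p' is \<open>filter_bank_identity\<close> at \<open>S *v p\<close>
      and \<open>S *v p'\<close>, summed over the image of K.\<close>
    fix p p' :: "real^'d" and K :: "(real^'d) set"
    assume p: "p \<in> Zd" "p' \<in> Zd" and K: "finite K" "K \<subseteq> Zd" "{l\<in>Zd. p - A0 *v l \<in> M} \<subseteq> K"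
    define B where "B n = (-1) powi \<lfloor>qA \<bullet> n\<rfloor> * cnj (h (lA - n))" for n
    have injS: "inj_on ((*v) S) K" by (rule inj_on_inverseI[where g="(*v) ?T"]) (rule S_inv(4))
    have arg: "S *v (r - A0 *v l) = S *v r - A *v (S *v l)" for r l
      by (simp only: matrix_vector_mult_diff_distrib SA0v)
    have "(\<Sum>l\<in>K. a (p - A0 *v l) * cnj (a (p' - A0 *v l)) + b (p - A0 *v l) * cnj (b (p' - A0 *v l)))
      = (\<Sum>l\<in>(*v) S ` K. h (S *v p - A *v l) * cnj (h (S *v p' - A *v l)) + B (S *v p - A *v l) * cnj (B (S *v p' - A *v l)))"
      unfolding sum.reindex[OF injS] o_def a_def b_def B_def arg ..
    also have "\<dots> = (if S *v p = S *v p' then 1 else 0)"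
    proof (rule filter_bank_identity[OF dA qA_Z part q_even q_odd cond_even cond_odd h_supp h_orth])
      show "{l \<in> Zd. S *v p - A *v l \<in> ?L \<or> lA - (S *v p - A *v l) \<in> ?L} \<subseteq> (*v) S ` K"
      proof
        fix l assume "l \<in> {l \<in> Zd. S *v p - A *v l \<in> ?L \<or> lA - (S *v p - A *v l) \<in> ?L}"
        then have l: "l \<in> Zd" "S *v p - A *v l \<in> ?L \<or> lA - (S *v p - A *v l) \<in> ?L" by auto
        have e: "S *v (p - A0 *v (?T *v l)) = S *v p - A *v l" unfolding arg S_inv ..
        have "S *v p - A *v l \<in> Zd" by (intro Zd_diff S_Zd p Zd_integral_matrix[OF A_int] l)
        then have "p - A0 *v (?T *v l) \<in> M" using l(2) by (intro in_M) (auto simp: e)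
        then have "?T *v l \<in> K" using K(3) T_Zd[OF l(1)] by blast
        then show "l \<in> (*v) S ` K" by (intro image_eqI[where x="?T *v l"]) (simp_all add: S_inv)
      qed
    qed (use p K S_Zd Zd_integral_matrix[OF A_int] in \<open>auto simp: B_def\<close>)
    also have "S *v p = S *v p' \<longleftrightarrow> p = p'" using S_inv(4) by metis
    finally show "(\<Sum>l\<in>K. a (p - A0 *v l) * cnj (a (p' - A0 *v l)) + b (p - A0 *v l) * cnj (b (p' - A0 *v l)))
      = (if p = p' then 1 else 0)" .
  qed
  show ?thesis
    using rp.parseval_psi rp.Vn_nested rp.Vn_dense phi0 by (auto simp: dil_eq psi_sum)
qed

end
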